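(* Let $F=K(z,t)$ be the function field over $K=\mathbb F_{49}$ defined by $z^{16}=t(t+1)^6$. Then $F$ is $\mathbb F_{49}$-maximal, its Frobenius dimension is $3$, its $\mathcal D$-order sequence is $(0,1,2,7)$, and there exists an $\mathbb F_{49}$-rational place $P$ of $F$ (namely the unique pole of $t$) with $j_2(P)=3=8-\lfloor\tfrac{2}{3}\cdot 8\rfloor$.
   Context: Here $q=7$. A function field $F$ over $\mathbb F_{q^2}$ (with $\mathbb F_{q^2}$ algebraically closed in $F$) of genus $g$ is $\mathbb F_{q^2}$-maximal if its number of degree-one places equals $q^2+1+2gq$. For a maximal function field, the Frobenius linear series is the complete linear series $\mathcal D=|(q+1)P_0|=\{\mathrm{div}(f)+(q+1)P_0: 0\neq f\in\mathcal L((q+1)P_0)\}$ for a degree-one place $P_0$ (it does not depend on $P_0$); its projective dimension $r=\dim_K\mathcal L((q+1)P_0)-1$ is the Frobenius dimension. For a place $P$, an integer $j$ is a $(\mathcal D,P)$-order if some divisor $E\in\mathcal D$ has $v_P(E)=j$; there are exactly $r+1$ such orders $j_0(P)<\dots<j_r(P)$. The $\mathcal D$-order sequence $(\epsilon_0,\dots,\epsilon_r)$ is the $(\mathcal D,P)$-order sequence of all but finitely many places $P$.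
   Formalization: Orders are taken after extending the constant field to the algebraic closure (D is the complete series |8Q_0| there, places are those of the extended field); over F_49 itself D is finite, so almost all places would have only the order 0. *)

theory Defs
  imports Complex_Main "HOL-Computational_Algebra.Polynomial"
begin

definition subfield :: "'a::field set \<Rightarrow> bool" where
  "subfield S \<longleftrightarrow> 0 \<in> S \<and> 1 \<in> S \<and>
     (\<forall>x\<in>S. \<forall>y\<in>S. x + y \<in> S \<and> x * y \<in> S) \<and>
     (\<forall>x\<in>S. - x \<in> S \<and> inverse x \<in> S)"

definition gen_field :: "'a::field set \<Rightarrow> 'a set" where
  "gen_field A = \<Inter>{S. subfield S \<and> A \<subseteq> S}"

definition poly_over :: "'a::field set \<Rightarrow> 'a poly \<Rightarrow> bool" where
  "poly_over k p \<longleftrightarrow> (\<forall>i. coeff p i \<in> k)"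

definition algebraic_over :: "'a::field set \<Rightarrow> 'a \<Rightarrow> bool" where
  "algebraic_over k x \<longleftrightarrow> (\<exists>p. p \<noteq> 0 \<and> poly_over k p \<and> poly p x = 0)"

definition alg_closed_subfield :: "'a::field set \<Rightarrow> bool" where
  "alg_closed_subfield k \<longleftrightarrow> subfield k \<and>
     (\<forall>p. poly_over k p \<and> degree p > 0 \<longrightarrow> (\<exists>x\<in>k. poly p x = 0))"

definition span_over :: "'a::field set \<Rightarrow> 'a set \<Rightarrow> 'a set" where
  "span_over k B = {\<Sum>b\<in>B. c b * b | c. \<forall>b\<in>B. c b \<in> k}"

definition dim_over :: "'a::field set \<Rightarrow> 'a set \<Rightarrow> nat" where
  "dim_over k V = (LEAST n. \<exists>B. finite B \<and> card B = n \<and> B \<subseteq> V \<and> V \<subseteq> span_over k B)"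

section \<open>Places of a function field E/k (identified with their valuation rings)\<close>

definition place :: "'a::field set \<Rightarrow> 'a set \<Rightarrow> 'a set \<Rightarrow> bool" where
  "place E k R \<longleftrightarrow> k \<subseteq> R \<and> R \<subseteq> E \<and> R \<noteq> E \<and>
     (\<forall>x\<in>R. \<forall>y\<in>R. x + y \<in> R \<and> x * y \<in> R \<and> - x \<in> R) \<and>
     (\<forall>x\<in>E. x \<noteq> 0 \<longrightarrow> x \<in> R \<or> inverse x \<in> R)"

definition max_ideal :: "'a::field set \<Rightarrow> 'a set" where
  "max_ideal R = {x\<in>R. x = 0 \<or> inverse x \<notin> R}"

definition is_unit_in :: "'a::field set \<Rightarrow> 'a \<Rightarrow> bool" where
  "is_unit_in R u \<longleftrightarrow> u \<noteq> 0 \<and> u \<in> R \<and> inverse u \<in> R"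

definition uniformizer :: "'a::field set \<Rightarrow> 'a \<Rightarrow> bool" where
  "uniformizer R p \<longleftrightarrow> p \<in> max_ideal R \<and> p \<noteq> 0 \<and> (\<forall>x\<in>max_ideal R. \<exists>y\<in>R. x = p * y)"

text \<open>normalized discrete valuation v_O (meaningful for nonzero arguments)\<close>
definition val :: "'a::field set \<Rightarrow> 'a \<Rightarrow> int" where
  "val R x = (THE n::int. \<exists>p. uniformizer R p \<and> is_unit_in R (x * p powi (- n)))"

definition deg_place :: "'a::field set \<Rightarrow> 'a set \<Rightarrow> nat" where
  "deg_place k R = (LEAST n. \<exists>B. finite B \<and> card B = n \<and> B \<subseteq> R \<and>
      (\<forall>x\<in>R. \<exists>c. (\<forall>b\<in>B. c b \<in> k) \<and> x - (\<Sum>b\<in>B. c b * b) \<in> max_ideal R))"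

definition is_divisor :: "'a::field set \<Rightarrow> 'a set \<Rightarrow> ('a set \<Rightarrow> int) \<Rightarrow> bool" where
  "is_divisor E k A \<longleftrightarrow> finite {R. A R \<noteq> 0} \<and> (\<forall>R. A R \<noteq> 0 \<longrightarrow> place E k R)"

definition deg_div :: "'a::field set \<Rightarrow> ('a set \<Rightarrow> int) \<Rightarrow> int" where
  "deg_div k A = (\<Sum>R\<in>{R. A R \<noteq> 0}. A R * int (deg_place k R))"

definition LL :: "'a::field set \<Rightarrow> 'a set \<Rightarrow> ('a set \<Rightarrow> int) \<Rightarrow> 'a set" where
  "LL E k A = {x\<in>E. x = 0 \<or> (\<forall>R. place E k R \<longrightarrow> val R x \<ge> - A R)}"

definition ell :: "'a::field set \<Rightarrow> 'a set \<Rightarrow> ('a set \<Rightarrow> int) \<Rightarrow> nat" where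
  "ell E k A = dim_over k (LL E k A)"

definition genus :: "'a::field set \<Rightarrow> 'a set \<Rightarrow> int" where
  "genus E k = (GREATEST g. \<exists>A. is_divisor E k A \<and> g = deg_div k A - int (ell E k A) + 1)"

definition pt_div :: "'a set \<Rightarrow> int \<Rightarrow> 'a set \<Rightarrow> int" where
  "pt_div P m = (\<lambda>R. if R = P then m else 0)"

definition num_rational_places :: "'a::field set \<Rightarrow> 'a set \<Rightarrow> nat" where
  "num_rational_places E k = card {R. place E k R \<and> deg_place k R = 1}"

text \<open>E/k is k-maximal (k = F_{q^2}); includes the standing assumption that k is
  algebraically closed in E\<close>
definition is_maximal :: "'a::field set \<Rightarrow> 'a set \<Rightarrow> nat \<Rightarrow> bool" where
  "is_maximal E k q \<longleftrightarrow> (\<forall>x\<in>E. algebraic_over k x \<longrightarrow> x \<in> k) \<and>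
     int (num_rational_places E k) = int q ^ 2 + 1 + 2 * genus E k * int q"

definition orders :: "'a::field set \<Rightarrow> 'a set \<Rightarrow> 'a set \<Rightarrow> int \<Rightarrow> 'a set \<Rightarrow> int set" where
  "orders E k Q0 m Q = {val Q f + (if Q = Q0 then m else 0) | f. f \<in> LL E k (pt_div Q0 m) \<and> f \<noteq> 0}"

end

theory Submission
  imports Defs "HOL-Library.FuncSet"
begin

text \<open>With \<open>a = z ^ 8 / (t + 1) ^ 3\<close> and \<open>w = z ^ 3 / (t + 1)\<close> one has \<open>a ^ 2 = t\<close> and \<open>F = K(a, w, z)\<close>, and
  \<open>K[a, w, z]\<close> is free over \<open>K[a]\<close> with eight basis elements \<open>w ^ i * z ^ j\<close>. At the unique place at
  infinity \<open>w\<close>, \<open>z\<close>, \<open>a\<close> have pole orders 5, 7, 8; the orders of the basis elements at the four totally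
  ramified places are distinct modulo 8, so that \<open>K[a, w, z]\<close> consists of all functions without a pole
  outside infinity. Hence the Weierstrass semigroup at infinity is generated by 5, 7, 8, the genus is 7
  and \<open>L(8 P) = <1, w, z, a>\<close> for the place \<open>P\<close> at infinity. The places of \<open>F\<close> are the Frobenius orbits of
  the places over the algebraic closure; there are 4 ramified and \<open>18 * 8\<close> unramified rational places,
  which is \<open>49 + 1 + 2 * 7 * 7\<close> altogether.

  For a point \<open>Q = (\<alpha>, \<beta>, \<gamma>)\<close> put \<open>f = \<gamma> ^ 7 * z - a - \<alpha> ^ 7 - 3 * \<beta> ^ 7 * w\<close>. If \<open>Q\<close> is rational then
  \<open>f + f ^ 7 = 3 * (w - \<beta>) ^ 8 - (z - \<gamma>) ^ 8\<close> shows that \<open>f\<close> has divisor \<open>8 Q - 8 P\<close>; so the linear series does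
  not depend on the rational place. Its orders are 0, 1, 3, 8 at infinity, and at a general point \<open>f\<close> only
  has order 7, so that the orders there are 0, 1, 2, 7.\<close>

text \<open>The curve is the quotient of the Hermitian curve \<open>y ^ 8 = x ^ 7 + x\<close> by the
  group of order 3 generated by \<open>(x, y) -> (4 * x, 2 * y)\<close>, where 2 and 4 are the
  primitive cube roots of unity modulo 7. The invariants \<open>x ^ 3\<close>, \<open>x * y\<close>,
  \<open>y ^ 3\<close> are \<open>a\<close>, \<open>w\<close>, \<open>z\<close>, and
  \<open>f\<close> is the norm of a tangent line. Residues at places of \<open>F\<close> lie in
  varying finite fields. Over the algebraic closure they are constants, so every nonzero function
  has an order and a leading coefficient. These are computed without fixing the place, which yields
  uniqueness of the place over a point; keeping track of a subfield of leading coefficients yields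
  the residue fields. The genus is a maximum over all divisors, so a bound is needed for every
  divisor. Each one is enlarged to a multiple of infinity plus the divisor of a power of
  \<open>a ^ (49 ^ j) - a\<close>; these functions vanish at any finitely many affine places for
  suitable \<open>j\<close>, and their zeros are known explicitly. Dimensions are obtained by
  counting elements of finite spaces.\<close>

section \<open>Subrings, generated subfields and polynomials with coefficients in a subring\<close>

definition subring :: "'a::field set \<Rightarrow> bool" where
  "subring A \<longleftrightarrow> 1 \<in> A \<and> (\<forall>x\<in>A. \<forall>y\<in>A. x + y \<in> A \<and> x * y \<in> A \<and> - x \<in> A)"

lemma subring_closed:
  assumes "subring A"
  shows subring_one: "1 \<in> A"
    and subring_zero: "0 \<in> A"
    and subring_add: "x \<in> A \<Longrightarrow> y \<in> A \<Longrightarrow> x + y \<in> A"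
    and subring_mult: "x \<in> A \<Longrightarrow> y \<in> A \<Longrightarrow> x * y \<in> A"
    and subring_minus: "x \<in> A \<Longrightarrow> - x \<in> A"
    and subring_diff: "x \<in> A \<Longrightarrow> y \<in> A \<Longrightarrow> x - y \<in> A"
    and subring_power: "x \<in> A \<Longrightarrow> x ^ n \<in> A"
proof -
  show 1: "1 \<in> A" and a: "x \<in> A \<Longrightarrow> y \<in> A \<Longrightarrow> x + y \<in> A"
    and m: "x \<in> A \<Longrightarrow> y \<in> A \<Longrightarrow> x * y \<in> A" and u: "x \<in> A \<Longrightarrow> - x \<in> A" for x y
    using assms unfolding subring_def by auto
  show "0 \<in> A" using a[OF 1 u[OF 1]] by simp
  show "x \<in> A \<Longrightarrow> y \<in> A \<Longrightarrow> x - y \<in> A" using a[OF _ u, of x y] by simp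
  show "x \<in> A \<Longrightarrow> x ^ n \<in> A" by (induction n) (auto intro: 1 m)
qed

lemma subring_sum:
  assumes "subring A" "\<And>i. i \<in> I \<Longrightarrow> f i \<in> A"
  shows "sum f I \<in> A"
  using assms(2) by (induction I rule: infinite_finite_induct)
    (auto intro: subring_zero[OF assms(1)] subring_add[OF assms(1)])

lemma subring_poly:
  assumes "subring A" "poly_over A p" "x \<in> A"
  shows "poly p x \<in> A"
  unfolding poly_altdef using assms
  by (intro subring_sum subring_mult subring_power) (auto simp: poly_over_def)

lemma subfield_subring: "subfield S \<Longrightarrow> subring S"
  by (auto simp: subfield_def subring_def)

lemma subfield_inverse: "subfield S \<Longrightarrow> x \<in> S \<Longrightarrow> inverse x \<in> S"
  by (auto simp: subfield_def)

lemma subfield_divide: "subfield S \<Longrightarrow> x \<in> S \<Longrightarrow> y \<in> S \<Longrightarrow> x / y \<in> S"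
  by (auto simp: subfield_def divide_inverse)

lemma subfieldI:
  assumes "subring S" "\<And>x. x \<in> S \<Longrightarrow> x \<noteq> 0 \<Longrightarrow> inverse x \<in> S"
  shows "subfield S"
  unfolding subfield_def
  using assms subring_closed[OF assms(1)] by (metis inverse_zero)

lemma subfield_gen_field: "subfield (gen_field A)"
  unfolding gen_field_def subfield_def by blast

lemma gen_field_subset: "A \<subseteq> gen_field A"
  unfolding gen_field_def by blast

lemma gen_field_least: "subfield S \<Longrightarrow> A \<subseteq> S \<Longrightarrow> gen_field A \<subseteq> S"
  unfolding gen_field_def by blast

lemma poly_over_0 [simp]: "subring A \<Longrightarrow> poly_over A 0"
  by (simp add: poly_over_def subring_zero)

lemma poly_over_pCons [simp]:
  "poly_over A (pCons c p) \<longleftrightarrow> c \<in> A \<and> poly_over A p"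
  unfolding poly_over_def by (auto simp: coeff_pCons split: nat.splits)

lemma poly_over_add: "subring A \<Longrightarrow> poly_over A p \<Longrightarrow> poly_over A q \<Longrightarrow> poly_over A (p + q)"
  by (simp add: poly_over_def subring_add)

lemma poly_over_diff: "subring A \<Longrightarrow> poly_over A p \<Longrightarrow> poly_over A q \<Longrightarrow> poly_over A (p - q)"
  by (simp add: poly_over_def subring_diff)

lemma poly_over_smult: "subring A \<Longrightarrow> c \<in> A \<Longrightarrow> poly_over A p \<Longrightarrow> poly_over A (smult c p)"
  by (simp add: poly_over_def subring_mult)

lemma poly_over_monom: "subring A \<Longrightarrow> c \<in> A \<Longrightarrow> poly_over A (monom c n)"
  by (simp add: poly_over_def subring_zero)

lemma poly_over_mult: "subring A \<Longrightarrow> poly_over A p \<Longrightarrow> poly_over A q \<Longrightarrow> poly_over A (p * q)"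
  by (simp add: poly_over_def coeff_mult subring_sum subring_mult)

lemma poly_over_mono: "A \<subseteq> B \<Longrightarrow> poly_over A p \<Longrightarrow> poly_over B p"
  by (auto simp: poly_over_def)

lemma poly_over_sum:
  "subring A \<Longrightarrow> (\<And>i. i \<in> I \<Longrightarrow> poly_over A (f i)) \<Longrightarrow> poly_over A (sum f I)"
  by (simp add: poly_over_def coeff_sum subring_sum)

lemma poly_over_synthetic_div:
  assumes "subring A" "poly_over A p" "c \<in> A"
  shows "poly_over A (synthetic_div p c)"
  using assms(2)
proof (induction p)
  case (pCons b p)
  then show ?case using subring_poly[OF assms(1) _ assms(3)] by simp
qed (use assms in simp)

lemma poly_root_factor:
  assumes "subring A" "poly_over A p" "c \<in> A" "poly p c = 0" "p \<noteq> 0"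
  obtains q where "poly_over A q" "p = [:- c, 1:] * q" "q \<noteq> 0" "degree q < degree p"
proof -
  let ?q = "synthetic_div p c"
  have p: "p = [:- c, 1:] * ?q"
    using synthetic_div_correct'[of c p] assms(4) by simp
  have "?q \<noteq> 0" using p assms(5) by auto
  moreover have "degree p = Suc (degree ?q)"
    by (subst p, subst degree_mult_eq) (use calculation in auto)
  ultimately show ?thesis using that[of ?q] poly_over_synthetic_div[OF assms(1-3)] p by simp
qed

section \<open>Chevalley's extension theorem\<close>

definition adjoin :: "'a::field set \<Rightarrow> 'a \<Rightarrow> 'a set" where
  "adjoin B x = {poly p x | p. poly_over B p}"

lemma subring_adjoin:
  assumes "subring B" shows "subring (adjoin B x)"
  unfolding subring_def
proof (intro conjI ballI)
  show "1 \<in> adjoin B x"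
    unfolding adjoin_def using assms by (auto intro!: exI[of _ 1] simp: one_pCons subring_one)
  fix u v assume "u \<in> adjoin B x" "v \<in> adjoin B x"
  then obtain p q where pq: "poly_over B p" "poly_over B q" "u = poly p x" "v = poly q x"
    unfolding adjoin_def by auto
  show "u + v \<in> adjoin B x" "u * v \<in> adjoin B x"
    unfolding adjoin_def using pq assms poly_over_add poly_over_mult
    by (metis (mono_tags, lifting) mem_Collect_eq poly_add poly_mult)+
  have "- u = poly (0 - p) x" using pq by simp
  then show "- u \<in> adjoin B x"
    unfolding adjoin_def using pq assms poly_over_diff poly_over_0 by blast
qed

lemma adjoin_superset: "subring B \<Longrightarrow> B \<subseteq> adjoin B x"
  unfolding adjoin_def by (auto intro!: exI[of _ "[:_:]"])

lemma adjoin_elem: "subring B \<Longrightarrow> x \<in> adjoin B x"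
  unfolding adjoin_def
  by (auto intro!: exI[of _ "[:0, 1:]"] simp: subring_one subring_zero)

text \<open>Since \<open>1 - s * c 0\<close> is a unit, the relation for \<open>inverse x\<close>
  can be solved for 1; multiplied by \<open>x ^ n\<close> it expresses the top power by lower ones
  over \<open>B\<close>. Substituting this in \<open>p\<close> lowers its degree. The element
  \<open>inverse s\<close> takes the place of 1 in the usual argument with an ideal of
  non-units.\<close>

lemma chevalley_descent:
  assumes B: "subring B" and s: "s \<noteq> 0" "s \<in> B" "inverse s \<notin> B"
    and unit: "\<And>c. c \<in> B \<Longrightarrow> inverse (1 - s * c) \<in> B"
    and x: "x \<noteq> 0"
    and p: "poly_over B p" "poly p x = inverse s"
    and q: "poly_over B q" "poly q (inverse x) = inverse s"
    and le: "degree q \<le> degree p"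
  shows "\<exists>p'. poly_over B p' \<and> poly p' x = inverse s \<and> degree p' < degree p"
proof -
  define n where "n = degree p"
  define c where "c = coeff q"
  have cB: "c i \<in> B" for i using q by (auto simp: c_def poly_over_def)
  have nz: "1 - s * c 0 \<noteq> 0"
  proof
    assume "1 - s * c 0 = 0"
    then have "c 0 = inverse s" using s by (simp add: field_simps)
    then show False using cB[of 0] s by simp
  qed
  have n0: "degree q \<noteq> 0"
  proof
    assume "degree q = 0"
    then have "poly q (inverse x) = c 0"
      unfolding c_def by (elim degree_eq_zeroE) simp
    then show False using q cB[of 0] s by simp
  qed
  define v where "v = inverse (1 - s * c 0)"
  have vB: "v \<in> B" using unit cB by (simp add: v_def)
  have "inverse s = (\<Sum>j\<le>degree q. c j * inverse x ^ j)"
    using q(2) by (simp add: poly_altdef c_def)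
  also have "\<dots> = c 0 + (\<Sum>j=1..degree q. c j * inverse x ^ j)"
    by (simp add: sum.atMost_shift sum.atLeast1_atMost_eq lessThan_Suc_atMost)
  finally have e1: "1 - s * c 0 = s * (\<Sum>j=1..degree q. c j * inverse x ^ j)"
    using s(1) by (simp add: field_simps)
  have "1 = v * (1 - s * c 0)" using nz by (simp add: v_def)
  also have "\<dots> = s * v * (\<Sum>j=1..degree q. c j * inverse x ^ j)" using e1 by simp
  finally have e2: "x ^ n = s * v * (\<Sum>j=1..degree q. c j * inverse x ^ j) * x ^ n" by simp
  define r where "r = (\<Sum>j=1..degree q. monom (s * v * c j) (n - j))"
  have rB: "poly_over B r" unfolding r_def
    by (intro poly_over_sum[OF B] poly_over_monom[OF B] subring_mult[OF B] s vB cB)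
  have "poly r x = (\<Sum>j=1..degree q. s * v * c j * x ^ (n - j))"
    by (simp add: r_def poly_sum poly_monom)
  also have "\<dots> = (\<Sum>j=1..degree q. s * v * c j * (inverse x ^ j * x ^ n))"
  proof (intro sum.cong refl)
    fix j assume "j \<in> {1..degree q}"
    then have "x ^ n = x ^ j * x ^ (n - j)"
      using le by (simp add: n_def flip: power_add)
    then show "s * v * c j * x ^ (n - j) = s * v * c j * (inverse x ^ j * x ^ n)"
      using x by (simp add: field_simps power_inverse)
  qed
  also have "\<dots> = x ^ n"
    by (subst (2) e2) (simp add: sum_distrib_left sum_distrib_right mult_ac)
  finally have r: "poly r x = x ^ n" .
  have dr: "degree r < n"
    unfolding r_def
  proof (rule le_less_trans[OF degree_sum_le[of _ _ "n - 1"]])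
    fix j assume "j \<in> {1..degree q}"
    then show "degree (monom (s * v * c j) (n - j)) \<le> n - 1"
      using degree_monom_le le_trans by (metis atLeastAtMost_iff diff_le_mono2)
  qed (use n0 le in \<open>auto simp: n_def\<close>)
  define p' where "p' = p - monom (coeff p n) n + smult (coeff p n) r"
  have "poly_over B p'" unfolding p'_def
    using p rB B by (intro poly_over_add poly_over_diff poly_over_smult poly_over_monom)
      (auto simp: poly_over_def)
  moreover have "poly p' x = inverse s"
    by (simp add: p'_def r poly_monom p)
  moreover have "degree p' < n"
  proof -
    have "degree (p - monom (coeff p n) n) < n"
    proof -
      have "degree (p - monom (coeff p n) n) \<le> n - 1"
        by (rule degree_le) (auto simp: n_def coeff_eq_0)
      then show ?thesis using n0 le by (simp add: n_def)
    qed
    then show ?thesis unfolding p'_def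
      by (intro degree_add_less) (use dr degree_smult_le le_less_trans in blast)+
  qed
  ultimately show ?thesis by (auto simp: n_def)
qed

text \<open>Avoiding the single element \<open>inverse s\<close> passes to unions of chains, so a
  maximal subring with this property exists. If neither \<open>x\<close> nor
  \<open>inverse x\<close> belonged to it, adjoining either one would produce
  \<open>inverse s\<close>, and the descent would never stop.\<close>

theorem chevalley:
  fixes A :: "'a::field set"
  assumes A: "subring A" and s: "s \<in> A" "inverse s \<notin> A"
  obtains B where "A \<subseteq> B" "subring B" "inverse s \<notin> B" "\<And>x. x \<noteq> 0 \<Longrightarrow> x \<in> B \<or> inverse x \<in> B"
proof -
  have s0: "s \<noteq> 0" using s subring_zero[OF A] by auto
  define S where "S = {B. subring B \<and> A \<subseteq> B \<and> inverse s \<notin> B}"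
  have "\<exists>M\<in>S. \<forall>X\<in>S. M \<subseteq> X \<longrightarrow> X = M"
  proof (rule subset_Zorn_nonempty)
    show "S \<noteq> {}" using A s by (auto simp: S_def)
    fix C assume C: "C \<noteq> {}" "subset.chain S C"
    have sub: "\<And>B. B \<in> C \<Longrightarrow> subring B \<and> A \<subseteq> B \<and> inverse s \<notin> B"
      using C by (auto simp: subset.chain_def S_def)
    have "subring (\<Union>C)" unfolding subring_def
    proof (intro conjI ballI)
      show "1 \<in> \<Union>C" using C sub subring_one by blast
      fix x y assume "x \<in> \<Union>C" "y \<in> \<Union>C"
      then obtain B B' where B: "x \<in> B" "y \<in> B'" "B \<in> C" "B' \<in> C" by auto
      then have "B \<subseteq> B' \<or> B' \<subseteq> B" using C by (auto simp: subset.chain_def)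
      then obtain D where D: "x \<in> D" "y \<in> D" "D \<in> C" using B by blast
      then show "x + y \<in> \<Union>C" "x * y \<in> \<Union>C" "- x \<in> \<Union>C"
        using sub[OF D(3)] subring_closed[of D] by blast+
    qed
    then show "\<Union>C \<in> S" using C sub by (auto simp: S_def)
  qed
  then obtain B where B: "subring B" "A \<subseteq> B" "inverse s \<notin> B"
    and max: "\<And>X. subring X \<Longrightarrow> B \<subseteq> X \<Longrightarrow> inverse s \<notin> X \<Longrightarrow> X = B"
    unfolding S_def by auto
  have adj: "\<exists>p. poly_over B p \<and> poly p x = inverse s" if "x \<notin> B" for x
  proof (rule ccontr)
    assume "\<not> ?thesis"
    then have "inverse s \<notin> adjoin B x" by (auto simp: adjoin_def)
    then have "adjoin B x = B"
      using max[OF subring_adjoin adjoin_superset] B(1) by simp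
    then show False using adjoin_elem[OF B(1), of x] that by simp
  qed
  \<comment> \<open>Otherwise adjoining the inverse of \<open>u = 1 - s * c\<close> produces
    \<open>inverse s\<close>. Clearing denominators puts \<open>u ^ n * inverse s\<close> into
    \<open>B\<close>, and as \<open>u ^ n\<close> is 1 modulo \<open>s\<close>, also
    \<open>inverse s\<close> itself.\<close>
  have unit: "inverse (1 - s * c) \<in> B" if c: "c \<in> B" for c
  proof (rule ccontr)
    define u where "u = 1 - s * c"
    assume "inverse (1 - s * c) \<notin> B"
    then obtain p where p: "poly_over B p" "poly p (inverse u) = inverse s"
      using adj u_def by blast
    have u0: "u \<noteq> 0"
    proof
      assume "u = 0"
      then have "c = inverse s" using s0 by (simp add: u_def field_simps)
      then show False using c B by simp
    qed
    have uB: "u \<in> B" using B c s by (auto simp: u_def intro!: subring_diff subring_one subring_mult)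
    have "u ^ degree p * inverse s = (\<Sum>i\<le>degree p. coeff p i * u ^ (degree p - i))"
      unfolding p(2)[symmetric] poly_altdef sum_distrib_left
    proof (intro sum.cong refl)
      fix i assume "i \<in> {..degree p}"
      then have "u ^ degree p = u ^ i * u ^ (degree p - i)" by (simp flip: power_add)
      then show "u ^ degree p * (coeff p i * inverse u ^ i) = coeff p i * u ^ (degree p - i)"
        using u0 by (simp add: field_simps power_inverse)
    qed
    also have "\<dots> \<in> B" using p uB B by (intro subring_sum subring_mult subring_power) (auto simp: poly_over_def)
    finally have inB: "u ^ degree p * inverse s \<in> B" .
    have "\<exists>e\<in>B. u ^ n = 1 - s * e" for n
    proof (induction n)
      case 0 then show ?case using subring_zero[OF B(1)] by (intro bexI[of _ 0]) auto
    next
      case (Suc n)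
      then obtain e where e: "e \<in> B" "u ^ n = 1 - s * e" by auto
      have "u ^ Suc n = 1 - s * (e + c - s * c * e)"
        unfolding power_Suc e(2) by (simp add: u_def algebra_simps)
      moreover have "e + c - s * c * e \<in> B"
        using e c s B by (intro subring_diff subring_add subring_mult) auto
      ultimately show ?case by blast
    qed
    then obtain e where e: "e \<in> B" "u ^ degree p = 1 - s * e" by blast
    have "u ^ degree p * inverse s + e = inverse s" using e s0 by (simp add: field_simps)
    then show False using subring_add[OF B(1) inB e(1)] B by simp
  qed
  \<comment> \<open>Whichever relation has the larger degree is shortened, so the sum of the two
    degrees decreases.\<close>
  have none: False if "x \<noteq> 0" "poly_over B p" "poly p x = inverse s"
    "poly_over B q" "poly q (inverse x) = inverse s" for x p q
    using that
  proof (induction "degree p + degree q" arbitrary: x p q rule: less_induct)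
    case less
    show ?case
    proof (cases "degree q \<le> degree p")
      case True
      then obtain p' where "poly_over B p'" "poly p' x = inverse s" "degree p' < degree p"
        using chevalley_descent[OF B(1) s0 _ B(3) unit less.prems] s B by blast
      then show False using less.hyps[of p' q x] less.prems by auto
    next
      case False
      then obtain q' where "poly_over B q'" "poly q' (inverse x) = inverse s" "degree q' < degree q"
        using chevalley_descent[OF B(1) s0 _ B(3) unit, of "inverse x" q p] s B less.prems by auto
      then show False using less.hyps[of p q' x] less.prems by auto
    qed
  qed
  show ?thesis
  proof (rule that[OF B(2,1,3)])
    fix x :: 'a assume "x \<noteq> 0"
    then show "x \<in> B \<or> inverse x \<in> B"
      using adj[of x] adj[of "inverse x"] none[of x] by blast
  qed
qed

section \<open>Places and discrete valuations\<close>

lemma powi_add0: "(p::'a::field) \<noteq> 0 \<Longrightarrow> p powi (m + n) = p powi m * p powi n"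
  by (rule power_int_add) simp

locale vplace =
  fixes E k R :: "'a::field set"
  assumes E: "subfield E" and k: "subfield k" and pl: "place E k R"
begin

lemma ring: "subring R"
  using pl k unfolding place_def subring_def subfield_def by auto

lemmas R_zero = subring_zero[OF ring] and R_one = subring_one[OF ring]
  and R_add = subring_add[OF ring] and R_mult = subring_mult[OF ring]
  and R_minus = subring_minus[OF ring] and R_diff = subring_diff[OF ring]
  and R_power = subring_power[OF ring] and R_sum = subring_sum[OF ring]
  and R_poly = subring_poly[OF ring]

lemma k_R: "x \<in> k \<Longrightarrow> x \<in> R"
  and R_E: "x \<in> R \<Longrightarrow> x \<in> E"
  using pl unfolding place_def by auto

lemma R_cases: "x \<in> E \<Longrightarrow> x \<notin> R \<Longrightarrow> inverse x \<in> R"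
  using pl R_zero unfolding place_def by (cases "x = 0") auto

lemma m_R: "x \<in> max_ideal R \<Longrightarrow> x \<in> R"
  by (simp add: max_ideal_def)

lemma m_zero: "0 \<in> max_ideal R"
  by (simp add: max_ideal_def R_zero)

lemma one_notin_m: "1 \<notin> max_ideal R"
  by (simp add: max_ideal_def R_one)

lemma notin_R: "x \<in> E \<Longrightarrow> x \<notin> R \<Longrightarrow> inverse x \<in> max_ideal R"
  using R_cases by (auto simp: max_ideal_def)

lemma m_mult: "x \<in> max_ideal R \<Longrightarrow> y \<in> R \<Longrightarrow> x * y \<in> max_ideal R"
proof (rule ccontr)
  assume x: "x \<in> max_ideal R" and y: "y \<in> R" and n: "x * y \<notin> max_ideal R"
  have "x * y \<in> R" by (intro R_mult m_R x y)
  with n have xy: "x * y \<noteq> 0" "inverse (x * y) \<in> R" by (auto simp only: max_ideal_def mem_Collect_eq)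
  then have "inverse x = y * inverse (x * y)" by (simp add: nonzero_inverse_mult_distrib)
  with xy(2) have "inverse x \<in> R" using R_mult[OF y xy(2)] by (simp only:)
  then show False using x xy by (auto simp: max_ideal_def)
qed

lemma m_mult': "x \<in> R \<Longrightarrow> y \<in> max_ideal R \<Longrightarrow> x * y \<in> max_ideal R"
  using m_mult[of y x] by (simp add: mult.commute)

lemma m_add: "x \<in> max_ideal R \<Longrightarrow> y \<in> max_ideal R \<Longrightarrow> x + y \<in> max_ideal R"
proof (cases "x = 0 \<or> y = 0")
  case False
  assume x: "x \<in> max_ideal R" and y: "y \<in> max_ideal R"
  then have "x / y \<in> E" using E m_R R_E subfield_divide by blast
  then have "x / y \<in> R \<or> y / x \<in> R" using R_cases[of "x / y"] by auto
  moreover have "x + y = y * (1 + x / y)" "x + y = x * (1 + y / x)"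
    using False by (auto simp: field_simps)
  moreover have "1 + u \<in> R" if "u \<in> R" for u by (intro R_add R_one that)
  ultimately show ?thesis using m_mult[OF x] m_mult[OF y] by fastforce
qed auto

lemma m_minus: "x \<in> max_ideal R \<Longrightarrow> - x \<in> max_ideal R"
  using m_mult[of x "-1"] R_minus[OF R_one] by simp

lemma m_diff: "x \<in> max_ideal R \<Longrightarrow> y \<in> max_ideal R \<Longrightarrow> x - y \<in> max_ideal R"
  using m_add[of x "- y"] m_minus[of y] by simp

lemma m_sum: "(\<And>i. i \<in> I \<Longrightarrow> f i \<in> max_ideal R) \<Longrightarrow> sum f I \<in> max_ideal R"
  by (induction I rule: infinite_finite_induct) (auto intro: m_zero m_add)

lemma unit_iff: "is_unit_in R x \<longleftrightarrow> x \<in> R \<and> x \<notin> max_ideal R"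
  using R_zero by (auto simp: is_unit_in_def max_ideal_def)

lemma unit_R: "is_unit_in R x \<Longrightarrow> x \<in> R" and unit_notin_m: "is_unit_in R x \<Longrightarrow> x \<notin> max_ideal R"
  by (simp_all add: unit_iff)

lemma unit_mult: "is_unit_in R x \<Longrightarrow> is_unit_in R y \<Longrightarrow> is_unit_in R (x * y)"
  using R_mult by (auto simp: is_unit_in_def)

lemma unit_inverse: "is_unit_in R x \<Longrightarrow> is_unit_in R (inverse x)"
  by (auto simp: is_unit_in_def)

lemma unit_k: "x \<in> k \<Longrightarrow> x \<noteq> 0 \<Longrightarrow> is_unit_in R x"
  using k k_R subfield_inverse by (auto simp: is_unit_in_def)

lemma m_k: "x \<in> k \<Longrightarrow> x \<in> max_ideal R \<Longrightarrow> x = 0"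
  using unit_k unit_iff by blast

lemma m_prime: "x \<in> R \<Longrightarrow> y \<in> R \<Longrightarrow> x * y \<in> max_ideal R \<Longrightarrow> x \<in> max_ideal R \<or> y \<in> max_ideal R"
  using unit_mult[of x y] unit_iff by blast

lemma m_power: "x \<in> max_ideal R \<Longrightarrow> n > 0 \<Longrightarrow> x ^ n \<in> max_ideal R"
  by (cases n) (auto intro: m_mult R_power m_R)

lemma power_m: "x \<in> R \<Longrightarrow> x ^ n \<in> max_ideal R \<Longrightarrow> x \<in> max_ideal R"
  by (induction n) (use one_notin_m m_prime R_power in auto)

lemma power_R:
  assumes "x \<in> E" "x ^ n \<in> R" "n > 0" shows "x \<in> R"
proof (rule ccontr)
  assume "x \<notin> R"
  then have "inverse x \<in> max_ideal R" using assms notin_R by simp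
  then have "inverse x ^ n * x ^ n \<in> max_ideal R" using m_mult m_power assms by blast
  moreover have "x \<noteq> 0" using \<open>x \<notin> R\<close> R_zero by auto
  ultimately show False using one_notin_m by (simp add: power_inverse)
qed

text \<open>Valuation rings are integrally closed: dividing the equation of \<open>x\<close> by its
  top power would put the leading coefficient, a nonzero constant, into the maximal ideal.\<close>

lemma algebraic_R:
  assumes x: "x \<in> E" and alg: "algebraic_over k x" shows "x \<in> R"
proof (rule ccontr)
  assume "x \<notin> R"
  then have im: "inverse x \<in> max_ideal R" and x0: "x \<noteq> 0" using x notin_R R_zero by auto
  obtain p where p: "p \<noteq> 0" "poly_over k p" "poly p x = 0"
    using alg by (auto simp: algebraic_over_def)
  let ?n = "degree p"
  have "0 = poly p x * inverse x ^ ?n" using p by simp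
  also have "\<dots> = (\<Sum>i\<le>?n. coeff p i * inverse x ^ (?n - i))"
    unfolding poly_altdef sum_distrib_right
  proof (intro sum.cong refl)
    fix i assume "i \<in> {..?n}"
    then have "inverse x ^ ?n = inverse x ^ i * inverse x ^ (?n - i)" by (simp flip: power_add)
    then show "coeff p i * x ^ i * inverse x ^ ?n = coeff p i * inverse x ^ (?n - i)"
      using x0 by (simp add: field_simps)
  qed
  also have "\<dots> = lead_coeff p + (\<Sum>i<?n. coeff p i * inverse x ^ (?n - i))"
    by (simp add: lessThan_Suc_atMost[symmetric] add.commute)
  finally have "lead_coeff p = - (\<Sum>i<?n. coeff p i * inverse x ^ (?n - i))"
    by (simp add: eq_neg_iff_add_eq_0)
  moreover have "(\<Sum>i<?n. coeff p i * inverse x ^ (?n - i)) \<in> max_ideal R"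
    using p im by (intro m_sum m_mult' m_power) (auto intro: k_R simp: poly_over_def)
  ultimately have "lead_coeff p \<in> max_ideal R" using m_minus by metis
  then show False using m_k p by (metis poly_over_def leading_coeff_0_iff)
qed

lemma max_ideal_mono:
  assumes "R \<subseteq> R'" "x \<in> E" "x \<in> max_ideal R'" shows "x \<in> max_ideal R"
proof (cases "x = 0")
  case False
  then have "inverse x \<notin> R" using assms by (auto simp: max_ideal_def)
  then show ?thesis using R_cases[OF assms(2)] by (auto simp: max_ideal_def)
qed (simp add: m_zero)

end

section \<open>Orders and leading coefficients with respect to a local parameter\<close>

text \<open>\<open>p\<close> generates the value group of the valuation ring \<open>R\<close> of the field \<open>E\<close>.\<close>
definition dval :: "'a::field set \<Rightarrow> 'a set \<Rightarrow> 'a \<Rightarrow> bool" where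
  "dval E R p \<longleftrightarrow> p \<in> max_ideal R \<and> p \<noteq> 0 \<and>
     (\<forall>x\<in>E. x \<noteq> 0 \<longrightarrow> (\<exists>n. is_unit_in R (x * p powi (- n))))"

text \<open>\<open>x\<close> has order \<open>n\<close> with respect to \<open>p\<close>, and its leading coefficient is represented in \<open>l\<close>.\<close>
definition lord :: "'a::field set \<Rightarrow> 'a \<Rightarrow> 'a set \<Rightarrow> 'a \<Rightarrow> int \<Rightarrow> bool" where
  "lord R p l x n \<longleftrightarrow> (\<exists>c\<in>l. c \<noteq> 0 \<and> x * p powi (- n) - c \<in> max_ideal R)"

context vplace
begin

lemma powi_R: "p \<in> R \<Longrightarrow> n \<ge> 0 \<Longrightarrow> p powi n \<in> R"
  by (auto simp: power_int_def intro: R_power)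

lemma powi_m: "p \<in> max_ideal R \<Longrightarrow> n > 0 \<Longrightarrow> p powi n \<in> max_ideal R"
  by (auto simp: power_int_def intro: m_power)

lemma unit_powi_unique:
  assumes p: "p \<in> max_ideal R" "p \<noteq> 0"
    and u: "is_unit_in R (x * p powi (- n))" "is_unit_in R (x * p powi (- m))"
  shows "n = m"
proof -
  have aux: "\<not> n < m" if "is_unit_in R (x * p powi (- n))" "is_unit_in R (x * p powi (- m))" for n m
  proof
    assume "n < m"
    have "x * p powi (- n) = x * p powi (- m) * p powi (m - n)"
      using powi_add0[OF p(2), of "- m" "m - n"] by (simp add: mult.assoc)
    moreover have "\<dots> \<in> max_ideal R"
      using that \<open>n < m\<close> p by (intro m_mult' powi_m) (auto simp: unit_iff)
    ultimately have "x * p powi (- n) \<in> max_ideal R" by (simp only:)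
    then show False using that(1) unit_iff by blast
  qed
  show ?thesis using aux[of n m] aux[of m n] u by linarith
qed

context
  fixes p assumes dv: "dval E R p"
begin

lemma p_m: "p \<in> max_ideal R" and p0: "p \<noteq> 0"
  using dv by (auto simp: dval_def)

lemma dval_unit: "x \<in> E \<Longrightarrow> x \<noteq> 0 \<Longrightarrow> \<exists>n. is_unit_in R (x * p powi (- n))"
  using dv by (auto simp: dval_def)

lemma powi_split: "x = x * p powi (- n) * p powi n"
  using powi_add0[OF p0, of "- n" n] p0 by (simp add: mult.assoc power_int_minus)

lemma dval_R_iff:
  assumes "is_unit_in R (x * p powi (- n))" shows "x \<in> R \<longleftrightarrow> n \<ge> 0"
proof
  assume x: "x \<in> R"
  show "n \<ge> 0"
  proof (rule ccontr)
    assume "\<not> n \<ge> 0"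
    then have "x * p powi (- n) \<in> max_ideal R"
      by (intro m_mult' x powi_m p_m) simp
    then show False using assms unit_iff by blast
  qed
next
  assume "n \<ge> 0"
  then have "x * p powi (- n) * p powi n \<in> R"
    by (rule R_mult[OF unit_R[OF assms] powi_R[OF m_R[OF p_m]]])
  then show "x \<in> R" using powi_split[of x n, symmetric] by (rule back_subst[of "\<lambda>y. y \<in> R"])
qed

lemma dval_m_iff:
  assumes "is_unit_in R (x * p powi (- n))" shows "x \<in> max_ideal R \<longleftrightarrow> n > 0"
proof
  assume x: "x \<in> max_ideal R"
  have "is_unit_in R x" if "n = 0" using assms that by simp
  then have "n \<noteq> 0" using x by (auto simp only: unit_iff)
  then show "n > 0" using dval_R_iff[OF assms] m_R[OF x] by simp
next
  assume "n > 0"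
  then have "x * p powi (- n) * p powi n \<in> max_ideal R"
    using assms by (intro m_mult' powi_m p_m) (auto simp: unit_iff)
  then show "x \<in> max_ideal R"
    using powi_split[of x n, symmetric] by (rule back_subst[of "\<lambda>y. y \<in> max_ideal R"])
qed

lemma dval_uniformizer: "uniformizer R p"
  unfolding uniformizer_def
proof (intro conjI ballI p_m p0)
  fix x assume x: "x \<in> max_ideal R"
  show "\<exists>y\<in>R. x = p * y"
  proof (cases "x = 0")
    case True then show ?thesis using R_zero by auto
  next
    case False
    then obtain n where n: "is_unit_in R (x * p powi (- n))" using dval_unit x m_R R_E by blast
    then have "n > 0" using dval_m_iff x by simp
    have "x * p powi (- n) * p powi (n - 1) = x * p powi (- 1)"
      by (simp only: mult.assoc powi_add0[OF p0, symmetric]) simp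
    then have "x = p * (x * p powi (- n) * p powi (n - 1))"
      using p0 by (simp only: power_int_minus power_int_1_right) simp
    moreover have "x * p powi (- n) * p powi (n - 1) \<in> R"
      using \<open>n > 0\<close> by (intro R_mult[OF unit_R[OF n] powi_R[OF m_R[OF p_m]]]) simp
    ultimately show ?thesis by blast
  qed
qed

text \<open>\<open>val\<close> ranges over all uniformizers. A value found with \<open>p\<close> is
  the only one because two uniformizers divide each other and so differ by a unit.\<close>

lemma val_eqI:
  assumes u: "is_unit_in R (x * p powi (- n))"
  shows "val R x = n"
  unfolding val_def
proof (rule the_equality)
  show "\<exists>p. uniformizer R p \<and> is_unit_in R (x * p powi (- n))" using u dval_uniformizer by blast
  fix m assume "\<exists>p. uniformizer R p \<and> is_unit_in R (x * p powi (- m))"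
  then obtain q where q: "uniformizer R q" "is_unit_in R (x * q powi (- m))" by blast
  obtain y where y: "y \<in> R" "q = p * y" using q dval_uniformizer by (auto simp: uniformizer_def)
  obtain y' where y': "y' \<in> R" "p = q * y'" using q dval_uniformizer by (auto simp: uniformizer_def)
  have "y * y' = 1" using y y' p0 by (metis mult.assoc mult_cancel_left1)
  then have yu: "is_unit_in R y" using y y' by (auto simp: is_unit_in_def inverse_unique)
  have powi_unit: "is_unit_in R (y powi j)" for j
  proof -
    have "is_unit_in R (u ^ i)" if "is_unit_in R u" for u i
      using that by (induction i) (auto intro: unit_mult simp: is_unit_in_def R_one R_mult)
    then show ?thesis using yu unit_inverse by (auto simp: power_int_def)
  qed
  have "y powi (- m) * y powi m = 1"
    using \<open>y * y' = 1\<close> powi_add0[of y "-m" m] by (metis add.left_inverse mult_zero_left power_int_0_right zero_neq_one)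
  then have "x * q powi (- m) * y powi m = x * p powi (- m)"
    unfolding y(2) power_int_mult_distrib by (simp only: mult.assoc mult_1_right)
  then have "is_unit_in R (x * p powi (- m))" using unit_mult[OF q(2) powi_unit[of m]] by (simp only:)
  then show "m = n" using unit_powi_unique[OF p_m p0 _ u] by blast
qed

lemma val_unit: "x \<in> E \<Longrightarrow> x \<noteq> 0 \<Longrightarrow> is_unit_in R (x * p powi (- val R x))"
  using dval_unit val_eqI by metis

lemma val_nonneg_iff: "x \<in> E \<Longrightarrow> x \<noteq> 0 \<Longrightarrow> val R x \<ge> 0 \<longleftrightarrow> x \<in> R"
  and val_pos_iff: "x \<in> E \<Longrightarrow> x \<noteq> 0 \<Longrightarrow> val R x > 0 \<longleftrightarrow> x \<in> max_ideal R"
  using dval_R_iff dval_m_iff val_unit by blast+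

lemma val_mult:
  assumes "x \<in> E" "y \<in> E" "x \<noteq> 0" "y \<noteq> 0" shows "val R (x * y) = val R x + val R y"
proof (rule val_eqI)
  have "x * y * p powi (- (val R x + val R y)) = (x * p powi (- val R x)) * (y * p powi (- val R y))"
    using powi_add0[OF p0, of "- val R x" "- val R y"] by (simp add: mult_ac)
  then show "is_unit_in R (x * y * p powi (- (val R x + val R y)))"
    using unit_mult val_unit assms by metis
qed

lemma val_inverse:
  assumes "x \<in> E" "x \<noteq> 0" shows "val R (inverse x) = - val R x"
proof (rule val_eqI)
  have "inverse x * p powi (- (- val R x)) = inverse (x * p powi (- val R x))"
    by (simp add: power_int_minus)
  then show "is_unit_in R (inverse x * p powi (- (- val R x)))"
    using unit_inverse val_unit assms by metis
qed

lemma val_power: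
  assumes "x \<in> E" "x \<noteq> 0" shows "val R (x ^ n) = int n * val R x"
proof (induction n)
  case 0
  show ?case by (rule val_eqI) (simp add: is_unit_in_def R_one)
next
  case (Suc n)
  then show ?case
    using assms val_mult[of x "x ^ n"] subring_power[OF subfield_subring[OF E]]
    by (simp add: algebra_simps)
qed

lemma val_ge_iff:
  assumes "x \<in> E" "x \<noteq> 0" shows "val R x \<ge> n \<longleftrightarrow> x * p powi (- n) \<in> R"
proof -
  have "x * p powi (- n) * p powi (- (val R x - n)) = x * p powi (- val R x)"
    using powi_add0[OF p0, of "- n" "- (val R x - n)"] by (simp add: mult.assoc)
  then have "is_unit_in R (x * p powi (- n) * p powi (- (val R x - n)))"
    using val_unit[OF assms] by (simp only:)
  from dval_R_iff[OF this] show ?thesis by auto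
qed

lemma val_gt_iff:
  assumes "x \<in> E" "x \<noteq> 0" shows "val R x > n \<longleftrightarrow> x * p powi (- n) \<in> max_ideal R"
proof -
  have "x * p powi (- n) * p powi (- (val R x - n)) = x * p powi (- val R x)"
    using powi_add0[OF p0, of "- n" "- (val R x - n)"] by (simp add: mult.assoc)
  then have "is_unit_in R (x * p powi (- n) * p powi (- (val R x - n)))"
    using val_unit[OF assms] by (simp only:)
  from dval_m_iff[OF this] show ?thesis by auto
qed

lemma val_add_ge:
  assumes "x \<in> E" "y \<in> E" "x = 0 \<or> val R x \<ge> n" "y = 0 \<or> val R y \<ge> n" "x + y \<noteq> 0"
  shows "val R (x + y) \<ge> n"
proof -
  have *: "u * p powi (- n) \<in> R" if "u \<in> E" "u = 0 \<or> val R u \<ge> n" for u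
    using that R_zero val_ge_iff[OF that(1)] by (cases "u = 0") auto
  have "x * p powi (- n) \<in> R" "y * p powi (- n) \<in> R"
    using *[OF assms(1,3)] *[OF assms(2,4)] by auto
  then have "(x + y) * p powi (- n) \<in> R" using R_add by (simp add: distrib_right)
  then show ?thesis using assms val_ge_iff subring_add[OF subfield_subring[OF E]] by auto
qed

end

subsection \<open>Orders with leading coefficients\<close>

lemma lord_unit: "lord R p l x n \<Longrightarrow> l \<subseteq> k \<Longrightarrow> is_unit_in R (x * p powi (- n))"
proof -
  assume "lord R p l x n" and l: "l \<subseteq> k"
  then obtain c where c: "c \<in> k" "c \<noteq> 0" "x * p powi (- n) - c \<in> max_ideal R"
    by (auto simp: lord_def)
  then have "x * p powi (- n) \<in> R" using R_add[OF m_R k_R, of "x * p powi (- n) - c" c] by simp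
  moreover have "x * p powi (- n) \<notin> max_ideal R"
    using c m_diff[of "x * p powi (- n)" "x * p powi (- n) - c"] m_k[of c] by auto
  ultimately show ?thesis by (simp add: unit_iff)
qed

lemma dvalI:
  assumes "p \<in> max_ideal R" "p \<noteq> 0" "\<And>x. x \<in> E \<Longrightarrow> x \<noteq> 0 \<Longrightarrow> \<exists>n. lord R p k x n"
  shows "dval E R p"
  unfolding dval_def using assms lord_unit by blast

lemma lord_val: "dval E R p \<Longrightarrow> lord R p l x n \<Longrightarrow> l \<subseteq> k \<Longrightarrow> val R x = n"
  using val_eqI lord_unit by blast

context
  fixes p l assumes p: "p \<in> max_ideal R" "p \<noteq> 0" and l: "subfield l" "l \<subseteq> k"
begin

lemma lord_nonzero: "lord R p l x n \<Longrightarrow> x \<noteq> 0"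
  using lord_unit[OF _ l(2)] by (auto simp: is_unit_in_def)

lemma lord_const: "c \<in> l \<Longrightarrow> c \<noteq> 0 \<Longrightarrow> lord R p l c 0"
  by (auto simp: lord_def m_zero intro!: bexI[of _ c])

lemma lord_uniformizer: "lord R p l p 1"
  using p subring_one[OF subfield_subring[OF l(1)]]
  by (auto simp: lord_def m_zero power_int_minus intro!: bexI[of _ 1])

lemma lord_residue: "x - c \<in> max_ideal R \<Longrightarrow> c \<in> l \<Longrightarrow> c \<noteq> 0 \<Longrightarrow> lord R p l x 0"
  by (auto simp: lord_def)

lemma lord_mult:
  assumes "lord R p l x n" "lord R p l y m" shows "lord R p l (x * y) (n + m)"
proof -
  define x' y' where "x' = x * p powi (- n)" and "y' = y * p powi (- m)"
  obtain c d where c: "c \<in> l" "c \<noteq> 0" "x' - c \<in> max_ideal R"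
    and d: "d \<in> l" "d \<noteq> 0" "y' - d \<in> max_ideal R"
    using assms by (auto simp: lord_def x'_def y'_def)
  have "y' \<in> R" using lord_unit[OF assms(2) l(2)] by (simp add: y'_def unit_iff)
  then have "(x' - c) * y' + c * (y' - d) \<in> max_ideal R"
    using c d l by (intro m_add m_mult m_mult') (auto intro: k_R)
  moreover have "x * y * p powi (- (n + m)) - c * d = (x' - c) * y' + c * (y' - d)"
    using powi_add0[OF p(2), of "- n" "- m"] by (simp add: x'_def y'_def algebra_simps)
  moreover have "c * d \<in> l" using c d l subring_mult subfield_subring by blast
  ultimately show ?thesis unfolding lord_def using c d by (intro bexI[of _ "c * d"]) auto
qed

lemma lord_inverse:
  assumes "lord R p l x n" shows "lord R p l (inverse x) (- n)"
proof -
  define x' where "x' = x * p powi (- n)"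
  obtain c where c: "c \<in> l" "c \<noteq> 0" "x' - c \<in> max_ideal R"
    using assms by (auto simp: lord_def x'_def)
  have u: "is_unit_in R x'" using lord_unit[OF assms l(2)] by (simp add: x'_def)
  have "inverse x' - inverse c = (x' - c) * (- (inverse x' * inverse c))"
    using u c by (auto simp: field_simps is_unit_in_def)
  also have "\<dots> \<in> max_ideal R"
    using u c l subfield_inverse[OF l(1)]
    by (intro m_mult c R_minus R_mult) (auto simp: is_unit_in_def intro: k_R)
  finally show ?thesis unfolding lord_def
    using c subfield_inverse[OF l(1)] by (intro bexI[of _ "inverse c"]) (auto simp: x'_def power_int_minus)
qed

lemma lord_divide:
  assumes "lord R p l x n" "lord R p l y m" shows "lord R p l (x / y) (n - m)"
  using lord_mult[OF assms(1) lord_inverse[OF assms(2)]] by (simp add: divide_inverse)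

lemma lord_power:
  assumes "lord R p l x n" shows "lord R p l (x ^ i) (int i * n)"
proof (induction i)
  case 0
  then show ?case using lord_const[of 1] subring_one[OF subfield_subring[OF l(1)]] by simp
next
  case (Suc i)
  then show ?case using lord_mult[OF assms Suc.IH] by (simp add: algebra_simps)
qed

lemma lord_higher: "lord R p l x m \<Longrightarrow> m > n \<Longrightarrow> x * p powi (- n) \<in> max_ideal R"
proof -
  assume x: "lord R p l x m" and "m > n"
  have "x * p powi (- n) = x * p powi (- m) * p powi (m - n)"
    using powi_add0[OF p(2), of "- m" "m - n"] by (simp add: mult.assoc)
  moreover have "\<dots> \<in> max_ideal R"
    using lord_unit[OF x l(2)] \<open>m > n\<close> p by (intro m_mult' powi_m) (auto simp: unit_iff)
  ultimately show ?thesis by (simp only:)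
qed

lemma lord_add:
  assumes "lord R p l x n" "y * p powi (- n) \<in> max_ideal R" shows "lord R p l (x + y) n"
proof -
  obtain c where c: "c \<in> l" "c \<noteq> 0" "x * p powi (- n) - c \<in> max_ideal R"
    using assms(1) by (auto simp: lord_def)
  then have "(x * p powi (- n) - c) + y * p powi (- n) \<in> max_ideal R"
    using assms m_add by blast
  then show ?thesis using c unfolding lord_def by (intro bexI[of _ c]) (auto simp: algebra_simps)
qed

lemma lord_add_less: "lord R p l x n \<Longrightarrow> lord R p l y m \<Longrightarrow> n < m \<Longrightarrow> lord R p l (x + y) n"
  using lord_add lord_higher by blast

lemma lord_minus: "lord R p l x n \<Longrightarrow> lord R p l (- x) n"
  using lord_mult[of "-1" 0 x n] lord_const[of "-1"] subring_minus[OF subfield_subring[OF l(1)]]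
    subring_one[OF subfield_subring[OF l(1)]] by auto

text \<open>A term of strictly smallest order cannot be cancelled. Its leading coefficient survives
  as well, so the field \<open>l\<close> is preserved.\<close>

lemma lord_sum:
  assumes fin: "finite I" "i \<in> I" and T: "\<And>j. j \<in> I \<Longrightarrow> lord R p l (T j) (e j)"
    and less: "\<And>j. j \<in> I \<Longrightarrow> j \<noteq> i \<Longrightarrow> e i < e j"
  shows "lord R p l (sum T I) (e i)"
proof -
  have "sum T (I - {i}) * p powi (- e i) \<in> max_ideal R"
    unfolding sum_distrib_right using T less lord_higher by (intro m_sum) blast
  then show ?thesis using lord_add[OF T[OF fin(2)]] fin by (simp add: sum.remove)
qed

end

end

section \<open>Simple extensions and residues\<close>

lemma subfield_fractions:
  assumes R: "subring R" shows "subfield {x / y | x y. x \<in> R \<and> y \<in> R \<and> y \<noteq> 0}"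
    (is "subfield ?S")
proof -
  have add: "x / y + x' / y' \<in> ?S" and mult: "(x / y) * (x' / y') \<in> ?S"
    if "x \<in> R" "y \<in> R" "y \<noteq> 0" "x' \<in> R" "y' \<in> R" "y' \<noteq> 0" for x y x' y'
  proof -
    have "x / y + x' / y' = (x * y' + x' * y) / (y * y')" "(x / y) * (x' / y') = (x * x') / (y * y')"
      using that by (auto simp: field_simps)
    moreover have "x * y' + x' * y \<in> R" "x * x' \<in> R" "y * y' \<in> R" "y * y' \<noteq> 0"
      using that by (auto intro: subring_add[OF R] subring_mult[OF R])
    ultimately show "x / y + x' / y' \<in> ?S" "(x / y) * (x' / y') \<in> ?S" by blast+
  qed
  have minus: "- (x / y) \<in> ?S" if "x \<in> R" "y \<in> R" "y \<noteq> 0" for x y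
  proof -
    have "- (x / y) = (- x) / y" "- x \<in> R" using that subring_minus[OF R] by auto
    then show ?thesis using that by blast
  qed
  have inv: "inverse (x / y) \<in> ?S" if "x \<in> R" "y \<in> R" "y \<noteq> 0" "x / y \<noteq> 0" for x y
  proof -
    have "inverse (x / y) = y / x" "x \<noteq> 0" using that by auto
    then show ?thesis using that by blast
  qed
  have one: "1 \<in> ?S"
    by (rule CollectI, rule exI[of _ 1], rule exI[of _ 1]) (simp add: subring_one[OF R])
  have "subring ?S" unfolding subring_def
  proof (intro conjI ballI one)
    fix u v assume "u \<in> ?S" "v \<in> ?S"
    then obtain x y x' y' where "u = x / y" "v = x' / y'"
      "x \<in> R" "y \<in> R" "y \<noteq> 0" "x' \<in> R" "y' \<in> R" "y' \<noteq> 0" by auto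
    then show "u + v \<in> ?S" "u * v \<in> ?S" "- u \<in> ?S"
      using add[of x y x' y'] mult[of x y x' y'] minus[of x y] by simp_all
  qed
  then show ?thesis
  proof (rule subfieldI)
    fix u assume "u \<in> ?S" "u \<noteq> 0"
    then obtain x y where "u = x / y" "x \<in> R" "y \<in> R" "y \<noteq> 0" by auto
    then show "inverse u \<in> ?S" using inv[of x y] \<open>u \<noteq> 0\<close> by simp
  qed
qed

text \<open>The polynomials of the type have coefficients in the whole field. Division with
  remainder is redone by cancelling leading terms so that quotient and remainder stay over
  \<open>S\<close>.\<close>

lemma poly_over_division:
  assumes S: "subfield S" and m: "poly_over S m" and p: "poly_over S p" "p \<noteq> 0"
  shows "\<exists>q r. poly_over S q \<and> poly_over S r \<and> m = p * q + r \<and> (r = 0 \<or> degree r < degree p)"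
  using m
proof (induction "degree m" arbitrary: m rule: less_induct)
  case less
  note R = subfield_subring[OF S]
  show ?case
  proof (cases "m = 0 \<or> degree m < degree p")
    case True
    then show ?thesis using less.prems R by (intro exI[of _ 0] exI[of _ m]) auto
  next
    case False
    define c where "c = lead_coeff m / lead_coeff p"
    define t where "t = monom c (degree m - degree p)"
    have cS: "c \<in> S" using less.prems p unfolding c_def
      by (intro subfield_divide[OF S]) (auto simp: poly_over_def)
    have tS: "poly_over S t" unfolding t_def by (rule poly_over_monom[OF R cS])
    have c0: "c \<noteq> 0" using False p by (auto simp: c_def)
    have dpt: "degree (p * t) = degree m"
      using False p c0 by (auto simp: t_def degree_mult_eq degree_monom_eq)
    have lpt: "lead_coeff (p * t) = lead_coeff m"
      using p by (simp only: lead_coeff_mult t_def lead_coeff_monom c_def) simp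
    define m' where "m' = m - p * t"
    have m'S: "poly_over S m'" unfolding m'_def
      by (intro poly_over_diff[OF R] poly_over_mult[OF R] less.prems p tS)
    have "m' = 0 \<or> degree m' < degree m"
    proof (rule disjCI)
      assume "\<not> degree m' < degree m"
      moreover have "degree m' \<le> degree m" unfolding m'_def using dpt by (intro degree_diff_le) auto
      moreover have "coeff m' (degree m) = 0" using lpt dpt by (simp add: m'_def)
      ultimately show "m' = 0" by (metis leading_coeff_0_iff le_antisym not_le)
    qed
    then have "\<exists>q r. poly_over S q \<and> poly_over S r \<and> m' = p * q + r \<and> (r = 0 \<or> degree r < degree p)"
    proof
      assume "m' = 0"
      then show ?thesis using R by (intro exI[of _ 0]) auto
    qed (use less.hyps m'S in blast)
    then obtain q r where qr: "poly_over S q" "poly_over S r" "m' = p * q + r"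
      "r = 0 \<or> degree r < degree p" by blast
    have "m = p * (q + t) + r" using qr(3) by (simp add: m'_def algebra_simps)
    then show ?thesis using qr poly_over_add[OF R qr(1) tS] by blast
  qed
qed

text \<open>A nonzero value \<open>poly p w\<close> is inverted by induction on the degree: dividing
  an annihilator of least degree by \<open>p\<close> leaves a remainder whose value at
  \<open>w\<close> is a multiple of \<open>poly p w\<close>.\<close>

lemma subfield_adjoin:
  assumes S: "subfield S" and alg: "algebraic_over S w" shows "subfield (adjoin S w)"
proof -
  note R = subfield_subring[OF S]
  have "\<exists>m. (m \<noteq> 0 \<and> poly_over S m \<and> poly m w = 0) \<and>
    (\<forall>p. (p \<noteq> 0 \<and> poly_over S p \<and> poly p w = 0) \<longrightarrow> degree m \<le> degree p)"
    using ex_has_least_nat[of "\<lambda>p. p \<noteq> 0 \<and> poly_over S p \<and> poly p w = 0" _ degree] alg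
    unfolding algebraic_over_def by blast
  then obtain m where m: "m \<noteq> 0" "poly_over S m" "poly m w = 0"
    and min: "\<And>p. p \<noteq> 0 \<Longrightarrow> poly_over S p \<Longrightarrow> poly p w = 0 \<Longrightarrow> degree m \<le> degree p" by blast
  have inv: "\<exists>s. poly_over S s \<and> poly s w * poly p w = 1"
    if "poly_over S p" "poly p w \<noteq> 0" for p
    using that
  proof (induction "degree p" arbitrary: p rule: less_induct)
    case less
    show ?case
    proof (cases "degree p = 0")
      case True
      then obtain c where c: "p = [:c:]" by (elim degree_eq_zeroE)
      then show ?thesis using less.prems R S
        by (intro exI[of _ "[:inverse c:]"]) (auto simp: subfield_inverse)
    next
      case False
      then have p0: "p \<noteq> 0" by auto
      obtain q r where qr: "poly_over S q" "poly_over S r" "m = p * q + r"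
        "r = 0 \<or> degree r < degree p"
        using poly_over_division[OF S m(2) less.prems(1) p0] by blast
      have rw: "poly r w = - (poly p w * poly q w)"
        using m(3) unfolding qr(3) by (simp add: eq_neg_iff_add_eq_0 add.commute)
      show ?thesis
      proof (cases "poly r w = 0")
        case False
        then have "degree r < degree p" using qr by auto
        then obtain s where s: "poly_over S s" "poly s w * poly r w = 1"
          using less.hyps[of r] qr False by blast
        then have "poly (0 - s * q) w * poly p w = 1" using rw by (simp add: mult_ac)
        then show ?thesis using poly_over_diff[OF R poly_over_0[OF R] poly_over_mult[OF R s(1) qr(1)]]
          by blast
      next
        case True
        \<comment> \<open>Now \<open>q\<close> annihilates \<open>w\<close>. By minimality it can
          only be zero, so \<open>m\<close> has smaller degree than \<open>p\<close>, and reducing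
          \<open>p\<close> modulo \<open>m\<close> keeps its value.\<close>
        then have qw: "poly q w = 0" using rw less.prems by simp
        show ?thesis
        proof (cases "q = 0")
          case q: False
          have "degree m = degree p + degree q"
          proof (cases "r = 0")
            case True then show ?thesis using qr p0 q by (simp add: degree_mult_eq)
          next
            case False
            then show ?thesis using qr p0 q
              by (subst qr(3), subst degree_add_eq_left) (auto simp: degree_mult_eq)
          qed
          then show ?thesis using min[OF q qr(1) qw] False by simp
        next
          case True
          then have dm: "degree m < degree p" using qr m by auto
          obtain q' r' where qr': "poly_over S q'" "poly_over S r'" "p = m * q' + r'"
            "r' = 0 \<or> degree r' < degree m"
            using poly_over_division[OF S less.prems(1) m(2,1)] by blast
          have "poly r' w = poly p w" unfolding qr'(3) by (simp add: m)
          moreover have "degree r' < degree p" using qr' dm False by auto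
          ultimately show ?thesis using less.hyps[of r'] qr' less.prems by auto
        qed
      qed
    qed
  qed
  show ?thesis
  proof (rule subfieldI[OF subring_adjoin[OF R]])
    fix x assume "x \<in> adjoin S w" "x \<noteq> 0"
    then obtain p where p: "poly_over S p" "x = poly p w" by (auto simp: adjoin_def)
    then obtain s where "poly_over S s" "poly s w * x = 1" using inv \<open>x \<noteq> 0\<close> by blast
    then show "inverse x \<in> adjoin S w"
      unfolding adjoin_def by (auto simp: inverse_unique mult.commute intro!: exI[of _ s])
  qed
qed

section \<open>Algebraically closed constant fields and residues\<close>

locale acf =
  fixes Kb :: "'a::field set"
  assumes acf: "alg_closed_subfield Kb"
begin

lemma Kb_field: "subfield Kb" and Kb_root: "poly_over Kb p \<Longrightarrow> degree p > 0 \<Longrightarrow> \<exists>x\<in>Kb. poly p x = 0"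
  using acf by (auto simp: alg_closed_subfield_def)

lemmas Kb_ring = subfield_subring[OF Kb_field]

lemmas Kb_closed = subring_one[OF Kb_ring] subring_zero[OF Kb_ring] subring_add[OF Kb_ring]
  subring_mult[OF Kb_ring] subring_minus[OF Kb_ring] subring_diff[OF Kb_ring]
  subring_power[OF Kb_ring] subfield_inverse[OF Kb_field] subfield_divide[OF Kb_field]

lemma Kb_linear_factor:
  assumes "poly_over Kb p" "degree p > 0"
  obtains r q where "r \<in> Kb" "poly_over Kb q" "p = [:- r, 1:] * q" "q \<noteq> 0" "degree q < degree p"
proof -
  obtain r where r: "r \<in> Kb" "poly p r = 0" using Kb_root assms by blast
  moreover have "p \<noteq> 0" using assms by auto
  ultimately show ?thesis using poly_root_factor[OF Kb_ring assms(1) r(1,2)] that by blast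
qed

text \<open>The polynomial is a constant times linear factors with roots in \<open>Kb\<close>, and
  none of these factors vanishes at an element outside \<open>Kb\<close>.\<close>

lemma Kb_poly_nonzero:
  assumes x: "x \<notin> Kb" and p: "poly_over Kb p" "p \<noteq> 0" shows "poly p x \<noteq> 0"
  using p
proof (induction "degree p" arbitrary: p rule: less_induct)
  case less
  show ?case
  proof (cases "degree p = 0")
    case True
    then obtain c where "p = [:c:]" by (elim degree_eq_zeroE)
    then show ?thesis using less by auto
  next
    case False
    then obtain r q where q: "r \<in> Kb" "poly_over Kb q" "p = [:- r, 1:] * q" "q \<noteq> 0" "degree q < degree p"
      using Kb_linear_factor less.prems by (metis not_gr_zero)
    have "poly q x \<noteq> 0" using less.hyps q by blast
    moreover have "x - r \<noteq> 0" using x q(1) by auto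
    ultimately show ?thesis unfolding q(3) by simp
  qed
qed

lemma Kb_nth_root:
  assumes "c \<in> Kb" "n > 0" obtains x where "x \<in> Kb" "x ^ n = c"
proof -
  have "poly_over Kb (monom 1 n + [:- c:])"
    using assms Kb_closed by (intro poly_over_add[OF Kb_ring] poly_over_monom[OF Kb_ring]) (auto simp: Kb_ring)
  moreover have "degree (monom 1 n + [:- c:]) = n"
    using assms by (subst degree_add_eq_left) (auto simp: degree_monom_eq)
  ultimately obtain x where "x \<in> Kb" "poly (monom 1 n + [:- c:]) x = 0"
    using Kb_root[of "monom 1 n + [:- c:]"] assms by auto
  then show ?thesis using that by (simp add: poly_monom)
qed

end

text \<open>\<open>c\<close> is the residue of \<open>x\<close>, assumed to lie in \<open>k\<close>.\<close>
definition rs :: "'a::field set \<Rightarrow> 'a set \<Rightarrow> 'a \<Rightarrow> 'a \<Rightarrow> bool" where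
  "rs k R x c \<longleftrightarrow> c \<in> k \<and> x - c \<in> max_ideal R"

context vplace
begin

lemma rs_R: "rs k R x c \<Longrightarrow> x \<in> R"
  using R_add[of "x - c" c] by (auto simp: rs_def intro: m_R k_R)

lemma rs_const: "c \<in> k \<Longrightarrow> rs k R c c"
  by (simp add: rs_def m_zero)

lemma rs_m: "x \<in> max_ideal R \<Longrightarrow> rs k R x 0"
  using subring_zero[OF subfield_subring[OF k]] by (simp add: rs_def)

lemma rs_m_iff: "rs k R x c \<Longrightarrow> x \<in> max_ideal R \<longleftrightarrow> c = 0"
  using m_diff[of x "x - c"] m_k[of c] by (auto simp: rs_def)

lemma rs_unique: "rs k R x c \<Longrightarrow> rs k R x d \<Longrightarrow> c = d"
  using m_diff[of "x - d" "x - c"] m_k[of "c - d"] subring_diff[OF subfield_subring[OF k]]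
  by (auto simp: rs_def)

lemma rs_add: "rs k R x c \<Longrightarrow> rs k R y d \<Longrightarrow> rs k R (x + y) (c + d)"
  using m_add[of "x - c" "y - d"] subring_add[OF subfield_subring[OF k]]
  by (auto simp: rs_def algebra_simps)

lemma rs_mult: "rs k R x c \<Longrightarrow> rs k R y d \<Longrightarrow> rs k R (x * y) (c * d)"
proof -
  assume x: "rs k R x c" and y: "rs k R y d"
  have "(x - c) * y + c * (y - d) \<in> max_ideal R"
    using x y rs_R[OF y] by (intro m_add m_mult m_mult') (auto simp: rs_def k_R)
  then show ?thesis using x y subring_mult[OF subfield_subring[OF k]]
    by (auto simp: rs_def algebra_simps)
qed

lemma rs_minus: "rs k R x c \<Longrightarrow> rs k R (- x) (- c)"
  using rs_mult[of "-1" "-1" x c] rs_const[of "-1"] subring_minus[OF subfield_subring[OF k]]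
    subring_one[OF subfield_subring[OF k]] by auto

lemma rs_diff: "rs k R x c \<Longrightarrow> rs k R y d \<Longrightarrow> rs k R (x - y) (c - d)"
  using rs_add[OF _ rs_minus] by fastforce

lemma rs_power: "rs k R x c \<Longrightarrow> rs k R (x ^ n) (c ^ n)"
  by (induction n) (auto intro: rs_mult rs_const subring_one[OF subfield_subring[OF k]])

lemma rs_inverse: 
  assumes x: "rs k R x c" and c: "c \<noteq> 0" shows "rs k R (inverse x) (inverse c)"
proof -
  have u: "is_unit_in R x" using rs_R[OF x] rs_m_iff[OF x] c by (simp add: unit_iff)
  have "inverse x - inverse c = (x - c) * (- (inverse x * inverse c))"
    using u c by (auto simp: field_simps is_unit_in_def)
  also have "\<dots> \<in> max_ideal R"
    using u c x subfield_inverse[OF k]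
    by (intro m_mult R_minus R_mult) (auto simp: is_unit_in_def rs_def intro: k_R)
  finally show ?thesis using x subfield_inverse[OF k] by (auto simp: rs_def)
qed

lemma rs_divide: "rs k R x c \<Longrightarrow> rs k R y d \<Longrightarrow> d \<noteq> 0 \<Longrightarrow> rs k R (x / y) (c / d)"
  using rs_mult rs_inverse by (simp add: divide_inverse)

lemma rs_poly: "rs k R x c \<Longrightarrow> poly_over k p \<Longrightarrow> rs k R (poly p x) (poly p c)"
  by (induction p) (auto intro!: rs_add rs_mult rs_const subring_zero[OF subfield_subring[OF k]])

lemma rs_sum: "(\<And>i. i \<in> I \<Longrightarrow> rs k R (f i) (g i)) \<Longrightarrow> rs k R (sum f I) (sum g I)"
  by (induction I rule: infinite_finite_induct)
    (auto intro: rs_add rs_const subring_zero[OF subfield_subring[OF k]])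

end

text \<open>The maximal ideal is prime, so it contains \<open>x - r\<close> for some linear factor
  of \<open>p\<close>; the root \<open>r\<close> is then the residue.\<close>

lemma (in acf) residue_root:
  assumes "vplace E Kb R" "x \<in> R" "poly_over Kb p" "p \<noteq> 0" "poly p x \<in> max_ideal R"
  obtains r where "r \<in> Kb" "poly p r = 0" "rs Kb R x r"
proof -
  interpret vplace E Kb R by fact
  have "\<exists>r. r \<in> Kb \<and> poly p r = 0 \<and> rs Kb R x r"
    using assms(3-5)
  proof (induction "degree p" arbitrary: p rule: less_induct)
    case less
    show ?case
    proof (cases "degree p = 0")
      case True
      then obtain c where c: "p = [:c:]" by (elim degree_eq_zeroE)
      then show ?thesis using less m_k[of c] by auto
    next
      case False
      then obtain r q where q: "r \<in> Kb" "poly_over Kb q" "p = [:- r, 1:] * q" "q \<noteq> 0" "degree q < degree p"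
        using Kb_linear_factor less.prems by (metis not_gr_zero)
      have "(x - r) * poly q x \<in> max_ideal R"
        using less.prems(3) unfolding q(3) by (simp add: algebra_simps)
      moreover have "x - r \<in> R" by (intro R_diff k_R q assms(2))
      moreover have "poly q x \<in> R"
        by (rule R_poly[OF poly_over_mono[OF _ q(2)] assms(2)]) (use k_R in blast)
      ultimately have "x - r \<in> max_ideal R \<or> poly q x \<in> max_ideal R" using m_prime by blast
      then show ?thesis
      proof
        assume "x - r \<in> max_ideal R"
        moreover have "poly p r = 0" unfolding q(3) by simp
        ultimately show ?thesis using q(1) by (auto simp: rs_def)
      next
        assume "poly q x \<in> max_ideal R"
        then obtain r' where "r' \<in> Kb" "poly q r' = 0" "rs Kb R x r'" using less.hyps q by blast
        moreover from this have "poly p r' = 0" unfolding q(3) by simp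
        ultimately show ?thesis by blast
      qed
    qed
  qed
  then show ?thesis using that by blast
qed

section \<open>The coordinate ring of the curve\<close>

text \<open>With \<open>a = z ^ 8 / (t + 1) ^ 3\<close> and \<open>w = z ^ 3 / (t + 1)\<close> the equation \<open>z ^ 16 = t * (t + 1) ^ 6\<close>
  becomes the space curve below; \<open>w\<close>, \<open>z\<close>, \<open>a\<close> have pole orders 5, 7, 8 at infinity.\<close>
definition curve_eqs :: "'a::field \<Rightarrow> 'a \<Rightarrow> 'a \<Rightarrow> bool" where
  "curve_eqs a w z \<longleftrightarrow> w ^ 3 = a * z \<and> z ^ 3 = w * (a ^ 2 + 1) \<and> w ^ 2 * z ^ 2 = a ^ 3 + a"

text \<open>Index 8 would be \<open>w ^ 2 * z ^ 2\<close>, which the curve equations turn into a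
  polynomial in \<open>a\<close>. As \<open>w ^ 3\<close> and \<open>z ^ 3\<close> are reduced
  likewise, these eight products remain.\<close>

definition mono8 :: "'a::field \<Rightarrow> 'a \<Rightarrow> nat \<Rightarrow> 'a" where
  "mono8 w z l = w ^ (l mod 3) * z ^ (l div 3)"

lemma sum8: "(\<Sum>l<8. f l) = f 0 + f 1 + f 2 + f 3 + f 4 + f 5 + f 6 + f (7::nat)"
  by (simp add: eval_nat_numeral)

lemma less8: "(l::nat) < 8 \<longleftrightarrow> l = 0 \<or> l = 1 \<or> l = 2 \<or> l = 3 \<or> l = 4 \<or> l = 5 \<or> l = 6 \<or> l = 7"
  by auto

context
  fixes a w z :: "'a::field" assumes eqs: "curve_eqs a w z"
begin

lemma curve_eqs_w8: "w ^ 8 = a ^ 3 * (a ^ 2 + 1)"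
proof -
  have "w ^ 8 = w ^ 2 * (w ^ 3) ^ 2" by (simp flip: power_mult power_add)
  also have "\<dots> = a ^ 2 * (w ^ 2 * z ^ 2)" using eqs by (simp add: curve_eqs_def power_mult_distrib)
  also have "\<dots> = a ^ 2 * (a ^ 3 + a)" using eqs by (simp add: curve_eqs_def)
  finally show ?thesis by (simp add: algebra_simps eval_nat_numeral)
qed

lemma curve_eqs_z8: "z ^ 8 = a * (a ^ 2 + 1) ^ 3"
proof -
  have "z ^ 8 = z ^ 2 * (z ^ 3) ^ 2" by (simp flip: power_mult power_add)
  also have "\<dots> = z ^ 2 * (w * (a ^ 2 + 1)) ^ 2" using eqs by (simp add: curve_eqs_def)
  also have "\<dots> = (a ^ 2 + 1) ^ 2 * (w ^ 2 * z ^ 2)" by (simp only: power_mult_distrib mult_ac)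
  also have "\<dots> = (a ^ 2 + 1) ^ 2 * (a ^ 3 + a)" using eqs by (simp add: curve_eqs_def)
  finally show ?thesis by (simp add: algebra_simps eval_nat_numeral)
qed

lemma mono8_values:
  "mono8 w z 0 = 1" "mono8 w z 1 = w" "mono8 w z 2 = w ^ 2" "mono8 w z 3 = z" "mono8 w z 4 = w * z"
  "mono8 w z 5 = w ^ 2 * z" "mono8 w z 6 = z ^ 2" "mono8 w z 7 = w * z ^ 2"
  by (simp_all add: mono8_def)

lemma mono8_w:
  "w * mono8 w z 0 = mono8 w z 1" "w * mono8 w z 1 = mono8 w z 2" "w * mono8 w z 2 = a * mono8 w z 3"
  "w * mono8 w z 3 = mono8 w z 4" "w * mono8 w z 4 = mono8 w z 5" "w * mono8 w z 5 = a * mono8 w z 6"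
  "w * mono8 w z 6 = mono8 w z 7" "w * mono8 w z 7 = (a ^ 3 + a) * mono8 w z 0"
proof -
  have w3: "w * w ^ 2 = a * z" using eqs by (simp add: curve_eqs_def eval_nat_numeral)
  have "w * (w * z ^ 2) = a ^ 3 + a" using eqs by (simp add: curve_eqs_def eval_nat_numeral mult.assoc)
  then show "w * mono8 w z 7 = (a ^ 3 + a) * mono8 w z 0" unfolding mono8_values by simp
  show "w * mono8 w z 2 = a * mono8 w z 3" unfolding mono8_values by (rule w3)
  have "w * (w ^ 2 * z) = a * z ^ 2" unfolding mult.assoc[symmetric] w3 by (simp add: power2_eq_square)
  then show "w * mono8 w z 5 = a * mono8 w z 6" unfolding mono8_values .
qed (unfold mono8_values, simp_all add: power2_eq_square)

lemma mono8_z: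
  "z * mono8 w z 0 = mono8 w z 3" "z * mono8 w z 1 = mono8 w z 4" "z * mono8 w z 2 = mono8 w z 5"
  "z * mono8 w z 3 = mono8 w z 6" "z * mono8 w z 4 = mono8 w z 7"
  "z * mono8 w z 5 = (a ^ 3 + a) * mono8 w z 0"
  "z * mono8 w z 6 = (a ^ 2 + 1) * mono8 w z 1" "z * mono8 w z 7 = (a ^ 2 + 1) * mono8 w z 2"
proof -
  have z3: "z * z ^ 2 = w * (a ^ 2 + 1)" using eqs by (simp add: curve_eqs_def eval_nat_numeral)
  then show "z * mono8 w z 6 = (a ^ 2 + 1) * mono8 w z 1" unfolding mono8_values by (simp only: mult.commute)
  have "z * (w * z ^ 2) = w * (z * z ^ 2)" by (simp only: mult.left_commute)
  also have "\<dots> = (a ^ 2 + 1) * w ^ 2" unfolding z3 by (simp add: power2_eq_square)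
  finally show "z * mono8 w z 7 = (a ^ 2 + 1) * mono8 w z 2" unfolding mono8_values .
  have "z * (w ^ 2 * z) = a ^ 3 + a"
    using eqs by (simp add: power2_eq_square curve_eqs_def mult_ac)
  then show "z * mono8 w z 5 = (a ^ 3 + a) * mono8 w z 0" unfolding mono8_values by simp
qed (unfold mono8_values, simp_all add: power2_eq_square)

end

section \<open>Semilinear ring homomorphisms and normal forms\<close>

text \<open>The semilinear ring homomorphism from \<open>k[a, w, z]\<close> that is \<open>\<sigma>\<close> on \<open>k\<close> and maps \<open>a\<close>, \<open>w\<close>, \<open>z\<close>
  to \<open>a'\<close>, \<open>w'\<close>, \<open>z'\<close>, as a relation. It covers evaluation at a point, the Frobenius and, for the
  identity, membership in the ring.\<close>
inductive crel :: "'a::field \<Rightarrow> 'a \<Rightarrow> 'a \<Rightarrow> 'a set \<Rightarrow> ('a \<Rightarrow> 'a) \<Rightarrow> 'a \<Rightarrow> 'a \<Rightarrow> 'a \<Rightarrow> 'a \<Rightarrow> 'a \<Rightarrow> bool"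
  for a w z k \<sigma> a' w' z' where
  crel_const: "c \<in> k \<Longrightarrow> crel a w z k \<sigma> a' w' z' c (\<sigma> c)"
| crel_a: "crel a w z k \<sigma> a' w' z' a a'"
| crel_w: "crel a w z k \<sigma> a' w' z' w w'"
| crel_z: "crel a w z k \<sigma> a' w' z' z z'"
| crel_add: "crel a w z k \<sigma> a' w' z' x x' \<Longrightarrow> crel a w z k \<sigma> a' w' z' y y' \<Longrightarrow>
    crel a w z k \<sigma> a' w' z' (x + y) (x' + y')"
| crel_mult: "crel a w z k \<sigma> a' w' z' x x' \<Longrightarrow> crel a w z k \<sigma> a' w' z' y y' \<Longrightarrow>
    crel a w z k \<sigma> a' w' z' (x * y) (x' * y')"

definition field_hom :: "('a::field \<Rightarrow> 'a) \<Rightarrow> bool" where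
  "field_hom \<sigma> \<longleftrightarrow> \<sigma> 0 = 0 \<and> \<sigma> 1 = 1 \<and> (\<forall>x y. \<sigma> (x + y) = \<sigma> x + \<sigma> y \<and> \<sigma> (x * y) = \<sigma> x * \<sigma> y)"

lemma field_hom_id: "field_hom (\<lambda>x. x)"
  by (simp add: field_hom_def)

text \<open>Both elements carry the same coefficient polynomials, up to \<open>\<sigma>\<close>.
  Once the coefficients of \<open>x\<close> are known to be unique, \<open>x'\<close> is determined
  by \<open>x\<close>.\<close>

definition nform :: "'a::field \<Rightarrow> 'a \<Rightarrow> 'a \<Rightarrow> 'a set \<Rightarrow> ('a \<Rightarrow> 'a) \<Rightarrow> 'a \<Rightarrow> 'a \<Rightarrow> 'a \<Rightarrow> 'a \<Rightarrow> 'a \<Rightarrow> bool" where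
  "nform a w z k \<sigma> a' w' z' x x' \<longleftrightarrow> (\<exists>c. (\<forall>l<8. poly_over k (c l)) \<and>
     x = (\<Sum>l<8. poly (c l) a * mono8 w z l) \<and> x' = (\<Sum>l<8. poly (map_poly \<sigma> (c l)) a' * mono8 w' z' l))"

lemma map_poly_add_hom: "field_hom \<sigma> \<Longrightarrow> map_poly \<sigma> (p + q) = map_poly \<sigma> p + map_poly \<sigma> q"
  by (intro poly_eqI) (simp add: coeff_map_poly field_hom_def)

lemma map_poly_smult_hom: "field_hom \<sigma> \<Longrightarrow> map_poly \<sigma> (smult c p) = smult (\<sigma> c) (map_poly \<sigma> p)"
  by (intro poly_eqI) (simp add: coeff_map_poly field_hom_def)

lemma map_poly_pCons_hom: "field_hom \<sigma> \<Longrightarrow> map_poly \<sigma> (pCons c p) = pCons (\<sigma> c) (map_poly \<sigma> p)"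
  by (simp add: map_poly_pCons field_hom_def)

lemma nformI8:
  assumes "\<forall>c\<in>{c0,c1,c2,c3,c4,c5,c6,c7}. poly_over k c"
    "x = poly c0 a * mono8 w z 0 + poly c1 a * mono8 w z 1 + poly c2 a * mono8 w z 2 + poly c3 a * mono8 w z 3
      + poly c4 a * mono8 w z 4 + poly c5 a * mono8 w z 5 + poly c6 a * mono8 w z 6 + poly c7 a * mono8 w z 7"
    "x' = poly (map_poly \<sigma> c0) a' * mono8 w' z' 0 + poly (map_poly \<sigma> c1) a' * mono8 w' z' 1
      + poly (map_poly \<sigma> c2) a' * mono8 w' z' 2 + poly (map_poly \<sigma> c3) a' * mono8 w' z' 3
      + poly (map_poly \<sigma> c4) a' * mono8 w' z' 4 + poly (map_poly \<sigma> c5) a' * mono8 w' z' 5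
      + poly (map_poly \<sigma> c6) a' * mono8 w' z' 6 + poly (map_poly \<sigma> c7) a' * mono8 w' z' 7"
  shows "nform a w z k \<sigma> a' w' z' x x'"
  unfolding nform_def sum8 using assms
  by (intro exI[of _ "\<lambda>l. [c0,c1,c2,c3,c4,c5,c6,c7] ! l"]) (simp add: less8)

context
  fixes a w z a' w' z' :: "'a::field" and k :: "'a set" and \<sigma> :: "'a \<Rightarrow> 'a"
  assumes eqs: "curve_eqs a w z" "curve_eqs a' w' z'" and k: "subring k" and \<sigma>: "field_hom \<sigma>"
begin

private abbreviation "NF \<equiv> nform a w z k \<sigma> a' w' z'"

lemma nform_one: "NF 1 1"
  unfolding one_pCons
  by (rule nformI8[of 1 0 0 0 0 0 0 0])
    (use k \<sigma> in \<open>auto simp: mono8_def one_pCons subring_one map_poly_pCons_hom field_hom_def\<close>)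

lemma nform_add:
  assumes "NF x x'" "NF y y'" shows "NF (x + y) (x' + y')"
proof -
  obtain c where c: "\<forall>l<8. poly_over k (c l)" "x = (\<Sum>l<8. poly (c l) a * mono8 w z l)"
    "x' = (\<Sum>l<8. poly (map_poly \<sigma> (c l)) a' * mono8 w' z' l)" using assms by (auto simp: nform_def)
  obtain d where d: "\<forall>l<8. poly_over k (d l)" "y = (\<Sum>l<8. poly (d l) a * mono8 w z l)"
    "y' = (\<Sum>l<8. poly (map_poly \<sigma> (d l)) a' * mono8 w' z' l)" using assms by (auto simp: nform_def)
  show ?thesis unfolding nform_def
    by (rule exI[of _ "\<lambda>l. c l + d l"])
      (use c d \<sigma> in \<open>simp add: poly_over_add[OF k] map_poly_add_hom sum.distrib distrib_right\<close>)
qed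

lemma nform_const_mult:
  assumes "NF x x'" "b \<in> k" shows "NF (b * x) (\<sigma> b * x')"
proof -
  obtain c where c: "\<forall>l<8. poly_over k (c l)" "x = (\<Sum>l<8. poly (c l) a * mono8 w z l)"
    "x' = (\<Sum>l<8. poly (map_poly \<sigma> (c l)) a' * mono8 w' z' l)" using assms by (auto simp: nform_def)
  show ?thesis unfolding nform_def
    by (rule exI[of _ "\<lambda>l. smult b (c l)"])
      (use c \<sigma> in \<open>simp add: poly_over_smult[OF k assms(2)] map_poly_smult_hom sum_distrib_left mult.assoc\<close>)
qed

lemma nform_a:
  assumes "NF x x'" shows "NF (a * x) (a' * x')"
proof -
  obtain c where c: "\<forall>l<8. poly_over k (c l)" "x = (\<Sum>l<8. poly (c l) a * mono8 w z l)"
    "x' = (\<Sum>l<8. poly (map_poly \<sigma> (c l)) a' * mono8 w' z' l)" using assms by (auto simp: nform_def)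
  show ?thesis unfolding nform_def
    by (rule exI[of _ "\<lambda>l. pCons 0 (c l)"])
      (use c \<sigma> subring_zero[OF k] in \<open>simp add: map_poly_pCons_hom sum_distrib_left mult.assoc field_hom_def\<close>)
qed

lemma nform_w:
  assumes "NF x x'" shows "NF (w * x) (w' * x')"
proof -
  obtain c where c: "\<forall>l<8. poly_over k (c l)" "x = (\<Sum>l<8. poly (c l) a * mono8 w z l)"
    "x' = (\<Sum>l<8. poly (map_poly \<sigma> (c l)) a' * mono8 w' z' l)" using assms by (auto simp: nform_def)
  have eq: "w * (\<Sum>l<8. f l * mono8 w z l) =
      (a ^ 3 + a) * f 7 * mono8 w z 0 + f 0 * mono8 w z 1 + f 1 * mono8 w z 2 + a * f 2 * mono8 w z 3
      + f 3 * mono8 w z 4 + f 4 * mono8 w z 5 + a * f 5 * mono8 w z 6 + f 6 * mono8 w z 7"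
    if "curve_eqs a w z" for f :: "nat \<Rightarrow> 'a" and a w z
  proof -
    have "w * (\<Sum>l<8. f l * mono8 w z l) = (\<Sum>l<8. f l * (w * mono8 w z l))"
      by (simp add: sum_distrib_left mult.left_commute)
    then show ?thesis unfolding sum8 mono8_w[OF that] by (simp add: mult_ac add_ac)
  qed
  have \<sigma>0: "\<sigma> 0 = 0" using \<sigma> by (simp add: field_hom_def)
  show ?thesis
  proof (rule nformI8[of "pCons 0 (pCons 0 (pCons 0 (c 7))) + pCons 0 (c 7)" "c 0" "c 1" "pCons 0 (c 2)"
      "c 3" "c 4" "pCons 0 (c 5)" "c 6"], goal_cases)
    case 1
    show ?case using c(1) subring_zero[OF k] by (auto intro!: poly_over_add[OF k])
  next
    case 2
    show ?case unfolding c(2) eq[OF eqs(1)]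
      by (simp add: algebra_simps power3_eq_cube power2_eq_square)
  next
    case 3
    show ?case unfolding c(3) eq[OF eqs(2)] map_poly_add_hom[OF \<sigma>] map_poly_pCons_hom[OF \<sigma>] \<sigma>0
      by (simp add: algebra_simps power3_eq_cube power2_eq_square)
  qed
qed

lemma nform_z:
  assumes "NF x x'" shows "NF (z * x) (z' * x')"
proof -
  obtain c where c: "\<forall>l<8. poly_over k (c l)" "x = (\<Sum>l<8. poly (c l) a * mono8 w z l)"
    "x' = (\<Sum>l<8. poly (map_poly \<sigma> (c l)) a' * mono8 w' z' l)" using assms by (auto simp: nform_def)
  have eq: "z * (\<Sum>l<8. f l * mono8 w z l) =
      (a ^ 3 + a) * f 5 * mono8 w z 0 + (a ^ 2 + 1) * f 6 * mono8 w z 1 + (a ^ 2 + 1) * f 7 * mono8 w z 2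
      + f 0 * mono8 w z 3 + f 1 * mono8 w z 4 + f 2 * mono8 w z 5 + f 3 * mono8 w z 6 + f 4 * mono8 w z 7"
    if "curve_eqs a w z" for f :: "nat \<Rightarrow> 'a" and a w z
  proof -
    have "z * (\<Sum>l<8. f l * mono8 w z l) = (\<Sum>l<8. f l * (z * mono8 w z l))"
      by (simp add: sum_distrib_left mult.left_commute)
    then show ?thesis unfolding sum8 mono8_z[OF that] by (simp add: mult_ac add_ac)
  qed
  have \<sigma>0: "\<sigma> 0 = 0" using \<sigma> by (simp add: field_hom_def)
  show ?thesis
  proof (rule nformI8[of "pCons 0 (pCons 0 (pCons 0 (c 5))) + pCons 0 (c 5)"
      "pCons 0 (pCons 0 (c 6)) + c 6" "pCons 0 (pCons 0 (c 7)) + c 7" "c 0" "c 1" "c 2" "c 3" "c 4"], goal_cases)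
    case 1
    show ?case using c(1) subring_zero[OF k] by (auto intro!: poly_over_add[OF k])
  next
    case 2
    show ?case unfolding c(2) eq[OF eqs(1)]
      by (simp add: algebra_simps power3_eq_cube power2_eq_square)
  next
    case 3
    show ?case unfolding c(3) eq[OF eqs(2)] map_poly_add_hom[OF \<sigma>] map_poly_pCons_hom[OF \<sigma>] \<sigma>0
      by (simp add: algebra_simps power3_eq_cube power2_eq_square)
  qed
qed

text \<open>The images of the generators satisfy the same curve equations, so every reduction step
  on the left can be copied on the right.\<close>

lemma crel_nform: "crel a w z k \<sigma> a' w' z' x x' \<Longrightarrow> NF x x'"
proof -
  \<comment> \<open>Multiplication by \<open>x\<close> is shown to preserve all normal forms. For a
    product this is composition, so two normal forms never have to be multiplied.\<close>
  have "NF y y' \<Longrightarrow> NF (x * y) (x' * y')" if "crel a w z k \<sigma> a' w' z' x x'" for x x' y y'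
    using that
  proof (induction arbitrary: y y')
    case (crel_add x x' u u')
    then show ?case using nform_add[of "x * y" "x' * y'" "u * y" "u' * y'"] by (simp add: distrib_right)
  next
    case (crel_mult x x' u u')
    then show ?case by (simp add: mult.assoc)
  qed (auto intro: nform_const_mult nform_a nform_w nform_z)
  from this[OF _ nform_one] show "crel a w z k \<sigma> a' w' z' x x' \<Longrightarrow> NF x x'" by simp
qed

end

lemma crel_power:
  assumes "crel a w z k \<sigma> a' w' z' x x'" "1 \<in> k" "\<sigma> 1 = 1"
  shows "crel a w z k \<sigma> a' w' z' (x ^ n) (x' ^ n)"
proof (induction n)
  case 0
  show ?case using crel_const[of 1 k a w z \<sigma> a' w' z'] assms by simp
qed (use assms crel_mult in auto)

lemma crel_poly:
  assumes "poly_over k p" "0 \<in> k" "field_hom \<sigma>"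
  shows "crel a w z k \<sigma> a' w' z' (poly p a) (poly (map_poly \<sigma> p) a')"
  using assms(1)
proof (induction p)
  case 0
  show ?case using crel_const[of 0 k a w z \<sigma> a' w' z'] assms by (simp add: field_hom_def)
next
  case (pCons c p)
  then show ?case using assms crel_const[of c k] by (auto simp: map_poly_pCons_hom intro!: crel_add crel_mult crel_a)
qed

section \<open>The coordinate ring and denominators in one variable\<close>

definition cring :: "'a::field \<Rightarrow> 'a \<Rightarrow> 'a \<Rightarrow> 'a set \<Rightarrow> 'a set" where
  "cring a w z k = {x. crel a w z k (\<lambda>x. x) a w z x x}"

lemma subring_cring:
  assumes "subring k" shows "subring (cring a w z k)"
  unfolding subring_def
proof (intro conjI ballI)
  show "1 \<in> cring a w z k"
    using crel_const[of 1 k _ _ _ "\<lambda>x. x"] subring_one[OF assms] by (auto simp: cring_def)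
  fix x y assume "x \<in> cring a w z k" "y \<in> cring a w z k"
  then show "x + y \<in> cring a w z k" "x * y \<in> cring a w z k" "- x \<in> cring a w z k"
    using crel_mult[OF crel_const[of "-1" k a w z "\<lambda>x. x" a w z], of x x] subring_minus[OF assms subring_one[OF assms]]
    by (auto simp: cring_def intro: crel_add crel_mult)
qed

lemma cring_gens:
  "k \<subseteq> cring a w z k" "a \<in> cring a w z k" "w \<in> cring a w z k" "z \<in> cring a w z k"
  using crel_const[of _ k _ _ _ "\<lambda>x. x"] by (auto simp: cring_def intro: crel_a crel_w crel_z)

lemma cring_poly: "subring k \<Longrightarrow> poly_over k p \<Longrightarrow> poly p a \<in> cring a w z k"
  using subring_poly[OF subring_cring poly_over_mono[OF cring_gens(1)] cring_gens(2)] by blast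

lemma cring_least:
  assumes "x \<in> cring a w z k" "subring R" "k \<subseteq> R" "a \<in> R" "w \<in> R" "z \<in> R" shows "x \<in> R"
proof -
  have "x \<in> R" if "crel a w z k (\<lambda>x. x) a w z x x'" for x x'
    using that by induction (use assms in \<open>auto intro: subring_add subring_mult\<close>)
  then show ?thesis using assms(1) unfolding cring_def by blast
qed

lemma cring_crel:
  assumes "x \<in> cring a w z k" shows "\<exists>x'. crel a w z k \<sigma> a' w' z' x x'"
proof -
  have "\<exists>x'. crel a w z k \<sigma> a' w' z' x x'" if "crel a w z k (\<lambda>x. x) a w z x y" for x y
    using that by induction (blast intro: crel.intros)+
  then show ?thesis using assms unfolding cring_def by blast
qed

lemma cring_normal_form:
  assumes "x \<in> cring a w z k" "curve_eqs a w z" "subring k"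
  obtains c where "\<forall>l<8. poly_over k (c l)" "x = (\<Sum>l<8. poly (c l) a * mono8 w z l)"
  using crel_nform[OF assms(2,2,3) field_hom_id] assms(1) unfolding cring_def nform_def by blast

text \<open>The denominator can be taken in \<open>k[a]\<close>: \<open>w\<close> is algebraic over
  \<open>k(a)\<close> through its eighth power, so \<open>k(a)[w]\<close> is a field, and it
  contains \<open>z = w ^ 3 / a\<close>. It remains to clear the denominators of the
  coefficients.\<close>

lemma gen_field_fraction:
  assumes eqs: "curve_eqs a w z" and k: "subfield k" and tr: "\<And>p. poly_over k p \<Longrightarrow> p \<noteq> 0 \<Longrightarrow> poly p a \<noteq> 0"
    and x: "x \<in> gen_field (k \<union> {a, w, z})"
  obtains d where "poly_over k d" "d \<noteq> 0" "x * poly d a \<in> cring a w z k"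
proof -
  note kr = subfield_subring[OF k]
  define S where "S = {u / v | u v. u \<in> adjoin k a \<and> v \<in> adjoin k a \<and> v \<noteq> 0}"
  have S: "subfield S" unfolding S_def by (rule subfield_fractions[OF subring_adjoin[OF kr]])
  note Sr = subfield_subring[OF S]
  have one: "1 \<in> adjoin k a" using subring_one[OF subring_adjoin[OF kr]] .
  have adS: "adjoin k a \<subseteq> S"
  proof
    fix u assume "u \<in> adjoin k a"
    then show "u \<in> S" unfolding S_def using one
      by (intro CollectI exI[of _ u] exI[of _ 1]) simp
  qed
  have aS: "a \<in> S" and kS: "k \<subseteq> S"
    using adS adjoin_elem[OF kr] adjoin_superset[OF kr] by auto
  have a0: "a \<noteq> 0" using tr[of "[:0, 1:]"] kr by (auto simp: subring_one subring_zero)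
  have "algebraic_over S w" unfolding algebraic_over_def
  proof (intro exI conjI)
    show "poly (monom 1 8 - [:a ^ 3 * (a ^ 2 + 1):]) w = 0"
      by (simp add: poly_monom curve_eqs_w8[OF eqs])
    show "poly_over S (monom 1 8 - [:a ^ 3 * (a ^ 2 + 1):])"
      using aS Sr by (intro poly_over_diff[OF Sr] poly_over_monom[OF Sr])
        (auto intro!: subring_one subring_mult subring_add subring_power)
    have "coeff (monom 1 8 - [:a ^ 3 * (a ^ 2 + 1):]) 8 = (1::'a)"
      by (simp add: eval_nat_numeral)
    then show "monom 1 8 - [:a ^ 3 * (a ^ 2 + 1):] \<noteq> 0" by (metis coeff_0 zero_neq_one)
  qed
  then have ad: "subfield (adjoin S w)" by (rule subfield_adjoin[OF S])
  have SA: "S \<subseteq> adjoin S w" and wA: "w \<in> adjoin S w"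
    using adjoin_superset[OF Sr] adjoin_elem[OF Sr] by auto
  have "z = w ^ 3 / a" using eqs a0 by (simp add: curve_eqs_def)
  then have "z \<in> adjoin S w"
    using wA SA aS subfield_divide[OF ad] subring_power[OF subfield_subring[OF ad]] by auto
  then have "gen_field (k \<union> {a, w, z}) \<subseteq> adjoin S w"
    using aS kS SA wA by (intro gen_field_least[OF ad]) auto
  then obtain p where p: "poly_over S p" "x = poly p w" using x by (auto simp: adjoin_def)
  note Cr = subring_cring[OF kr, of a w z]
  have "\<exists>d. poly_over k d \<and> d \<noteq> 0 \<and> poly p w * poly d a \<in> cring a w z k"
    using p(1)
  proof (induction p)
    case 0
    show ?case using kr subring_zero[OF Cr]
      by (intro exI[of _ 1]) (simp add: one_pCons subring_one)
  next
    case (pCons s p)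
    then obtain d where d: "poly_over k d" "d \<noteq> 0" "poly p w * poly d a \<in> cring a w z k" by auto
    obtain u v where uv: "poly_over k u" "poly_over k v" "poly v a \<noteq> 0" "s = poly u a / poly v a"
      using pCons.prems by (auto simp: S_def adjoin_def)
    have "poly (pCons s p) w * poly (v * d) a = poly u a * poly d a + w * (poly p w * poly d a) * poly v a"
      using uv(3,4) by (simp add: field_simps)
    also have "\<dots> \<in> cring a w z k"
      by (intro subring_add[OF Cr] subring_mult[OF Cr] cring_poly[OF kr] cring_gens d uv)
    finally show ?case using uv d poly_over_mult[OF kr uv(2) d(1)] by (intro exI[of _ "v * d"]) auto
  qed
  then show ?thesis using that p by blast
qed

section \<open>Totally ramified places\<close>

text \<open>The whole type is the function field over the algebraically closed \<open>Kb\<close>, so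
  that the places \<open>plc\<close> correspond to the geometric points of the curve.\<close>

locale curve = acf Kb for Kb :: "'a::field set" +
  fixes a w z :: 'a
  assumes seven: "(7::'a) = 0" and a_notin: "a \<notin> Kb" and eqs: "curve_eqs a w z"
    and gen: "gen_field (Kb \<union> {a, w, z}) = UNIV"
begin

abbreviation plc :: "'a set \<Rightarrow> bool" where "plc Q \<equiv> place UNIV Kb Q"

lemma two_nonzero: "(2::'a) \<noteq> 0" and three_nonzero: "(3::'a) \<noteq> 0"
proof -
  have one: "(1::'a) = 7 - 3 * 2" "(1::'a) = 7 - 2 * 3" by simp_all
  show "(2::'a) \<noteq> 0"
  proof
    assume "(2::'a) = 0"
    with one(1) seven have "(1::'a) = 0 - 3 * 0" by (simp only:)
    then show False by simp
  qed
  show "(3::'a) \<noteq> 0"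
  proof
    assume "(3::'a) = 0"
    with one(2) seven have "(1::'a) = 0 - 2 * 0" by (simp only:)
    then show False by simp
  qed
qed

lemma vplace_plc: "plc Q \<Longrightarrow> vplace UNIV Kb Q"
proof unfold_locales
  show "subfield (UNIV::'a set)" by (simp add: subfield_def)
qed (rule Kb_field)

lemma a_transcendental: "poly_over Kb p \<Longrightarrow> p \<noteq> 0 \<Longrightarrow> poly p a \<noteq> 0"
  using Kb_poly_nonzero[OF a_notin] .

lemma a_nonzero: "a \<noteq> 0" and a2_nonzero: "a ^ 2 + 1 \<noteq> 0" and w_nonzero: "w \<noteq> 0" and z_nonzero: "z \<noteq> 0"
proof -
  show 1: "a \<noteq> 0" using a_notin Kb_closed by auto
  have "poly [:1, 0, 1:] a \<noteq> 0"
    by (rule a_transcendental) (use Kb_ring Kb_closed in auto)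
  then show 2: "a ^ 2 + 1 \<noteq> 0" by (simp add: power2_eq_square add.commute)
  have "w ^ 8 \<noteq> 0" "z ^ 8 \<noteq> 0"
    using 1 2 unfolding curve_eqs_w8[OF eqs] curve_eqs_z8[OF eqs] by auto
  then show "w \<noteq> 0" "z \<noteq> 0" by auto
qed

lemma wza: "w ^ 3 = a * z" and zzw: "z ^ 3 = w * (a ^ 2 + 1)" and wwzz: "w ^ 2 * z ^ 2 = a ^ 3 + a"
  using eqs by (auto simp: curve_eqs_def)

lemmas w8 = curve_eqs_w8[OF eqs] and z8 = curve_eqs_z8[OF eqs]

text \<open>Nonzero polynomials in \<open>a\<close> have orders divisible by 8, so the nonzero terms
  have pairwise different orders and the least one prevails. A set \<open>S\<close> of places is
  treated at once because the resulting order must not depend on the place: this later shows that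
  the place is unique.\<close>

lemma comb_orders:
  assumes l: "subfield l" "l \<subseteq> Kb"
    and P: "\<And>Q. Q \<in> S \<Longrightarrow> plc Q" "\<And>Q. Q \<in> S \<Longrightarrow> \<pi> \<in> max_ideal Q" "\<pi> \<noteq> 0"
    and lc: "\<And>Q c. Q \<in> S \<Longrightarrow> poly_over l c \<Longrightarrow> c \<noteq> 0 \<Longrightarrow> lord Q \<pi> l (poly c a) (8 * \<nu> c)"
    and lw: "\<And>Q. Q \<in> S \<Longrightarrow> lord Q \<pi> l w m" and lz: "\<And>Q. Q \<in> S \<Longrightarrow> lord Q \<pi> l z n"
    and inj: "inj_on (\<lambda>j. (int (j mod 3) * m + int (j div 3) * n) mod 8) {..<8}"
    and c: "\<forall>j<8. poly_over l (c j)" "\<exists>j<8. c j \<noteq> 0"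
  shows "\<exists>j<8. c j \<noteq> 0 \<and> (\<forall>Q\<in>S. lord Q \<pi> l (\<Sum>j<8. poly (c j) a * mono8 w z j)
           (8 * \<nu> (c j) + int (j mod 3) * m + int (j div 3) * n))"
proof -
  define e where "e j = 8 * \<nu> (c j) + int (j mod 3) * m + int (j div 3) * n" for j
  define J where "J = {j \<in> {..<8}. c j \<noteq> 0}"
  have J: "finite J" "J \<noteq> {}" using c by (auto simp: J_def)
  obtain i where i: "i \<in> J" "\<And>j. j \<in> J \<Longrightarrow> e i \<le> e j"
    using ex_min_if_finite[of "e ` J"] J by (force simp: not_less)
  have less: "e i < e j" if "j \<in> J" "j \<noteq> i" for j
  proof -
    have "e i \<noteq> e j"
    proof
      assume "e i = e j"
      then have "e i mod 8 = e j mod 8" by simp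
      then have "(int (i mod 3) * m + int (i div 3) * n) mod 8 = (int (j mod 3) * m + int (j div 3) * n) mod 8"
        by (simp add: e_def add.assoc)
      then show False using inj_onD[OF inj, of i j] that i(1) by (auto simp: J_def)
    qed
    then show ?thesis using i(2)[OF that(1)] by simp
  qed
  have "lord Q \<pi> l (\<Sum>j<8. poly (c j) a * mono8 w z j) (e i)" if Q: "Q \<in> S" for Q
  proof -
    interpret vplace UNIV Kb Q using vplace_plc P Q by blast
    note L = P(2)[OF Q] P(3) l
    have "lord Q \<pi> l (\<Sum>j\<in>J. poly (c j) a * mono8 w z j) (e i)"
    proof (rule lord_sum[OF L J(1) i(1)])
      show "e i < e j" if "j \<in> J" "j \<noteq> i" for j using less that .
      fix j assume j: "j \<in> J"
      have "lord Q \<pi> l (mono8 w z j) (int (j mod 3) * m + int (j div 3) * n)"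
        unfolding mono8_def by (intro lord_mult[OF L] lord_power[OF L] lw lz Q)
      moreover have "lord Q \<pi> l (poly (c j) a) (8 * \<nu> (c j))"
        using j c by (intro lc[OF Q]) (auto simp: J_def)
      ultimately show "lord Q \<pi> l (poly (c j) a * mono8 w z j) (e j)"
        using lord_mult[OF L] by (fastforce simp: e_def add.assoc)
    qed
    moreover have "(\<Sum>j<8. poly (c j) a * mono8 w z j) = (\<Sum>j\<in>J. poly (c j) a * mono8 w z j)"
      by (rule sum.mono_neutral_right) (auto simp: J_def)
    ultimately show ?thesis by simp
  qed
  then show ?thesis using i(1) unfolding e_def J_def by blast
qed

lemma field_orders:
  assumes l: "subfield l" "l \<subseteq> Kb"
    and P: "\<And>Q. Q \<in> S \<Longrightarrow> plc Q" "\<And>Q. Q \<in> S \<Longrightarrow> \<pi> \<in> max_ideal Q" "\<pi> \<noteq> 0"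
    and lc: "\<And>Q c. Q \<in> S \<Longrightarrow> poly_over l c \<Longrightarrow> c \<noteq> 0 \<Longrightarrow> lord Q \<pi> l (poly c a) (8 * \<nu> c)"
    and lw: "\<And>Q. Q \<in> S \<Longrightarrow> lord Q \<pi> l w m" and lz: "\<And>Q. Q \<in> S \<Longrightarrow> lord Q \<pi> l z n"
    and inj: "inj_on (\<lambda>j. (int (j mod 3) * m + int (j div 3) * n) mod 8) {..<8}"
    and x: "x \<in> gen_field (l \<union> {a, w, z})" "x \<noteq> 0"
  shows "\<exists>i. \<forall>Q\<in>S. lord Q \<pi> l x i"
proof -
  note lr = subfield_subring[OF l(1)]
  have tr: "poly p a \<noteq> 0" if "poly_over l p" "p \<noteq> 0" for p
    using that a_transcendental poly_over_mono l by blast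
  obtain d where d: "poly_over l d" "d \<noteq> 0" "x * poly d a \<in> cring a w z l"
    using gen_field_fraction[OF eqs l(1) tr x(1)] by blast
  obtain c where c: "\<forall>j<8. poly_over l (c j)" "x * poly d a = (\<Sum>j<8. poly (c j) a * mono8 w z j)"
    using cring_normal_form[OF d(3) eqs lr] by blast
  have "\<exists>j<8. c j \<noteq> 0"
  proof (rule ccontr)
    assume "\<not> ?thesis"
    then have "x * poly d a = 0" unfolding c(2) by (intro sum.neutral) auto
    then show False using x tr d by auto
  qed
  then obtain i where i: "\<forall>Q\<in>S. lord Q \<pi> l (x * poly d a) i"
    using comb_orders[OF l P lc lw lz inj c(1)] unfolding c(2) by blast
  have "lord Q \<pi> l x (i - 8 * \<nu> d)" if Q: "Q \<in> S" for Q
  proof -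
    interpret vplace UNIV Kb Q using vplace_plc P Q by blast
    have "lord Q \<pi> l (x * poly d a / poly d a) (i - 8 * \<nu> d)"
      using lord_divide[OF P(2)[OF Q] P(3) l _ lc[OF Q d(1,2)]] i Q by blast
    then show ?thesis using tr[OF d(1,2)] by simp
  qed
  then show ?thesis by blast
qed

lemma lord_poly_at:
  assumes Q: "plc Q" and \<pi>: "\<pi> \<in> max_ideal Q" "\<pi> \<noteq> 0" and l: "subfield l" "l \<subseteq> Kb"
    and r: "r \<in> l" "a - r \<in> max_ideal Q" "lord Q \<pi> l (a - r) e"
    and c: "poly_over l c" "c \<noteq> 0"
  shows "lord Q \<pi> l (poly c a) (e * int (order r c))"
proof -
  interpret vplace UNIV Kb Q using vplace_plc Q by blast
  note lr = subfield_subring[OF l(1)]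
  show ?thesis using c
  proof (induction "degree c" arbitrary: c rule: less_induct)
    case less
    show ?case
    proof (cases "poly c r = 0")
      case False
      have "rs Kb Q (poly c a) (poly c r)"
        using rs_poly[of a r c] r l less.prems poly_over_mono by (auto simp: rs_def)
      then have "lord Q \<pi> l (poly c a) 0"
        using False subring_poly[OF lr less.prems(1) r(1)] by (intro lord_residue[OF \<pi> l]) (auto simp: rs_def)
      then show ?thesis using False by (simp add: order_0I)
    next
      case True
      obtain q where q: "poly_over l q" "c = [:- r, 1:] * q" "q \<noteq> 0" "degree q < degree c"
        using poly_root_factor[OF lr less.prems(1) r(1) True less.prems(2)] by blast
      have "order r c = Suc (order r q)"
        using order_mult[of "[:- r, 1:]" q r] order_power_n_n[of r 1] q less.prems by simp
      moreover have "lord Q \<pi> l ((a - r) * poly q a) (e + e * int (order r q))"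
        by (rule lord_mult[OF \<pi> l r(3) less.hyps[OF q(4,1,3)]])
      moreover have "poly c a = (a - r) * poly q a" unfolding q(2) by (simp add: algebra_simps)
      ultimately show ?thesis by (simp add: distrib_left)
    qed
  qed
qed

section \<open>The place at infinity\<close>

definition inf_place :: "'a set \<Rightarrow> bool" where
  "inf_place Q \<longleftrightarrow> plc Q \<and> inverse a \<in> max_ideal Q"

lemma inf_place_plc: "inf_place Q \<Longrightarrow> plc Q"
  by (simp add: inf_place_def)

text \<open>As \<open>inverse a\<close> is transcendental too, \<open>a\<close> is not a polynomial
  in it. Chevalley's theorem therefore extends \<open>Kb[inverse a]\<close> to a valuation ring
  without \<open>a\<close>.\<close>

lemma inf_place_exists: "\<exists>Q. inf_place Q"
proof -
  let ?A = "adjoin Kb (inverse a)"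
  have "a \<notin> ?A"
  proof
    assume "a \<in> ?A"
    then obtain p where p: "poly_over Kb p" "a = poly p (inverse a)" by (auto simp: adjoin_def)
    have "poly (pCons (-1) p) (inverse a) = 0" using p a_nonzero by simp
    moreover have "inverse a \<notin> Kb" using a_notin subfield_inverse[OF Kb_field, of "inverse a"] by auto
    ultimately show False using Kb_poly_nonzero[of "inverse a" "pCons (-1) p"] p Kb_closed by auto
  qed
  then obtain B where B: "?A \<subseteq> B" "subring B" "a \<notin> B" "\<And>x. x \<noteq> 0 \<Longrightarrow> x \<in> B \<or> inverse x \<in> B"
    using chevalley[OF subring_adjoin[OF Kb_ring] adjoin_elem[OF Kb_ring], of "inverse a"] by auto
  have "plc B" unfolding place_def
    using B adjoin_superset[OF Kb_ring, of "inverse a"] by (auto simp: subring_def)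
  moreover have "inverse a \<in> max_ideal B"
    using B adjoin_elem[OF Kb_ring, of "inverse a"] by (auto simp: max_ideal_def)
  ultimately show ?thesis by (auto simp: inf_place_def)
qed

text \<open>\<open>(z / a) ^ 8\<close> is \<open>inverse a\<close> times the unit
  \<open>(1 + inverse a ^ 2) ^ 3\<close>, which gives \<open>inverse a\<close> the order 8. The
  other orders follow from \<open>z = (z / a) * a\<close> and
  \<open>z ^ 3 = w * (a ^ 2 + 1)\<close>.\<close>

lemma inf_orders:
  assumes Q: "inf_place Q" and l: "subfield l" "l \<subseteq> Kb"
  shows "z / a \<in> max_ideal Q" and "lord Q (z / a) l a (- 8)"
    and "lord Q (z / a) l z (- 7)" and "lord Q (z / a) l w (- 5)"
proof -
  interpret vplace UNIV Kb Q using vplace_plc Q by (simp add: inf_place_def)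
  define b where "b = inverse a"
  have b: "b \<in> max_ideal Q" using Q by (simp add: inf_place_def b_def)
  define u where "u = z / a"
  have b2: "1 + b ^ 2 = (a ^ 2 + 1) / a ^ 2" using a_nonzero by (simp add: b_def field_simps)
  have "a * s / a ^ 8 = inverse a * (s / (a ^ 2) ^ 3)" for s
    using a_nonzero by (simp add: divide_simps eval_nat_numeral)
  then have u8: "u ^ 8 = b * (1 + b ^ 2) ^ 3"
    unfolding b2 u_def power_divide z8 unfolding b_def .
  have r1: "rs Kb Q (1 + b ^ 2) 1"
    using rs_add[OF rs_const[of 1] rs_power[OF rs_m[OF b], of 2]] Kb_closed by simp
  have b2nz: "1 + b ^ 2 \<noteq> 0" using a2_nonzero a_nonzero unfolding b2 by simp
  have "u ^ 8 \<in> max_ideal Q" unfolding u8 using b by (intro m_mult R_power rs_R[OF r1])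
  then show um: "z / a \<in> max_ideal Q"
    using power_m[of u 8] power_R[of u 8] m_R unfolding u_def[symmetric] by simp
  have u0: "z / a \<noteq> 0" using z_nonzero a_nonzero by simp
  note L = um u0 l
  have one: "1 \<in> l" using subring_one[OF subfield_subring[OF l(1)]] .
  have o1: "lord Q (z / a) l (1 + b ^ 2) 0"
    using r1 one by (intro lord_residue[OF L]) (auto simp: rs_def)
  have "lord Q (z / a) l (u ^ 8 / (1 + b ^ 2) ^ 3) (int 8 * 1 - int 3 * 0)"
    unfolding u_def by (intro lord_divide[OF L] lord_power[OF L] lord_uniformizer[OF L] o1)
  then have ob: "lord Q (z / a) l b 8" unfolding u8 using b2nz by simp
  show oa: "lord Q (z / a) l a (- 8)" using lord_inverse[OF L ob] by (simp add: b_def)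
  have "lord Q (z / a) l (z / a * a) (1 + - 8)"
    by (intro lord_mult[OF L] lord_uniformizer[OF L] oa)
  then show oz: "lord Q (z / a) l z (- 7)" using a_nonzero by simp
  have "w = w * s * b ^ 2 / (s / a ^ 2)" if "s \<noteq> 0" for s
    using a_nonzero that by (simp add: b_def field_simps)
  from this[OF a2_nonzero] have "w = z ^ 3 * b ^ 2 / (1 + b ^ 2)" unfolding b2 zzw .
  moreover have "lord Q (z / a) l (z ^ 3 * b ^ 2 / (1 + b ^ 2)) (int 3 * - 7 + int 2 * 8 - 0)"
    by (intro lord_divide[OF L] lord_mult[OF L] lord_power[OF L] oz ob o1)
  ultimately show "lord Q (z / a) l w (- 5)" by simp
qed

lemma inf_poly_order:
  assumes Q: "inf_place Q" and l: "subfield l" "l \<subseteq> Kb" and c: "poly_over l c" "c \<noteq> 0"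
  shows "lord Q (z / a) l (poly c a) (8 * - int (degree c))"
proof -
  interpret vplace UNIV Kb Q using vplace_plc Q by (simp add: inf_place_def)
  have u0: "z / a \<noteq> 0" using z_nonzero a_nonzero by simp
  note L = inf_orders(1)[OF Q l] u0 l
  show ?thesis using c
  proof (induction c)
    case (pCons d c)
    show ?case
    proof (cases "c = 0")
      case True
      then show ?thesis using pCons by (auto intro!: lord_const[OF L])
    next
      case False
      have 1: "lord Q (z / a) l (a * poly c a) (- 8 + 8 * - int (degree c))"
        using pCons False by (intro lord_mult[OF L] inf_orders[OF Q l]) auto
      have "lord Q (z / a) l (a * poly c a + d) (- 8 + 8 * - int (degree c))"
      proof (cases "d = 0")
        case False
        then show ?thesis using pCons by (intro lord_add_less[OF L 1 lord_const[OF L, of d]]) auto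
      qed (use 1 in simp)
      then show ?thesis using False by (simp add: add.commute algebra_simps)
    qed
  qed simp
qed

lemma inj_inf: "inj_on (\<lambda>j. (int (j mod 3) * - 5 + int (j div 3) * - 7) mod 8) {..<8}"
  and inj_zero: "inj_on (\<lambda>j. (int (j mod 3) * 3 + int (j div 3) * 1) mod 8) {..<8}"
  and inj_i: "inj_on (\<lambda>j. (int (j mod 3) * 1 + int (j div 3) * 3) mod 8) {..<8}"
proof -
  have "{..<8::nat} = {0,1,2,3,4,5,6,7}" by auto
  then show "inj_on (\<lambda>j. (int (j mod 3) * - 5 + int (j div 3) * - 7) mod 8) {..<8}"
    "inj_on (\<lambda>j. (int (j mod 3) * 3 + int (j div 3) * 1) mod 8) {..<8}"
    "inj_on (\<lambda>j. (int (j mod 3) * 1 + int (j div 3) * 3) mod 8) {..<8}"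
    by (simp_all add: inj_on_def)
qed

lemma inf_comb:
  assumes l: "subfield l" "l \<subseteq> Kb" and c: "\<forall>j<8. poly_over l (c j)" "\<exists>j<8. c j \<noteq> 0"
  shows "\<exists>j<8. c j \<noteq> 0 \<and> (\<forall>Q. inf_place Q \<longrightarrow> lord Q (z / a) l (\<Sum>j<8. poly (c j) a * mono8 w z j)
           (- (8 * int (degree (c j)) + 5 * int (j mod 3) + 7 * int (j div 3))))"
proof -
  let ?S = "{Q. inf_place Q}"
  have "\<exists>j<8. c j \<noteq> 0 \<and> (\<forall>Q\<in>?S. lord Q (z / a) l (\<Sum>j<8. poly (c j) a * mono8 w z j)
      (8 * - int (degree (c j)) + int (j mod 3) * - 5 + int (j div 3) * - 7))"
  proof (rule comb_orders[OF l, where S = ?S and \<nu> = "\<lambda>c. - int (degree c)"])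
    show "z / a \<noteq> 0" using z_nonzero a_nonzero by simp
  qed (use c inj_inf in \<open>simp_all add: inf_orders[OF _ l] inf_poly_order[OF _ l, simplified] inf_place_plc\<close>)
  moreover have "8 * - int (degree (c j)) + int (j mod 3) * - 5 + int (j div 3) * - 7 =
    - (8 * int (degree (c j)) + 5 * int (j mod 3) + 7 * int (j div 3))" for j by simp
  ultimately show ?thesis by (simp only: mem_Collect_eq Ball_def)
qed

lemma inf_field:
  assumes l: "subfield l" "l \<subseteq> Kb" and x: "x \<in> gen_field (l \<union> {a, w, z})" "x \<noteq> 0"
  shows "\<exists>n. \<forall>Q. inf_place Q \<longrightarrow> lord Q (z / a) l x n"
proof -
  let ?S = "{Q. inf_place Q}"
  have "\<exists>n. \<forall>Q\<in>?S. lord Q (z / a) l x n"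
  proof (rule field_orders[OF l, where S = ?S and \<nu> = "\<lambda>c. - int (degree c)" and m = "- 5" and n = "- 7"])
    show "z / a \<noteq> 0" using z_nonzero a_nonzero by simp
  qed (use x inj_inf in \<open>simp_all add: inf_orders[OF _ l] inf_poly_order[OF _ l, simplified] inf_place_plc\<close>)
  then show ?thesis by simp
qed

section \<open>The finite ramified places\<close>

text \<open>The remaining ramified places lie over the roots of \<open>X ^ 3 + X\<close>; the local parameter is \<open>z\<close>
  over \<open>0\<close> and \<open>w\<close> over the square roots of \<open>-1\<close>.\<close>
definition ram_par :: "'a \<Rightarrow> 'a" where "ram_par r = (if r = 0 then z else w)"

definition ram_w :: "'a \<Rightarrow> int" where "ram_w r = (if r = 0 then 3 else 1)"

definition ram_z :: "'a \<Rightarrow> int" where "ram_z r = (if r = 0 then 1 else 3)"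

lemma ram_par_nonzero: "ram_par r \<noteq> 0"
  by (simp add: ram_par_def w_nonzero z_nonzero)

lemma finite_wz: "plc Q \<Longrightarrow> a \<in> Q \<Longrightarrow> w \<in> Q \<and> z \<in> Q"
proof -
  assume Q: "plc Q" and a: "a \<in> Q"
  interpret vplace UNIV Kb Q using vplace_plc Q by blast
  have "w ^ 8 \<in> Q" "z ^ 8 \<in> Q"
    unfolding w8 z8 using a by (auto intro!: R_mult R_power R_add R_one)
  then show ?thesis using power_R[of w 8] power_R[of z 8] by simp
qed

text \<open>Over 0 the eighth power of \<open>z\<close> is \<open>a\<close> times a unit. Over a
  square root \<open>r\<close> of -1 the eighth power of \<open>w\<close> is \<open>a - r\<close>
  times \<open>a ^ 3 * (a + r)\<close>, a unit because \<open>a + r\<close> has residue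
  \<open>2 * r\<close>.\<close>

lemma ram_orders:
  assumes Q: "plc Q" "a - r \<in> max_ideal Q" and r: "r \<in> l" "r ^ 3 + r = 0" and l: "subfield l" "l \<subseteq> Kb"
  shows "ram_par r \<in> max_ideal Q" and "lord Q (ram_par r) l (a - r) 8"
    and "lord Q (ram_par r) l w (ram_w r)" and "lord Q (ram_par r) l z (ram_z r)"
proof -
  interpret vplace UNIV Kb Q using vplace_plc Q by blast
  note lr = subfield_subring[OF l(1)]
  have one: "1 \<in> l" using subring_one[OF lr] .
  have rK: "r \<in> Kb" using r(1) l(2) by blast
  then have ra: "rs Kb Q a r" using Q(2) by (simp add: rs_def)
  have wz: "w \<in> Q" "z \<in> Q" using finite_wz[OF Q(1) rs_R[OF ra]] by auto
  have main: "ram_par r \<in> max_ideal Q \<and> lord Q (ram_par r) l (a - r) 8 \<and>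
    lord Q (ram_par r) l w (ram_w r) \<and> lord Q (ram_par r) l z (ram_z r)"
  proof (cases "r = 0")
    case True
    then have am: "a \<in> max_ideal Q" using Q by simp
    have r1: "rs Kb Q (a ^ 2 + 1) 1"
      using rs_add[OF rs_power[OF rs_m[OF am], of 2] rs_const[of 1]] Kb_closed by simp
    have "z ^ 8 \<in> max_ideal Q" unfolding z8 using am by (intro m_mult R_power rs_R[OF r1])
    then have zm: "z \<in> max_ideal Q" using power_m wz by blast
    note L = zm z_nonzero l
    have o1: "lord Q z l (a ^ 2 + 1) 0" using r1 one by (intro lord_residue[OF L]) (auto simp: rs_def)
    have "lord Q z l (z ^ 8 / (a ^ 2 + 1) ^ 3) (int 8 * 1 - int 3 * 0)"
      by (intro lord_divide[OF L] lord_power[OF L] lord_uniformizer[OF L] o1)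
    then have oa: "lord Q z l a 8" unfolding z8 using a2_nonzero by simp
    have "lord Q z l (z ^ 3 / (a ^ 2 + 1)) (int 3 * 1 - 0)"
      by (intro lord_divide[OF L] lord_power[OF L] lord_uniformizer[OF L] o1)
    then have ow: "lord Q z l w 3" unfolding zzw using a2_nonzero by simp
    show ?thesis using zm oa ow lord_uniformizer[OF L] True by (simp add: ram_par_def ram_w_def ram_z_def)
  next
    case False
    have "r * (r ^ 2 + 1) = r ^ 3 + r" by (simp add: algebra_simps eval_nat_numeral)
    then have r2: "r ^ 2 = - 1" using r(2) False by (simp add: eq_neg_iff_add_eq_0)
    have rp: "rs Kb Q (a + r) (2 * r)"
      using rs_add[OF ra rs_const[OF rK]] by (simp only: mult_2)
    have nz: "2 * r \<noteq> 0" "2 * r \<in> l"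
      using False two_nonzero subring_add[OF lr r(1) r(1)] unfolding mult_2[symmetric] by simp_all
    have fac: "a ^ 2 + 1 = (a - r) * (a + r)" using r2 by (simp add: algebra_simps power2_eq_square)
    have "w ^ 8 \<in> max_ideal Q" unfolding w8 fac
      by (rule m_mult'[OF R_power[OF rs_R[OF ra]] m_mult[OF Q(2) rs_R[OF rp]]])
    then have wm: "w \<in> max_ideal Q" using power_m wz by blast
    note L = wm w_nonzero l
    have oa: "lord Q w l a 0" by (rule lord_residue[OF L Q(2) r(1) False])
    have op: "lord Q w l (a + r) 0" using rp nz by (intro lord_residue[OF L, of _ "2 * r"]) (auto simp: rs_def)
    have apr: "a + r \<noteq> 0" using a2_nonzero fac by auto
    have "lord Q w l (w ^ 8 / (a ^ 3 * (a + r))) (int 8 * 1 - (int 3 * 0 + 0))"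
      by (intro lord_divide[OF L] lord_mult[OF L] lord_power[OF L] lord_uniformizer[OF L] oa op)
    moreover have "w ^ 8 / (a ^ 3 * (a + r)) = a - r" unfolding w8 fac using a_nonzero apr by simp
    ultimately have oar: "lord Q w l (a - r) 8" by simp
    have "lord Q w l (w ^ 3 / a) (int 3 * 1 - 0)"
      by (intro lord_divide[OF L] lord_power[OF L] lord_uniformizer[OF L] oa)
    then have oz: "lord Q w l z 3" unfolding wza using a_nonzero by simp
    show ?thesis using wm oar oz lord_uniformizer[OF L] False by (simp add: ram_par_def ram_w_def ram_z_def)
  qed
  then show "ram_par r \<in> max_ideal Q" "lord Q (ram_par r) l (a - r) 8"
    "lord Q (ram_par r) l w (ram_w r)" "lord Q (ram_par r) l z (ram_z r)" by auto
qed

lemma inj_ram: "inj_on (\<lambda>j. (int (j mod 3) * ram_w r + int (j div 3) * ram_z r) mod 8) {..<8}"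
  using inj_zero inj_i by (simp add: ram_w_def ram_z_def)

lemma ram_comb:
  assumes l: "subfield l" "l \<subseteq> Kb" and r: "r \<in> l" "r ^ 3 + r = 0"
    and c: "\<forall>j<8. poly_over l (c j)" "\<exists>j<8. c j \<noteq> 0"
  shows "\<exists>j<8. c j \<noteq> 0 \<and> (\<forall>Q. plc Q \<and> a - r \<in> max_ideal Q \<longrightarrow>
    lord Q (ram_par r) l (\<Sum>j<8. poly (c j) a * mono8 w z j)
           (8 * int (order r (c j)) + int (j mod 3) * ram_w r + int (j div 3) * ram_z r))"
proof -
  let ?S = "{Q. plc Q \<and> a - r \<in> max_ideal Q}"
  have "\<exists>j<8. c j \<noteq> 0 \<and> (\<forall>Q\<in>?S. lord Q (ram_par r) l (\<Sum>j<8. poly (c j) a * mono8 w z j)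
      (8 * int (order r (c j)) + int (j mod 3) * ram_w r + int (j div 3) * ram_z r))"
  proof (rule comb_orders[OF l, where S = ?S and \<nu> = "\<lambda>c. int (order r c)"])
  qed (use c inj_ram[of r] ram_par_nonzero ram_orders[OF _ _ r l] lord_poly_at[OF _ _ ram_par_nonzero l r(1)]
    in \<open>simp_all\<close>)
  then show ?thesis by (simp only: mem_Collect_eq Ball_def)
qed

lemma ram_field:
  assumes l: "subfield l" "l \<subseteq> Kb" and r: "r \<in> l" "r ^ 3 + r = 0"
    and x: "x \<in> gen_field (l \<union> {a, w, z})" "x \<noteq> 0"
  shows "\<exists>n. \<forall>Q. plc Q \<and> a - r \<in> max_ideal Q \<longrightarrow> lord Q (ram_par r) l x n"
proof -
  let ?S = "{Q. plc Q \<and> a - r \<in> max_ideal Q}"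
  have "\<exists>n. \<forall>Q\<in>?S. lord Q (ram_par r) l x n"
  proof (rule field_orders[OF l, where S = ?S and \<nu> = "\<lambda>c. int (order r c)" and m = "ram_w r" and n = "ram_z r"])
  qed (use x inj_ram[of r] ram_par_nonzero ram_orders[OF _ _ r l] lord_poly_at[OF _ _ ram_par_nonzero l r(1)]
    in \<open>simp_all\<close>)
  then show ?thesis by (simp only: mem_Collect_eq Ball_def)
qed

end

section \<open>Affine points and their places\<close>

lemma field_hom_uminus_one: "field_hom \<sigma> \<Longrightarrow> \<sigma> (- 1) = - 1"
  unfolding field_hom_def by (metis add.right_inverse eq_neg_iff_add_eq_0 add.commute)

lemma crel_sum:
  assumes "\<And>i. i \<in> I \<Longrightarrow> crel a w z k \<sigma> a' w' z' (f i) (g i)" "0 \<in> k" "\<sigma> 0 = 0"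
  shows "crel a w z k \<sigma> a' w' z' (sum f I) (sum g I)"
  using assms(1)
proof (induction I rule: infinite_finite_induct)
  case (infinite I)
  then show ?case using crel_const[of 0 k a w z \<sigma> a' w' z'] assms by simp
next
  case empty
  then show ?case using crel_const[of 0 k a w z \<sigma> a' w' z'] assms by simp
qed (auto intro: crel_add)

context curve
begin

text \<open>A nontrivial relation would give 0 a finite order at infinity.\<close>

lemma cring_independent:
  assumes "\<forall>j<8. poly_over Kb (c j)" "(\<Sum>j<8. poly (c j) a * mono8 w z j) = 0" "j < 8"
  shows "c j = 0"
proof (rule ccontr)
  assume "c j \<noteq> 0"
  then obtain n where n: "\<And>Q. inf_place Q \<Longrightarrow> lord Q (z / a) Kb 0 n"
    using inf_comb[OF Kb_field subset_refl assms(1)] assms(2,3) by auto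
  obtain Q where Q: "inf_place Q" using inf_place_exists by blast
  interpret vplace UNIV Kb Q using vplace_plc inf_place_plc[OF Q] by blast
  show False using lord_unit[OF n[OF Q]] by (simp add: is_unit_in_def)
qed

text \<open>Only zero coefficients represent 0. This makes the relation single valued, so that
  evaluation and Frobenius are well defined.\<close>

lemma crel_zero:
  assumes "crel a w z Kb \<sigma> a' w' z' 0 x'" "curve_eqs a' w' z'" "field_hom \<sigma>"
  shows "x' = 0"
proof -
  obtain c where c: "\<forall>l<8. poly_over Kb (c l)" "0 = (\<Sum>l<8. poly (c l) a * mono8 w z l)"
    "x' = (\<Sum>l<8. poly (map_poly \<sigma> (c l)) a' * mono8 w' z' l)"
    using crel_nform[OF eqs assms(2) Kb_ring assms(3,1)] by (auto simp: nform_def)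
  then show ?thesis using cring_independent[OF c(1) c(2)[symmetric]] by simp
qed

lemma crel_unique:
  assumes "crel a w z Kb \<sigma> a' w' z' x x'" "crel a w z Kb \<sigma> a' w' z' x x''" "curve_eqs a' w' z'" "field_hom \<sigma>"
  shows "x' = x''"
proof -
  have "crel a w z Kb \<sigma> a' w' z' (x + (- 1) * x) (x' + \<sigma> (- 1) * x'')"
    using assms Kb_closed by (intro crel_add crel_mult crel_const) auto
  then show ?thesis
    using crel_zero[OF _ assms(3,4), of "x' - x''"] field_hom_uminus_one[OF assms(4)] by simp
qed

definition pt :: "'a \<Rightarrow> 'a \<Rightarrow> 'a \<Rightarrow> bool" where
  "pt \<alpha> \<beta> \<gamma> \<longleftrightarrow> \<alpha> \<in> Kb \<and> \<beta> \<in> Kb \<and> \<gamma> \<in> Kb \<and> curve_eqs \<alpha> \<beta> \<gamma>"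

definition cen :: "'a set \<Rightarrow> 'a \<Rightarrow> 'a \<Rightarrow> 'a \<Rightarrow> bool" where
  "cen Q \<alpha> \<beta> \<gamma> \<longleftrightarrow> plc Q \<and> pt \<alpha> \<beta> \<gamma> \<and> rs Kb Q a \<alpha> \<and> rs Kb Q w \<beta> \<and> rs Kb Q z \<gamma>"

abbreviation ev :: "'a \<Rightarrow> 'a \<Rightarrow> 'a \<Rightarrow> 'a \<Rightarrow> 'a \<Rightarrow> bool" where
  "ev \<alpha> \<beta> \<gamma> \<equiv> crel a w z Kb (\<lambda>x. x) \<alpha> \<beta> \<gamma>"

text \<open>\<open>c\<close> is the value at a point of the element \<open>x\<close> of its local ring.\<close>
definition lval :: "'a \<Rightarrow> 'a \<Rightarrow> 'a \<Rightarrow> 'a \<Rightarrow> 'a \<Rightarrow> bool" where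
  "lval \<alpha> \<beta> \<gamma> x c \<longleftrightarrow> (\<exists>g h b d. ev \<alpha> \<beta> \<gamma> g b \<and> ev \<alpha> \<beta> \<gamma> h d \<and> d \<noteq> 0 \<and> x = g / h \<and> c = b / d)"

lemma ev_const: "c \<in> Kb \<Longrightarrow> ev \<alpha> \<beta> \<gamma> c c"
  using crel_const[of c Kb a w z "\<lambda>x. x"] by simp

lemma ev_diff: "ev \<alpha> \<beta> \<gamma> x c \<Longrightarrow> ev \<alpha> \<beta> \<gamma> y d \<Longrightarrow> ev \<alpha> \<beta> \<gamma> (x - y) (c - d)"
  using crel_add[OF _ crel_mult[OF ev_const[of "-1"]], of \<alpha> \<beta> \<gamma> x c y d] Kb_closed by simp

lemma ev_power: "ev \<alpha> \<beta> \<gamma> x c \<Longrightarrow> ev \<alpha> \<beta> \<gamma> (x ^ n) (c ^ n)"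
  using crel_power[of a w z Kb "\<lambda>x. x"] Kb_closed by simp

lemma ev_Kb: "ev \<alpha> \<beta> \<gamma> x c \<Longrightarrow> pt \<alpha> \<beta> \<gamma> \<Longrightarrow> c \<in> Kb"
  by (induction rule: crel.induct) (auto simp: pt_def intro: Kb_closed)

lemma ev_rs: "ev \<alpha> \<beta> \<gamma> x c \<Longrightarrow> cen Q \<alpha> \<beta> \<gamma> \<Longrightarrow> rs Kb Q x c"
proof (induction rule: crel.induct)
  case (crel_const c)
  then interpret vplace UNIV Kb Q using vplace_plc by (simp add: cen_def)
  show ?case using crel_const rs_const by blast
next
  case (crel_add x x' y y')
  then interpret vplace UNIV Kb Q using vplace_plc by (simp add: cen_def)
  show ?case using crel_add rs_add by blast
next
  case (crel_mult x x' y y')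
  then interpret vplace UNIV Kb Q using vplace_plc by (simp add: cen_def)
  show ?case using crel_mult rs_mult by blast
qed (simp_all add: cen_def)

context
  fixes \<alpha> \<beta> \<gamma> assumes pt: "pt \<alpha> \<beta> \<gamma>"
begin

lemma pt_Kb: "\<alpha> \<in> Kb" "\<beta> \<in> Kb" "\<gamma> \<in> Kb" and pt_eqs: "curve_eqs \<alpha> \<beta> \<gamma>"
  using pt by (auto simp: pt_def)

lemma a_minus_nonzero: "a - \<alpha> \<noteq> 0"
  using a_notin pt_Kb by auto

lemma ev_nonzero: "ev \<alpha> \<beta> \<gamma> x c \<Longrightarrow> c \<noteq> 0 \<Longrightarrow> x \<noteq> 0"
  using crel_zero pt_eqs field_hom_id by blast

lemma lval_ev: "ev \<alpha> \<beta> \<gamma> x c \<Longrightarrow> lval \<alpha> \<beta> \<gamma> x c"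
  unfolding lval_def using ev_const[of 1] Kb_closed(1) by (intro exI[of _ x] exI[of _ 1] exI[of _ c]) auto

lemma lval_add:
  assumes "lval \<alpha> \<beta> \<gamma> x c" "lval \<alpha> \<beta> \<gamma> y d" shows "lval \<alpha> \<beta> \<gamma> (x + y) (c + d)"
proof -
  obtain g h p q where 1: "ev \<alpha> \<beta> \<gamma> g p" "ev \<alpha> \<beta> \<gamma> h q" "q \<noteq> 0" "x = g / h" "c = p / q"
    using assms(1) by (auto simp: lval_def)
  obtain g' h' p' q' where 2: "ev \<alpha> \<beta> \<gamma> g' p'" "ev \<alpha> \<beta> \<gamma> h' q'" "q' \<noteq> 0" "y = g' / h'" "d = p' / q'"
    using assms(2) by (auto simp: lval_def)
  have "x + y = (g * h' + g' * h) / (h * h')" "c + d = (p * q' + p' * q) / (q * q')"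
    using 1 2 ev_nonzero by (auto simp: field_simps)
  moreover have "ev \<alpha> \<beta> \<gamma> (g * h' + g' * h) (p * q' + p' * q)" "ev \<alpha> \<beta> \<gamma> (h * h') (q * q')"
    by (intro crel_add crel_mult 1 2)+
  moreover have "q * q' \<noteq> 0" using 1 2 by simp
  ultimately show ?thesis unfolding lval_def by blast
qed

lemma lval_mult:
  assumes "lval \<alpha> \<beta> \<gamma> x c" "lval \<alpha> \<beta> \<gamma> y d" shows "lval \<alpha> \<beta> \<gamma> (x * y) (c * d)"
proof -
  obtain g h p q where 1: "ev \<alpha> \<beta> \<gamma> g p" "ev \<alpha> \<beta> \<gamma> h q" "q \<noteq> 0" "x = g / h" "c = p / q"
    using assms(1) by (auto simp: lval_def)
  obtain g' h' p' q' where 2: "ev \<alpha> \<beta> \<gamma> g' p'" "ev \<alpha> \<beta> \<gamma> h' q'" "q' \<noteq> 0" "y = g' / h'" "d = p' / q'"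
    using assms(2) by (auto simp: lval_def)
  have "x * y = (g * g') / (h * h')" "c * d = (p * p') / (q * q')" using 1 2 by auto
  moreover have "ev \<alpha> \<beta> \<gamma> (g * g') (p * p')" "ev \<alpha> \<beta> \<gamma> (h * h') (q * q')"
    by (intro crel_mult 1 2)+
  moreover have "q * q' \<noteq> 0" using 1 2 by simp
  ultimately show ?thesis unfolding lval_def by blast
qed

lemma lval_const: "c \<in> Kb \<Longrightarrow> lval \<alpha> \<beta> \<gamma> c c"
  by (intro lval_ev ev_const)

lemma lval_minus: "lval \<alpha> \<beta> \<gamma> x c \<Longrightarrow> lval \<alpha> \<beta> \<gamma> (- x) (- c)"
  using lval_mult[OF lval_const[of "-1"]] Kb_closed by fastforce

lemma lval_diff: "lval \<alpha> \<beta> \<gamma> x c \<Longrightarrow> lval \<alpha> \<beta> \<gamma> y d \<Longrightarrow> lval \<alpha> \<beta> \<gamma> (x - y) (c - d)"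
  using lval_add[OF _ lval_minus] by fastforce

lemma lval_inverse:
  assumes "lval \<alpha> \<beta> \<gamma> x c" "c \<noteq> 0" shows "lval \<alpha> \<beta> \<gamma> (inverse x) (inverse c)"
proof -
  obtain g h p q where 1: "ev \<alpha> \<beta> \<gamma> g p" "ev \<alpha> \<beta> \<gamma> h q" "q \<noteq> 0" "x = g / h" "c = p / q"
    using assms(1) by (auto simp: lval_def)
  then have "inverse x = h / g" "inverse c = q / p" "p \<noteq> 0" using assms(2) by auto
  then show ?thesis unfolding lval_def using 1 by blast
qed

lemma lval_divide:
  "lval \<alpha> \<beta> \<gamma> x c \<Longrightarrow> lval \<alpha> \<beta> \<gamma> y d \<Longrightarrow> d \<noteq> 0 \<Longrightarrow> lval \<alpha> \<beta> \<gamma> (x / y) (c / d)"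
  using lval_mult lval_inverse by (simp add: divide_inverse)

lemma lval_zero: "lval \<alpha> \<beta> \<gamma> 0 c \<Longrightarrow> c = 0"
proof -
  assume "lval \<alpha> \<beta> \<gamma> 0 c"
  then obtain g h p q where 1: "ev \<alpha> \<beta> \<gamma> g p" "ev \<alpha> \<beta> \<gamma> h q" "q \<noteq> 0" "0 = g / h" "c = p / q"
    by (auto simp: lval_def)
  then have "g = 0" using ev_nonzero by auto
  then have "p = 0" using 1 ev_nonzero by blast
  then show ?thesis using 1 by simp
qed

lemma lval_unique: "lval \<alpha> \<beta> \<gamma> x c \<Longrightarrow> lval \<alpha> \<beta> \<gamma> x d \<Longrightarrow> c = d"
  using lval_diff[of x c x d] lval_zero[of "c - d"] by simp

lemma lval_rs: "lval \<alpha> \<beta> \<gamma> x c \<Longrightarrow> cen Q \<alpha> \<beta> \<gamma> \<Longrightarrow> rs Kb Q x c"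
proof -
  assume "lval \<alpha> \<beta> \<gamma> x c" and Q: "cen Q \<alpha> \<beta> \<gamma>"
  then obtain g h p q where 1: "ev \<alpha> \<beta> \<gamma> g p" "ev \<alpha> \<beta> \<gamma> h q" "q \<noteq> 0" "x = g / h" "c = p / q"
    by (auto simp: lval_def)
  interpret vplace UNIV Kb Q using Q vplace_plc by (simp add: cen_def)
  show ?thesis using rs_divide[OF ev_rs[OF 1(1) Q] ev_rs[OF 1(2) Q] 1(3)] 1 by simp
qed

definition lring :: "'a set" where "lring = {x. \<exists>c. lval \<alpha> \<beta> \<gamma> x c}"

lemma subring_lring: "subring lring"
  unfolding subring_def lring_def
  using lval_add lval_mult lval_minus lval_const[OF Kb_closed(1)] by blast

lemma lring_cring: "cring a w z Kb \<subseteq> lring"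
  unfolding lring_def using cring_crel lval_ev by blast

lemma lring_divide: "x \<in> lring \<Longrightarrow> lval \<alpha> \<beta> \<gamma> y d \<Longrightarrow> d \<noteq> 0 \<Longrightarrow> x / y \<in> lring"
  unfolding lring_def using lval_divide by blast

lemmas lring_closed = subring_closed[OF subring_lring]

lemma lring_gens: "Kb \<subseteq> lring" "a \<in> lring" "w \<in> lring" "z \<in> lring"
  using lring_cring cring_gens(1)[of Kb a w z] cring_gens(2)[of a w z Kb] cring_gens(3)[of w a z Kb]
    cring_gens(4)[of z a w Kb] by blast+

lemma lval_poly: "poly_over Kb p \<Longrightarrow> lval \<alpha> \<beta> \<gamma> (poly p a) (poly p \<alpha>)"
proof -
  assume p: "poly_over Kb p"
  have "ev \<alpha> \<beta> \<gamma> (poly p a) (poly (map_poly (\<lambda>x. x) p) \<alpha>)"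
    by (intro crel_poly p field_hom_id Kb_closed)
  then show ?thesis using lval_ev by simp
qed

lemma poly_quot:
  assumes "poly_over Kb p"
  shows "\<exists>y. lval \<alpha> \<beta> \<gamma> y (poly (pderiv p) \<alpha>) \<and> poly p a - poly p \<alpha> = (a - \<alpha>) * y"
  using assms
proof (induction p)
  case 0
  show ?case using lval_const[of 0] Kb_closed by (intro exI[of _ 0]) simp
next
  case (pCons c p)
  then obtain y where y: "lval \<alpha> \<beta> \<gamma> y (poly (pderiv p) \<alpha>)" "poly p a - poly p \<alpha> = (a - \<alpha>) * y" by auto
  have "poly (pCons c p) a - poly (pCons c p) \<alpha> = (a - \<alpha>) * poly p a + \<alpha> * (poly p a - poly p \<alpha>)"
    by (simp add: algebra_simps)
  also have "\<dots> = (a - \<alpha>) * (poly p a + \<alpha> * y)" unfolding y(2) by (simp add: algebra_simps)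
  finally have "poly (pCons c p) a - poly (pCons c p) \<alpha> = (a - \<alpha>) * (poly p a + \<alpha> * y)" .
  moreover have "lval \<alpha> \<beta> \<gamma> (poly p a + \<alpha> * y) (poly (pderiv (pCons c p)) \<alpha>)"
    unfolding pderiv_pCons using pCons.prems pt_Kb(1)
    by (simp add: lval_add lval_mult lval_poly lval_const y(1))
  ultimately show ?case by blast
qed

section \<open>Unramified points\<close>

context
  assumes unram: "\<alpha> ^ 3 + \<alpha> \<noteq> 0"
begin

lemma unram_nonzero: "\<alpha> \<noteq> 0" "\<alpha> ^ 2 + 1 \<noteq> 0" "\<beta> \<noteq> 0" "\<gamma> \<noteq> 0"
proof -
  have eq: "\<alpha> ^ 3 + \<alpha> = \<alpha> * (\<alpha> ^ 2 + 1)" by (simp add: algebra_simps eval_nat_numeral)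
  show "\<alpha> \<noteq> 0" "\<alpha> ^ 2 + 1 \<noteq> 0" using unram unfolding eq by auto
  then have "\<beta> ^ 8 \<noteq> 0" "\<gamma> ^ 8 \<noteq> 0"
    unfolding curve_eqs_w8[OF pt_eqs] curve_eqs_z8[OF pt_eqs] by auto
  then show "\<beta> \<noteq> 0" "\<gamma> \<noteq> 0" by auto
qed

text \<open>Since \<open>8 = 1\<close>, the linear coefficient of an eighth root is immediate.\<close>
lemma eighth_root_quot:
  assumes u: "ev \<alpha> \<beta> \<gamma> u c" "u ^ 8 = poly p a" "c ^ 8 = poly p \<alpha>" "c \<noteq> 0" and p: "poly_over Kb p"
  shows "\<exists>y. lval \<alpha> \<beta> \<gamma> y (poly (pderiv p) \<alpha> / c ^ 7) \<and> u - c = (a - \<alpha>) * y"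
proof -
  have cK: "c \<in> Kb" using ev_Kb[OF u(1) pt] .
  define s where "s = (\<Sum>i<8. c ^ (8 - Suc i) * u ^ i)"
  have "ev \<alpha> \<beta> \<gamma> s (\<Sum>i<8. c ^ (8 - Suc i) * c ^ i)"
    unfolding s_def using Kb_closed cK by (intro crel_sum crel_mult ev_power u ev_const) auto
  also have "(\<Sum>i<8. c ^ (8 - Suc i) * c ^ i) = (\<Sum>i<8::nat. c ^ 7)"
    by (intro sum.cong refl) (simp flip: power_add)
  also have "\<dots> = (7 + 1) * c ^ 7" by simp
  finally have s: "ev \<alpha> \<beta> \<gamma> s (c ^ 7)" unfolding seven by simp
  have s0: "c ^ 7 \<noteq> 0" using u(4) by simp
  obtain x where x: "lval \<alpha> \<beta> \<gamma> x (poly (pderiv p) \<alpha>)" "poly p a - poly p \<alpha> = (a - \<alpha>) * x"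
    using poly_quot[OF p] by blast
  have "(u - c) * s = u ^ 8 - c ^ 8" using power_diff_sumr2[of u 8 c] by (simp add: s_def)
  also have "\<dots> = (a - \<alpha>) * x" unfolding u(2,3) x(2) ..
  finally have "u - c = (a - \<alpha>) * (x / s)" using ev_nonzero[OF s s0] by (simp add: field_simps)
  then show ?thesis using lval_divide[OF x(1) lval_ev[OF s] s0] by blast
qed

text \<open>Differentiating \<open>w ^ 8 = a ^ 3 * (a ^ 2 + 1)\<close> with \<open>8 = 1\<close>
  gives \<open>w ^ 7 * dw = (5 * a ^ 4 + 3 * a ^ 2) * da\<close>; the value of the quotient is the
  derivative at the point.\<close>

lemma w_quot: "\<exists>y. lval \<alpha> \<beta> \<gamma> y ((5 * \<alpha> ^ 4 + 3 * \<alpha> ^ 2) / \<beta> ^ 7) \<and> w - \<beta> = (a - \<alpha>) * y"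
proof -
  define p :: "'a poly" where "p = [:0, 0, 0, 1, 0, 1:]"
  have pK: "poly_over Kb p" unfolding p_def using Kb_closed Kb_ring by simp
  have pv: "poly p x = x ^ 3 * (x ^ 2 + 1)" for x
    by (simp add: p_def algebra_simps eval_nat_numeral)
  have pd: "poly (pderiv p) \<alpha> = 5 * \<alpha> ^ 4 + 3 * \<alpha> ^ 2"
    by (simp add: p_def pderiv_pCons algebra_simps eval_nat_numeral)
  show ?thesis unfolding pd[symmetric]
  proof (rule eighth_root_quot[OF crel_w _ _ _ pK])
    show "w ^ 8 = poly p a" unfolding pv by (rule w8)
    show "\<beta> ^ 8 = poly p \<alpha>" unfolding pv by (rule curve_eqs_w8[OF pt_eqs])
    show "\<beta> \<noteq> 0" by (rule unram_nonzero(3))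
  qed
qed

lemma z_quot: "\<exists>y. lval \<alpha> \<beta> \<gamma> y ((\<alpha> ^ 2 + 1) ^ 2 / \<gamma> ^ 7) \<and> z - \<gamma> = (a - \<alpha>) * y"
proof -
  define p :: "'a poly" where "p = [:0, 1, 0, 3, 0, 3, 0, 1:]"
  have "1 + 1 + 1 \<in> Kb" by (intro Kb_closed)
  have pK: "poly_over Kb p" unfolding p_def using Kb_closed Kb_ring \<open>1 + 1 + 1 \<in> Kb\<close> by simp
  have pv: "poly p x = x * (x ^ 2 + 1) ^ 3" for x
    by (simp add: p_def algebra_simps eval_nat_numeral)
  \<comment> \<open>The derivative of \<open>X * (X ^ 2 + 1) ^ 3\<close> is
    \<open>(X ^ 2 + 1) ^ 2 * (7 * X ^ 2 + 1)\<close>.\<close>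
  have "poly (pderiv p) \<alpha> = (\<alpha> ^ 2 + 1) ^ 2 + 7 * (\<alpha> ^ 2 + 2 * \<alpha> ^ 4 + \<alpha> ^ 6)"
    by (simp add: p_def pderiv_pCons algebra_simps eval_nat_numeral)
  then have pd: "poly (pderiv p) \<alpha> = (\<alpha> ^ 2 + 1) ^ 2" unfolding seven by simp
  show ?thesis unfolding pd[symmetric]
  proof (rule eighth_root_quot[OF crel_z _ _ _ pK])
    show "z ^ 8 = poly p a" unfolding pv by (rule z8)
    show "\<gamma> ^ 8 = poly p \<alpha>" unfolding pv by (rule curve_eqs_z8[OF pt_eqs])
    show "\<gamma> \<noteq> 0" by (rule unram_nonzero(4))
  qed
qed

lemma w_ideal: "\<exists>y\<in>lring. w - \<beta> = (a - \<alpha>) * y" and z_ideal: "\<exists>y\<in>lring. z - \<gamma> = (a - \<alpha>) * y"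
  using w_quot z_quot by (auto simp: lring_def)

lemma ev_ideal: "ev \<alpha> \<beta> \<gamma> x c \<Longrightarrow> \<exists>y\<in>lring. x - c = (a - \<alpha>) * y"
proof (induction rule: crel.induct)
  case (crel_const c)
  then show ?case using lring_closed(2) by (intro bexI[of _ 0]) auto
next
  case crel_a
  then show ?case using lring_closed(1) by (intro bexI[of _ 1]) auto
next
  case crel_w
  show ?case using w_ideal .
next
  case crel_z
  show ?case using z_ideal .
next
  case (crel_add x x' y y')
  then obtain u v where "u \<in> lring" "v \<in> lring" "x - x' = (a - \<alpha>) * u" "y - y' = (a - \<alpha>) * v" by blast
  moreover have "x + y - (x' + y') = (x - x') + (y - y')" by simp
  ultimately have "x + y - (x' + y') = (a - \<alpha>) * (u + v)" "u \<in> lring" "v \<in> lring"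
    by (simp_all only: distrib_left)
  then show ?case using lring_closed(3) by blast
next
  case (crel_mult x x' y y')
  then obtain u v where uv: "u \<in> lring" "v \<in> lring" "x - x' = (a - \<alpha>) * u" "y - y' = (a - \<alpha>) * v" by blast
  have "x * y - x' * y' = (x - x') * y + x' * (y - y')" by (simp add: algebra_simps)
  also have "\<dots> = (a - \<alpha>) * (u * y + x' * v)" unfolding uv by (simp add: algebra_simps)
  finally have "x * y - x' * y' = (a - \<alpha>) * (u * y + x' * v)" .
  moreover have "y \<in> lring" "x' \<in> lring"
    using lval_ev[OF crel_mult.hyps(2)] lval_const[OF ev_Kb[OF crel_mult.hyps(1) pt]] by (auto simp: lring_def)
  ultimately show ?case using uv lring_closed(3,4) by blast
qed

text \<open>The numerator is congruent to its value modulo \<open>a - \<alpha>\<close>, generator by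
  generator. Hence \<open>a - \<alpha>\<close> generates the maximal ideal of the local
  ring.\<close>

lemma lval_ideal: "lval \<alpha> \<beta> \<gamma> x 0 \<Longrightarrow> \<exists>y\<in>lring. x = (a - \<alpha>) * y"
proof -
  assume "lval \<alpha> \<beta> \<gamma> x 0"
  then obtain g h d where 1: "ev \<alpha> \<beta> \<gamma> g 0" "ev \<alpha> \<beta> \<gamma> h d" "d \<noteq> 0" "x = g / h"
    by (auto simp: lval_def)
  obtain y where y: "y \<in> lring" "g = (a - \<alpha>) * y" using ev_ideal[OF 1(1)] by auto
  have "x = (a - \<alpha>) * (y / h)" using 1 y by simp
  then show ?thesis using lring_divide[OF y(1) lval_ev[OF 1(2)] 1(3)] by blast
qed

lemma poly_unit_part:
  assumes "poly_over Kb d" "d \<noteq> 0"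
  shows "\<exists>s u c. lval \<alpha> \<beta> \<gamma> u c \<and> c \<noteq> 0 \<and> poly d a = (a - \<alpha>) ^ s * u"
  using assms
proof (induction "degree d" arbitrary: d rule: less_induct)
  case less
  show ?case
  proof (cases "poly d \<alpha> = 0")
    case False
    then show ?thesis using lval_poly[OF less.prems(1)]
      by (intro exI[of _ 0] exI[of _ "poly d a"] exI[of _ "poly d \<alpha>"]) simp
  next
    case True
    obtain q where q: "poly_over Kb q" "d = [:- \<alpha>, 1:] * q" "q \<noteq> 0" "degree q < degree d"
      using poly_root_factor[OF Kb_ring less.prems(1) pt_Kb(1) True less.prems(2)] by blast
    obtain s u c where s: "lval \<alpha> \<beta> \<gamma> u c" "c \<noteq> 0" "poly q a = (a - \<alpha>) ^ s * u"
      using less.hyps[OF q(4,1,3)] by blast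
    have "poly d a = (a - \<alpha>) * poly q a" unfolding q(2) by (simp add: algebra_simps)
    then have "poly d a = (a - \<alpha>) ^ Suc s * u" using s(3) by simp
    then show ?thesis using s(1,2) by blast
  qed
qed

text \<open>Factors \<open>a - \<alpha>\<close> can be split off only finitely often, because within
  the local ring \<open>x\<close> divides a nonzero polynomial in \<open>a\<close>, which has a
  finite order at \<open>\<alpha>\<close>.\<close>

lemma lring_unit_part:
  assumes "x \<in> lring" "x \<noteq> 0"
  shows "\<exists>n u c. lval \<alpha> \<beta> \<gamma> u c \<and> c \<noteq> 0 \<and> x = (a - \<alpha>) ^ n * u"
proof -
  have step: "\<exists>n u c. lval \<alpha> \<beta> \<gamma> u c \<and> c \<noteq> 0 \<and> x = (a - \<alpha>) ^ n * u"
    if "x \<in> lring" "y \<in> lring" "x * y = (a - \<alpha>) ^ s * u0" "lval \<alpha> \<beta> \<gamma> u0 c0" "c0 \<noteq> 0" for x y s u0 c0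
    using that
  proof (induction s arbitrary: x)
    case (0 x)
    obtain c d where c: "lval \<alpha> \<beta> \<gamma> x c" "lval \<alpha> \<beta> \<gamma> y d" using 0 by (auto simp: lring_def)
    have "c * d = c0" using lval_unique[OF lval_mult[OF c]] 0 by simp
    then have "c \<noteq> 0" using 0 by auto
    then show ?case using c by (intro exI[of _ 0] exI[of _ x] exI[of _ c]) simp
  next
    case (Suc s x)
    obtain c where c: "lval \<alpha> \<beta> \<gamma> x c" using Suc by (auto simp: lring_def)
    show ?case
    proof (cases "c = 0")
      case True
      then obtain x1 where x1: "x1 \<in> lring" "x = (a - \<alpha>) * x1" using lval_ideal c by blast
      have "x1 * y = (a - \<alpha>) ^ s * u0"
        using Suc.prems(3) a_minus_nonzero unfolding x1(2) by (simp add: mult.assoc)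
      then obtain n u c where n: "lval \<alpha> \<beta> \<gamma> u c" "c \<noteq> 0" "x1 = (a - \<alpha>) ^ n * u"
        using Suc.IH[OF x1(1) Suc.prems(2)] Suc.prems by blast
      then have "x = (a - \<alpha>) ^ Suc n * u" using x1 by simp
      then show ?thesis using n by blast
    qed (use c in \<open>intro exI[of _ 0] exI[of _ x] exI[of _ c], simp\<close>)
  qed
  obtain d where d: "poly_over Kb d" "d \<noteq> 0" "inverse x * poly d a \<in> cring a w z Kb"
    using gen_field_fraction[OF eqs Kb_field a_transcendental, of "inverse x"] gen by auto
  obtain s u c where s: "lval \<alpha> \<beta> \<gamma> u c" "c \<noteq> 0" "poly d a = (a - \<alpha>) ^ s * u"
    using poly_unit_part[OF d(1,2)] by blast
  have "x * (inverse x * poly d a) = (a - \<alpha>) ^ s * u" using s assms by simp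
  then show ?thesis using step[OF assms(1) _ _ s(1,2)] d(3) lring_cring by blast
qed

lemma unram_field:
  assumes "x \<noteq> 0"
  shows "\<exists>n u c. lval \<alpha> \<beta> \<gamma> u c \<and> c \<noteq> 0 \<and> x = u * (a - \<alpha>) powi n"
proof -
  obtain d where d: "poly_over Kb d" "d \<noteq> 0" "x * poly d a \<in> cring a w z Kb"
    using gen_field_fraction[OF eqs Kb_field a_transcendental, of x] gen by auto
  have "poly d a \<noteq> 0" using a_transcendental d by blast
  moreover from this obtain n u c where 1: "lval \<alpha> \<beta> \<gamma> u c" "c \<noteq> 0" "x * poly d a = (a - \<alpha>) ^ n * u"
    using lring_unit_part[of "x * poly d a"] d lring_cring assms by auto
  moreover obtain s v b where 2: "lval \<alpha> \<beta> \<gamma> v b" "b \<noteq> 0" "poly d a = (a - \<alpha>) ^ s * v"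
    using poly_unit_part[OF d(1,2)] by blast
  ultimately have "x = (u / v) * ((a - \<alpha>) ^ n / (a - \<alpha>) ^ s)"
    by (simp add: field_simps)
  also have "(a - \<alpha>) ^ n / (a - \<alpha>) ^ s = (a - \<alpha>) powi (int n - int s)"
    using a_minus_nonzero by (simp add: power_int_diff)
  finally show ?thesis using lval_divide[OF 1(1) 2(1,2)] 1(2) 2(2) by (metis divide_eq_0_iff)
qed

lemma unram_lord:
  assumes "x \<noteq> 0"
  shows "\<exists>n. \<forall>Q. cen Q \<alpha> \<beta> \<gamma> \<longrightarrow> lord Q (a - \<alpha>) Kb x n"
proof -
  obtain n u c where n: "lval \<alpha> \<beta> \<gamma> u c" "c \<noteq> 0" "x = u * (a - \<alpha>) powi n"
    using unram_field assms by blast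
  have "x * (a - \<alpha>) powi (- n) = u"
    using n(3) powi_add0[OF a_minus_nonzero, of n "- n"] by (simp add: mult.assoc)
  then show ?thesis using lval_rs[OF n(1)] n(2) unfolding lord_def rs_def by auto
qed

end

lemma ram_cen: "\<alpha> ^ 3 + \<alpha> = 0 \<Longrightarrow> \<beta> = 0 \<and> \<gamma> = 0"
proof -
  assume "\<alpha> ^ 3 + \<alpha> = 0"
  moreover have "\<alpha> ^ 3 + \<alpha> = \<alpha> * (\<alpha> ^ 2 + 1)" by (simp add: algebra_simps eval_nat_numeral)
  ultimately have "\<alpha> = 0 \<or> \<alpha> ^ 2 + 1 = 0" by (simp only: mult_eq_0_iff)
  then have "\<beta> ^ 8 = 0" "\<gamma> ^ 8 = 0"
    unfolding curve_eqs_w8[OF pt_eqs] curve_eqs_z8[OF pt_eqs] by auto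
  then show ?thesis by simp
qed

text \<open>In the local ring \<open>a - \<alpha>\<close> has the value 0 and so is not invertible;
  Chevalley's theorem preserves this. The residues of \<open>w\<close> and \<open>z\<close> come
  from divisibility by \<open>a - \<alpha>\<close> at unramified points and from the vanishing of
  the eighth powers at ramified ones.\<close>

lemma cen_exists: "\<exists>Q. cen Q \<alpha> \<beta> \<gamma>"
proof -
  have "inverse (a - \<alpha>) \<notin> lring"
  proof
    assume "inverse (a - \<alpha>) \<in> lring"
    then obtain c where "lval \<alpha> \<beta> \<gamma> (inverse (a - \<alpha>)) c" by (auto simp: lring_def)
    moreover have "lval \<alpha> \<beta> \<gamma> (a - \<alpha>) (\<alpha> - \<alpha>)" using pt_Kb by (intro lval_ev ev_diff crel_a ev_const)
    ultimately have "lval \<alpha> \<beta> \<gamma> (inverse (a - \<alpha>) * (a - \<alpha>)) (c * (\<alpha> - \<alpha>))" by (rule lval_mult)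
    then have "lval \<alpha> \<beta> \<gamma> 1 0" using a_minus_nonzero by simp
    then show False using lval_unique[OF lval_const[OF Kb_closed(1)], of 0] by simp
  qed
  moreover have "a - \<alpha> \<in> lring" using lring_gens pt_Kb by (intro lring_closed) auto
  ultimately obtain Q where Q: "lring \<subseteq> Q" "subring Q" "inverse (a - \<alpha>) \<notin> Q"
    "\<And>x. x \<noteq> 0 \<Longrightarrow> x \<in> Q \<or> inverse x \<in> Q"
    using chevalley[OF subring_lring] by blast
  have plc: "plc Q" unfolding place_def using Q lring_gens by (auto simp: subring_def)
  interpret vplace UNIV Kb Q using vplace_plc plc by blast
  have am: "a - \<alpha> \<in> max_ideal Q" using Q(1,3) \<open>a - \<alpha> \<in> lring\<close> by (auto simp: max_ideal_def)
  then have ra: "rs Kb Q a \<alpha>" using pt_Kb by (simp add: rs_def)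
  have "w - \<beta> \<in> max_ideal Q \<and> z - \<gamma> \<in> max_ideal Q"
  proof (cases "\<alpha> ^ 3 + \<alpha> = 0")
    case False
    obtain y y' where "y \<in> lring" "w - \<beta> = (a - \<alpha>) * y" "y' \<in> lring" "z - \<gamma> = (a - \<alpha>) * y'"
      using w_ideal z_ideal False by blast
    then show ?thesis using m_mult[OF am] Q(1) by auto
  next
    case True
    have wz: "w \<in> Q" "z \<in> Q" using finite_wz[OF plc rs_R[OF ra]] by auto
    have b0: "\<beta> = 0" "\<gamma> = 0" using ram_cen[OF True] by auto
    have "rs Kb Q (a ^ 3 * (a ^ 2 + 1)) (\<alpha> ^ 3 * (\<alpha> ^ 2 + 1))" "rs Kb Q (a * (a ^ 2 + 1) ^ 3) (\<alpha> * (\<alpha> ^ 2 + 1) ^ 3)"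
      using Kb_closed(1) by (intro rs_mult rs_power rs_add rs_const ra; simp)+
    then have "rs Kb Q (w ^ 8) 0" "rs Kb Q (z ^ 8) 0"
      unfolding w8[symmetric] z8[symmetric] curve_eqs_w8[OF pt_eqs, symmetric] curve_eqs_z8[OF pt_eqs, symmetric]
      by (simp_all add: b0)
    then show ?thesis using power_m wz b0 by (simp add: rs_def) blast
  qed
  then show ?thesis using plc ra pt pt_Kb by (auto simp: cen_def rs_def)
qed

definition par :: "'a" where "par = (if \<alpha> ^ 3 + \<alpha> = 0 then ram_par \<alpha> else a - \<alpha>)"

lemma par_nonzero: "par \<noteq> 0"
  using a_minus_nonzero ram_par_nonzero by (simp add: par_def)

lemma cen_lord: "x \<noteq> 0 \<Longrightarrow> \<exists>n. \<forall>Q. cen Q \<alpha> \<beta> \<gamma> \<longrightarrow> lord Q par Kb x n"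
proof (cases "\<alpha> ^ 3 + \<alpha> = 0")
  case True
  assume "x \<noteq> 0"
  then show ?thesis
    using ram_field[OF Kb_field subset_refl pt_Kb(1) True, of x] gen True by (auto simp: par_def cen_def rs_def)
next
  case False
  assume "x \<noteq> 0"
  then show ?thesis using unram_lord[OF False, of x] False by (simp add: par_def)
qed

lemma par_m: "cen Q \<alpha> \<beta> \<gamma> \<Longrightarrow> par \<in> max_ideal Q"
  using ram_orders(1)[of Q \<alpha> Kb] pt_Kb Kb_field by (auto simp: par_def cen_def rs_def)

lemma cen_dval: "cen Q \<alpha> \<beta> \<gamma> \<Longrightarrow> dval UNIV Q par"
proof -
  assume Q: "cen Q \<alpha> \<beta> \<gamma>"
  interpret vplace UNIV Kb Q using Q vplace_plc by (simp add: cen_def)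
  show ?thesis by (rule dvalI[OF par_m[OF Q] par_nonzero]) (use cen_lord Q in blast)
qed

text \<open>The order of an element with respect to \<open>par\<close> was found without choosing a
  place, and its sign decides membership in the valuation ring.\<close>

lemma cen_unique: "cen Q \<alpha> \<beta> \<gamma> \<Longrightarrow> cen Q' \<alpha> \<beta> \<gamma> \<Longrightarrow> Q = Q'"
proof -
  have "x \<in> Q'" if Q: "cen Q \<alpha> \<beta> \<gamma>" "cen Q' \<alpha> \<beta> \<gamma>" and x: "x \<in> Q" for Q Q' x
  proof (cases "x = 0")
    case True
    interpret vplace UNIV Kb Q' using Q vplace_plc by (simp add: cen_def)
    show ?thesis using True R_zero by simp
  next
    case False
    then obtain n where n: "lord Q par Kb x n" "lord Q' par Kb x n" using cen_lord Q by blast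
    interpret A: vplace UNIV Kb Q using Q vplace_plc by (simp add: cen_def)
    interpret B: vplace UNIV Kb Q' using Q vplace_plc by (simp add: cen_def)
    show ?thesis
      using A.dval_R_iff[OF cen_dval[OF Q(1)] A.lord_unit[OF n(1) subset_refl]]
        B.dval_R_iff[OF cen_dval[OF Q(2)] B.lord_unit[OF n(2) subset_refl]] x by simp
  qed
  then show "cen Q \<alpha> \<beta> \<gamma> \<Longrightarrow> cen Q' \<alpha> \<beta> \<gamma> \<Longrightarrow> Q = Q'" by blast
qed

end

lemma inf_lord: "x \<noteq> 0 \<Longrightarrow> \<exists>n. \<forall>Q. inf_place Q \<longrightarrow> lord Q (z / a) Kb x n"
  using inf_field[OF Kb_field subset_refl, of x] gen by simp

lemma inf_par_nonzero: "z / a \<noteq> 0"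
  using z_nonzero a_nonzero by simp

lemma inf_dval: "inf_place Q \<Longrightarrow> dval UNIV Q (z / a)"
proof -
  assume Q: "inf_place Q"
  interpret vplace UNIV Kb Q using Q vplace_plc inf_place_plc by blast
  show ?thesis
    by (rule dvalI[OF inf_orders(1)[OF Q Kb_field subset_refl] inf_par_nonzero]) (use inf_lord Q in blast)
qed

lemma inf_place_unique: "inf_place Q \<Longrightarrow> inf_place Q' \<Longrightarrow> Q = Q'"
proof -
  have "x \<in> Q'" if Q: "inf_place Q" "inf_place Q'" and x: "x \<in> Q" for Q Q' x
  proof (cases "x = 0")
    case True
    interpret vplace UNIV Kb Q' using Q vplace_plc inf_place_plc by blast
    show ?thesis using True R_zero by simp
  next
    case False
    then obtain n where n: "lord Q (z / a) Kb x n" "lord Q' (z / a) Kb x n" using inf_lord Q by blast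
    interpret A: vplace UNIV Kb Q using Q vplace_plc inf_place_plc by blast
    interpret B: vplace UNIV Kb Q' using Q vplace_plc inf_place_plc by blast
    show ?thesis
      using A.dval_R_iff[OF inf_dval[OF Q(1)] A.lord_unit[OF n(1) subset_refl]]
        B.dval_R_iff[OF inf_dval[OF Q(2)] B.lord_unit[OF n(2) subset_refl]] x by simp
  qed
  then show "inf_place Q \<Longrightarrow> inf_place Q' \<Longrightarrow> Q = Q'" by blast
qed

lemma inf_or_affine: "plc Q \<Longrightarrow> inf_place Q \<longleftrightarrow> a \<notin> Q"
proof -
  assume Q: "plc Q"
  interpret vplace UNIV Kb Q using Q vplace_plc by blast
  have "\<not> (inverse a \<in> max_ideal Q \<and> a \<in> Q)"
    using m_mult[of "inverse a" a] one_notin_m a_nonzero by auto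
  then show ?thesis using notin_R[of a] Q by (auto simp: inf_place_def)
qed

text \<open>If no nonzero polynomial in \<open>a\<close> had residue 0, all denominators would be
  units and \<open>Q\<close> would be the whole field. So \<open>a\<close> has a residue in
  \<open>Kb\<close>. Those of \<open>w\<close> and \<open>z\<close> exist because their eighth
  powers have residues, and the curve equations pass to residues.\<close>

lemma affine_cen:
  assumes Q: "plc Q" "a \<in> Q" shows "\<exists>\<alpha> \<beta> \<gamma>. cen Q \<alpha> \<beta> \<gamma>"
proof -
  interpret vplace UNIV Kb Q using Q vplace_plc by blast
  have wz: "w \<in> Q" "z \<in> Q" using finite_wz[OF Q] by auto
  have sub: "cring a w z Kb \<subseteq> Q"
    using cring_least[OF _ ring _ Q(2) wz] k_R by blast
  have "\<exists>p. poly_over Kb p \<and> p \<noteq> 0 \<and> poly p a \<in> max_ideal Q"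
  proof (rule ccontr)
    assume neg: "\<not> ?thesis"
    have "x \<in> Q" for x
    proof -
      obtain d where d: "poly_over Kb d" "d \<noteq> 0" "x * poly d a \<in> cring a w z Kb"
        using gen_field_fraction[OF eqs Kb_field a_transcendental, of x] gen by auto
      have "poly d a \<in> Q" using sub cring_poly[OF Kb_ring d(1)] by blast
      then have u: "is_unit_in Q (poly d a)" using neg d unit_iff by blast
      then have "x * poly d a * inverse (poly d a) \<in> Q"
        using d(3) sub u by (intro R_mult[of "x * poly d a"]) (auto simp: is_unit_in_def)
      moreover have "x * poly d a * inverse (poly d a) = x" using u by (simp add: is_unit_in_def)
      ultimately show ?thesis by (simp only:)
    qed
    then show False using Q(1) by (auto simp: place_def)
  qed
  then obtain p where "poly_over Kb p" "p \<noteq> 0" "poly p a \<in> max_ideal Q" by blast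
  then obtain \<alpha> where \<alpha>: "\<alpha> \<in> Kb" "rs Kb Q a \<alpha>" using residue_root[OF vplace_plc[OF Q(1)] Q(2)] by blast
  have root: "\<exists>\<beta>. \<beta> \<in> Kb \<and> rs Kb Q x \<beta>" if "x \<in> Q" "rs Kb Q (x ^ 8) c" for x c
  proof -
    have "poly_over Kb (monom 1 8 - [:c:])"
      using that Kb_ring Kb_closed by (intro poly_over_diff poly_over_monom) (auto simp: rs_def)
    moreover have "coeff (monom 1 8 - [:c:]) 8 = (1::'a)" by (simp add: eval_nat_numeral)
    then have "monom 1 8 - [:c:] \<noteq> 0" by (metis coeff_0 zero_neq_one)
    moreover have "poly (monom 1 8 - [:c:]) x \<in> max_ideal Q" using that by (simp add: poly_monom rs_def)
    ultimately show ?thesis using residue_root[OF vplace_plc[OF Q(1)] that(1)] by blast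
  qed
  have "rs Kb Q (w ^ 8) (\<alpha> ^ 3 * (\<alpha> ^ 2 + 1))" "rs Kb Q (z ^ 8) (\<alpha> * (\<alpha> ^ 2 + 1) ^ 3)"
    unfolding w8 z8 using Kb_closed(1) by (intro rs_mult rs_power rs_add rs_const \<alpha>; simp)+
  then obtain \<beta> \<gamma> where bg: "\<beta> \<in> Kb" "rs Kb Q w \<beta>" "\<gamma> \<in> Kb" "rs Kb Q z \<gamma>" using root wz by blast
  have "rs Kb Q (w ^ 3) (\<beta> ^ 3)" "rs Kb Q (w ^ 3) (\<alpha> * \<gamma>)"
    "rs Kb Q (z ^ 3) (\<gamma> ^ 3)" "rs Kb Q (z ^ 3) (\<beta> * (\<alpha> ^ 2 + 1))"
    "rs Kb Q (w ^ 2 * z ^ 2) (\<beta> ^ 2 * \<gamma> ^ 2)" "rs Kb Q (w ^ 2 * z ^ 2) (\<alpha> ^ 3 + \<alpha>)"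
    subgoal by (intro rs_power bg)
    subgoal unfolding wza by (intro rs_mult bg \<alpha>)
    subgoal by (intro rs_power bg)
    subgoal unfolding zzw using Kb_closed(1) by (intro rs_mult rs_add rs_power rs_const bg \<alpha>)
    subgoal by (intro rs_mult rs_power bg)
    subgoal unfolding wwzz by (intro rs_add rs_power \<alpha>)
    done
  then have "curve_eqs \<alpha> \<beta> \<gamma>" unfolding curve_eqs_def using rs_unique by blast
  then show ?thesis using Q \<alpha> bg unfolding cen_def pt_def by blast
qed

lemma plc_dval: "plc Q \<Longrightarrow> \<exists>p. dval UNIV Q p"
  using inf_or_affine inf_dval affine_cen cen_dval unfolding cen_def by metis

end

section \<open>Functions regular outside infinity\<close>

context curve
begin

definition regular :: "'a \<Rightarrow> bool" where
  "regular x \<longleftrightarrow> (\<forall>Q. plc Q \<and> a \<in> Q \<longrightarrow> x \<in> Q)"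

lemma regular_ring: "subring {x. regular x}"
  unfolding subring_def
proof (intro conjI ballI)
  show "1 \<in> {x. regular x}"
    unfolding regular_def using vplace.R_one[OF vplace_plc] by simp
  fix x y assume "x \<in> {x. regular x}" "y \<in> {x. regular x}"
  then show "x + y \<in> {x. regular x}" "x * y \<in> {x. regular x}" "- x \<in> {x. regular x}"
    unfolding regular_def using vplace.R_add[OF vplace_plc] vplace.R_mult[OF vplace_plc]
      vplace.R_minus[OF vplace_plc] by simp_all
qed

lemma regular_cring: "x \<in> cring a w z Kb \<Longrightarrow> regular x"
proof -
  assume "x \<in> cring a w z Kb"
  then have "x \<in> Q" if "plc Q" "a \<in> Q" for Q
    using cring_least[OF _ vplace.ring[OF vplace_plc[OF that(1)]] _ that(2)] finite_wz[OF that]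
      vplace.k_R[OF vplace_plc[OF that(1)]] by blast
  then show ?thesis by (simp add: regular_def)
qed

text \<open>A fourth root \<open>e\<close> of -1 is a primitive eighth root of unity, as -1 differs
  from 1; its powers times one root of \<open>c\<close> are eight different roots.\<close>

lemma eighth_roots:
  assumes c: "c \<in> Kb" "c \<noteq> 0"
  shows "\<exists>S. S \<subseteq> Kb \<and> card S = 8 \<and> (\<forall>x\<in>S. x ^ 8 = c)"
proof -
  obtain b where b: "b \<in> Kb" "b ^ 8 = c" using Kb_nth_root[OF c(1)] by (metis zero_less_numeral)
  obtain e where e: "e \<in> Kb" "e ^ 4 = - 1"
    using Kb_nth_root[of "-1" 4] Kb_closed by (metis zero_less_numeral)
  have b0: "b \<noteq> 0" using b c by auto
  have e0: "e \<noteq> 0" using e by auto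
  have e8: "e ^ 8 = 1"
  proof -
    have "e ^ 8 = (e ^ 4) ^ 2" by (simp flip: power_mult)
    then show ?thesis using e by simp
  qed
  have m1: "(-1::'a) \<noteq> 1"
  proof
    assume "(-1::'a) = 1"
    then have "(2::'a) = 0" by (metis add.left_inverse one_add_one)
    then show False using two_nonzero by simp
  qed
  have ne: "e ^ i \<noteq> 1" if "0 < i" "i < 8" for i
  proof
    assume ei: "e ^ i = 1"
    have "(-1) ^ i = (e ^ i) ^ 4" unfolding e(2)[symmetric] by (simp flip: power_mult add: mult.commute)
    then have "(-1::'a) ^ i = 1" using ei by simp
    then have "even i" using m1 by (metis minus_one_power_iff)
    then obtain j where j: "i = 2 * j" by blast
    have "(-1) ^ j = (e ^ i) ^ 2" unfolding e(2)[symmetric] j by (simp flip: power_mult add: mult_ac)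
    then have "(-1::'a) ^ j = 1" using ei by simp
    then have "even j" using m1 by (metis minus_one_power_iff)
    then have "i = 4" using j that by auto
    then show False using ei e m1 by simp
  qed
  have inj: "inj_on (\<lambda>i. b * e ^ i) {..<8}"
  proof (rule linorder_inj_onI)
    fix i j :: nat assume "i < j" "i \<in> {..<8}" "j \<in> {..<8}"
    then have "e ^ j = e ^ i * e ^ (j - i)" "e ^ (j - i) \<noteq> 1"
      using ne[of "j - i"] by (auto simp flip: power_add)
    then show "b * e ^ i \<noteq> b * e ^ j" using b0 e0 by simp
  qed auto
  have "(b * e ^ i) ^ 8 = c" for i
  proof -
    have "(b * e ^ i) ^ 8 = b ^ 8 * (e ^ 8) ^ i" by (simp add: power_mult_distrib mult.commute flip: power_mult)
    then show ?thesis using b e8 by simp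
  qed
  moreover have "b * e ^ i \<in> Kb" for i using b e Kb_closed by simp
  ultimately show ?thesis using card_image[OF inj] by (intro exI[of _ "(\<lambda>i. b * e ^ i) ` {..<8}"]) auto
qed

lemma unram_pt:
  assumes "\<alpha> \<in> Kb" "\<beta> \<in> Kb" "\<alpha> \<noteq> 0" "\<beta> ^ 8 = \<alpha> ^ 3 * (\<alpha> ^ 2 + 1)"
  shows "pt \<alpha> \<beta> (\<beta> ^ 3 / \<alpha>)"
proof -
  have "(\<beta> ^ 3 / \<alpha>) ^ 3 = \<beta> * \<beta> ^ 8 / \<alpha> ^ 3" by (simp add: power_divide eval_nat_numeral)
  also have "\<dots> = \<beta> * (\<alpha> ^ 2 + 1)" unfolding assms using assms by simp
  finally have 1: "(\<beta> ^ 3 / \<alpha>) ^ 3 = \<beta> * (\<alpha> ^ 2 + 1)" .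
  have "\<beta> ^ 2 * (\<beta> ^ 3 / \<alpha>) ^ 2 = \<beta> ^ 8 / \<alpha> ^ 2" by (simp add: power_divide eval_nat_numeral)
  also have "\<dots> = \<alpha> ^ 3 + \<alpha>" unfolding assms using assms by (simp add: field_simps eval_nat_numeral)
  finally show ?thesis using 1 assms Kb_closed by (simp add: pt_def curve_eqs_def)
qed

text \<open>At the eight points over an unramified \<open>\<alpha>\<close> the combination becomes a
  polynomial in \<open>\<beta>\<close> of degree at most 7 with eight roots. Over a ramified
  \<open>\<alpha>\<close> a nonzero combination has order below 8, whereas
  \<open>a - \<alpha>\<close> has order 8.\<close>

lemma constant_comb_zero:
  assumes \<alpha>: "\<alpha> \<in> Kb" and e: "\<And>j. j < 8 \<Longrightarrow> e j \<in> Kb"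
    and eq: "(\<Sum>j<8. e j * mono8 w z j) = (a - \<alpha>) * y" and y: "regular y" and j: "j < 8"
  shows "e j = 0"
proof (cases "\<alpha> ^ 3 + \<alpha> = 0")
  case False
  have "\<alpha> ^ 3 + \<alpha> = \<alpha> * (\<alpha> ^ 2 + 1)" by (simp add: algebra_simps eval_nat_numeral)
  then have nz: "\<alpha> \<noteq> 0" "\<alpha> ^ 2 + 1 \<noteq> 0" using False by auto
  define c where "c = \<alpha> ^ 3 * (\<alpha> ^ 2 + 1)"
  have "c \<in> Kb" "c \<noteq> 0" using nz \<alpha> Kb_closed by (auto simp: c_def)
  then obtain S where S: "S \<subseteq> Kb" "card S = 8" "\<And>x. x \<in> S \<Longrightarrow> x ^ 8 = c" using eighth_roots by meson
  \<comment> \<open>Substituting \<open>\<gamma> = \<beta> ^ 3 / \<alpha>\<close> turns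
    \<open>mono8 \<beta> \<gamma> j\<close> into \<open>\<beta> ^ j / \<alpha> ^ (j div 3)\<close>,
    so each index has its own power of \<open>\<beta>\<close>.\<close>
  define p where "p = (\<Sum>j<8. monom (e j / \<alpha> ^ (j div 3)) j)"
  have root: "poly p \<beta> = 0" if \<beta>: "\<beta> \<in> S" for \<beta>
  proof -
    define \<gamma> where "\<gamma> = \<beta> ^ 3 / \<alpha>"
    have pt: "pt \<alpha> \<beta> \<gamma>" unfolding \<gamma>_def
      by (rule unram_pt) (use \<alpha> nz S \<beta> in \<open>auto simp: c_def\<close>)
    obtain Q where Q: "cen Q \<alpha> \<beta> \<gamma>" using cen_exists[OF pt] by blast
    then have plc: "plc Q" and r: "rs Kb Q a \<alpha>" "rs Kb Q w \<beta>" "rs Kb Q z \<gamma>" by (auto simp: cen_def)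
    interpret vplace UNIV Kb Q using vplace_plc plc by blast
    have "rs Kb Q (\<Sum>j<8. e j * mono8 w z j) (\<Sum>j<8. e j * mono8 \<beta> \<gamma> j)"
      unfolding mono8_def using e by (intro rs_sum rs_mult rs_power rs_const r) auto
    moreover have "y \<in> Q" using y plc rs_R[OF r(1)] by (simp add: regular_def)
    then have "(a - \<alpha>) * y \<in> max_ideal Q" using r(1) by (intro m_mult) (auto simp: rs_def)
    ultimately have "(\<Sum>j<8. e j * mono8 \<beta> \<gamma> j) = 0" using eq rs_m_iff by metis
    moreover have "poly p \<beta> = (\<Sum>j<8. e j * mono8 \<beta> \<gamma> j)"
      unfolding p_def poly_sum poly_monom
    proof (intro sum.cong refl)
      fix j :: nat
      have "mono8 \<beta> \<gamma> j = \<beta> ^ (j mod 3) * (\<beta> ^ (3 * (j div 3)) / \<alpha> ^ (j div 3))"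
        by (simp add: mono8_def \<gamma>_def power_divide power_mult)
      also have "\<dots> = \<beta> ^ j / \<alpha> ^ (j div 3)" by (simp flip: power_add)
      finally show "e j / \<alpha> ^ (j div 3) * \<beta> ^ j = e j * mono8 \<beta> \<gamma> j" by simp
    qed
    ultimately show ?thesis by simp
  qed
  have "p = 0"
  proof (rule ccontr)
    assume p: "p \<noteq> 0"
    have "card S \<le> card {x. poly p x = 0}"
      using root poly_roots_finite[OF p] by (intro card_mono) auto
    also have "\<dots> \<le> degree p" using p by (rule card_poly_roots_bound)
    also have "degree p \<le> 7" unfolding p_def
      by (intro degree_sum_le) (auto intro: order.trans[OF degree_monom_le])
    finally show False using S by simp
  qed
  moreover have "coeff p j = e j / \<alpha> ^ (j div 3)"
    using j by (simp add: p_def coeff_sum if_distrib sum.delta cong: if_cong)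
  ultimately show ?thesis using nz by simp
next
  case True
  show ?thesis
  proof (rule ccontr)
    assume ej: "e j \<noteq> 0"
    have pt: "pt \<alpha> 0 0" unfolding pt_def curve_eqs_def using \<alpha> Kb_closed True by simp
    obtain Q where Q: "cen Q \<alpha> 0 0" using cen_exists[OF pt] by blast
    then have plc: "plc Q" and am: "a - \<alpha> \<in> max_ideal Q" and ra: "rs Kb Q a \<alpha>" by (auto simp: cen_def rs_def)
    interpret vplace UNIV Kb Q using vplace_plc plc by blast
    note L = ram_orders(1)[OF plc am \<alpha> True Kb_field subset_refl] ram_par_nonzero
    have dv: "dval UNIV Q (ram_par \<alpha>)" using cen_dval[OF pt Q] True by (simp add: par_def[OF pt])
    obtain i where i: "i < 8" "e i \<noteq> 0" and
      o: "lord Q (ram_par \<alpha>) Kb (\<Sum>j<8. poly [:e j:] a * mono8 w z j)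
        (8 * int (order \<alpha> [:e i:]) + int (i mod 3) * ram_w \<alpha> + int (i div 3) * ram_z \<alpha>)"
      using ram_comb[OF Kb_field subset_refl \<alpha> True, of "\<lambda>j. [:e j:]"] e ej j plc am Kb_ring by auto
    have "order \<alpha> [:e i:] = 0" using i by (intro order_0I) simp
    then have o': "lord Q (ram_par \<alpha>) Kb ((a - \<alpha>) * y) (int (i mod 3) * ram_w \<alpha> + int (i div 3) * ram_z \<alpha>)"
      using o eq by simp
    have oa: "lord Q (ram_par \<alpha>) Kb (a - \<alpha>) 8" using ram_orders(2)[OF plc am \<alpha> True Kb_field subset_refl] .
    have nz: "(a - \<alpha>) * y \<noteq> 0" using lord_nonzero[OF L Kb_field subset_refl o'] .
    have yQ: "y \<in> Q" using y plc rs_R[OF ra] by (simp add: regular_def)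
    have "val Q ((a - \<alpha>) * y) = 8 + val Q y"
      using val_mult[OF dv, of "a - \<alpha>" y] nz lord_val[OF dv oa subset_refl] by simp
    moreover have "val Q y \<ge> 0" using val_nonneg_iff[OF dv, of y] nz yQ by simp
    \<comment> \<open>The eight basis elements have the orders 0, ..., 7 at a finite ramified
      place.\<close>
    moreover have "int (i mod 3) * ram_w \<alpha> + int (i div 3) * ram_z \<alpha> < 8"
      using i(1) unfolding less8 ram_w_def ram_z_def by auto
    ultimately show False using lord_val[OF dv o' subset_refl] by simp
  qed
qed

text \<open>Linear factors are removed from the denominator one at a time. Dividing each coefficient
  by \<open>a - \<alpha>\<close> leaves a combination with constant coefficients that is
  \<open>a - \<alpha>\<close> times a regular function, hence zero.\<close>

lemma regular_imp_cring:
  assumes x: "regular x" shows "x \<in> cring a w z Kb"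
proof -
  note Cr = subring_cring[OF Kb_ring, of a w z]
  have "x \<in> cring a w z Kb" if "poly_over Kb d" "d \<noteq> 0" "x * poly d a \<in> cring a w z Kb" for d
    using that
  proof (induction "degree d" arbitrary: d rule: less_induct)
    case less
    show ?case
    proof (cases "degree d = 0")
      case True
      then obtain b where b: "d = [:b:]" by (elim degree_eq_zeroE)
      then have b': "b \<in> Kb" "b \<noteq> 0" using less.prems by auto
      then have "x * b * inverse b \<in> cring a w z Kb"
        using less.prems cring_gens(1)[of Kb a w z] Kb_closed unfolding b
        by (intro subring_mult[OF Cr, of "x * b" "inverse b"]) auto
      moreover have "x * b * inverse b = x" using b' by simp
      ultimately show ?thesis by (simp only:)
    next
      case False
      then obtain \<alpha> q where q: "\<alpha> \<in> Kb" "poly_over Kb q" "d = [:- \<alpha>, 1:] * q" "q \<noteq> 0" "degree q < degree d"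
        using Kb_linear_factor less.prems by (metis not_gr_zero)
      have am: "a - \<alpha> \<noteq> 0" using q a_notin by auto
      have dq: "poly d a = (a - \<alpha>) * poly q a" unfolding q(3) by (simp add: algebra_simps)
      obtain c where c: "\<forall>j<8. poly_over Kb (c j)" "x * poly d a = (\<Sum>j<8. poly (c j) a * mono8 w z j)"
        using cring_normal_form[OF less.prems(3) eqs Kb_ring] by blast
      define s where "s j = synthetic_div (c j) \<alpha>" for j
      have sK: "poly_over Kb (s j)" if "j < 8" for j
        unfolding s_def using that c q by (intro poly_over_synthetic_div[OF Kb_ring]) auto
      have cs: "poly (c j) a = poly (c j) \<alpha> + (a - \<alpha>) * poly (s j) a" for j
        using arg_cong[OF synthetic_div_correct[of "c j" \<alpha>], of "\<lambda>p. poly p a"]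
        by (simp add: s_def algebra_simps)
      define S where "S = (\<Sum>j<8. poly (s j) a * mono8 w z j)"
      have SC: "S \<in> cring a w z Kb" unfolding S_def mono8_def
        by (intro subring_sum[OF Cr] subring_mult[OF Cr] subring_power[OF Cr] cring_poly[OF Kb_ring] cring_gens sK) simp
      have sum: "x * poly d a = (\<Sum>j<8. poly (c j) \<alpha> * mono8 w z j) + (a - \<alpha>) * S"
        unfolding c(2) S_def cs by (simp add: distrib_right sum.distrib sum_distrib_left mult.assoc)
      then have eq: "(\<Sum>j<8. poly (c j) \<alpha> * mono8 w z j) = (a - \<alpha>) * (x * poly q a - S)"
        unfolding dq by (simp add: algebra_simps)
      have "regular (x * poly q a - S)"
        using subring_diff[OF regular_ring] subring_mult[OF regular_ring] x
          regular_cring[OF SC] regular_cring[OF cring_poly[OF Kb_ring q(2)]] by blast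
      then have "poly (c j) \<alpha> = 0" if "j < 8" for j
        using constant_comb_zero[OF q(1) _ eq _ that] subring_poly[OF Kb_ring _ q(1)] c(1) by blast
      then have "(a - \<alpha>) * (x * poly q a - S) = 0" unfolding eq[symmetric] by simp
      then have "x * poly q a = S" using am by simp
      then show ?thesis using less.hyps[OF q(5,2,4)] SC by simp
    qed
  qed
  moreover obtain d where "poly_over Kb d" "d \<noteq> 0" "x * poly d a \<in> cring a w z Kb"
    using gen_field_fraction[OF eqs Kb_field a_transcendental, of x] gen by auto
  ultimately show ?thesis by blast
qed

text \<open>The Weierstrass semigroup at infinity consists of the numbers below.\<close>
lemma regular_inf_order:
  assumes x: "regular x" "x \<noteq> 0"
  obtains d j where "j < (8::nat)" "\<And>Q. inf_place Q \<Longrightarrow> lord Q (z / a) Kb x (- int (8 * d + 5 * (j mod 3) + 7 * (j div 3)))"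
proof -
  obtain c where c: "\<forall>j<8. poly_over Kb (c j)" "x = (\<Sum>j<8. poly (c j) a * mono8 w z j)"
    using cring_normal_form[OF regular_imp_cring[OF x(1)] eqs Kb_ring] by blast
  have "\<exists>j<8. c j \<noteq> 0"
  proof (rule ccontr)
    assume "\<not> ?thesis"
    then have "x = 0" unfolding c(2) by (intro sum.neutral) auto
    then show False using x by simp
  qed
  then obtain j where "j < 8" "\<And>Q. inf_place Q \<Longrightarrow> lord Q (z / a) Kb x
      (- (8 * int (degree (c j)) + 5 * int (j mod 3) + 7 * int (j div 3)))"
    using inf_comb[OF Kb_field subset_refl c(1)] unfolding c(2)[symmetric] by blast
  then show ?thesis using that[of j "degree (c j)"] by simp
qed

end

section \<open>Finite vector spaces over a finite field\<close>

lemma span_overI: "(\<And>b. b \<in> B \<Longrightarrow> c b \<in> k) \<Longrightarrow> (\<Sum>b\<in>B. c b * b) \<in> span_over k B"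
  unfolding span_over_def by blast

lemma card_span_le:
  assumes "finite k" "finite B" shows "finite (span_over k B)" "card (span_over k B) \<le> card k ^ card B"
proof -
  have "span_over k B \<subseteq> (\<lambda>c. \<Sum>b\<in>B. c b * b) ` (PiE B (\<lambda>_. k))"
  proof
    fix x assume "x \<in> span_over k B"
    then obtain c where c: "x = (\<Sum>b\<in>B. c b * b)" "\<forall>b\<in>B. c b \<in> k" by (auto simp: span_over_def)
    then have "x = (\<Sum>b\<in>B. restrict c B b * b)" unfolding c(1) by (intro sum.cong) auto
    then show "x \<in> (\<lambda>c. \<Sum>b\<in>B. c b * b) ` (PiE B (\<lambda>_. k))"
      using c by (intro image_eqI[of _ _ "restrict c B"]) auto
  qed
  moreover have f: "finite (PiE B (\<lambda>_. k))" using assms by (simp add: finite_PiE)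
  ultimately show "finite (span_over k B)" by (meson finite_surj)
  have "card (span_over k B) \<le> card (PiE B (\<lambda>_. k))"
    by (rule surj_card_le[OF f]) fact
  then show "card (span_over k B) \<le> card k ^ card B" using assms by (simp add: card_PiE)
qed

definition subspace_over :: "'a::field set \<Rightarrow> 'a set \<Rightarrow> bool" where
  "subspace_over k V \<longleftrightarrow> 0 \<in> V \<and> (\<forall>x\<in>V. \<forall>y\<in>V. x + y \<in> V) \<and> (\<forall>c\<in>k. \<forall>x\<in>V. c * x \<in> V)"

lemma subspace_sum:
  assumes "subspace_over k V" "\<And>i. i \<in> I \<Longrightarrow> f i \<in> V" shows "sum f I \<in> V"
  using assms(2) by (induction I rule: infinite_finite_induct) (use assms(1) in \<open>auto simp: subspace_over_def\<close>)

text \<open>A spanning set of least size is independent, so its combinations are pairwise different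
  and can be counted.\<close>

lemma finite_space_basis:
  assumes k: "subfield k" "finite k" and V: "subspace_over k V" "finite V"
  shows "\<exists>B. finite B \<and> B \<subseteq> V \<and> V \<subseteq> span_over k B \<and> card V = card k ^ card B"
proof -
  note kr = subfield_subring[OF k(1)]
  define P where "P B \<longleftrightarrow> finite B \<and> B \<subseteq> V \<and> V \<subseteq> span_over k B" for B
  have "V \<subseteq> span_over k V"
  proof
    fix x assume x: "x \<in> V"
    have "(\<Sum>b\<in>V. (if b = x then 1 else 0) * b) = (\<Sum>b\<in>V. if b = x then x else 0)"
      by (intro sum.cong) auto
    then have "x = (\<Sum>b\<in>V. (if b = x then 1 else 0) * b)" using V x by simp
    then show "x \<in> span_over k V"
      using span_overI[of V "\<lambda>b. if b = x then 1 else 0" k] subring_one[OF kr] subring_zero[OF kr] by auto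
  qed
  then have "P V" using V by (auto simp: P_def)
  then obtain B where B: "P B" and min: "\<And>B'. P B' \<Longrightarrow> card B \<le> card B'"
    using ex_has_least_nat[of P V card] by blast
  have fB: "finite B" "B \<subseteq> V" "V \<subseteq> span_over k B" using B by (auto simp: P_def)
  have inj: "inj_on (\<lambda>c. \<Sum>b\<in>B. c b * b) (PiE B (\<lambda>_. k))"
  proof (rule inj_onI, rule ccontr)
    fix c d assume c: "c \<in> PiE B (\<lambda>_. k)" and d: "d \<in> PiE B (\<lambda>_. k)" and "c \<noteq> d"
      and eq: "(\<Sum>b\<in>B. c b * b) = (\<Sum>b\<in>B. d b * b)"
    then obtain b0 where b0: "b0 \<in> B" "c b0 \<noteq> d b0" by (meson PiE_ext)
    define e where "e b = (c b - d b) / (d b0 - c b0)" for b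
    have ek: "e b \<in> k" if "b \<in> B" for b
      unfolding e_def using c d that b0(1) by (intro subfield_divide[OF k(1)] subring_diff[OF kr]) auto
    have "(\<Sum>b\<in>B. (c b - d b) * b) = 0" using eq by (simp add: left_diff_distrib sum_subtractf)
    then have "(d b0 - c b0) * b0 = (\<Sum>b\<in>B - {b0}. (c b - d b) * b)"
      using fB(1) b0(1) by (simp add: sum.remove algebra_simps eq_diff_eq)
    then have "b0 = (\<Sum>b\<in>B - {b0}. (c b - d b) * b) / (d b0 - c b0)"
      using b0(2) by (simp add: nonzero_eq_divide_eq mult.commute)
    then have b0e: "b0 = (\<Sum>b\<in>B - {b0}. e b * b)" by (simp add: e_def sum_divide_distrib)
    have "P (B - {b0})" unfolding P_def
    proof (intro conjI subsetI)
      fix x assume "x \<in> V"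
      then obtain f where f: "x = (\<Sum>b\<in>B. f b * b)" "\<forall>b\<in>B. f b \<in> k" using fB by (auto simp: span_over_def)
      have "x = f b0 * b0 + (\<Sum>b\<in>B - {b0}. f b * b)" unfolding f(1) using fB(1) b0(1) by (simp add: sum.remove)
      also have "\<dots> = (\<Sum>b\<in>B - {b0}. (f b0 * e b + f b) * b)"
        by (subst (2) b0e) (simp add: sum_distrib_left distrib_right sum.distrib mult.assoc)
      finally show "x \<in> span_over k (B - {b0})"
        using span_overI[of "B - {b0}" "\<lambda>b. f b0 * e b + f b" k] f(2) ek b0(1)
          subring_add[OF kr] subring_mult[OF kr] by auto
    qed (use fB in auto)
    then have "card B \<le> card (B - {b0})" by (rule min)
    then show False using b0(1) fB(1) by (metis card_Diff1_less not_le)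
  qed
  have "(\<lambda>c. \<Sum>b\<in>B. c b * b) ` (PiE B (\<lambda>_. k)) \<subseteq> V"
  proof
    fix x assume "x \<in> (\<lambda>c. \<Sum>b\<in>B. c b * b) ` (PiE B (\<lambda>_. k))"
    then obtain c where "x = (\<Sum>b\<in>B. c b * b)" "c \<in> PiE B (\<lambda>_. k)" by blast
    then have "c b * b \<in> V" if "b \<in> B" for b
      using that fB(2) V(1) PiE_mem[of c B "\<lambda>_. k" b] by (auto simp: subspace_over_def)
    then show "x \<in> V" using \<open>x = _\<close> subspace_sum[OF V(1), of B "\<lambda>b. c b * b"] by simp
  qed
  then have "card k ^ card B \<le> card V"
    using card_inj_on_le[OF inj _ V(2)] fB(1) by (simp add: card_PiE)
  moreover have "card V \<le> card k ^ card B"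
    using card_span_le[OF k(2) fB(1)] card_mono[OF _ fB(3)] by (meson le_trans)
  ultimately show ?thesis using fB by (intro exI[of _ B]) auto
qed

text \<open>Turns dimensions into cardinalities: a spanning set of size \<open>m\<close> yields at
  most \<open>card k ^ m\<close> elements, and a basis attains this.\<close>

lemma dim_over_eq:
  assumes k: "subfield k" "finite k" "card k > 1" and V: "subspace_over k V" and card: "card V = card k ^ n"
  shows "dim_over k V = n"
  unfolding dim_over_def
proof (rule Least_equality)
  have fV: "finite V" using card k by (intro card_ge_0_finite) simp
  obtain B where "finite B" "B \<subseteq> V" "V \<subseteq> span_over k B" "card V = card k ^ card B"
    using finite_space_basis[OF k(1,2) V fV] by blast
  moreover from this have "card B = n" using card k by simp
  ultimately show "\<exists>B. finite B \<and> card B = n \<and> B \<subseteq> V \<and> V \<subseteq> span_over k B" by blast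
  fix m assume "\<exists>B. finite B \<and> card B = m \<and> B \<subseteq> V \<and> V \<subseteq> span_over k B"
  then obtain B where "finite B" "card B = m" "V \<subseteq> span_over k B" by blast
  then have "card V \<le> card (span_over k B)" "card (span_over k B) \<le> card k ^ m"
    using card_span_le[OF k(2), of B] card_mono[of "span_over k B" V] by auto
  then have "card k ^ n \<le> card k ^ m" using card by simp
  then show "n \<le> m" using k by simp
qed

section \<open>The function field over the finite field\<close>

locale curve_K = curve Kb a w z for Kb :: "'a::field set" and a w z +
  fixes K F :: "'a set"
  assumes K_field: "subfield K" and card_K: "card K = 49" and K_Kb: "K \<subseteq> Kb"
    and Kb_alg: "x \<in> Kb \<Longrightarrow> algebraic_over K x" and F_def: "F = gen_field (K \<union> {a, w, z})"
begin

lemmas K_ring = subfield_subring[OF K_field]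

lemma finite_K: "finite K"
  using card_K by (intro card_ge_0_finite) simp

lemma pow7_add: "(x + y) ^ 7 = x ^ 7 + (y::'a) ^ 7"
proof -
  \<comment> \<open>The inner binomial coefficients are 7, 21, 35, 35, 21, 7.\<close>
  have "(x + y) ^ 7 = x ^ 7 + y ^ 7 +
    7 * (x^6 * y + 3 * x^5 * y^2 + 5 * x^4 * y^3 + 5 * x^3 * y^4 + 3 * x^2 * y^5 + x * y^6)"
    by (simp add: algebra_simps eval_nat_numeral)
  then show ?thesis unfolding seven by simp
qed

lemma pow7_diff: "(x - y) ^ 7 = x ^ 7 - (y::'a) ^ 7"
  using pow7_add[of x "- y"] by simp

lemma pow49_add: "(x + y) ^ 49 = x ^ 49 + (y::'a) ^ 49"
proof -
  have "(u::'a) ^ 49 = (u ^ 7) ^ 7" for u by (simp flip: power_mult)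
  then show ?thesis by (simp only: pow7_add)
qed

lemma frob_add: "(x + y) ^ (49 ^ j) = x ^ (49 ^ j) + (y::'a) ^ (49 ^ j)"
proof (induction j)
  case (Suc j)
  have "(u::'a) ^ (49 ^ Suc j) = (u ^ (49 ^ j)) ^ 49" for u by (simp flip: power_mult add: mult.commute)
  then show ?case by (simp only: pow49_add Suc)
qed simp

lemma frob_hom: "field_hom (\<lambda>x::'a. x ^ (49 ^ j))"
  by (simp add: field_hom_def frob_add power_mult_distrib)

lemma frob_diff: "(x - y) ^ (49 ^ j) = x ^ (49 ^ j) - (y::'a) ^ (49 ^ j)"
  using frob_add[of "x - y" y j] by simp

lemma frob_inj: "(x::'a) ^ (49 ^ j) = y ^ (49 ^ j) \<Longrightarrow> x = y"
  using frob_diff[of x y j] by simp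

lemma frob_frob: "((x::'a) ^ (49 ^ i)) ^ (49 ^ j) = x ^ (49 ^ (i + j))"
  by (simp flip: power_mult power_add)

text \<open>Multiplication by \<open>x\<close> permutes the 48 nonzero elements, so multiplying
  their product by \<open>x ^ 48\<close> does not change it.\<close>

lemma K_pow48: assumes "x \<in> K" "x \<noteq> 0" shows "x ^ 48 = 1"
proof -
  let ?K = "K - {0}"
  have c: "card ?K = 48" using card_K finite_K subring_zero[OF K_ring] by (simp add: card_Diff_singleton)
  have "bij_betw (\<lambda>y. x * y) ?K ?K"
    by (rule bij_betw_byWitness[where f' = "\<lambda>y. inverse x * y"])
      (use assms subring_mult[OF K_ring] subfield_inverse[OF K_field] in auto)
  then have "(\<Prod>y\<in>?K. x * y) = (\<Prod>y\<in>?K. y)" by (rule prod.reindex_bij_betw)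
  then have "x ^ 48 * (\<Prod>y\<in>?K. y) = (\<Prod>y\<in>?K. y)" by (simp add: prod.distrib c)
  moreover have "(\<Prod>y\<in>?K. y) \<noteq> 0" using finite_K by simp
  ultimately show ?thesis by simp
qed

lemma K_iff: "x \<in> K \<longleftrightarrow> x ^ 49 = x"
proof -
  have sub: "K \<subseteq> {x. x ^ 49 = x}"
  proof
    fix x assume x: "x \<in> K"
    have "x ^ 49 = x ^ 48 * x" by (simp flip: power_Suc2)
    then show "x \<in> {x. x ^ 49 = x}" using K_pow48[OF x] by (cases "x = 0") auto
  qed
  define p where "p = monom 1 49 - [:0, 1::'a:]"
  have "coeff p 49 = 1" by (simp add: p_def eval_nat_numeral)
  then have p0: "p \<noteq> 0" by (metis coeff_0 zero_neq_one)
  have dp: "degree p \<le> 49" unfolding p_def by (intro degree_diff_le) (auto simp: degree_monom_eq)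
  have eq: "{x. x ^ 49 = x} = {x. poly p x = 0}" by (auto simp: p_def poly_monom)
  have "card {x::'a. x ^ 49 = x} \<le> 49" unfolding eq using card_poly_roots_bound[OF p0] dp by linarith
  moreover have "finite {x::'a. x ^ 49 = x}" unfolding eq by (rule poly_roots_finite[OF p0])
  ultimately have "K = {x. x ^ 49 = x}" using card_seteq[OF _ sub] card_K by simp
  then show ?thesis by blast
qed

lemma K_frob: "x \<in> K \<Longrightarrow> x ^ (49 ^ j) = x"
proof (induction j)
  case (Suc j)
  have "x ^ (49 ^ Suc j) = (x ^ (49 ^ j)) ^ 49" by (simp flip: power_mult add: mult.commute)
  then show ?case using Suc K_iff by simp
qed simp

lemma poly_frob: "poly_over K p \<Longrightarrow> poly p (x ^ (49 ^ j)) = (poly p x) ^ (49 ^ j)"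
  by (induction p) (simp_all add: K_frob frob_add power_mult_distrib)

lemma frob_root_count: 
  assumes "j > 0" shows "finite {x::'a. x ^ (49 ^ j) = x}" "card {x::'a. x ^ (49 ^ j) = x} \<le> 49 ^ j"
proof -
  let ?n = "49 ^ j :: nat"
  have n: "?n \<noteq> 1" using assms by simp
  define p where "p = monom 1 ?n - [:0, 1::'a:]"
  have "coeff p ?n = 1" using n by (simp add: p_def coeff_pCons split: nat.split)
  then have p0: "p \<noteq> 0" by (metis coeff_0 zero_neq_one)
  have "degree [:0, 1::'a:] \<le> ?n" by (simp add: Suc_le_eq)
  then have dp: "degree p \<le> ?n" unfolding p_def by (intro degree_diff_le) (auto simp: degree_monom_eq)
  have eq: "{x. x ^ ?n = x} = {x. poly p x = 0}" by (auto simp: p_def poly_monom)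
  show "card {x::'a. x ^ (49 ^ j) = x} \<le> 49 ^ j" unfolding eq using card_poly_roots_bound[OF p0] dp by linarith
  show "finite {x::'a. x ^ (49 ^ j) = x}" unfolding eq by (rule poly_roots_finite[OF p0])
qed

text \<open>The conjugates \<open>x ^ (49 ^ i)\<close> are roots of one polynomial over
  \<open>K\<close>, so two of them coincide; injectivity of the Frobenius cancels the smaller
  exponent.\<close>

lemma Kb_periodic: assumes "x \<in> Kb" shows "\<exists>l>0. x ^ (49 ^ l) = x"
proof -
  obtain p where p: "p \<noteq> 0" "poly_over K p" "poly p x = 0"
    using Kb_alg[OF assms] by (auto simp: algebraic_over_def)
  have "range (\<lambda>i. x ^ (49 ^ i)) \<subseteq> {y. poly p y = 0}"
    using poly_frob[OF p(2), of x] p(3) by auto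
  then have "finite (range (\<lambda>i. x ^ (49 ^ i)))" using poly_roots_finite[OF p(1)] finite_subset by blast
  then have "\<not> inj (\<lambda>i. x ^ (49 ^ i))" using finite_imageD infinite_UNIV_nat by blast
  then obtain i' j' where "i' \<noteq> j'" "x ^ (49 ^ i') = x ^ (49 ^ j')" unfolding inj_def by blast
  then obtain i j where ij: "i < j" "x ^ (49 ^ i) = x ^ (49 ^ j)"
    by (cases "i' < j'") (use that[of i' j'] that[of j' i'] in auto)
  have "x ^ (49 ^ j) = (x ^ (49 ^ (j - i))) ^ (49 ^ i)" using ij(1) by (simp add: frob_frob)
  then have "(x ^ (49 ^ (j - i))) ^ (49 ^ i) = x ^ (49 ^ i)" using ij(2) by simp
  then have "x ^ (49 ^ (j - i)) = x" by (rule frob_inj)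
  then show ?thesis using ij(1) by (intro exI[of _ "j - i"]) auto
qed

lemma frob_period_mult: "(x::'a) ^ (49 ^ l) = x \<Longrightarrow> x ^ (49 ^ (l * m)) = x"
proof (induction m)
  case (Suc m)
  have "x ^ (49 ^ (l * Suc m)) = (x ^ (49 ^ (l * m))) ^ (49 ^ l)" by (simp add: frob_frob add.commute)
  then show ?case using Suc by simp
qed simp

lemma F_field: "subfield F"
  unfolding F_def by (rule subfield_gen_field)

lemmas F_ring = subfield_subring[OF F_field]

lemma F_gens: "K \<subseteq> F" "a \<in> F" "w \<in> F" "z \<in> F"
  using gen_field_subset[of "K \<union> {a, w, z}"] by (auto simp: F_def)

lemmas F_closed = subring_closed[OF F_ring] subfield_inverse[OF F_field] subfield_divide[OF F_field]

lemma frob_a: "j > 0 \<Longrightarrow> a ^ (49 ^ j) - a \<noteq> 0"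
proof -
  assume j: "j > 0"
  let ?n = "49 ^ j :: nat"
  define p where "p = monom 1 ?n - [:0, 1::'a:]"
  have "?n \<noteq> 1" using j by simp
  then have "coeff p ?n = 1" by (simp add: p_def coeff_pCons split: nat.split)
  then have "p \<noteq> 0" by (metis coeff_0 zero_neq_one)
  moreover have "poly_over Kb p" unfolding p_def
    by (intro poly_over_diff[OF Kb_ring] poly_over_monom[OF Kb_ring]) (use Kb_closed Kb_ring in auto)
  ultimately show ?thesis using a_transcendental[of p] by (simp add: p_def poly_monom)
qed

lemma rs_frob_a: "plc Q \<Longrightarrow> rs Kb Q a \<alpha> \<Longrightarrow> \<alpha> ^ (49 ^ j) = \<alpha> \<Longrightarrow> a ^ (49 ^ j) - a \<in> max_ideal Q"
proof -
  assume Q: "plc Q" "rs Kb Q a \<alpha>" "\<alpha> ^ (49 ^ j) = \<alpha>"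
  interpret vplace UNIV Kb Q using vplace_plc Q by blast
  show ?thesis using rs_diff[OF rs_power[OF Q(2), of "49 ^ j"] Q(2)] Q(3) by (simp add: rs_def)
qed

text \<open>A unit has order 0, and its leading coefficient in \<open>Kb\<close> is its
  residue.\<close>

lemma residue_exists: "plc Q \<Longrightarrow> x \<in> Q \<Longrightarrow> \<exists>c. rs Kb Q x c"
proof (cases "x \<in> max_ideal Q")
  case True
  assume Q: "plc Q"
  interpret vplace UNIV Kb Q using vplace_plc Q by blast
  show ?thesis using rs_m True by blast
next
  case False
  assume Q: "plc Q" "x \<in> Q"
  interpret vplace UNIV Kb Q using vplace_plc Q by blast
  have u: "is_unit_in Q x" and x0: "x \<noteq> 0" using False Q unit_iff m_zero by auto
  obtain p n where n: "lord Q p Kb x n" "dval UNIV Q p"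
  proof (cases "a \<in> Q")
    case True
    then obtain \<alpha> \<beta> \<gamma> where c: "cen Q \<alpha> \<beta> \<gamma>" using affine_cen Q by blast
    then have pt: "pt \<alpha> \<beta> \<gamma>" by (simp add: cen_def)
    show ?thesis using that cen_lord[OF pt x0] cen_dval[OF pt c] c by blast
  next
    case False
    then show ?thesis using that inf_lord[OF x0] inf_dval inf_or_affine[OF Q(1)] by blast
  qed
  have "n = 0" using unit_powi_unique[OF p_m[OF n(2)] p0[OF n(2)] lord_unit[OF n(1) subset_refl], of 0] u by simp
  then show ?thesis using n(1) by (auto simp: lord_def rs_def)
qed

text \<open>The restriction must stay proper. At infinity \<open>a\<close> is outside. At an affine
  place the residue of \<open>a\<close> lies in a finite field, so some
  \<open>a ^ (49 ^ j) - a\<close> is a nonzero element of \<open>F\<close> in the maximal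
  ideal.\<close>

lemma place_restrict: assumes Q: "plc Q" shows "place F K (Q \<inter> F)"
proof -
  interpret vplace UNIV Kb Q using vplace_plc Q by blast
  have "Q \<inter> F \<noteq> F"
  proof (cases "a \<in> Q")
    case True
    then obtain \<alpha> where r: "rs Kb Q a \<alpha>" using residue_exists Q by blast
    then obtain j where j: "j > 0" "\<alpha> ^ (49 ^ j) = \<alpha>" using Kb_periodic by (auto simp: rs_def)
    have "a ^ (49 ^ j) - a \<in> max_ideal Q" using rs_frob_a Q r j by blast
    then have "inverse (a ^ (49 ^ j) - a) \<notin> Q" using frob_a[OF j(1)] by (auto simp: max_ideal_def)
    moreover have "inverse (a ^ (49 ^ j) - a) \<in> F" using F_gens by (intro F_closed)
    ultimately show ?thesis by blast
  qed (use F_gens in blast)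
  then show ?thesis unfolding place_def using K_Kb k_R F_gens R_cases R_add R_mult R_minus F_closed by auto
qed

lemma vplace_F: "place F K P \<Longrightarrow> vplace F K P"
  by unfold_locales (auto simp: F_field K_field)

lemma max_ideal_restrict: "plc Q \<Longrightarrow> x \<in> max_ideal (Q \<inter> F) \<longleftrightarrow> x \<in> max_ideal Q \<and> x \<in> F"
  using F_closed(8)[of x] by (auto simp: max_ideal_def)

text \<open>Chevalley's theorem gives a proper valuation ring \<open>B\<close> above
  \<open>P\<close>, which contains \<open>Kb\<close> by integral closedness. If it met
  \<open>F\<close> in more than \<open>P\<close>, some \<open>v\<close> in the maximal ideal of
  \<open>P\<close> would be a unit of \<open>B\<close>. Its residue is a root of unity, so some
  \<open>v ^ n - 1\<close> lies in the maximal ideal of \<open>B\<close>, hence in that of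
  \<open>P\<close>, together with \<open>v ^ n\<close>.\<close>

lemma place_lift: assumes P: "place F K P" shows "\<exists>Q. plc Q \<and> Q \<inter> F = P"
proof -
  interpret P: vplace F K P using vplace_F P by blast
  obtain x where x: "x \<in> F" "x \<notin> P" using P by (auto simp: place_def)
  then have s: "inverse x \<in> P" "inverse (inverse x) \<notin> P" using P.R_cases by auto
  obtain B where B: "P \<subseteq> B" "subring B" "x \<notin> B" "\<And>x. x \<noteq> 0 \<Longrightarrow> x \<in> B \<or> inverse x \<in> B"
    using chevalley[OF P.ring s] by auto
  have "place UNIV K B" unfolding place_def using B P.k_R by (auto simp: subring_def)
  then interpret B': vplace UNIV K B
    using vplace.E[OF vplace_plc[OF inf_place_plc]] inf_place_exists K_field
    by unfold_locales blast+
  have "Kb \<subseteq> B" using B'.algebraic_R Kb_alg by blast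
  then have Q: "plc B" unfolding place_def using B by (auto simp: subring_def)
  interpret B: vplace UNIV Kb B using vplace_plc Q by blast
  have "y \<in> P" if y: "y \<in> B" "y \<in> F" for y
  proof (rule ccontr)
    assume "y \<notin> P"
    define v where "v = inverse y"
    have v: "v \<in> max_ideal P" using P.notin_R y \<open>y \<notin> P\<close> by (simp add: v_def)
    have y0: "y \<noteq> 0" using \<open>y \<notin> P\<close> P.R_zero by auto
    have vB: "v \<in> B" using v P.m_R B(1) by blast
    then obtain c where c: "rs Kb B v c" using residue_exists Q by blast
    have "v \<notin> max_ideal B" using y y0 by (auto simp: v_def max_ideal_def)
    then have c0: "c \<noteq> 0" using B.rs_m_iff[OF c] by simp
    obtain j where j: "j > 0" "c ^ (49 ^ j) = c" using Kb_periodic c by (auto simp: rs_def)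
    define n :: nat where "n = 49 ^ j - 1"
    have "(49::nat) ^ j > 1" by (rule one_less_power) (use j in auto)
    then have n: "n > 0" "Suc n = 49 ^ j" by (auto simp: n_def)
    have "c * c ^ n = c" using j(2) unfolding n(2)[symmetric] by simp
    then have "c ^ n = 1" using c0 by simp
    then have "v ^ n - 1 \<in> max_ideal B" using B.rs_power[OF c, of n] by (simp add: rs_def)
    moreover have "v ^ n - 1 \<in> F" using y by (intro F_closed) (simp add: v_def F_closed)
    ultimately have "v ^ n - 1 \<in> max_ideal P" using P.max_ideal_mono[OF B(1)] by blast
    then have "v ^ n - (v ^ n - 1) \<in> max_ideal P" by (rule P.m_diff[OF P.m_power[OF v n(1)]])
    then show False using P.one_notin_m by simp
  qed
  then have "B \<inter> F = P" using B(1) P.R_E by blast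
  then show ?thesis using Q by blast
qed

end

section \<open>Frobenius orbits and degrees of places\<close>

context curve_K
begin

lemma pt_frob:
  assumes "pt \<alpha> \<beta> \<gamma>" shows "pt (\<alpha> ^ (49 ^ j)) (\<beta> ^ (49 ^ j)) (\<gamma> ^ (49 ^ j))"
proof -
  let ?n = "49 ^ j :: nat"
  have sw: "(x ^ ?n) ^ m = (x ^ m) ^ ?n" for x :: 'a and m by (simp flip: power_mult add: mult.commute)
  have e: "\<beta> ^ 3 = \<alpha> * \<gamma>" "\<gamma> ^ 3 = \<beta> * (\<alpha> ^ 2 + 1)" "\<beta> ^ 2 * \<gamma> ^ 2 = \<alpha> ^ 3 + \<alpha>"
    using assms by (auto simp: pt_def curve_eqs_def)
  have "(\<beta> ^ ?n) ^ 3 = \<alpha> ^ ?n * \<gamma> ^ ?n" unfolding sw e(1) by (simp only: power_mult_distrib)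
  moreover have "(\<gamma> ^ ?n) ^ 3 = \<beta> ^ ?n * ((\<alpha> ^ ?n) ^ 2 + 1)"
    unfolding sw e(2) by (simp only: power_mult_distrib frob_add power_one)
  moreover have "(\<beta> ^ ?n) ^ 2 * (\<gamma> ^ ?n) ^ 2 = (\<alpha> ^ ?n) ^ 3 + \<alpha> ^ ?n"
  proof -
    have "(\<beta> ^ ?n) ^ 2 * (\<gamma> ^ ?n) ^ 2 = (\<beta> ^ 2 * \<gamma> ^ 2) ^ ?n"
      unfolding sw by (rule power_mult_distrib[symmetric])
    also have "\<dots> = (\<alpha> ^ ?n) ^ 3 + \<alpha> ^ ?n" unfolding e(3) frob_add sw ..
    finally show ?thesis .
  qed
  ultimately show ?thesis using assms Kb_closed by (simp add: pt_def curve_eqs_def)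
qed

lemma ev_conj:
  "ev \<alpha> \<beta> \<gamma> g p \<Longrightarrow> \<exists>g'. crel a w z Kb (\<lambda>x. x ^ (49 ^ j)) a w z g g' \<and>
    ev (\<alpha> ^ (49 ^ j)) (\<beta> ^ (49 ^ j)) (\<gamma> ^ (49 ^ j)) g' (p ^ (49 ^ j))"
proof (induction rule: crel.induct)
  case (crel_const c)
  have "crel a w z Kb (\<lambda>x. x ^ (49 ^ j)) a w z c (c ^ (49 ^ j))"
    using crel.crel_const[OF crel_const, of a w z "\<lambda>x. x ^ (49 ^ j)"] .
  moreover have "ev (\<alpha> ^ (49 ^ j)) (\<beta> ^ (49 ^ j)) (\<gamma> ^ (49 ^ j)) (c ^ (49 ^ j)) (c ^ (49 ^ j))"
    by (intro ev_const Kb_closed crel_const)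
  ultimately show ?case by blast
next
  case (crel_add x x' y y')
  then show ?case unfolding frob_add by (blast intro: crel.crel_add)
next
  case (crel_mult x x' y y')
  then show ?case unfolding power_mult_distrib by (blast intro: crel.crel_mult)
qed (blast intro: crel.intros)+

lemma cring_K_fixed:
  assumes "x \<in> cring a w z K" shows "crel a w z Kb (\<lambda>x. x ^ (49 ^ j)) a w z x x"
proof -
  have "crel a w z Kb (\<lambda>x. x ^ (49 ^ j)) a w z x x" if "crel a w z K (\<lambda>x. x) a w z x x'" for x x'
    using that
  proof induction
    case (crel_const c)
    then show ?case using crel.crel_const[of c Kb a w z "\<lambda>x. x ^ (49 ^ j)" a w z] K_Kb K_frob by auto
  qed (blast intro: crel.intros)+
  then show ?thesis using assms by (auto simp: cring_def)
qed

lemma F_fraction: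
  assumes "x \<in> F" obtains d where "poly_over K d" "d \<noteq> 0" "x * poly d a \<in> cring a w z K"
  using gen_field_fraction[OF eqs K_field _ assms[unfolded F_def]] a_transcendental poly_over_mono[OF K_Kb]
  by blast

lemma rs_lval:
  assumes Q: "cen Q \<alpha> \<beta> \<gamma>" and unram: "\<alpha> ^ 3 + \<alpha> \<noteq> 0" and r: "rs Kb Q x c"
  shows "lval \<alpha> \<beta> \<gamma> x c"
proof -
  have pt: "pt \<alpha> \<beta> \<gamma>" using Q by (simp add: cen_def)
  interpret vplace UNIV Kb Q using Q vplace_plc by (simp add: cen_def)
  note lr = lring_closed[OF pt]
  have "x \<in> lring \<alpha> \<beta> \<gamma>"
  proof (cases "x = 0")
    case False
    obtain n u d where u: "lval \<alpha> \<beta> \<gamma> u d" "d \<noteq> 0" "x = u * (a - \<alpha>) powi n"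
      using unram_field[OF pt unram False] by blast
    have "x * (a - \<alpha>) powi (- n) = u"
      using u(3) powi_add0[OF a_minus_nonzero[OF pt], of n "- n"] by (simp add: mult.assoc)
    then have "lord Q (a - \<alpha>) Kb x n"
      using lval_rs[OF pt u(1) Q] u(2) unfolding lord_def rs_def by auto
    moreover have "dval UNIV Q (a - \<alpha>)" using cen_dval[OF pt Q] unram by (simp add: par_def[OF pt])
    ultimately have "n \<ge> 0" using dval_R_iff lord_unit rs_R[OF r] by blast
    then have "(a - \<alpha>) powi n = (a - \<alpha>) ^ nat n" by (simp add: power_int_def)
    moreover have "u \<in> lring \<alpha> \<beta> \<gamma>" using u(1) by (auto simp: lring_def[OF pt])
    moreover have "a - \<alpha> \<in> lring \<alpha> \<beta> \<gamma>" using lring_gens[OF pt] pt_Kb[OF pt] lr(6) by blast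
    ultimately show ?thesis using u(3) lr(4,7) by simp
  qed (use lr in simp)
  then obtain c' where c': "lval \<alpha> \<beta> \<gamma> x c'" by (auto simp: lring_def[OF pt])
  then show ?thesis using rs_unique[OF lval_rs[OF pt c' Q] r] by simp
qed

text \<open>Elements of \<open>F\<close> are fixed by the Frobenius on coefficients, but the
  fraction \<open>g / h\<close> that is defined at the point may have coefficients outside
  \<open>K\<close>. Conjugating \<open>g1 * h = h1 * g\<close>, with \<open>g1\<close> and
  \<open>h1\<close> over \<open>K\<close>, shows that \<open>x\<close> is also
  \<open>g' / h'\<close>, which can be evaluated at the conjugate point.\<close>

lemma frob_transport:
  assumes Q: "cen Q \<alpha> \<beta> \<gamma>" and unram: "\<alpha> ^ 3 + \<alpha> \<noteq> 0"
    and Q': "cen Q' (\<alpha> ^ (49 ^ j)) (\<beta> ^ (49 ^ j)) (\<gamma> ^ (49 ^ j))"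
    and x: "x \<in> F" "rs Kb Q x c"
  shows "rs Kb Q' x (c ^ (49 ^ j))"
proof -
  let ?\<sigma> = "\<lambda>x::'a. x ^ (49 ^ j)"
  have pt: "pt \<alpha> \<beta> \<gamma>" and pt': "pt (?\<sigma> \<alpha>) (?\<sigma> \<beta>) (?\<sigma> \<gamma>)" using Q Q' by (auto simp: cen_def)
  obtain d where d: "poly_over K d" "d \<noteq> 0" "x * poly d a \<in> cring a w z K" using F_fraction[OF x(1)] by blast
  define g1 h1 where "g1 = x * poly d a" and "h1 = poly d a"
  have h1: "h1 \<noteq> 0" unfolding h1_def using a_transcendental d poly_over_mono[OF K_Kb] by blast
  have fixd: "crel a w z Kb ?\<sigma> a w z g1 g1" "crel a w z Kb ?\<sigma> a w z h1 h1"
    unfolding g1_def h1_def using d(3) cring_poly[OF K_ring d(1)] cring_K_fixed by blast+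
  obtain g h p q where gh: "ev \<alpha> \<beta> \<gamma> g p" "ev \<alpha> \<beta> \<gamma> h q" "q \<noteq> 0" "x = g / h" "c = p / q"
    using rs_lval[OF Q unram x(2)] by (auto simp: lval_def)
  have h0: "h \<noteq> 0" using ev_nonzero[OF pt] gh by blast
  obtain g' where g': "crel a w z Kb ?\<sigma> a w z g g'" "ev (?\<sigma> \<alpha>) (?\<sigma> \<beta>) (?\<sigma> \<gamma>) g' (?\<sigma> p)"
    using ev_conj[OF gh(1)] by blast
  obtain h' where h': "crel a w z Kb ?\<sigma> a w z h h'" "ev (?\<sigma> \<alpha>) (?\<sigma> \<beta>) (?\<sigma> \<gamma>) h' (?\<sigma> q)"
    using ev_conj[OF gh(2)] by blast
  have q': "?\<sigma> q \<noteq> 0" using gh(3) by simp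
  have h'0: "h' \<noteq> 0" using ev_nonzero[OF pt' h'(2) q'] .
  have "g1 * h = h1 * g" unfolding g1_def h1_def gh(4) using h0 by simp
  then have "g1 * h' = h1 * g'"
    using crel_unique[OF crel_mult[OF fixd(1) h'(1)] _ eqs frob_hom] crel_mult[OF fixd(2) g'(1)] by simp
  then have "x = g' / h'" using h1 h'0 by (simp add: g1_def h1_def field_simps)
  moreover have "?\<sigma> c = ?\<sigma> p / ?\<sigma> q" by (simp add: gh(5) power_divide)
  ultimately have "lval (?\<sigma> \<alpha>) (?\<sigma> \<beta>) (?\<sigma> \<gamma>) x (?\<sigma> c)"
    unfolding lval_def using g'(2) h'(2) q' by blast
  then show ?thesis using lval_rs[OF pt' _ Q'] by blast
qed

text \<open>The residue field of the place \<open>Q \<inter> F\<close> of \<open>F\<close>, realised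
  inside \<open>Kb\<close>.\<close>

definition resid :: "'a set \<Rightarrow> 'a set" where
  "resid Q = {c. \<exists>x\<in>F. rs Kb Q x c}"

text \<open>Residues of units are leading coefficients of order 0. This is the reason for computing
  orders with leading coefficients in a subfield.\<close>

lemma resid_ram:
  assumes Q: "plc Q" and p: "dval UNIV Q p" and o: "\<And>x. x \<in> F \<Longrightarrow> x \<noteq> 0 \<Longrightarrow> \<exists>n. lord Q p K x n"
  shows "resid Q \<subseteq> K"
proof
  fix c assume "c \<in> resid Q"
  then obtain x where x: "x \<in> F" "rs Kb Q x c" by (auto simp: resid_def)
  interpret vplace UNIV Kb Q using vplace_plc Q by blast
  show "c \<in> K"
  proof (cases "x \<in> max_ideal Q")
    case True
    then show ?thesis using rs_m_iff[OF x(2)] subring_zero[OF K_ring] by simp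
  next
    case False
    then obtain n where n: "lord Q p K x n" using o x(1) m_zero by blast
    have "is_unit_in Q x" using False rs_R[OF x(2)] unit_iff by blast
    then have "n = 0"
      using unit_powi_unique[OF p_m[OF p] p0[OF p] lord_unit[OF n K_Kb], of 0] by simp
    then obtain b where "b \<in> K" "x - b \<in> max_ideal Q" using n by (auto simp: lord_def)
    then have "rs Kb Q x b" using K_Kb by (auto simp: rs_def)
    then show ?thesis using rs_unique[OF x(2)] \<open>b \<in> K\<close> by blast
  qed
qed

lemma resid_inf: "inf_place Q \<Longrightarrow> resid Q \<subseteq> K"
  using inf_field[OF K_field K_Kb] by (intro resid_ram[OF inf_place_plc inf_dval]) (auto simp: F_def)

lemma ram_in_K: "\<alpha> ^ 3 + \<alpha> = 0 \<Longrightarrow> \<alpha> \<in> K"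
proof -
  assume "\<alpha> ^ 3 + \<alpha> = 0"
  moreover have "\<alpha> ^ 3 + \<alpha> = \<alpha> * (\<alpha> ^ 2 + 1)" by (simp add: algebra_simps eval_nat_numeral)
  ultimately have "\<alpha> = 0 \<or> \<alpha> ^ 2 = - 1" by (simp only: mult_eq_0_iff eq_neg_iff_add_eq_0)
  moreover have e: "\<alpha> ^ 49 = \<alpha> * (\<alpha> ^ 2) ^ 24" by (simp flip: power_mult power_Suc)
  ultimately show ?thesis
  proof (elim disjE)
    assume "\<alpha> ^ 2 = - 1"
    then have "\<alpha> ^ 49 = \<alpha>" unfolding e by simp
    then show ?thesis by (simp add: K_iff)
  qed (simp add: subring_zero[OF K_ring])
qed

lemma resid_ram_cen:
  assumes Q: "cen Q \<alpha> \<beta> \<gamma>" "\<alpha> ^ 3 + \<alpha> = 0" shows "resid Q \<subseteq> K"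
proof (rule resid_ram)
  have pt: "pt \<alpha> \<beta> \<gamma>" using Q by (simp add: cen_def)
  show "plc Q" using Q by (simp add: cen_def)
  show "dval UNIV Q (ram_par \<alpha>)" using cen_dval[OF pt Q(1)] Q(2) by (simp add: par_def[OF pt])
  show "\<exists>n. lord Q (ram_par \<alpha>) K x n" if "x \<in> F" "x \<noteq> 0" for x
    using ram_field[OF K_field K_Kb ram_in_K[OF Q(2)] Q(2), of x] that Q(1) by (auto simp: F_def cen_def rs_def)
qed

lemma K_one: "{c::'a. c ^ (49 ^ 1) = c} = K"
  using K_iff by auto

text \<open>For an unramified point \<open>l\<close> is the length of its Frobenius orbit: the
  \<open>l\<close>-th power of the Frobenius fixes the point and hence all residues, and the
  conjugate points give \<open>l\<close> different places with the same restriction, because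
  residues of elements of \<open>F\<close> there are conjugate. At ramified places the residue field
  is \<open>K\<close>, and \<open>l\<close> is 1.\<close>

lemma fibre:
  assumes Q: "plc Q"
  obtains l S where "l > 0" "resid Q \<subseteq> {c. c ^ (49 ^ l) = c}" "card S = l"
    "S \<subseteq> {Q'. plc Q' \<and> Q' \<inter> F = Q \<inter> F}"
proof (cases "inf_place Q \<or> (\<exists>\<alpha> \<beta> \<gamma>. cen Q \<alpha> \<beta> \<gamma> \<and> \<alpha> ^ 3 + \<alpha> = 0)")
  case True
  then have "resid Q \<subseteq> K" using resid_inf resid_ram_cen by blast
  then show ?thesis using that[of 1 "{Q}"] Q K_one by simp
next
  case False
  then obtain \<alpha> \<beta> \<gamma> where c: "cen Q \<alpha> \<beta> \<gamma>" and unram: "\<alpha> ^ 3 + \<alpha> \<noteq> 0"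
    using affine_cen inf_or_affine Q by blast
  then have pt: "pt \<alpha> \<beta> \<gamma>" by (simp add: cen_def)
  define P where "P l \<longleftrightarrow> l > 0 \<and> \<alpha> ^ (49 ^ l) = \<alpha> \<and> \<beta> ^ (49 ^ l) = \<beta> \<and> \<gamma> ^ (49 ^ l) = \<gamma>" for l
  obtain i j k where "i > 0" "\<alpha> ^ (49 ^ i) = \<alpha>" "j > 0" "\<beta> ^ (49 ^ j) = \<beta>" "k > 0" "\<gamma> ^ (49 ^ k) = \<gamma>"
    using Kb_periodic pt_Kb[OF pt] by metis
  then have "P (i * (j * k))"
    using frob_period_mult[of \<alpha> i "j * k"] frob_period_mult[of \<beta> j "i * k"] frob_period_mult[of \<gamma> k "i * j"]
    unfolding P_def by (simp only: mult.left_commute[of j] mult.commute[of k] mult.assoc nat_0_less_mult_iff)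
  then obtain l where l: "P l" and min: "\<And>m. P m \<Longrightarrow> l \<le> m"
    using ex_has_least_nat[of P _ id] by auto
  have sub: "resid Q \<subseteq> {c. c ^ (49 ^ l) = c}"
  proof
    fix c' assume "c' \<in> resid Q"
    then obtain x where x: "x \<in> F" "rs Kb Q x c'" by (auto simp: resid_def)
    interpret vplace UNIV Kb Q using vplace_plc Q by blast
    have "rs Kb Q x (c' ^ (49 ^ l))"
      by (rule frob_transport[OF c unram _ x]) (use l c in \<open>simp add: P_def\<close>)
    then have "c' = c' ^ (49 ^ l)" by (rule rs_unique[OF x(2)])
    then show "c' \<in> {c. c ^ (49 ^ l) = c}" by (intro CollectI) (rule sym)
  qed
  define q where "q i = (SOME Q'. cen Q' (\<alpha> ^ (49 ^ i)) (\<beta> ^ (49 ^ i)) (\<gamma> ^ (49 ^ i)))" for i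
  have q: "cen (q i) (\<alpha> ^ (49 ^ i)) (\<beta> ^ (49 ^ i)) (\<gamma> ^ (49 ^ i))" for i
    unfolding q_def using cen_exists[OF pt_frob[OF pt]] by (rule someI_ex)
  have qF: "q i \<inter> F = Q \<inter> F" for i
  proof -
    have plq: "plc (q i)" using q by (simp add: cen_def)
    interpret A: vplace UNIV Kb Q using vplace_plc Q by blast
    interpret B: vplace UNIV Kb "q i" using vplace_plc plq by blast
    have tr: "rs Kb (q i) x (c' ^ (49 ^ i))" if "x \<in> F" "rs Kb Q x c'" for x c'
      using frob_transport[OF c unram q that] .
    have "x \<in> q i" if "x \<in> Q \<inter> F" for x
      using residue_exists[OF Q, of x] tr[of x] that B.rs_R by blast
    moreover have "x \<in> Q" if "x \<in> q i \<inter> F" for x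
    proof (rule ccontr)
      assume "x \<notin> Q"
      then have "inverse x \<in> max_ideal Q" using A.notin_R by simp
      then have "rs Kb (q i) (inverse x) (0 ^ (49 ^ i))"
        using tr[of "inverse x" 0] A.rs_m that F_closed(8) by blast
      then have "inverse x \<in> max_ideal (q i)" using B.rs_m_iff by fastforce
      then have "inverse x * x \<in> max_ideal (q i)" using that B.m_mult by blast
      moreover have "x \<noteq> 0" using \<open>x \<notin> Q\<close> A.R_zero by auto
      ultimately show False using B.one_notin_m by simp
    qed
    ultimately show ?thesis by blast
  qed
  have inj: "inj_on q {..<l}"
  proof (rule linorder_inj_onI)
    fix i j :: nat assume ij: "i < j" "i \<in> {..<l}" "j \<in> {..<l}"
    show "q i \<noteq> q j"
    proof
      assume eq: "q i = q j"
      interpret vplace UNIV Kb "q i" using vplace_plc q by (simp add: cen_def)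
      have "rs Kb (q i) a (\<alpha> ^ (49 ^ i))" "rs Kb (q i) a (\<alpha> ^ (49 ^ j))"
        "rs Kb (q i) w (\<beta> ^ (49 ^ i))" "rs Kb (q i) w (\<beta> ^ (49 ^ j))"
        "rs Kb (q i) z (\<gamma> ^ (49 ^ i))" "rs Kb (q i) z (\<gamma> ^ (49 ^ j))"
        using q[of i] q[of j] eq by (auto simp: cen_def)
      then have e: "\<alpha> ^ (49 ^ i) = \<alpha> ^ (49 ^ j)" "\<beta> ^ (49 ^ i) = \<beta> ^ (49 ^ j)" "\<gamma> ^ (49 ^ i) = \<gamma> ^ (49 ^ j)"
        using rs_unique by blast+
      have "x ^ (49 ^ (j - i)) = x" if "x ^ (49 ^ i) = x ^ (49 ^ j)" for x :: 'a
      proof (rule frob_inj)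
        show "(x ^ (49 ^ (j - i))) ^ (49 ^ i) = x ^ (49 ^ i)" using ij(1) that by (simp add: frob_frob)
      qed
      then have "P (j - i)" using e ij(1) by (simp add: P_def)
      then show False using min[of "j - i"] ij by auto
    qed
  qed auto
  show ?thesis
  proof (rule that[OF _ sub])
    show "l > 0" using l by (simp add: P_def)
    show "card (q ` {..<l}) = l" using card_image[OF inj] by simp
    show "q ` {..<l} \<subseteq> {Q'. plc Q' \<and> Q' \<inter> F = Q \<inter> F}" using q qF by (auto simp: cen_def)
  qed
qed

lemma K_resid: "plc Q \<Longrightarrow> K \<subseteq> resid Q"
  unfolding resid_def using F_gens(1) vplace.rs_const[OF vplace_plc] K_Kb by blast

lemma finite_resid: "plc Q \<Longrightarrow> finite (resid Q)"
proof -
  assume "plc Q"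
  then obtain l where "l > 0" "resid Q \<subseteq> {c. c ^ (49 ^ l) = c}" using fibre by metis
  then show ?thesis using frob_root_count finite_subset by blast
qed

lemma resid_subspace: "plc Q \<Longrightarrow> subspace_over K (resid Q)"
proof -
  assume Q: "plc Q"
  interpret vplace UNIV Kb Q using vplace_plc Q by blast
  show ?thesis unfolding subspace_over_def
  proof (intro conjI ballI)
    show "0 \<in> resid Q" using K_resid[OF Q] subring_zero[OF K_ring] by blast
    show "x + y \<in> resid Q" if "x \<in> resid Q" "y \<in> resid Q" for x y
      using that rs_add F_closed(3) unfolding resid_def by blast
    show "c * x \<in> resid Q" if c: "c \<in> K" and "x \<in> resid Q" for c x
    proof -
      obtain y where y: "y \<in> F" "rs Kb Q y x" using \<open>x \<in> resid Q\<close> by (auto simp: resid_def)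
      have "rs Kb Q (c * y) (c * x)" using c K_Kb by (intro rs_mult rs_const y) auto
      moreover have "c * y \<in> F" using c F_gens(1) y(1) F_closed(4) by blast
      ultimately show ?thesis by (auto simp: resid_def)
    qed
  qed
qed

text \<open>A basis of the residue field over \<open>K\<close> lifts to a family as required by
  \<open>deg_place\<close>; conversely the residues of any such family span the residue field, so it
  cannot be smaller.\<close>

lemma deg_place_spanning:
  assumes Q: "plc Q"
  shows "card (resid Q) = 49 ^ deg_place K (Q \<inter> F)"
proof -
  interpret vplace UNIV Kb Q using vplace_plc Q by blast
  define good where "good B \<longleftrightarrow> finite B \<and> B \<subseteq> Q \<inter> F \<and>
      (\<forall>x\<in>Q \<inter> F. \<exists>c. (\<forall>b\<in>B. c b \<in> K) \<and> x - (\<Sum>b\<in>B. c b * b) \<in> max_ideal (Q \<inter> F))" for B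
  have deg: "deg_place K (Q \<inter> F) = (LEAST n. \<exists>B. good B \<and> card B = n)"
    unfolding deg_place_def good_def by (rule arg_cong[of _ _ Least]) blast
  obtain B where B: "finite B" "B \<subseteq> resid Q" "resid Q \<subseteq> span_over K B" "card (resid Q) = card K ^ card B"
    using finite_space_basis[OF K_field finite_K resid_subspace[OF Q] finite_resid[OF Q]] by blast
  have "\<forall>b\<in>B. \<exists>x. x \<in> F \<and> rs Kb Q x b" using B(2) by (auto simp: resid_def)
  then obtain f where f: "\<And>b. b \<in> B \<Longrightarrow> f b \<in> F \<and> rs Kb Q (f b) b" by metis
  have inj: "inj_on f B" using f rs_unique by (metis inj_onI)
  have "good (f ` B)" unfolding good_def
  proof (intro conjI ballI)
    show "finite (f ` B)" using B by simp
    show "f ` B \<subseteq> Q \<inter> F" using f rs_R by blast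
    fix x assume x: "x \<in> Q \<inter> F"
    then obtain r where r: "rs Kb Q x r" using residue_exists Q by blast
    then have "r \<in> span_over K B" using x B(3) by (auto simp: resid_def)
    then obtain c where c: "r = (\<Sum>b\<in>B. c b * b)" "\<forall>b\<in>B. c b \<in> K" by (auto simp: span_over_def)
    define c' where "c' y = c (inv_into B f y)" for y
    have s: "(\<Sum>y\<in>f ` B. c' y * y) = (\<Sum>b\<in>B. c b * f b)"
      using inj by (simp add: sum.reindex c'_def inv_into_f_f)
    have "rs Kb Q (\<Sum>b\<in>B. c b * f b) r" unfolding c(1)
      using c(2) f K_Kb by (intro rs_sum rs_mult rs_const) auto
    then have "x - (\<Sum>b\<in>B. c b * f b) \<in> max_ideal Q" using rs_diff[OF r] by (fastforce simp: rs_def)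
    moreover have "x - (\<Sum>b\<in>B. c b * f b) \<in> F"
      using x c(2) f F_gens(1) by (intro F_closed(6) subring_sum[OF F_ring] F_closed(4)) auto
    ultimately have "x - (\<Sum>y\<in>f ` B. c' y * y) \<in> max_ideal (Q \<inter> F)"
      using max_ideal_restrict[OF Q] s by simp
    moreover have "\<forall>y\<in>f ` B. c' y \<in> K" using c(2) inj by (auto simp: c'_def inv_into_f_f)
    ultimately show "\<exists>c. (\<forall>b\<in>f ` B. c b \<in> K) \<and> x - (\<Sum>b\<in>f ` B. c b * b) \<in> max_ideal (Q \<inter> F)" by blast
  qed
  moreover have "card B \<le> m" if B': "good B'" "card B' = m" for B' m
  proof -
    have gB: "finite B'" "B' \<subseteq> Q \<inter> F" using B' by (auto simp: good_def)
    have "\<forall>b\<in>B'. \<exists>c. rs Kb Q b c" using gB residue_exists[OF Q] by blast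
    then obtain g where g: "\<And>b. b \<in> B' \<Longrightarrow> rs Kb Q b (g b)" by metis
    have sub: "resid Q \<subseteq> (\<lambda>c. \<Sum>b\<in>B'. c b * g b) ` (PiE B' (\<lambda>_. K))"
    proof
      fix r assume "r \<in> resid Q"
      then obtain x where x: "x \<in> F" "rs Kb Q x r" by (auto simp: resid_def)
      then obtain c where c: "\<forall>b\<in>B'. c b \<in> K" "x - (\<Sum>b\<in>B'. c b * b) \<in> max_ideal (Q \<inter> F)"
        using B'(1) rs_R[OF x(2)] unfolding good_def by blast
      have 1: "rs Kb Q (\<Sum>b\<in>B'. c b * b) (\<Sum>b\<in>B'. c b * g b)"
        using c(1) g K_Kb by (intro rs_sum rs_mult rs_const) auto
      have "rs Kb Q (x - (\<Sum>b\<in>B'. c b * b)) 0" using c(2) max_ideal_restrict[OF Q] rs_m by blast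
      then have "rs Kb Q x (0 + (\<Sum>b\<in>B'. c b * g b))" using rs_add[OF _ 1] by fastforce
      then have "r = (\<Sum>b\<in>B'. c b * g b)" using rs_unique[OF x(2)] by simp
      also have "\<dots> = (\<Sum>b\<in>B'. restrict c B' b * g b)" by (intro sum.cong) auto
      finally show "r \<in> (\<lambda>c. \<Sum>b\<in>B'. c b * g b) ` (PiE B' (\<lambda>_. K))"
        using c(1) by (intro image_eqI[of _ _ "restrict c B'"]) auto
    qed
    have "card (resid Q) \<le> card (PiE B' (\<lambda>_. K))"
      by (rule surj_card_le[OF _ sub]) (use gB finite_K in \<open>simp add: finite_PiE\<close>)
    then have "(49::nat) ^ card B \<le> 49 ^ m" using B(4) B'(2) gB(1) by (simp add: card_PiE card_K)
    then show ?thesis by simp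
  qed
  ultimately have "deg_place K (Q \<inter> F) = card B"
    unfolding deg using card_image[OF inj] by (intro Least_equality) blast+
  then show ?thesis using B(4) card_K by simp
qed

lemma deg_place_eq_1_iff: "plc Q \<Longrightarrow> deg_place K (Q \<inter> F) = 1 \<longleftrightarrow> resid Q \<subseteq> K"
proof
  assume Q: "plc Q"
  show "resid Q \<subseteq> K" if "deg_place K (Q \<inter> F) = 1"
    using card_seteq[OF finite_resid[OF Q] K_resid[OF Q]] deg_place_spanning[OF Q] that card_K by simp
  show "deg_place K (Q \<inter> F) = 1" if "resid Q \<subseteq> K"
  proof -
    have "resid Q = K" using that K_resid[OF Q] by blast
    then have "(49::nat) ^ deg_place K (Q \<inter> F) = 49 ^ 1" using deg_place_spanning[OF Q] card_K by simp
    then show ?thesis by (simp only: power_inject_exp)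
  qed
qed

text \<open>Comparing sizes of residue fields, the degree is at most the orbit length. This converts
  degrees of places of \<open>F\<close> into numbers of geometric places.\<close>

lemma deg_le_fibre:
  assumes Q: "plc Q"
  obtains S where "card S = deg_place K (Q \<inter> F)" "S \<subseteq> {Q'. plc Q' \<and> Q' \<inter> F = Q \<inter> F}"
proof -
  obtain l S where l: "l > 0" "resid Q \<subseteq> {c. c ^ (49 ^ l) = c}" "card S = l"
    "S \<subseteq> {Q'. plc Q' \<and> Q' \<inter> F = Q \<inter> F}" by (rule fibre[OF Q])
  have "card (resid Q) \<le> 49 ^ l"
    using card_mono[OF frob_root_count(1)[OF l(1)] l(2)] frob_root_count(2)[OF l(1)] by linarith
  then have "deg_place K (Q \<inter> F) \<le> card S" using deg_place_spanning[OF Q] l(3) by simp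
  then obtain S' where "S' \<subseteq> S" "card S' = deg_place K (Q \<inter> F)" by (rule obtain_subset_with_card_n)
  then show ?thesis using that l(4) by blast
qed

lemma unit_restrict: "plc Q \<Longrightarrow> x \<in> F \<Longrightarrow> is_unit_in (Q \<inter> F) x \<longleftrightarrow> is_unit_in Q x"
  using F_closed(8) by (auto simp: is_unit_in_def)

lemma F_powi: "x \<in> F \<Longrightarrow> x powi n \<in> F"
  by (auto simp: power_int_def intro: F_closed)

lemma val_restrict_eq:
  assumes Q: "plc Q" and p: "dval UNIV Q p" "p \<in> F"
  shows "dval F (Q \<inter> F) p" "x \<in> F \<Longrightarrow> x \<noteq> 0 \<Longrightarrow> val (Q \<inter> F) x = val Q x"
proof -
  interpret vplace UNIV Kb Q using vplace_plc Q by blast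
  have u: "is_unit_in (Q \<inter> F) (x * p powi (- val Q x))" if "x \<in> F" "x \<noteq> 0" for x
    using val_unit[OF p(1), of x] unit_restrict[OF Q] that p F_powi F_closed(4) by simp
  then show d: "dval F (Q \<inter> F) p" unfolding dval_def
    using p_m[OF p(1)] p0[OF p(1)] max_ideal_restrict[OF Q] p(2) by blast
  interpret P: vplace F K "Q \<inter> F" using vplace_F place_restrict[OF Q] by blast
  show "x \<in> F \<Longrightarrow> x \<noteq> 0 \<Longrightarrow> val (Q \<inter> F) x = val Q x" using P.val_eqI[OF d u] by blast
qed

text \<open>The ramification index \<open>e\<close> is found as the least positive order of an
  element of \<open>F\<close>; division with remainder shows that it divides all orders.\<close>

lemma val_restrict:
  assumes Q: "plc Q"
  obtains e p where "e > 0" "dval F (Q \<inter> F) p" "\<And>x. x \<in> F \<Longrightarrow> x \<noteq> 0 \<Longrightarrow> val Q x = e * val (Q \<inter> F) x"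
proof -
  interpret vplace UNIV Kb Q using vplace_plc Q by blast
  interpret P: vplace F K "Q \<inter> F" using vplace_F place_restrict[OF Q] by blast
  obtain \<pi> where \<pi>: "dval UNIV Q \<pi>" using plc_dval Q by blast
  note vm = val_mult[OF \<pi>] val_inverse[OF \<pi>] val_power[OF \<pi>]
  define N where "N n \<longleftrightarrow> n > 0 \<and> (\<exists>x\<in>F. x \<noteq> 0 \<and> val Q x = int n)" for n
  obtain y where y: "y \<in> F" "y \<notin> Q" using place_restrict[OF Q] by (auto simp: place_def)
  then have "inverse y \<in> max_ideal Q" "y \<noteq> 0" using notin_R R_zero by auto
  then have "val Q (inverse y) > 0" using val_pos_iff[OF \<pi>] by simp
  then have "N (nat (val Q (inverse y)))"
    using y \<open>y \<noteq> 0\<close> F_closed(8) by (auto simp: N_def intro!: bexI[of _ "inverse y"])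
  then obtain e where e: "N e" and min: "\<And>m. N m \<Longrightarrow> e \<le> m"
    using ex_has_least_nat[of N _ id] by auto
  obtain p where p: "p \<in> F" "p \<noteq> 0" "val Q p = int e" using e by (auto simp: N_def)
  have e0: "e > 0" using e by (simp add: N_def)
  have vp: "val Q (p powi n) = n * int e" for n
    using vm(2)[of "p ^ nat (- n)"] vm(3)[of p] p by (cases "n \<ge> 0") (auto simp: power_int_def power_inverse)
  have key: "\<exists>n. val Q x = int e * n \<and> is_unit_in (Q \<inter> F) (x * p powi (- n))" if x: "x \<in> F" "x \<noteq> 0" for x
  proof -
    define n where "n = val Q x div int e"
    have vx: "val Q (x * p powi (- n)) = val Q x mod int e"
      using vm(1)[of x "p powi (- n)"] vp[of "- n"] x p minus_div_mult_eq_mod[of "val Q x" "int e"]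
      by (simp add: n_def mult.commute)
    have xF: "x * p powi (- n) \<in> F" using x p F_powi F_closed(4) by blast
    have nz: "x * p powi (- n) \<noteq> 0" using x p by simp
    have "val Q x mod int e = 0"
    proof (rule ccontr)
      assume "\<not> ?thesis"
      then have pos: "val Q x mod int e > 0" using e0 by (simp add: order.not_eq_order_implies_strict)
      then have "N (nat (val Q x mod int e))"
        unfolding N_def using xF nz vx by (auto intro!: bexI[of _ "x * p powi (- n)"])
      then have "int e \<le> val Q x mod int e" using min pos by fastforce
      then show False using pos_mod_bound[of "int e" "val Q x"] e0 by linarith
    qed
    then have "val Q x = int e * n" "val Q (x * p powi (- n)) = 0"
      using vx by (auto simp: n_def)
    moreover from this have "is_unit_in Q (x * p powi (- n))"
      using val_unit[OF \<pi>, of "x * p powi (- n)"] nz by simp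
    ultimately show ?thesis using unit_restrict[OF Q xF] by blast
  qed
  have "p \<in> max_ideal Q" using val_pos_iff[OF \<pi>, of p] p e0 by simp
  then have d: "dval F (Q \<inter> F) p" unfolding dval_def
    using key p max_ideal_restrict[OF Q] by blast
  show ?thesis
  proof (rule that[of "int e", OF _ d])
    show "int e > 0" using e0 by simp
    show "val Q x = int e * val (Q \<inter> F) x" if "x \<in> F" "x \<noteq> 0" for x
      using key[OF that] P.val_eqI[OF d] by blast
  qed
qed

end

section \<open>Riemann--Roch spaces at infinity\<close>

text \<open>The dimension formula by counting: each nonempty fibre of \<open>\<phi>\<close> is a
  translate of a subset of \<open>U\<close>.\<close>

lemma card_le_kernel:
  assumes W: "finite W" and U: "finite U"
    and \<phi>: "\<And>x. x \<in> V \<Longrightarrow> \<phi> x \<in> W" and ker: "\<And>x y. x \<in> V \<Longrightarrow> y \<in> V \<Longrightarrow> \<phi> x = \<phi> y \<Longrightarrow> x - y \<in> (U :: 'a::ab_group_add set)"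
  shows "finite V \<and> card V \<le> card U * card W"
proof -
  have fib: "finite {x \<in> V. \<phi> x = y} \<and> card {x \<in> V. \<phi> x = y} \<le> card U" for y
  proof (cases "{x \<in> V. \<phi> x = y} = {}")
    case False
    then obtain x0 where x0: "x0 \<in> V" "\<phi> x0 = y" by blast
    have sub: "(\<lambda>x. x - x0) ` {x \<in> V. \<phi> x = y} \<subseteq> U" using ker x0 by auto
    have inj: "inj_on (\<lambda>x. x - x0) {x \<in> V. \<phi> x = y}" by (auto simp: inj_on_def)
    show ?thesis using card_inj_on_le[OF inj sub U] finite_imageD[OF finite_subset[OF sub U] inj] by blast
  next
    case True
    show ?thesis unfolding True by simp
  qed
  have V: "V = (\<Union>y\<in>W. {x \<in> V. \<phi> x = y})" using \<phi> by auto
  have "finite V" using W fib by (subst V) blast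
  moreover have "card V \<le> (\<Sum>y\<in>W. card {x \<in> V. \<phi> x = y})" by (subst V) (rule card_UN_le[OF W])
  moreover have "\<dots> \<le> (\<Sum>y\<in>W. card U)" using fib by (intro sum_mono) blast
  ultimately show ?thesis by (simp add: mult.commute)
qed

context curve_K
begin

lemma place_dval: "place F K P \<Longrightarrow> \<exists>p. dval F P p"
  using place_lift val_restrict by metis

lemma LL_cond:
  "x \<in> LL F K A \<longleftrightarrow> x \<in> F \<and> (x = 0 \<or> (\<forall>P. place F K P \<longrightarrow> val P x \<ge> - A P))"
  by (auto simp: LL_def)

lemma val_K: "place F K P \<Longrightarrow> c \<in> K \<Longrightarrow> c \<noteq> 0 \<Longrightarrow> val P c = 0"
proof -
  assume P: "place F K P" and c: "c \<in> K" "c \<noteq> 0"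
  obtain p where p: "dval F P p" using place_dval[OF P] by blast
  interpret vplace F K P using vplace_F P by blast
  show ?thesis by (rule val_eqI[OF p]) (use unit_k c in simp)
qed

lemma LL_subspace: "subspace_over K (LL F K A)"
  unfolding subspace_over_def
proof (intro conjI ballI)
  show "0 \<in> LL F K A" by (simp add: LL_cond F_closed)
  show "x + y \<in> LL F K A" if x: "x \<in> LL F K A" and y: "y \<in> LL F K A" for x y
  proof -
    have "val P (x + y) \<ge> - A P" if P: "place F K P" and nz: "x + y \<noteq> 0" for P
    proof -
      obtain p where p: "dval F P p" using place_dval[OF P] by blast
      interpret vplace F K P using vplace_F P by blast
      show ?thesis using val_add_ge[OF p _ _ _ _ nz] x y P by (auto simp: LL_cond)
    qed
    then show ?thesis using x y F_closed(3) by (auto simp: LL_cond)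
  qed
  show "c * x \<in> LL F K A" if c: "c \<in> K" and x: "x \<in> LL F K A" for c x
  proof -
    have cF: "c \<in> F" using c F_gens by blast
    have "val P (c * x) \<ge> - A P" if P: "place F K P" and nz: "c * x \<noteq> 0" for P
    proof -
      obtain p where p: "dval F P p" using place_dval[OF P] by blast
      interpret vplace F K P using vplace_F P by blast
      show ?thesis using val_mult[OF p cF, of x] nz x P val_K[OF P c] by (auto simp: LL_cond)
    qed
    then show ?thesis using x cF F_closed(4) by (auto simp: LL_cond)
  qed
qed

lemma LL_mono: "(\<And>P. A P \<le> B P) \<Longrightarrow> LL F K A \<subseteq> LL F K B"
  unfolding LL_cond subset_iff by (meson neg_le_iff_le order.trans)

text \<open>Multiplication by \<open>p powi (B P)\<close> moves the allowed pole into the valuation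
  ring. Taking residues is then an additive map into the residue field, and functions with equal
  images differ by an element of \<open>LL F K A\<close>.\<close>

lemma LL_step:
  assumes P: "place F K P" and fin: "finite (LL F K A)" and B: "\<And>R. R \<noteq> P \<Longrightarrow> B R = A R" "B P = A P + 1"
  shows "finite (LL F K B) \<and> card (LL F K B) \<le> card (LL F K A) * 49 ^ deg_place K P"
proof -
  obtain Q where Q: "plc Q" "Q \<inter> F = P" using place_lift[OF P] by blast
  obtain p where p: "dval F P p" using place_dval[OF P] by blast
  interpret P: vplace F K P using vplace_F P by blast
  interpret vplace UNIV Kb Q using vplace_plc Q by blast
  have p0: "p \<noteq> 0" and pF: "p \<in> F" using P.p0[OF p] P.p_m[OF p] P.m_R P.R_E by auto
  define s where "s x = x * p powi (B P)" for x
  have sF: "s x \<in> F" if "x \<in> F" for x using that pF F_powi F_closed(4) by (simp add: s_def)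
  have sP: "s x \<in> P" if "x \<in> LL F K B" for x
    using that P.val_ge_iff[OF p, of x "- B P"] P P.R_zero by (cases "x = 0") (auto simp: LL_cond s_def)
  define \<phi> where "\<phi> x = (THE c. rs Kb Q (s x) c)" for x
  have \<phi>: "rs Kb Q (s x) (\<phi> x)" if x: "x \<in> LL F K B" for x
  proof -
    obtain c where c: "rs Kb Q (s x) c" using residue_exists[OF Q(1)] sP[OF x] Q(2) by blast
    then show ?thesis unfolding \<phi>_def by (rule theI) (use rs_unique[OF c] in auto)
  qed
  have "finite (LL F K B) \<and> card (LL F K B) \<le> card (LL F K A) * card (resid Q)"
  proof (rule card_le_kernel[OF finite_resid[OF Q(1)] fin])
    show "\<phi> x \<in> resid Q" if "x \<in> LL F K B" for x
      using \<phi>[OF that] sF that by (auto simp: resid_def LL_cond)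
    fix x y assume xy: "x \<in> LL F K B" "y \<in> LL F K B" "\<phi> x = \<phi> y"
    then have F: "x \<in> F" "y \<in> F" "x - y \<in> F" using F_closed(6) by (auto simp: LL_cond)
    have "- y \<in> LL F K B"
      using LL_subspace[of B] xy(2) subring_minus[OF K_ring subring_one[OF K_ring]]
      unfolding subspace_over_def by (metis mult_minus1)
    then have d: "x - y \<in> LL F K B"
      using LL_subspace[of B] xy(1) unfolding subspace_over_def by (metis add_uminus_conv_diff)
    have "rs Kb Q (s x - s y) 0" using rs_diff[OF \<phi>[OF xy(1)] \<phi>[OF xy(2)]] xy(3) by simp
    then have "s (x - y) \<in> max_ideal P"
      using max_ideal_restrict[OF Q(1)] F_closed(6)[OF sF[OF F(1)] sF[OF F(2)]] Q(2)
      by (simp add: rs_def s_def left_diff_distrib)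
    then have "x - y \<noteq> 0 \<Longrightarrow> val P (x - y) > - B P"
      using P.val_gt_iff[OF p F(3), of "- B P"] by (simp add: s_def)
    then have "val R (x - y) \<ge> - A R" if "place F K R" "x - y \<noteq> 0" for R
      using d that B(1)[of R] B(2) unfolding LL_cond by (cases "R = P") (fastforce, metis)
    then show "x - y \<in> LL F K A" using F(3) unfolding LL_cond by blast
  qed
  then show ?thesis using deg_place_spanning[OF Q(1)] Q(2) by simp
qed

text \<open>Raising one coefficient by 1 at a time, the dimension grows at most as much as the
  degree; the estimate is kept in terms of cardinalities.\<close>

lemma LL_chain:
  assumes S: "finite S" "\<And>P. P \<in> S \<Longrightarrow> place F K P" and out: "\<And>P. P \<notin> S \<Longrightarrow> A P = C P"
    and le: "\<And>P. A P \<le> C P" and fin: "finite (LL F K C)"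
  shows "card (LL F K C) \<le> card (LL F K A) * 49 ^ (\<Sum>P\<in>S. nat (C P - A P) * deg_place K P)"
  using out le fin
proof (induction "\<Sum>P\<in>S. nat (C P - A P)" arbitrary: C)
  case 0
  then have "nat (C P - A P) = 0" if "P \<in> S" for P
    using that S(1) by simp
  then have "C P = A P" for P using 0(2)[of P] 0(3)[of P] by (cases "P \<in> S") (fastforce, simp)
  then have "C = A" by blast
  then show ?case by simp
next
  case (Suc n)
  then have "(\<Sum>P\<in>S. nat (C P - A P)) \<noteq> 0" by simp
  then obtain P where P: "P \<in> S" "nat (C P - A P) \<noteq> 0" by (rule sum.not_neutral_contains_not_neutral)
  define C' where "C' = C(P := C P - 1)"
  have C': "C' R = C R" if "R \<noteq> P" for R using that by (simp add: C'_def)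
  have C'P: "C P = C' P + 1" "nat (C P - A P) = Suc (nat (C' P - A P))" using P(2) by (auto simp: C'_def)
  have split: "(\<Sum>R\<in>S. nat (C R - A R) * f R) = (\<Sum>R\<in>S. nat (C' R - A R) * f R) + f P" for f :: "'a set \<Rightarrow> nat"
  proof -
    have "(\<Sum>R\<in>S - {P}. nat (C R - A R) * f R) = (\<Sum>R\<in>S - {P}. nat (C' R - A R) * f R)"
      by (intro sum.cong refl) (use C' in auto)
    then show ?thesis using C'P(2) S(1) P(1) by (simp add: sum.remove)
  qed
  have fin': "finite (LL F K C')"
    by (rule finite_subset[OF LL_mono Suc.prems(3)]) (simp add: C'_def)
  have "card (LL F K C) \<le> card (LL F K C') * 49 ^ deg_place K P"
    using LL_step[OF S(2)[OF P(1)] fin', of C] C' C'P(1) by simp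
  also have "card (LL F K C') \<le> card (LL F K A) * 49 ^ (\<Sum>P\<in>S. nat (C' P - A P) * deg_place K P)"
  proof (rule Suc.hyps(1))
    show "n = (\<Sum>P\<in>S. nat (C' P - A P))" using split[of "\<lambda>_. 1"] Suc.hyps(2) by simp
    show "A R = C' R" if "R \<notin> S" for R using that P(1) Suc.prems(1) C' by metis
    show "A R \<le> C' R" for R using P(2) Suc.prems(2)[of R] C' by (cases "R = P") (auto simp: C'_def)
  qed (rule fin')
  finally show ?case unfolding split[of "deg_place K"] by (simp add: power_add mult.assoc)
qed

lemma card_subspace: "subspace_over K V \<Longrightarrow> finite V \<Longrightarrow> card V = 49 ^ dim_over K V"
proof -
  assume V: "subspace_over K V" "finite V"
  obtain B :: "'a set" where B: "card V = card K ^ card B" using finite_space_basis[OF K_field finite_K V] by blast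
  then have "dim_over K V = card B" by (intro dim_over_eq[OF K_field finite_K _ V(1)]) (simp add: card_K)
  then show ?thesis using B card_K by simp
qed

section \<open>Multiples of the place at infinity and the Weierstrass semigroup\<close>

definition Qinf :: "'a set" where "Qinf = (SOME Q. inf_place Q)"

definition Pinf :: "'a set" where "Pinf = Qinf \<inter> F"

lemma Qinf: "inf_place Qinf"
  unfolding Qinf_def using inf_place_exists by (rule someI_ex)

lemma Qinf_iff: "inf_place Q \<longleftrightarrow> Q = Qinf"
  using Qinf inf_place_unique by blast

lemma Qinf_plc: "plc Qinf"
  using Qinf by (rule inf_place_plc)

lemma affine_iff: "plc Q \<Longrightarrow> a \<in> Q \<longleftrightarrow> Q \<noteq> Qinf"
  using inf_or_affine Qinf_iff by blast

lemma Pinf_place: "place F K Pinf"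
  unfolding Pinf_def by (rule place_restrict[OF Qinf_plc])

lemma over_Pinf: "plc Q \<Longrightarrow> Q \<inter> F = Pinf \<longleftrightarrow> Q = Qinf"
  using affine_iff[of Q] affine_iff[OF Qinf_plc] F_gens(2) unfolding Pinf_def by blast

lemma Pinf_deg: "deg_place K Pinf = 1"
  unfolding Pinf_def using deg_place_eq_1_iff[OF Qinf_plc] resid_inf[OF Qinf] by simp

lemma val_Pinf:
  assumes "x \<in> F" "x \<noteq> 0" shows "val Pinf x = val Qinf x"
  unfolding Pinf_def using assms F_gens F_closed(9)
  by (intro val_restrict_eq(2)[OF Qinf_plc inf_dval[OF Qinf]]) auto

lemma val_Qinf: "lord Qinf (z / a) Kb x n \<Longrightarrow> val Qinf x = n"
  using vplace.lord_val[OF vplace_plc[OF Qinf_plc] inf_dval[OF Qinf]] by blast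

definition Lc :: "int \<Rightarrow> 'a set" where "Lc n = LL F K (pt_div Pinf n)"

text \<open>Every place of \<open>F\<close> is the restriction of a geometric one, so poles away
  from infinity can be tested over \<open>Kb\<close>; at infinity both valuations agree because the
  parameter \<open>z / a\<close> lies in \<open>F\<close>.\<close>

lemma Lc_iff: "x \<in> Lc n \<longleftrightarrow> x \<in> F \<and> (x = 0 \<or> regular x \<and> val Qinf x \<ge> - n)"
proof -
  have "(\<forall>P. place F K P \<longrightarrow> val P x \<ge> - pt_div Pinf n P) \<longleftrightarrow> regular x \<and> val Qinf x \<ge> - n"
    if x: "x \<in> F" "x \<noteq> 0"
  proof -
    have aff: "val P x \<ge> 0 \<longleftrightarrow> x \<in> P" if P: "place F K P" for P
    proof -
      obtain p where p: "dval F P p" using place_dval[OF P] by blast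
      interpret vplace F K P using vplace_F P by blast
      show ?thesis using val_nonneg_iff[OF p] x by blast
    qed
    show ?thesis
    proof
      assume l: "\<forall>P. place F K P \<longrightarrow> val P x \<ge> - pt_div Pinf n P"
      have "x \<in> Q" if Q: "plc Q" "a \<in> Q" for Q
      proof -
        have "Q \<inter> F \<noteq> Pinf" using over_Pinf affine_iff Q by blast
        then have "val (Q \<inter> F) x \<ge> 0" using l[rule_format, OF place_restrict[OF Q(1)]] by (simp add: pt_div_def)
        then show ?thesis using aff[OF place_restrict[OF Q(1)]] by blast
      qed
      then show "regular x \<and> val Qinf x \<ge> - n"
        using l Pinf_place val_Pinf[OF x] by (auto simp: regular_def pt_div_def)
    next
      assume r: "regular x \<and> val Qinf x \<ge> - n"
      show "\<forall>P. place F K P \<longrightarrow> val P x \<ge> - pt_div Pinf n P"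
      proof (intro allI impI)
        fix P assume P: "place F K P"
        show "val P x \<ge> - pt_div Pinf n P"
        proof (cases "P = Pinf")
          case False
          obtain Q where Q: "plc Q" "Q \<inter> F = P" using place_lift[OF P] by blast
          then have "Q \<noteq> Qinf" using False by (auto simp: Pinf_def)
          then have "x \<in> P" using r Q affine_iff x by (auto simp: regular_def)
          then show ?thesis using False aff[OF P] by (simp add: pt_div_def)
        qed (use r val_Pinf[OF x] in \<open>simp add: pt_div_def\<close>)
      qed
    qed
  qed
  then show ?thesis unfolding Lc_def LL_cond by blast
qed

lemma regular_val:
  assumes "regular x" "x \<noteq> 0"
  obtains d j where "j < (8::nat)" "val Qinf x = - int (8 * d + 5 * (j mod 3) + 7 * (j div 3))"
  using regular_inf_order[OF assms] val_Qinf Qinf by metis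

lemma Lc_minus_one: "Lc (- 1) = {0}"
proof -
  have "x = 0" if "x \<in> Lc (- 1)" for x
  proof (rule ccontr)
    assume "x \<noteq> 0"
    then have "regular x" "val Qinf x \<ge> 1" using that by (auto simp: Lc_iff)
    moreover from this obtain d j where "val Qinf x = - int (8 * d + 5 * (j mod 3) + 7 * (j div 3))"
      using regular_val[OF _ \<open>x \<noteq> 0\<close>] by blast
    ultimately show False using of_nat_0_le_iff[of "8 * d + 5 * (j mod 3) + 7 * (j div 3)"] by linarith
  qed
  then show ?thesis by (auto simp: Lc_iff F_closed)
qed

lemma Lc_gap:
  assumes "\<nexists>d j. j < (8::nat) \<and> n + 1 = int (8 * d + 5 * (j mod 3) + 7 * (j div 3))"
  shows "Lc (n + 1) = Lc n"
proof -
  have "val Qinf x \<noteq> - (n + 1)" if "regular x" "x \<noteq> 0" for x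
    using regular_val[OF that] assms by (metis add.inverse_inverse)
  then show ?thesis unfolding set_eq_iff Lc_iff by force
qed

text \<open>Residues bound the growth by a factor 49, and the elements \<open>c * x + y\<close> with
  \<open>c\<close> in \<open>K\<close> reach this bound: they are different because
  \<open>(c - c') * x\<close> has too large a pole for \<open>Lc n\<close>.\<close>

lemma Lc_nongap:
  assumes fin: "finite (Lc n)" and x: "x \<in> F" "regular x" "x \<noteq> 0" "val Qinf x = - (n + 1)"
  shows "finite (Lc (n + 1)) \<and> card (Lc (n + 1)) = 49 * card (Lc n)"
proof -
  have up: "finite (Lc (n + 1)) \<and> card (Lc (n + 1)) \<le> card (Lc n) * 49 ^ deg_place K Pinf"
    unfolding Lc_def using fin by (intro LL_step[OF Pinf_place]) (auto simp: Lc_def pt_div_def)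
  interpret vplace UNIV Kb Qinf using vplace_plc Qinf_plc by blast
  have xL: "x \<in> Lc (n + 1)" using x by (simp add: Lc_iff)
  have sub: "subspace_over K (Lc m)" for m unfolding Lc_def by (rule LL_subspace)
  define g where "g = (\<lambda>(c, y). c * x + y)"
  have "g ` (K \<times> Lc n) \<subseteq> Lc (n + 1)"
  proof
    fix u assume "u \<in> g ` (K \<times> Lc n)"
    then obtain c y where u: "c \<in> K" "y \<in> Lc n" "u = c * x + y" by (auto simp: g_def)
    then have "y \<in> Lc (n + 1)" by (auto simp: Lc_iff)
    then show "u \<in> Lc (n + 1)" using sub[of "n + 1"] u xL unfolding subspace_over_def by blast
  qed
  moreover have "inj_on g (K \<times> Lc n)"
  proof (rule inj_onI)
    fix u v assume "u \<in> K \<times> Lc n" "v \<in> K \<times> Lc n" "g u = g v"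
    then obtain c y c' y' where u: "u = (c, y)" "v = (c', y')" "c \<in> K" "c' \<in> K" "y \<in> Lc n" "y' \<in> Lc n"
      "c * x + y = c' * x + y'" by (auto simp: g_def)
    have d: "(c - c') * x = y' + (- 1) * y" using u(7) by (simp add: algebra_simps)
    have "- 1 \<in> K" by (rule subring_minus[OF K_ring subring_one[OF K_ring]])
    then have "(c - c') * x \<in> Lc n" unfolding d using sub[of n] u unfolding subspace_over_def by blast
    moreover have "c - c' \<in> K" using u subring_diff[OF K_ring] by blast
    then have "val Qinf ((c - c') * x) = - (n + 1)" if "c \<noteq> c'"
    proof -
      have "val Qinf (c - c') = 0"
        by (rule val_eqI[OF inf_dval[OF Qinf]]) (use unit_k \<open>c - c' \<in> K\<close> K_Kb that in auto)
      then show ?thesis using val_mult[OF inf_dval[OF Qinf], of "c - c'" x] x that by simp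
    qed
    ultimately have "c = c'" using x(3) unfolding Lc_iff by force
    then show "u = v" using u by simp
  qed
  ultimately have "card (K \<times> Lc n) \<le> card (Lc (n + 1))" using up card_inj_on_le by blast
  then show ?thesis using up Pinf_deg card_K by (simp add: card_cartesian_product)
qed

lemma regular_monomial: "regular (w ^ i * z ^ j * a ^ k)" and F_monomial: "w ^ i * z ^ j * a ^ k \<in> F"
  and val_monomial: "val Qinf (w ^ i * z ^ j * a ^ k) = - (5 * int i + 7 * int j + 8 * int k)"
proof -
  show "regular (w ^ i * z ^ j * a ^ k)"
    by (intro regular_cring subring_mult[OF subring_cring[OF Kb_ring]] subring_power[OF subring_cring[OF Kb_ring]] cring_gens)
  show "w ^ i * z ^ j * a ^ k \<in> F" using F_gens by (intro F_closed)
  interpret vplace UNIV Kb Qinf using vplace_plc Qinf_plc by blast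
  note L = inf_orders(1)[OF Qinf Kb_field subset_refl] inf_par_nonzero Kb_field subset_refl
  note o = inf_orders[OF Qinf Kb_field subset_refl]
  have "lord Qinf (z / a) Kb (w ^ i * z ^ j * a ^ k) (int i * - 5 + int j * - 7 + int k * - 8)"
    by (intro lord_mult[OF L] lord_power[OF L] o)
  then show "val Qinf (w ^ i * z ^ j * a ^ k) = - (5 * int i + 7 * int j + 8 * int k)"
    using val_Qinf by fastforce
qed

lemma Lc_nongap_monomial:
  assumes fin: "finite (Lc n)" and n: "n + 1 = 5 * int i + 7 * int j + 8 * int k"
  shows "finite (Lc (n + 1)) \<and> card (Lc (n + 1)) = 49 * card (Lc n)"
  by (rule Lc_nongap[OF fin F_monomial regular_monomial]) (use w_nonzero z_nonzero a_nonzero val_monomial n in auto)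

lemma not_pole_number:
  assumes "n \<in> {1, 2, 3, 4, 6, 9, 11::int}"
  shows "\<nexists>d j. j < (8::nat) \<and> n = int (8 * d + 5 * (j mod 3) + 7 * (j div 3))"
proof
  assume "\<exists>d j. j < (8::nat) \<and> n = int (8 * d + 5 * (j mod 3) + 7 * (j div 3))"
  then obtain d j where "j < (8::nat)" "n = int (8 * d + 5 * (j mod 3) + 7 * (j div 3))" by blast
  then show False using assms unfolding less8 by (elim disjE) (auto, presburger+)
qed

text \<open>Built up from \<open>Lc (- 1) = {0}\<close>: each of the pole numbers 0, 5, 7, 8, 10
  adds one dimension, each gap none.\<close>

lemma card_Lc_small: "finite (Lc 8)" "card (Lc 8) = 49 ^ 4" "finite (Lc 11)" "card (Lc 11) = 49 ^ 5"
proof -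
  have m1: "finite (Lc (- 1)) \<and> card (Lc (- 1)) = 49 ^ 0" unfolding Lc_minus_one by simp
  have 0: "finite (Lc 0) \<and> card (Lc 0) = 49 ^ 1"
    using Lc_nongap_monomial[of "- 1" 0 0 0] m1 by simp
  have gap: "Lc (n + 1) = Lc n" if "n + 1 \<in> {1, 2, 3, 4, 6, 9, 11}" for n
    by (rule Lc_gap[OF not_pole_number[OF that]])
  have g: "Lc 4 = Lc 0" "Lc 6 = Lc 5" "Lc 9 = Lc 8" "Lc 11 = Lc 10"
    using gap[of 0] gap[of 1] gap[of 2] gap[of 3] gap[of 5] gap[of 8] gap[of 10] by simp_all
  have 5: "finite (Lc 5) \<and> card (Lc 5) = 49 ^ 2"
    using Lc_nongap_monomial[of 4 1 0 0] 0 g by simp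
  have 7: "finite (Lc 7) \<and> card (Lc 7) = 49 ^ 3"
    using Lc_nongap_monomial[of 6 0 1 0] 5 g by simp
  have 8: "finite (Lc 8) \<and> card (Lc 8) = 49 ^ 4"
    using Lc_nongap_monomial[of 7 0 0 1] 7 by simp
  have 10: "finite (Lc 10) \<and> card (Lc 10) = 49 ^ 5"
    using Lc_nongap_monomial[of 9 2 0 0] 8 g by simp
  show "finite (Lc 8)" "card (Lc 8) = 49 ^ 4" "finite (Lc 11)" "card (Lc 11) = 49 ^ 5" using 8 10 g by simp_all
qed

text \<open>The five consecutive numbers 12, ..., 16 are sums of 5, 7, 8; adding multiples of 5
  gives the rest.\<close>

lemma pole_numbers_large: "n \<ge> 12 \<Longrightarrow> \<exists>i j k. n = 5 * i + 7 * j + 8 * (k::nat)"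
proof (induction n rule: less_induct)
  case (less n)
  show ?case
  proof (cases "n \<ge> 17")
    case True
    then have "n - 5 < n" "n - 5 \<ge> 12" by simp_all
    then obtain i j k where "n - 5 = 5 * i + 7 * j + 8 * k" using less.IH[of "n - 5"] by blast
    then have "n = 5 * (i + 1) + 7 * j + 8 * k" using True by simp
    then show ?thesis by blast
  next
    case False
    then have "n = 12 \<or> n = 13 \<or> n = 14 \<or> n = 15 \<or> n = 16" using less.prems by auto
    moreover have "12 = 5 * 1 + 7 * 1 + 8 * (0::nat)" "13 = 5 * 1 + 7 * 0 + 8 * (1::nat)"
      "14 = 5 * 0 + 7 * 2 + 8 * (0::nat)" "15 = 5 * 0 + 7 * 1 + 8 * (1::nat)"
      "16 = 5 * 0 + 7 * 0 + 8 * (2::nat)" by simp_all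
    ultimately show ?thesis by metis
  qed
qed

lemma card_Lc: "finite (Lc (int n + 11)) \<and> card (Lc (int n + 11)) = 49 ^ (n + 5)"
proof (induction n)
  case 0
  show ?case using card_Lc_small(3,4) by simp
next
  case (Suc n)
  obtain i j k where "n + 12 = 5 * i + 7 * j + 8 * k" using pole_numbers_large[of "n + 12"] by auto
  then have "int n + 11 + 1 = 5 * int i + 7 * int j + 8 * int k" by linarith
  then have "finite (Lc (int n + 11 + 1)) \<and> card (Lc (int n + 11 + 1)) = 49 * 49 ^ (n + 5)"
    using Lc_nongap_monomial[of "int n + 11" i j k] Suc by simp
  moreover have "int (Suc n) + 11 = int n + 11 + 1" by simp
  moreover have "(49::nat) ^ (Suc n + 5) = 49 * 49 ^ (n + 5)" by (simp only: add_Suc power_Suc)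
  ultimately show ?case by (simp only:)
qed

end

section \<open>The genus\<close>

context curve_K
begin

lemma val_a_minus:
  assumes "cen Q \<alpha> \<beta> \<gamma>" shows "val Q (a - \<alpha>) = (if \<alpha> ^ 3 + \<alpha> = 0 then 8 else 1)"
proof -
  have pt: "pt \<alpha> \<beta> \<gamma>" and Q: "plc Q" and am: "a - \<alpha> \<in> max_ideal Q"
    using assms by (auto simp: cen_def rs_def)
  interpret vplace UNIV Kb Q using vplace_plc Q by blast
  note dv = cen_dval[OF pt assms] and p = par_def[OF pt]
  show ?thesis
  proof (cases "\<alpha> ^ 3 + \<alpha> = 0")
    case True
    then show ?thesis
      using lord_val[OF dv _ subset_refl, of "a - \<alpha>" 8] ram_orders(2)[OF Q am pt_Kb(1)[OF pt] True Kb_field subset_refl]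
      by (simp add: p)
  next
    case False
    then show ?thesis
      using lord_val[OF dv lord_uniformizer[OF par_m[OF pt assms] par_nonzero[OF pt] Kb_field subset_refl] subset_refl]
      by (simp add: p)
  qed
qed

section \<open>The zeros of the functions used to enlarge divisors\<close>

definition over :: "'a \<Rightarrow> 'a set set" where
  "over \<alpha> = {Q. plc Q \<and> a - \<alpha> \<in> max_ideal Q}"

lemma over_cen: "Q \<in> over \<alpha> \<Longrightarrow> \<alpha> \<in> Kb \<Longrightarrow> \<exists>\<beta> \<gamma>. cen Q \<alpha> \<beta> \<gamma>"
proof -
  assume Q: "Q \<in> over \<alpha>" "\<alpha> \<in> Kb"
  then have plc: "plc Q" and r: "rs Kb Q a \<alpha>" by (auto simp: over_def rs_def)
  interpret vplace UNIV Kb Q using vplace_plc plc by blast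
  obtain \<alpha>' \<beta> \<gamma> where c: "cen Q \<alpha>' \<beta> \<gamma>" using affine_cen[OF plc rs_R[OF r]] by blast
  then have "\<alpha>' = \<alpha>" using rs_unique[OF r] by (auto simp: cen_def)
  then show ?thesis using c by blast
qed

text \<open>Over an unramified \<open>\<alpha>\<close> there is at most one place for each root
  \<open>\<beta>\<close> of an equation of degree 8, and \<open>a - \<alpha>\<close> has order 1
  there. Over a ramified one there is at most one place, with order 8.\<close>

lemma over_sum:
  assumes \<alpha>: "\<alpha> \<in> Kb" shows "finite (over \<alpha>) \<and> (\<Sum>Q\<in>over \<alpha>. val Q (a - \<alpha>)) \<le> 8"
proof (cases "\<alpha> ^ 3 + \<alpha> = 0")
  case True
  have "Q = Q'" if Q: "Q \<in> over \<alpha>" "Q' \<in> over \<alpha>" for Q Q'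
  proof -
    obtain \<beta> \<gamma> \<beta>' \<gamma>' where c: "cen Q \<alpha> \<beta> \<gamma>" "cen Q' \<alpha> \<beta>' \<gamma>'" using over_cen Q \<alpha> by metis
    then have pt: "pt \<alpha> \<beta> \<gamma>" "pt \<alpha> \<beta>' \<gamma>'" by (auto simp: cen_def)
    have "\<beta>' = \<beta>" "\<gamma>' = \<gamma>" using ram_cen[OF pt(1) True] ram_cen[OF pt(2) True] by auto
    then show ?thesis using cen_unique[OF pt(1) c(1)] c(2) by simp
  qed
  then have "over \<alpha> = {} \<or> (\<exists>Q. over \<alpha> = {Q})" by blast
  then show ?thesis
  proof (elim disjE exE)
    fix Q assume Q: "over \<alpha> = {Q}"
    then have "Q \<in> over \<alpha>" by blast
    then obtain \<beta> \<gamma> where "cen Q \<alpha> \<beta> \<gamma>" using over_cen \<alpha> by blast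
    then show ?thesis using Q val_a_minus True by simp
  qed simp
next
  case False
  define c where "c = \<alpha> ^ 3 * (\<alpha> ^ 2 + 1)"
  define p where "p = monom 1 8 - [:c:]"
  have "coeff p 8 = 1" by (simp add: p_def eval_nat_numeral)
  then have p0: "p \<noteq> 0" by (metis coeff_0 zero_neq_one)
  have dp: "degree p \<le> 8" unfolding p_def by (intro degree_diff_le) (auto simp: degree_monom_eq)
  have fin: "finite {x. poly p x = 0}" by (rule poly_roots_finite[OF p0])
  have card: "card {x. poly p x = 0} \<le> 8" using card_poly_roots_bound[OF p0] dp by linarith
  have ex: "\<exists>\<beta> \<gamma>. cen Q \<alpha> \<beta> \<gamma>" if "Q \<in> over \<alpha>" for Q using over_cen that \<alpha> by blast
  define b where "b Q = (SOME \<beta>. \<exists>\<gamma>. cen Q \<alpha> \<beta> \<gamma>)" for Q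
  have b: "\<exists>\<gamma>. cen Q \<alpha> (b Q) \<gamma>" if "Q \<in> over \<alpha>" for Q
    unfolding b_def using ex[OF that] by (rule someI_ex)
  have sub: "b ` over \<alpha> \<subseteq> {x. poly p x = 0}"
  proof
    fix x assume "x \<in> b ` over \<alpha>"
    then obtain Q \<gamma> where "cen Q \<alpha> x \<gamma>" using b by blast
    then show "x \<in> {x. poly p x = 0}"
      using curve_eqs_w8[of \<alpha> x \<gamma>] by (simp add: cen_def pt_def p_def poly_monom c_def)
  qed
  have inj: "inj_on b (over \<alpha>)"
  proof (rule inj_onI)
    fix Q Q' assume Q: "Q \<in> over \<alpha>" "Q' \<in> over \<alpha>" "b Q = b Q'"
    obtain \<gamma> \<gamma>' where g: "cen Q \<alpha> (b Q) \<gamma>" "cen Q' \<alpha> (b Q) \<gamma>'" using b Q by metis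
    then have pt: "pt \<alpha> (b Q) \<gamma>" "pt \<alpha> (b Q) \<gamma>'" by (auto simp: cen_def)
    have "\<alpha> * \<gamma> = \<alpha> * \<gamma>'" using pt by (simp add: pt_def curve_eqs_def)
    then have "\<gamma> = \<gamma>'" using unram_nonzero(1)[OF pt(1) False] by simp
    then show "Q = Q'" using g cen_unique[OF pt(1)] by simp
  qed
  have f: "finite (over \<alpha>)" by (rule finite_imageD[OF finite_subset[OF sub fin] inj])
  have "(\<Sum>Q\<in>over \<alpha>. val Q (a - \<alpha>)) = (\<Sum>Q\<in>over \<alpha>. 1)"
    by (intro sum.cong refl) (use ex val_a_minus False in force)
  also have "\<dots> = int (card (over \<alpha>))" by simp
  also have "\<dots> \<le> 8" using card_inj_on_le[OF inj sub fin] card by simp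
  finally show ?thesis using f by simp
qed

text \<open>The roots of \<open>X ^ (49 ^ j) - X\<close> are simple: for a root
  \<open>\<alpha>\<close> the function equals
  \<open>(a - \<alpha>) * ((a - \<alpha>) ^ n - 1)\<close>, and the second factor has residue
  -1.\<close>

lemma frob_a_val:
  assumes Q: "plc Q" "a \<in> Q" and j: "j > 0" and pos: "a ^ (49 ^ j) - a \<in> max_ideal Q"
  shows "\<exists>\<alpha>\<in>Kb. \<alpha> ^ (49 ^ j) = \<alpha> \<and> Q \<in> over \<alpha> \<and> val Q (a ^ (49 ^ j) - a) = val Q (a - \<alpha>)"
proof -
  interpret vplace UNIV Kb Q using vplace_plc Q by blast
  obtain \<alpha> \<beta> \<gamma> where c: "cen Q \<alpha> \<beta> \<gamma>" using affine_cen[OF Q] by blast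
  then have pt: "pt \<alpha> \<beta> \<gamma>" and r: "rs Kb Q a \<alpha>" by (auto simp: cen_def)
  have "rs Kb Q (a ^ (49 ^ j) - a) (\<alpha> ^ (49 ^ j) - \<alpha>)" by (intro rs_diff rs_power r)
  then have al: "\<alpha> ^ (49 ^ j) = \<alpha>" using rs_m_iff pos by auto
  define n :: nat where "n = 49 ^ j - 1"
  have "(49::nat) ^ j > 1" by (rule one_less_power) (use j in auto)
  then have n: "n > 0" "Suc n = 49 ^ j" by (auto simp: n_def)
  have am: "a - \<alpha> \<in> max_ideal Q" using r by (simp add: rs_def)
  have "a ^ (49 ^ j) - a = (a - \<alpha>) ^ (49 ^ j) - (a - \<alpha>)" unfolding frob_diff al by simp
  also have "\<dots> = (a - \<alpha>) * ((a - \<alpha>) ^ n - 1)" unfolding n(2)[symmetric] by (simp add: algebra_simps)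
  finally have eq: "a ^ (49 ^ j) - a = (a - \<alpha>) * ((a - \<alpha>) ^ n - 1)" .
  have "rs Kb Q ((a - \<alpha>) ^ n - 1) (0 - 1)"
    by (intro rs_diff rs_m m_power am n rs_const Kb_closed(1))
  then have u: "is_unit_in Q ((a - \<alpha>) ^ n - 1)" using rs_R rs_m_iff unit_iff by fastforce
  have "val Q ((a - \<alpha>) ^ n - 1) = 0" by (rule val_eqI[OF cen_dval[OF pt c]]) (use u in simp)
  then have "val Q (a ^ (49 ^ j) - a) = val Q (a - \<alpha>)"
    unfolding eq using val_mult[OF cen_dval[OF pt c], of "a - \<alpha>" "(a - \<alpha>) ^ n - 1"] a_minus_nonzero[OF pt] u
    by (simp add: is_unit_in_def)
  then show ?thesis using al pt_Kb[OF pt] am Q by (auto simp: over_def)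
qed

text \<open>Riemann's theorem needs that the zeros of a function outside infinity do not have larger degree
  than its pole. This is only needed for the functions \<open>a ^ (49 ^ j) - a\<close>, whose zeros are known.\<close>
definition zset :: "nat \<Rightarrow> 'a set set" where
  "zset j = {Q. plc Q \<and> a \<in> Q \<and> a ^ (49 ^ j) - a \<in> max_ideal Q}"

text \<open>At most \<open>49 ^ j\<close> abscissas contribute, each at most 8. The bound is the
  pole order at infinity, so the zeros do not outweigh the pole.\<close>

lemma zset_sum:
  assumes j: "j > 0"
  shows "finite (zset j) \<and> (\<Sum>Q\<in>zset j. val Q (a ^ (49 ^ j) - a)) \<le> 8 * 49 ^ j"
proof -
  define A where "A = {\<alpha> \<in> Kb. \<alpha> ^ (49 ^ j) = \<alpha>}"
  have "A \<subseteq> {x. x ^ (49 ^ j) = x}" by (auto simp: A_def)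
  then have A: "finite A" "card A \<le> 49 ^ j"
    using finite_subset[OF _ frob_root_count(1)[OF j]] card_mono[OF frob_root_count(1)[OF j], of A]
      frob_root_count(2)[OF j] by auto
  have ov: "finite (over \<alpha>)" "(\<Sum>Q\<in>over \<alpha>. val Q (a - \<alpha>)) \<le> 8" if "\<alpha> \<in> A" for \<alpha>
    using over_sum that by (auto simp: A_def)
  have sub: "zset j \<subseteq> (\<Union>\<alpha>\<in>A. over \<alpha>)"
  proof
    fix Q assume "Q \<in> zset j"
    then have "plc Q" "a \<in> Q" "a ^ (49 ^ j) - a \<in> max_ideal Q" by (auto simp: zset_def)
    from frob_a_val[OF this(1,2) j this(3)] show "Q \<in> (\<Union>\<alpha>\<in>A. over \<alpha>)" by (auto simp: A_def)
  qed
  have fin: "finite (zset j)" using finite_subset[OF sub] A(1) ov(1) by blast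
  have disj: "over \<alpha> \<inter> over \<alpha>' = {}" if ne: "\<alpha> \<in> A" "\<alpha>' \<in> A" "\<alpha> \<noteq> \<alpha>'" for \<alpha> \<alpha>'
  proof (rule ccontr)
    assume "over \<alpha> \<inter> over \<alpha>' \<noteq> {}"
    then obtain Q where Q: "Q \<in> over \<alpha>" "Q \<in> over \<alpha>'" by blast
    then have Q': "plc Q" "rs Kb Q a \<alpha>" "rs Kb Q a \<alpha>'" using ne by (auto simp: over_def rs_def A_def)
    interpret vplace UNIV Kb Q using vplace_plc Q' by blast
    show False using rs_unique[OF Q'(2,3)] ne by simp
  qed
  have eqv: "val Q (a ^ (49 ^ j) - a) = val Q (a - \<alpha>)" if "\<alpha> \<in> A" "Q \<in> over \<alpha>" "Q \<in> zset j" for Q \<alpha>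
  proof -
    have "plc Q" "a \<in> Q" "a ^ (49 ^ j) - a \<in> max_ideal Q" using that(3) by (auto simp: zset_def)
    from frob_a_val[OF this(1,2) j this(3)] obtain \<alpha>' where
      "\<alpha>' \<in> A" "Q \<in> over \<alpha>'" "val Q (a ^ (49 ^ j) - a) = val Q (a - \<alpha>')" by (auto simp: A_def)
    then show ?thesis using disj[OF that(1), of \<alpha>'] that(2) by blast
  qed
  have vpos: "val Q (a - \<alpha>) \<ge> 0" if "\<alpha> \<in> A" "Q \<in> over \<alpha>" for Q \<alpha>
    using over_cen[OF that(2)] val_a_minus that(1) by (fastforce simp: A_def)
  have "(\<Sum>Q\<in>zset j. val Q (a ^ (49 ^ j) - a)) = (\<Sum>Q\<in>(\<Union>\<alpha>\<in>A. over \<alpha> \<inter> zset j). val Q (a ^ (49 ^ j) - a))"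
    using sub by (intro sum.cong refl) blast
  also have "\<dots> = (\<Sum>\<alpha>\<in>A. \<Sum>Q\<in>over \<alpha> \<inter> zset j. val Q (a ^ (49 ^ j) - a))"
  proof (rule sum.UNION_disjoint[OF A(1)])
    show "\<forall>\<alpha>\<in>A. finite (over \<alpha> \<inter> zset j)" using fin by simp
    show "\<forall>\<alpha>\<in>A. \<forall>\<alpha>'\<in>A. \<alpha> \<noteq> \<alpha>' \<longrightarrow> over \<alpha> \<inter> zset j \<inter> (over \<alpha>' \<inter> zset j) = {}"
      using disj by blast
  qed
  also have "\<dots> \<le> (\<Sum>\<alpha>\<in>A. 8)"
  proof (intro sum_mono)
    fix \<alpha> assume \<alpha>: "\<alpha> \<in> A"
    have "(\<Sum>Q\<in>over \<alpha> \<inter> zset j. val Q (a ^ (49 ^ j) - a)) = (\<Sum>Q\<in>over \<alpha> \<inter> zset j. val Q (a - \<alpha>))"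
      by (intro sum.cong refl) (use eqv \<alpha> in blast)
    also have "\<dots> \<le> (\<Sum>Q\<in>over \<alpha>. val Q (a - \<alpha>))"
      by (intro sum_mono2) (use ov \<alpha> vpos in auto)
    finally show "(\<Sum>Q\<in>over \<alpha> \<inter> zset j. val Q (a ^ (49 ^ j) - a)) \<le> 8" using ov(2)[OF \<alpha>] by linarith
  qed
  also have "\<dots> = 8 * int (card A)" by simp
  also have "\<dots> \<le> 8 * 49 ^ j" using A(2) by (metis mult_left_mono of_nat_le_iff of_nat_numeral of_nat_power zero_le_numeral)
  finally show ?thesis using fin by simp
qed

lemma val_frob_inf: "j > 0 \<Longrightarrow> val Qinf (a ^ (49 ^ j) - a) = - (8 * 49 ^ j)"
proof -
  assume j: "j > 0"
  interpret vplace UNIV Kb Qinf using vplace_plc Qinf_plc by blast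
  note L = inf_orders(1)[OF Qinf Kb_field subset_refl] inf_par_nonzero Kb_field subset_refl
  note oa = inf_orders(2)[OF Qinf Kb_field subset_refl]
  have "(49::nat) ^ j > 1" by (rule one_less_power) (use j in auto)
  then have "int (49 ^ j) * - 8 < - 8" by linarith
  then have "lord Qinf (z / a) Kb (a ^ (49 ^ j) + - a) (int (49 ^ j) * - 8)"
    by (rule lord_add_less[OF L lord_power[OF L oa] lord_minus[OF L oa]])
  then show ?thesis using val_Qinf by fastforce
qed

lemma common_period:
  assumes "finite S" "\<And>x. x \<in> S \<Longrightarrow> x \<in> Kb" shows "\<exists>j>0. \<forall>x\<in>S. x ^ (49 ^ j) = x"
  using assms
proof (induction S rule: finite_induct)
  case (insert x S)
  then obtain i j where ij: "i > 0" "\<forall>x\<in>S. x ^ (49 ^ i) = x" "j > 0" "x ^ (49 ^ j) = x"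
    using Kb_periodic[of x] by auto
  have "\<forall>y\<in>insert x S. y ^ (49 ^ (i * j)) = y"
    using frob_period_mult[of x j i] frob_period_mult[of _ i j] ij by (auto simp: mult.commute)
  then show ?case using ij by (intro exI[of _ "i * j"]) simp
qed auto

lemma deg_div_sum:
  assumes "finite S" "{R. A R \<noteq> 0} \<subseteq> S" shows "deg_div K A = (\<Sum>R\<in>S. A R * int (deg_place K R))"
  unfolding deg_div_def using assms by (intro sum.mono_neutral_left) auto

text \<open>\<open>A\<close> is enlarged to a divisor \<open>C\<close> that differs from
  \<open>n\<close> times infinity by the divisor of a function \<open>f\<close>. So
  \<open>LL F K C\<close> is isomorphic to \<open>Lc n\<close>, of known dimension
  \<open>n - 6\<close>, while the degree of \<open>C\<close> is at most \<open>n\<close>. From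
  \<open>A\<close> to \<open>C\<close> the dimension grows at most as much as the degree, hence
  degree minus dimension of \<open>A\<close> is at most 6.\<close>

lemma riemann:
  assumes A: "is_divisor F K A" shows "deg_div K A - int (ell F K A) + 1 \<le> 7"
proof -
  define S where "S = {P. A P \<noteq> 0}"
  have S: "finite S" "\<And>P. P \<in> S \<Longrightarrow> place F K P" using A by (auto simp: is_divisor_def S_def)
  have "\<forall>P\<in>S - {Pinf}. \<exists>Q \<alpha>. plc Q \<and> Q \<inter> F = P \<and> a \<in> Q \<and> rs Kb Q a \<alpha>"
  proof
    fix P assume P: "P \<in> S - {Pinf}"
    then obtain Q where Q: "plc Q" "Q \<inter> F = P" using place_lift S by blast
    then have "a \<in> Q" using affine_iff[OF Q(1)] over_Pinf[OF Q(1)] P by blast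
    then show "\<exists>Q \<alpha>. plc Q \<and> Q \<inter> F = P \<and> a \<in> Q \<and> rs Kb Q a \<alpha>" using Q residue_exists by blast
  qed
  then obtain q c where q: "\<And>P. P \<in> S - {Pinf} \<Longrightarrow> plc (q P) \<and> q P \<inter> F = P \<and> a \<in> q P \<and> rs Kb (q P) a (c P)"
    by metis
  have "x \<in> Kb" if "x \<in> c ` (S - {Pinf})" for x using that q by (auto simp: rs_def)
  then have "\<exists>j>0. \<forall>x\<in>c ` (S - {Pinf}). x ^ (49 ^ j) = x" by (intro common_period) (use S(1) in simp)
  then obtain j where j: "j > 0" and "\<forall>x\<in>c ` (S - {Pinf}). x ^ (49 ^ j) = x" by (elim exE conjE)
  then have cj: "c P ^ (49 ^ j) = c P" if "P \<in> S - {Pinf}" for P using that by (metis imageI)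
  \<comment> \<open>\<open>j\<close> makes \<open>g\<close> vanish at every place of the support
    except \<open>Pinf\<close>; the power \<open>k\<close> makes its zeros dominate all coefficients
    of \<open>A\<close>.\<close>
  define k where "k = nat (\<Sum>P\<in>S. \<bar>A P\<bar>)"
  have k: "A P \<le> int k" if "P \<in> S" for P
    using member_le_sum[of P S "\<lambda>P. \<bar>A P\<bar>"] that S(1) by (simp add: k_def)
  define g where "g = a ^ (49 ^ j) - a"
  define f where "f = g ^ k"
  have g: "g \<in> F" "g \<noteq> 0" unfolding g_def using F_gens frob_a[OF j] by (auto intro!: F_closed)
  have f: "f \<in> F" "f \<noteq> 0" unfolding f_def using g F_closed by auto
  define m where "m = 8 * 49 ^ j * k"
  \<comment> \<open>After subtraction of the pole order \<open>m\<close> of \<open>f\<close>, enough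
    is left to dominate \<open>A Pinf\<close>; the summand 11 reaches the range where every
    dimension is known.\<close>
  define n where "n = int (m + nat \<bar>A Pinf\<bar>) + 11"
  have vfQ: "val Q f = int k * val Q g" if Q: "plc Q" for Q
  proof -
    interpret vplace UNIV Kb Q using vplace_plc Q by blast
    obtain p where "dval UNIV Q p" using plc_dval Q by blast
    then show ?thesis unfolding f_def using val_power g by blast
  qed
  have fP: "val P f \<ge> 0" "f \<in> P" "g \<in> P" if P: "place F K P" "P \<noteq> Pinf" for P
  proof -
    obtain Q where Q: "plc Q" "Q \<inter> F = P" using place_lift[OF P(1)] by blast
    then have "a \<in> Q" using affine_iff[OF Q(1)] over_Pinf[OF Q(1)] P by blast
    interpret vplace UNIV Kb Q using vplace_plc Q by blast
    have "g \<in> Q" "f \<in> Q" unfolding f_def g_def using \<open>a \<in> Q\<close> by (auto intro!: R_diff R_power)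
    then show "f \<in> P" "g \<in> P" using Q f g by blast+
    obtain p where p: "dval F P p" using place_dval[OF P(1)] by blast
    interpret P: vplace F K P using vplace_F P by blast
    show "val P f \<ge> 0" using P.val_nonneg_iff[OF p f] \<open>f \<in> P\<close> by blast
  qed
  have vf_inf: "val Qinf f = - int m" using vfQ[OF Qinf_plc] val_frob_inf[OF j] by (simp add: g_def m_def)
  \<comment> \<open>This is \<open>n\<close> times infinity plus the divisor of \<open>f\<close>,
    whose order at infinity is \<open>- m\<close>.\<close>
  define C where "C P = (if P = Pinf then n - int m else if place F K P then val P f else 0)" for P
  define T where "T = insert Pinf (S \<union> (\<lambda>Q. Q \<inter> F) ` zset j)"
  have T: "finite T" "\<And>P. P \<in> T \<Longrightarrow> place F K P"
    using S Pinf_place place_restrict zset_sum[OF j] by (auto simp: T_def zset_def)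
  have g_zset: "Q \<in> zset j"
    if h: "plc Q" "Q \<inter> F = P" "P \<noteq> Pinf" "val P f \<noteq> 0" "place F K P" for P Q
  proof -
    have aQ: "a \<in> Q" using affine_iff[OF h(1)] over_Pinf[OF h(1)] h by blast
    obtain p where p: "dval F P p" using place_dval[OF h(5)] by blast
    interpret P: vplace F K P using vplace_F h by blast
    have "val P g \<noteq> 0" using h(4) P.val_power[OF p g, of k] by (simp add: f_def)
    then have "val P g > 0" using P.val_nonneg_iff[OF p g] fP(3)[OF h(5,3)] by simp
    then have "g \<in> max_ideal P" using P.val_pos_iff[OF p g] by simp
    then show ?thesis using max_ideal_restrict[OF h(1)] h(1,2) aQ by (auto simp: zset_def g_def)
  qed
  have Cout: "C P = 0" if "P \<notin> T" for P
  proof (rule ccontr)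
    assume nz: "C P \<noteq> 0"
    have P: "P \<noteq> Pinf" using that by (auto simp: T_def)
    then have pl: "place F K P" "val P f \<noteq> 0" using nz by (auto simp: C_def split: if_splits)
    obtain Q where Q: "plc Q" "Q \<inter> F = P" using place_lift[OF pl(1)] by blast
    then have "Q \<in> zset j" using g_zset P pl by blast
    then show False using that Q by (auto simp: T_def)
  qed
  have Aout: "A P = C P" if "P \<notin> T" for P using that Cout by (auto simp: T_def S_def)
  have AC: "A P \<le> C P" for P
  proof (cases "P = Pinf \<or> P \<notin> S")
    case True
    then show ?thesis using fP(1)[of P] by (cases "P = Pinf") (simp_all add: C_def n_def S_def)
  next
    case False
    then have P: "P \<in> S - {Pinf}" "place F K P" using S by auto
    have q': "plc (q P)" "q P \<inter> F = P" "a \<in> q P" "rs Kb (q P) a (c P)" using q[OF P(1)] by auto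
    have "g \<in> max_ideal (q P)" unfolding g_def using rs_frob_a[OF q'(1,4) cj[OF P(1)]] .
    then have gm: "g \<in> max_ideal P" using max_ideal_restrict[OF q'(1), of g] q'(2) g(1) by simp
    obtain p where p: "dval F P p" using place_dval[OF P(2)] by blast
    interpret P: vplace F K P using vplace_F P by blast
    have "val P g \<ge> 1" using P.val_pos_iff[OF p g] gm by simp
    then have "val P f \<ge> int k" using P.val_power[OF p g, of k] mult_left_mono[of 1 "val P g" "int k"] by (simp add: f_def)
    then show ?thesis using k[of P] P False by (simp add: C_def)
  qed
  have LC: "x \<in> LL F K C \<longleftrightarrow> x * f \<in> Lc n" if x: "x \<in> F" for x
  proof (cases "x = 0")
    case True
    then show ?thesis by (simp add: LL_cond Lc_def F_closed)
  next
    case False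
    have "val P x \<ge> - C P \<longleftrightarrow> val P (x * f) \<ge> - pt_div Pinf n P" if P: "place F K P" for P
    proof -
      obtain p where p: "dval F P p" using place_dval[OF P] by blast
      interpret P: vplace F K P using vplace_F P by blast
      have "val P (x * f) = val P x + val P f" using P.val_mult[OF p x f(1) False f(2)] .
      then show ?thesis using P val_Pinf[OF f] vf_inf by (auto simp: C_def pt_div_def)
    qed
    then show ?thesis using False f x F_closed(4) by (simp add: LL_cond Lc_def)
  qed
  have bij: "bij_betw (\<lambda>x. x * f) (LL F K C) (Lc n)"
  proof (rule bij_betw_byWitness[where f' = "\<lambda>y. y / f"])
    have "x \<in> F" if "x \<in> LL F K C" for x using that by (simp add: LL_cond)
    then show "(\<lambda>x. x * f) ` LL F K C \<subseteq> Lc n" using LC by blast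
    show "(\<lambda>y. y / f) ` Lc n \<subseteq> LL F K C"
    proof
      fix u assume "u \<in> (\<lambda>y. y / f) ` Lc n"
      then obtain y where y: "y \<in> Lc n" "u = y / f" by blast
      have "u \<in> F" using y f F_closed(9) by (auto simp: Lc_iff)
      then show "u \<in> LL F K C" using LC y f by simp
    qed
  qed (use f in auto)
  have finn: "finite (Lc n)" and cardn: "card (Lc n) = 49 ^ (m + nat \<bar>A Pinf\<bar> + 5)"
    using card_Lc[of "m + nat \<bar>A Pinf\<bar>"] unfolding n_def by blast+
  have cardC: "card (LL F K C) = card (Lc n)" and finC: "finite (LL F K C)"
    using bij_betw_same_card[OF bij] bij_betw_finite[OF bij] finn by blast+
  define E where "E = (\<Sum>P\<in>T. nat (C P - A P) * deg_place K P)"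
  have "card (LL F K C) \<le> card (LL F K A) * 49 ^ E"
    unfolding E_def by (rule LL_chain[OF T Aout AC finC])
  also have "card (LL F K A) = 49 ^ ell F K A"
    unfolding ell_def by (rule card_subspace[OF LL_subspace finite_subset[OF LL_mono finC]]) (rule AC)
  finally have "(49::nat) ^ (m + nat \<bar>A Pinf\<bar> + 5) \<le> 49 ^ (ell F K A + E)"
    unfolding cardC cardn by (simp only: power_add)
  then have "m + nat \<bar>A Pinf\<bar> + 5 \<le> ell F K A + E" by (simp only: power_increasing_iff[of "49::nat"])
  then have main: "n - 6 \<le> int (ell F K A) + int E" by (simp add: n_def)
  have "int E = (\<Sum>P\<in>T. (C P - A P) * int (deg_place K P))"
    unfolding E_def using AC by (simp add: of_nat_diff)
  also have "\<dots> = deg_div K C - deg_div K A"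
    using T(1) Cout Aout by (subst (1 2) deg_div_sum[of T]) (auto simp: left_diff_distrib sum_subtractf)
  finally have E: "int E = deg_div K C - deg_div K A" .
  have "deg_div K C \<le> n"
  proof -
    define T' where "T' = {P \<in> T - {Pinf}. val P f \<noteq> 0}"
    have finT': "finite T'" using T by (simp add: T'_def)
    have "deg_div K C = (\<Sum>P\<in>T. C P * int (deg_place K P))" by (rule deg_div_sum) (use T Cout in auto)
    also have "\<dots> = C Pinf * int (deg_place K Pinf) + (\<Sum>P\<in>T - {Pinf}. C P * int (deg_place K P))"
      using T(1) by (intro sum.remove) (auto simp: T_def)
    also have "(\<Sum>P\<in>T - {Pinf}. C P * int (deg_place K P)) = (\<Sum>P\<in>T'. val P f * int (deg_place K P))"
      using T by (intro sum.mono_neutral_cong_right) (auto simp: T'_def C_def)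
    also have "\<dots> \<le> int m"
    proof -
      \<comment> \<open>A place of degree \<open>d\<close> is replaced by \<open>d\<close> geometric
        places above it, where \<open>f\<close> has at least the same order. All of them lie in
        \<open>zset j\<close>, whose total is bounded by the pole order.\<close>
      have "\<forall>P\<in>T'. \<exists>U. card U = deg_place K P \<and> U \<subseteq> {Q. plc Q \<and> Q \<inter> F = P}"
      proof
        fix P assume "P \<in> T'"
        then obtain Q where Q: "plc Q" "Q \<inter> F = P" using place_lift T by (auto simp: T'_def)
        then show "\<exists>U. card U = deg_place K P \<and> U \<subseteq> {Q. plc Q \<and> Q \<inter> F = P}" using deg_le_fibre[OF Q(1)] by metis
      qed
      then obtain U where U: "\<And>P. P \<in> T' \<Longrightarrow> card (U P) = deg_place K P \<and> U P \<subseteq> {Q. plc Q \<and> Q \<inter> F = P}" by metis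
      have UZ: "U P \<subseteq> zset j" if "P \<in> T'" for P
        using U[OF that] g_zset[of _ P] that T(2) by (auto simp: T'_def)
      have finZ: "finite (zset j)" using zset_sum[OF j] by blast
      have "(\<Sum>P\<in>T'. val P f * int (deg_place K P)) \<le> (\<Sum>P\<in>T'. \<Sum>Q\<in>U P. val Q f)"
      proof (intro sum_mono)
        fix P assume P: "P \<in> T'"
        have "val Q f \<ge> val P f" if Q: "Q \<in> U P" for Q
        proof -
          have Q': "plc Q" "Q \<inter> F = P" using U[OF P] Q by auto
          obtain e p where e: "e > 0" "dval F (Q \<inter> F) p" "\<And>x. x \<in> F \<Longrightarrow> x \<noteq> 0 \<Longrightarrow> val Q x = e * val (Q \<inter> F) x"
            using val_restrict[OF Q'(1)] by metis
          have "val P f \<ge> 0" using fP(1) P T by (auto simp: T'_def)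
          then show ?thesis using e(1) e(3)[OF f] Q'(2) mult_right_mono[of 1 e "val P f"] by simp
        qed
        then have "(\<Sum>Q\<in>U P. val P f) \<le> (\<Sum>Q\<in>U P. val Q f)" by (rule sum_mono)
        then show "val P f * int (deg_place K P) \<le> (\<Sum>Q\<in>U P. val Q f)" using U[OF P] by (simp add: mult.commute)
      qed
      also have "\<dots> = (\<Sum>Q\<in>(\<Union>P\<in>T'. U P). val Q f)"
      proof (rule sum.UNION_disjoint[symmetric, OF finT'])
        show "\<forall>P\<in>T'. finite (U P)" using UZ finZ finite_subset by blast
        show "\<forall>P\<in>T'. \<forall>P'\<in>T'. P \<noteq> P' \<longrightarrow> U P \<inter> U P' = {}" using U by blast
      qed
      also have "\<dots> \<le> (\<Sum>Q\<in>zset j. val Q f)"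
      proof (intro sum_mono2 finZ)
        show "(\<Union>P\<in>T'. U P) \<subseteq> zset j" using UZ by blast
        fix Q assume "Q \<in> zset j - (\<Union>P\<in>T'. U P)"
        then have Q: "plc Q" "g \<in> max_ideal Q" by (auto simp: zset_def g_def)
        interpret vplace UNIV Kb Q using vplace_plc Q by blast
        obtain p where "dval UNIV Q p" using plc_dval Q by blast
        then have "val Q g > 0" using val_pos_iff g Q by blast
        then show "val Q f \<ge> 0" using vfQ[OF Q(1)] by simp
      qed
      also have "\<dots> = (\<Sum>Q\<in>zset j. int k * val Q g)" by (intro sum.cong refl vfQ) (simp add: zset_def)
      also have "\<dots> = int k * (\<Sum>Q\<in>zset j. val Q g)" by (simp add: sum_distrib_left)
      also have "\<dots> \<le> int k * (8 * 49 ^ j)" using zset_sum[OF j] by (intro mult_left_mono) (auto simp: g_def)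
      finally show ?thesis by (simp add: m_def mult_ac)
    qed
    finally have "deg_div K C \<le> C Pinf * int (deg_place K Pinf) + int m" by simp
    moreover have "C Pinf = n - int m" by (simp add: C_def)
    ultimately show ?thesis using Pinf_deg by simp
  qed
  then show ?thesis using main E by linarith
qed

lemma dim_Lc: "finite (Lc n) \<Longrightarrow> card (Lc n) = 49 ^ i \<Longrightarrow> ell F K (pt_div Pinf n) = i"
proof -
  assume "finite (Lc n)" "card (Lc n) = 49 ^ i"
  then have "(49::nat) ^ ell F K (pt_div Pinf n) = 49 ^ i"
    unfolding ell_def Lc_def using card_subspace[OF LL_subspace] by simp
  then show ?thesis by (simp only: power_inject_exp)
qed

theorem genus_eq: "genus F K = 7"
  unfolding genus_def
proof (rule Greatest_equality)
  \<comment> \<open>The largest gap 11 attains the bound, as \<open>11 - 5 + 1 = 7\<close>.\<close>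
  have "is_divisor F K (pt_div Pinf 11)"
    using Pinf_place by (auto simp: is_divisor_def pt_div_def)
  moreover have "deg_div K (pt_div Pinf 11) = 11"
    using deg_div_sum[of "{Pinf}" "pt_div Pinf 11"] Pinf_deg by (auto simp: pt_div_def)
  moreover have "ell F K (pt_div Pinf 11) = 5" using dim_Lc card_Lc_small(3,4) by blast
  ultimately show "\<exists>A. is_divisor F K A \<and> 7 = deg_div K A - int (ell F K A) + 1"
    by (intro exI[of _ "pt_div Pinf 11"]) simp
qed (use riemann in blast)

end

section \<open>Rational places\<close>

context curve_K
begin

text \<open>An algebraic element lies in every valuation ring. Subtracting its residue at infinity,
  which belongs to \<open>K\<close>, gives a regular function with a zero at infinity; the only such
  function is 0.\<close>

lemma constants: assumes x: "x \<in> F" "algebraic_over K x" shows "x \<in> K"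
proof -
  have Q: "x \<in> Q" if "plc Q" for Q
    using vplace.algebraic_R[OF vplace_F[OF place_restrict[OF that]] x] by blast
  interpret vplace UNIV Kb Qinf using vplace_plc Qinf_plc by blast
  obtain c where c: "rs Kb Qinf x c" using residue_exists[OF Qinf_plc Q[OF Qinf_plc]] by blast
  then have cK: "c \<in> K" using resid_inf[OF Qinf] x by (auto simp: resid_def)
  have "regular (x - c)"
    using Q vplace.R_diff[OF vplace_plc] vplace.k_R[OF vplace_plc] cK K_Kb by (auto simp: regular_def)
  moreover have "x - c \<in> max_ideal Qinf" using c by (simp add: rs_def)
  moreover have "\<not> val Qinf u > 0" if "regular u" "u \<noteq> 0" for u
    using regular_val[OF that] by (metis neg_0_less_iff_less of_nat_less_0_iff)
  ultimately have "x - c = 0" using val_pos_iff[OF inf_dval[OF Qinf], of "x - c"] by blast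
  then show ?thesis using cK by simp
qed

lemma resid_rational:
  assumes c: "cen Q \<alpha> \<beta> \<gamma>" shows "resid Q \<subseteq> K \<longleftrightarrow> \<alpha> \<in> K \<and> \<beta> \<in> K \<and> \<gamma> \<in> K"
proof
  have r: "rs Kb Q a \<alpha>" "rs Kb Q w \<beta>" "rs Kb Q z \<gamma>" and plc: "plc Q" using c by (auto simp: cen_def)
  show "\<alpha> \<in> K \<and> \<beta> \<in> K \<and> \<gamma> \<in> K" if "resid Q \<subseteq> K"
    using that r F_gens unfolding resid_def by blast
  assume kk: "\<alpha> \<in> K \<and> \<beta> \<in> K \<and> \<gamma> \<in> K"
  show "resid Q \<subseteq> K"
  proof (cases "\<alpha> ^ 3 + \<alpha> = 0")
    case False
    show ?thesis
    proof
      fix e assume "e \<in> resid Q"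
      then obtain x where x: "x \<in> F" "rs Kb Q x e" by (auto simp: resid_def)
      interpret vplace UNIV Kb Q using vplace_plc plc by blast
      have "rs Kb Q x (e ^ (49 ^ 1))"
      proof (rule frob_transport[OF c False _ x])
        have "\<alpha> ^ (49 ^ 1) = \<alpha>" "\<beta> ^ (49 ^ 1) = \<beta>" "\<gamma> ^ (49 ^ 1) = \<gamma>" using kk K_iff by simp_all
        then show "cen Q (\<alpha> ^ (49 ^ 1)) (\<beta> ^ (49 ^ 1)) (\<gamma> ^ (49 ^ 1))" using c by (simp only:)
      qed
      then have "e = e ^ (49 ^ 1)" by (rule rs_unique[OF x(2)])
      then have "e ^ 49 = e" by (simp only: power_one_right) 
      then show "e \<in> K" using K_iff by blast
    qed
  qed (use resid_ram_cen c in blast)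
qed

text \<open>\<open>x ^ 48 - 1\<close> is \<open>x ^ n - c\<close> times a polynomial
  \<open>h\<close> of degree at most \<open>48 - n\<close>. All 48 nonzero elements of
  \<open>K\<close> are roots, and \<open>h\<close> accounts for at most \<open>48 - n\<close> of
  them.\<close>

lemma K_roots:
  assumes nm: "n * m = 48" and c: "c \<in> K" "c \<noteq> 0" "c ^ m = 1"
  shows "finite {x \<in> K. x ^ n = c} \<and> card {x \<in> K. x ^ n = c} = n"
proof -
  have n0: "n > 0" "m > 0" using nm by (auto intro!: gr0I)
  define p where "p = monom 1 n - [:c:]"
  define h where "h = (\<Sum>i<m. monom (c ^ (m - Suc i)) (n * i))"
  have "coeff p n = 1" using n0 by (simp add: p_def coeff_pCons split: nat.split)
  then have p0: "p \<noteq> 0" by (metis coeff_0 zero_neq_one)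
  have dp: "degree p \<le> n" unfolding p_def by (intro degree_diff_le) (auto simp: degree_monom_eq)
  have "coeff h (n * (m - 1)) = (\<Sum>i<m. if i = m - 1 then c ^ (m - Suc i) else 0)"
    unfolding h_def coeff_sum using n0 by (intro sum.cong refl) auto
  then have "coeff h (n * (m - 1)) = 1" using n0 by simp
  then have h0: "h \<noteq> 0" by (metis coeff_0 zero_neq_one)
  have dh: "degree h \<le> n * (m - 1)" unfolding h_def
  proof (intro degree_sum_le)
    fix i assume "i \<in> {..<m}"
    then have "n * i \<le> n * (m - 1)" using n0 by simp
    then show "degree (monom (c ^ (m - Suc i)) (n * i)) \<le> n * (m - 1)" using degree_monom_le le_trans by blast
  qed simp
  have fac: "x ^ 48 - 1 = poly p x * poly h x" for x
  proof -
    have "x ^ 48 - 1 = (x ^ n) ^ m - c ^ m" using c(3) nm by (simp flip: power_mult)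
    also have "\<dots> = (x ^ n - c) * (\<Sum>i<m. c ^ (m - Suc i) * (x ^ n) ^ i)" by (rule power_diff_sumr2)
    also have "\<dots> = poly p x * poly h x" by (simp add: p_def h_def poly_monom poly_sum power_mult)
    finally show ?thesis .
  qed
  have fp: "finite {x. poly p x = 0}" and fh: "finite {x. poly h x = 0}" using poly_roots_finite p0 h0 by auto
  have eq: "{x \<in> K. x ^ n = c} = K \<inter> {x. poly p x = 0}" by (auto simp: p_def poly_monom)
  have up: "card {x \<in> K. x ^ n = c} \<le> n" unfolding eq
    using card_mono[OF fp, of "K \<inter> {x. poly p x = 0}"] card_poly_roots_bound[OF p0] dp by auto
  have "K - {0} \<subseteq> {x \<in> K. x ^ n = c} \<union> {x. poly h x = 0}"
  proof
    fix x assume x: "x \<in> K - {0}"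
    then have "x ^ 48 = 1" using K_pow48 by blast
    then have "poly p x * poly h x = 0" using fac[of x] by simp
    then show "x \<in> {x \<in> K. x ^ n = c} \<union> {x. poly h x = 0}" unfolding eq using x by auto
  qed
  then have "card (K - {0}) \<le> card ({x \<in> K. x ^ n = c} \<union> {x. poly h x = 0})"
    using finite_K fh by (intro card_mono) auto
  also have "\<dots> \<le> card {x \<in> K. x ^ n = c} + card {x. poly h x = 0}" by (rule card_Un_le)
  finally have "card (K - {0}) \<le> card {x \<in> K. x ^ n = c} + card {x. poly h x = 0}" .
  moreover have "card (K - {0}) = 48"
    using card_K finite_K subring_zero[OF K_ring] by (simp add: card_Diff_singleton)
  moreover have "card {x. poly h x = 0} \<le> n * (m - 1)" using card_poly_roots_bound[OF h0] dh by linarith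
  moreover have "n * (m - 1) + n = n * m" using n0 by (cases m) auto
  then have "n * (m - 1) + n = 48" using nm by simp
  ultimately show ?thesis using up finite_K by simp
qed

section \<open>Counting the rational points\<close>

lemma K_numeral: "(numeral n :: 'a) \<in> K"
proof -
  have "of_nat m \<in> K" for m by (induction m) (auto intro: subring_add[OF K_ring] subring_one[OF K_ring] subring_zero[OF K_ring])
  from this[of "numeral n"] show ?thesis by simp
qed

lemma numeral_mod7: "(numeral n :: 'a) = of_nat (numeral n mod 7)"
proof -
  have "(numeral n :: 'a) = of_nat (numeral n)" by simp
  also have "\<dots> = of_nat (numeral n mod 7 + 7 * (numeral n div 7))" by (simp only: mod_mult_div_eq)
  also have "\<dots> = of_nat (numeral n mod 7) + 7 * of_nat (numeral n div 7)" unfolding of_nat_add of_nat_mult by simp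
  finally show ?thesis unfolding seven by simp
qed

lemma numerals_small: "(4::'a) \<noteq> 0" "(5::'a) \<noteq> 0" "(6::'a) \<noteq> 0"
proof -
  have "(4::'a) = 2 * 2" "(6::'a) = 2 * 3" "(5::'a) * 3 = 15" by simp_all
  moreover have "(15::'a) = 1" using numeral_mod7[of "num.Bit1 (num.Bit1 (num.Bit1 num.One))"] by simp
  ultimately show "(4::'a) \<noteq> 0" "(5::'a) \<noteq> 0" "(6::'a) \<noteq> 0"
    using two_nonzero three_nonzero by (metis mult_eq_0_iff, metis mult_zero_left zero_neq_one, metis mult_eq_0_iff)
qed

text \<open>The abscissas \<open>\<alpha>\<close> of the unramified rational points, for which \<open>\<alpha> ^ 5 + \<alpha> ^ 3\<close> has to be a
  nonzero eighth power. With \<open>N = \<alpha> ^ 8\<close>, \<open>N ^ 6 = 1\<close>, this means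
  \<open>(N ^ 2 - 1) * (N ^ 2 + 1 + \<alpha> ^ 2) = 0\<close>.\<close>
definition absc :: "'a set" where
  "absc = {\<alpha> \<in> K. \<alpha> ^ 3 + \<alpha> \<noteq> 0 \<and> (\<alpha> ^ 3 * (\<alpha> ^ 2 + 1)) ^ 6 = 1}"

lemma cubic_factor: "(x::'a) ^ 3 + x = x * (x ^ 2 + 1)"
  by (simp add: algebra_simps eval_nat_numeral)

lemma absc_iff:
  "\<alpha> \<in> absc \<longleftrightarrow> \<alpha> \<in> K \<and> \<alpha> \<noteq> 0 \<and> \<alpha> ^ 2 \<noteq> - 1 \<and> (\<alpha> ^ 16 = 1 \<or> \<alpha> ^ 2 = - 1 - \<alpha> ^ 16)"
proof -
  have "(\<alpha> ^ 3 * (\<alpha> ^ 2 + 1)) ^ 6 = 1 \<longleftrightarrow> \<alpha> ^ 16 = 1 \<or> \<alpha> ^ 2 = - 1 - \<alpha> ^ 16"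
    if \<alpha>: "\<alpha> \<noteq> 0" "\<alpha> ^ 2 + 1 \<noteq> 0"
  proof -
    define s where "s = \<alpha> ^ 3 * (\<alpha> ^ 2 + 1)"
    have s0: "s \<noteq> 0" using \<alpha> by (simp add: s_def)
    have s: "s = \<alpha> ^ 5 + \<alpha> ^ 3" by (simp add: s_def algebra_simps eval_nat_numeral)
    \<comment> \<open>For nonzero \<open>s\<close>, the condition \<open>s ^ 6 = 1\<close> is tested
      as \<open>s ^ 7 = s\<close>, because the seventh power is additive.\<close>
    have "s ^ 7 = \<alpha> ^ 35 + \<alpha> ^ 21" unfolding s pow7_add by (simp flip: power_mult)
    then have "s ^ 7 - s = \<alpha> ^ 3 * ((\<alpha> ^ 16 - 1) * (\<alpha> ^ 16 + 1 + \<alpha> ^ 2))"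
      unfolding s by (simp add: algebra_simps flip: power_add)
    moreover have "s ^ 7 - s = s * (s ^ 6 - 1)" by (simp add: algebra_simps eval_nat_numeral)
    ultimately have "s * (s ^ 6 - 1) = \<alpha> ^ 3 * ((\<alpha> ^ 16 - 1) * (\<alpha> ^ 16 + 1 + \<alpha> ^ 2))" by simp
    then have "s * (s ^ 6 - 1) = 0 \<longleftrightarrow> \<alpha> ^ 3 * ((\<alpha> ^ 16 - 1) * (\<alpha> ^ 16 + 1 + \<alpha> ^ 2)) = 0" by (simp only:)
    then have "s ^ 6 - 1 = 0 \<longleftrightarrow> \<alpha> ^ 16 - 1 = 0 \<or> \<alpha> ^ 16 + 1 + \<alpha> ^ 2 = 0"
      using s0 \<alpha>(1) by (simp only: mult_eq_0_iff power_not_zero simp_thms)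
    moreover have "\<alpha> ^ 16 + 1 + \<alpha> ^ 2 = \<alpha> ^ 2 - (- 1 - \<alpha> ^ 16)" by simp
    then have "\<alpha> ^ 16 + 1 + \<alpha> ^ 2 = 0 \<longleftrightarrow> \<alpha> ^ 2 = - 1 - \<alpha> ^ 16" by (simp only: right_minus_eq)
    ultimately show ?thesis unfolding s_def by simp
  qed
  then show ?thesis unfolding absc_def cubic_factor by (auto simp: eq_neg_iff_add_eq_0)
qed

text \<open>\<open>x ^ 16\<close> is a cube root of unity, and these are 1, 2, 4 modulo 7; if it is
  not 1, it determines \<open>x ^ 2\<close> as \<open>- 1 - x ^ 16\<close>.\<close>

lemma absc_cases:
  assumes "x \<in> absc" shows "x ^ 16 = 1 \<or> x ^ 2 = 4 \<and> x ^ 16 = 2 \<or> x ^ 2 = 2 \<and> x ^ 16 = 4"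
proof (cases "x ^ 16 = 1")
  case False
  define M where "M = x ^ 16"
  have x: "x \<in> K" "x \<noteq> 0" and x2: "x ^ 2 = - 1 - M"
    using assms False by (auto simp: absc_iff M_def)
  have "M ^ 3 = 1" using K_pow48[OF x] by (simp add: M_def flip: power_mult)
  moreover have "(M - 1) * ((M - 2) * (M - 4)) = M ^ 3 - 1 - 7 * M ^ 2 + 7 * (2 * M) - 7"
    by (simp add: algebra_simps eval_nat_numeral)
  ultimately have "(M - 1) * ((M - 2) * (M - 4)) = 0" unfolding seven by simp
  then have "M = 2 \<or> M = 4" using False by (auto simp: M_def)
  moreover have "- 1 - (2::'a) = 4 - 7" "- 1 - (4::'a) = 2 - 7" by simp_all
  then have "- 1 - (2::'a) = 4" "- 1 - (4::'a) = 2" unfolding seven by simp_all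
  ultimately show ?thesis using x2 unfolding M_def by metis
qed simp

lemma card_absc: "finite absc \<and> card absc = 18"
proof -
  have m1: "(-1::'a) \<in> K" by (rule subring_minus[OF K_ring subring_one[OF K_ring]])
  define A1 where "A1 = {x \<in> K. x ^ 16 = 1}"
  define A2 where "A2 = {x \<in> K. x ^ 2 = - 1}"
  have A1: "finite A1 \<and> card A1 = 16" unfolding A1_def
    by (rule K_roots[where m = 3]) (use subring_one[OF K_ring] in auto)
  have A2: "finite A2 \<and> card A2 = 2" unfolding A2_def
    by (rule K_roots[where m = 24]) (use m1 in auto)
  have sub: "A2 \<subseteq> A1"
  proof
    fix x assume x: "x \<in> A2"
    then have x2: "x \<in> K" "x ^ 2 = - 1" by (auto simp: A2_def)
    have "x ^ 16 = (x ^ 2) ^ 8" by (simp flip: power_mult)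
    also have "\<dots> = 1" unfolding x2(2) by simp
    finally show "x \<in> A1" using x2(1) by (simp add: A1_def)
  qed
  have n: "(16::'a) = 2" "(9::'a) = 2" "(65536::'a) = 2" "(43046721::'a) = 4" "(8::'a) = 1" "(-3::'a) = 4" "(-5::'a) = 2"
    "(14::'a) = 0"
  proof -
    show "(16::'a) = 2" "(9::'a) = 2" "(65536::'a) = 2" "(43046721::'a) = 4" "(8::'a) = 1" "(14::'a) = 0"
      by (subst numeral_mod7, simp)+
    have "(-3::'a) = 4 - 7" "(-5::'a) = 2 - 7" by simp_all
    then show "(-3::'a) = 4" "(-5::'a) = 2" unfolding seven by simp_all
  qed
  \<comment> \<open>The square roots of 4 and of 2, since \<open>3 ^ 2 = 9 = 2\<close>.\<close>
  define B where "B = {2, -2, 3, - 3 :: 'a}"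
  have B_pow: "x \<in> B \<Longrightarrow> x ^ 2 = 4 \<and> x ^ 16 = 2 \<or> x ^ 2 = 2 \<and> x ^ 16 = 4" for x
    unfolding B_def by (auto simp: n(1-5))
  have d: "(4::'a) \<noteq> 2" "(2::'a) \<noteq> 1" "(4::'a) \<noteq> 1" "(4::'a) \<noteq> - 1" "(2::'a) \<noteq> - 1"
  proof -
    have e: "(4::'a) - 2 = 2" "(2::'a) - 1 = 1" "(4::'a) - 1 = 3" "(4::'a) - - 1 = 5" "(2::'a) - - 1 = 3" by simp_all
    show "(4::'a) \<noteq> 2" using e(1) two_nonzero by (metis diff_self)
    show "(2::'a) \<noteq> 1" using e(2) by (metis diff_self zero_neq_one)
    show "(4::'a) \<noteq> 1" using e(3) three_nonzero by (metis diff_self)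
    show "(4::'a) \<noteq> - 1" using e(4) numerals_small(2) by (metis diff_self)
    show "(2::'a) \<noteq> - 1" using e(5) three_nonzero by (metis diff_self)
  qed
  have cardB: "finite B \<and> card B = 4"
  proof -
    have "(2::'a) \<noteq> - 2"
    proof
      assume "(2::'a) = - 2"
      then have "(2::'a) - - 2 = 0" by simp
      then show False using numerals_small(1) by simp
    qed
    moreover have "(3::'a) \<noteq> - 3"
    proof
      assume "(3::'a) = - 3"
      then have "(3::'a) - - 3 = 0" by simp
      then show False using numerals_small(3) by simp
    qed
    moreover have "(2::'a) \<noteq> 3" "(2::'a) \<noteq> - 3" "- 2 \<noteq> (3::'a)" "- 2 \<noteq> (- 3::'a)"
    proof -
      have sq: "(2::'a) ^ 2 = 4" "(3::'a) ^ 2 = 2" "(- 2::'a) ^ 2 = 4" "(- 3::'a) ^ 2 = 2" by (simp_all add: n)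
      show "(2::'a) \<noteq> 3" "(2::'a) \<noteq> - 3" "- 2 \<noteq> (3::'a)" "- 2 \<noteq> (- 3::'a)"
        using sq d(1) by metis+
    qed
    ultimately show ?thesis unfolding B_def by simp
  qed
  have BK: "B \<subseteq> K" unfolding B_def using K_numeral subring_minus[OF K_ring] by auto
  \<comment> \<open>From the 16 solutions of \<open>x ^ 16 = 1\<close> the two ramified abscissas
    are removed, and the four elements of \<open>B\<close> are added.\<close>
  have "absc = (A1 - A2) \<union> B"
  proof (intro equalityI subsetI)
    fix x assume "x \<in> absc"
    then have x: "x \<in> K" "x \<noteq> 0" "x ^ 2 \<noteq> - 1" "x ^ 16 = 1 \<or> x ^ 2 = - 1 - x ^ 16" by (auto simp: absc_iff)
    show "x \<in> (A1 - A2) \<union> B"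
    proof (cases "x ^ 16 = 1")
      case False
      then have "x ^ 2 = 2 ^ 2 \<or> x ^ 2 = 3 ^ 2" using absc_cases[OF \<open>x \<in> absc\<close>] by (auto simp: n)
      then show ?thesis unfolding power2_eq_iff B_def by auto
    qed (use x in \<open>auto simp: A1_def A2_def\<close>)
  next
    fix x assume "x \<in> (A1 - A2) \<union> B"
    then show "x \<in> absc"
    proof
      assume x: "x \<in> A1 - A2"
      then have "x \<noteq> 0" by (auto simp: A1_def)
      then show ?thesis using x by (auto simp: absc_iff A1_def A2_def)
    next
      assume x: "x \<in> B"
      have "- 1 - (2::'a) = 4" "- 1 - (4::'a) = 2" using n(6,7) by simp_all
      moreover have "x \<noteq> 0" using x two_nonzero three_nonzero by (auto simp: B_def)
      ultimately show ?thesis using B_pow[OF x] BK x d by (auto simp: absc_iff)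
    qed
  qed
  moreover have "(A1 - A2) \<inter> B = {}" using B_pow d by (fastforce simp: A1_def)
  moreover have "card (A1 - A2) = 14" using A1 A2 sub by (simp add: card_Diff_subset)
  ultimately show ?thesis using A1 cardB by (simp add: card_Un_disjoint)
qed

definition Kpts :: "('a \<times> 'a \<times> 'a) set" where
  "Kpts = {(\<alpha>, \<beta>, \<gamma>). \<alpha> \<in> K \<and> \<beta> \<in> K \<and> \<gamma> \<in> K \<and> curve_eqs \<alpha> \<beta> \<gamma>}"

lemma Kpts_pt: "(\<alpha>, \<beta>, \<gamma>) \<in> Kpts \<Longrightarrow> pt \<alpha> \<beta> \<gamma>"
  using K_Kb by (auto simp: Kpts_def pt_def)

lemma card_Kpts: "finite Kpts \<and> card Kpts = 147"
proof -
  define R where "R = (\<lambda>r. (r, 0::'a, 0::'a)) ` insert 0 {x \<in> K. x ^ 2 = - 1}"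
  define U where "U = (\<lambda>(\<alpha>, \<beta>). (\<alpha>, \<beta>, \<beta> ^ 3 / \<alpha>)) ` (SIGMA \<alpha>:absc. {\<beta> \<in> K. \<beta> ^ 8 = \<alpha> ^ 3 * (\<alpha> ^ 2 + 1)})"
  have m1: "(-1::'a) \<in> K" by (rule subring_minus[OF K_ring subring_one[OF K_ring]])
  have A2: "finite {x \<in> K. x ^ 2 = - 1} \<and> card {x \<in> K. x ^ 2 = - 1} = 2"
    by (rule K_roots[where m = 24]) (use m1 in auto)
  have R: "finite R \<and> card R = 3" unfolding R_def
    using A2 by (subst card_image) (auto simp: inj_on_def)
  have fib: "finite {\<beta> \<in> K. \<beta> ^ 8 = \<alpha> ^ 3 * (\<alpha> ^ 2 + 1)} \<and> card {\<beta> \<in> K. \<beta> ^ 8 = \<alpha> ^ 3 * (\<alpha> ^ 2 + 1)} = 8"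
    if "\<alpha> \<in> absc" for \<alpha>
  proof (rule K_roots[where m = 6])
    show "\<alpha> ^ 3 * (\<alpha> ^ 2 + 1) \<in> K" "\<alpha> ^ 3 * (\<alpha> ^ 2 + 1) \<noteq> 0" "(\<alpha> ^ 3 * (\<alpha> ^ 2 + 1)) ^ 6 = 1"
      using that subring_closed[OF K_ring] by (auto simp: absc_def)
  qed simp
  have "card (SIGMA \<alpha>:absc. {\<beta> \<in> K. \<beta> ^ 8 = \<alpha> ^ 3 * (\<alpha> ^ 2 + 1)}) = (\<Sum>\<alpha>\<in>absc. 8)"
    using card_absc fib by (subst card_SigmaI) auto
  also have "\<dots> = 144" using card_absc by simp
  finally have U: "finite U \<and> card U = 144" unfolding U_def
    using card_absc fib by (subst card_image) (auto simp: inj_on_def)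
  have "Kpts = R \<union> U"
  proof (intro equalityI subsetI)
    fix x assume x: "x \<in> Kpts"
    then obtain \<alpha> \<beta> \<gamma> where p: "x = (\<alpha>, \<beta>, \<gamma>)" "\<alpha> \<in> K" "\<beta> \<in> K" "\<gamma> \<in> K" "curve_eqs \<alpha> \<beta> \<gamma>" by (auto simp: Kpts_def)
    have pt: "pt \<alpha> \<beta> \<gamma>" using Kpts_pt x p by simp
    show "x \<in> R \<union> U"
    proof (cases "\<alpha> ^ 3 + \<alpha> = 0")
      case True
      then have "\<alpha> = 0 \<or> \<alpha> ^ 2 = - 1" unfolding cubic_factor by (simp add: eq_neg_iff_add_eq_0)
      then show ?thesis using ram_cen[OF pt True] p by (auto simp: R_def)
    next
      case False
      have b8: "\<beta> ^ 8 = \<alpha> ^ 3 * (\<alpha> ^ 2 + 1)" by (rule curve_eqs_w8[OF p(5)])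
      have "(\<beta> ^ 8) ^ 6 = 1" using K_pow48[OF p(3)] unram_nonzero(3)[OF pt False] by (simp flip: power_mult)
      then have "\<alpha> \<in> absc" unfolding b8 using p False by (simp add: absc_def)
      moreover have "\<gamma> = \<beta> ^ 3 / \<alpha>" using p(5) unram_nonzero(1)[OF pt False] by (simp add: curve_eqs_def)
      ultimately show ?thesis unfolding U_def p(1) using b8 p(3) by force
    qed
  next
    fix x assume "x \<in> R \<union> U"
    then show "x \<in> Kpts"
    proof
      assume "x \<in> R"
      then obtain r where r: "x = (r, 0, 0)" "r \<in> K" "r = 0 \<or> r ^ 2 = - 1"
        using subring_zero[OF K_ring] by (auto simp: R_def)
      then have "r ^ 3 + r = 0" unfolding cubic_factor by auto
      then show ?thesis using r subring_zero[OF K_ring] by (simp add: Kpts_def curve_eqs_def)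
    next
      assume "x \<in> U"
      then obtain \<alpha> \<beta> where p: "x = (\<alpha>, \<beta>, \<beta> ^ 3 / \<alpha>)" "\<alpha> \<in> absc" "\<beta> \<in> K" "\<beta> ^ 8 = \<alpha> ^ 3 * (\<alpha> ^ 2 + 1)"
        by (auto simp: U_def)
      then have k: "\<alpha> \<in> K" "\<alpha> \<noteq> 0" by (auto simp: absc_iff)
      have "pt \<alpha> \<beta> (\<beta> ^ 3 / \<alpha>)" by (rule unram_pt) (use k p K_Kb in auto)
      then show ?thesis using p k subfield_divide[OF K_field] subring_power[OF K_ring] by (simp add: Kpts_def pt_def)
    qed
  qed
  moreover have "R \<inter> U = {}"
  proof -
    have "\<alpha> ^ 3 + \<alpha> \<noteq> 0" if "\<alpha> \<in> absc" for \<alpha> using that by (simp add: absc_def)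
    moreover have "r ^ 3 + r = 0" if "r = 0 \<or> r ^ 2 = - 1" for r :: 'a using that unfolding cubic_factor by auto
    ultimately show ?thesis unfolding R_def U_def by fastforce
  qed
  ultimately show ?thesis using R U by (simp add: card_Un_disjoint)
qed

lemma rational_cen:
  assumes Q: "plc Q" and deg: "deg_place K (Q \<inter> F) = 1" and ninf: "Q \<noteq> Qinf"
  shows "\<exists>\<alpha> \<beta> \<gamma>. (\<alpha>, \<beta>, \<gamma>) \<in> Kpts \<and> cen Q \<alpha> \<beta> \<gamma>"
proof -
  obtain \<alpha> \<beta> \<gamma> where c: "cen Q \<alpha> \<beta> \<gamma>" using affine_cen[OF Q] affine_iff[OF Q] ninf by blast
  then have "\<alpha> \<in> K \<and> \<beta> \<in> K \<and> \<gamma> \<in> K" using resid_rational deg deg_place_eq_1_iff[OF Q] by blast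
  then show ?thesis using c by (auto simp: Kpts_def cen_def pt_def)
qed

text \<open>The coordinates lie in \<open>K\<close>, so \<open>a - \<alpha>\<close>,
  \<open>w - \<beta>\<close>, \<open>z - \<gamma>\<close> belong to \<open>F\<close>, and the
  restriction to \<open>F\<close> already knows the center.\<close>

lemma restrict_cen:
  assumes k: "(\<alpha>, \<beta>, \<gamma>) \<in> Kpts" and c: "cen Q \<alpha> \<beta> \<gamma>" and Q': "plc Q'" "Q' \<inter> F = Q \<inter> F"
  shows "cen Q' \<alpha> \<beta> \<gamma>"
proof -
  have Q: "plc Q" using c by (simp add: cen_def)
  have tr: "rs Kb Q' u e" if h: "rs Kb Q u e" "u \<in> F" "e \<in> K" for u e
  proof -
    have "u - e \<in> F" using h F_gens F_closed(6) by blast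
    then have "u - e \<in> max_ideal (Q \<inter> F)"
      using h max_ideal_restrict[OF Q, of "u - e"] by (simp add: rs_def)
    then have "u - e \<in> max_ideal Q'" unfolding Q'(2)[symmetric] using max_ideal_restrict[OF Q'(1)] by blast
    then show ?thesis using h K_Kb by (auto simp: rs_def)
  qed
  have "\<alpha> \<in> K" "\<beta> \<in> K" "\<gamma> \<in> K" using k by (auto simp: Kpts_def)
  then show ?thesis using c Q'(1) tr F_gens by (auto simp: cen_def)
qed

lemma over_rational:
  assumes Q: "plc Q" "deg_place K (Q \<inter> F) = 1" and Q': "plc Q'" "Q' \<inter> F = Q \<inter> F" shows "Q' = Q"
proof (cases "Q = Qinf")
  case True
  then show ?thesis using over_Pinf Q' by (simp add: Pinf_def)
next
  case False
  then obtain \<alpha> \<beta> \<gamma> where c: "(\<alpha>, \<beta>, \<gamma>) \<in> Kpts" "cen Q \<alpha> \<beta> \<gamma>" using rational_cen[OF Q] by blast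
  then show ?thesis using restrict_cen[OF c Q'] cen_unique[OF Kpts_pt[OF c(1)]] by blast
qed

lemma num_rational: "num_rational_places F K = 148"
proof -
  define q where "q = (\<lambda>(\<alpha>, \<beta>, \<gamma>). SOME Q. cen Q \<alpha> \<beta> \<gamma>)"
  have q: "cen (q (\<alpha>, \<beta>, \<gamma>)) \<alpha> \<beta> \<gamma>" if "(\<alpha>, \<beta>, \<gamma>) \<in> Kpts" for \<alpha> \<beta> \<gamma>
    unfolding q_def using someI_ex[OF cen_exists[OF Kpts_pt[OF that]]] by simp
  have inj: "inj_on (\<lambda>x. q x \<inter> F) Kpts"
  proof (rule inj_onI)
    fix x y assume xy: "x \<in> Kpts" "y \<in> Kpts" "q x \<inter> F = q y \<inter> F"
    obtain \<alpha> \<beta> \<gamma> \<alpha>' \<beta>' \<gamma>' where p: "x = (\<alpha>, \<beta>, \<gamma>)" "y = (\<alpha>', \<beta>', \<gamma>')" by (metis prod.exhaust)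
    have c: "cen (q x) \<alpha> \<beta> \<gamma>" "cen (q y) \<alpha>' \<beta>' \<gamma>'" using q xy p by auto
    then have plx: "plc (q y)" by (auto simp: cen_def)
    interpret vplace UNIV Kb "q y" using vplace_plc plx by blast
    have "cen (q y) \<alpha> \<beta> \<gamma>" by (rule restrict_cen[OF _ c(1) plx]) (use xy p in simp_all)
    then have "\<alpha> = \<alpha>'" "\<beta> = \<beta>'" "\<gamma> = \<gamma>'" using c(2) rs_unique by (auto simp: cen_def)
    then show "x = y" using p by simp
  qed
  have "{P. place F K P \<and> deg_place K P = 1} = insert Pinf ((\<lambda>x. q x \<inter> F) ` Kpts)"
  proof (intro equalityI subsetI)
    fix P assume "P \<in> {P. place F K P \<and> deg_place K P = 1}"
    then have P: "place F K P" "deg_place K P = 1" by auto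
    obtain Q where Q: "plc Q" "Q \<inter> F = P" using place_lift[OF P(1)] by blast
    show "P \<in> insert Pinf ((\<lambda>x. q x \<inter> F) ` Kpts)"
    proof (cases "Q = Qinf")
      case True
      then show ?thesis using Q by (simp add: Pinf_def)
    next
      case False
      then obtain \<alpha> \<beta> \<gamma> where k: "(\<alpha>, \<beta>, \<gamma>) \<in> Kpts" "cen Q \<alpha> \<beta> \<gamma>" using rational_cen[OF Q(1)] P Q by blast
      then have "Q = q (\<alpha>, \<beta>, \<gamma>)" using cen_unique[OF Kpts_pt[OF k(1)]] q by blast
      then show ?thesis using k(1) Q by blast
    qed
  next
    fix P assume "P \<in> insert Pinf ((\<lambda>x. q x \<inter> F) ` Kpts)"
    then show "P \<in> {P. place F K P \<and> deg_place K P = 1}"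
    proof
      assume "P \<in> (\<lambda>x. q x \<inter> F) ` Kpts"
      then obtain x where x: "x \<in> Kpts" "P = q x \<inter> F" by blast
      obtain \<alpha> \<beta> \<gamma> where p: "x = (\<alpha>, \<beta>, \<gamma>)" by (metis prod.exhaust)
      have c: "cen (q x) \<alpha> \<beta> \<gamma>" and pl: "plc (q x)" using q[of \<alpha> \<beta> \<gamma>] x p by (auto simp: cen_def)
      have "resid (q x) \<subseteq> K" using resid_rational[OF c] x p by (auto simp: Kpts_def)
      then show ?thesis using x(2) place_restrict[OF pl] deg_place_eq_1_iff[OF pl] by simp
    qed (use Pinf_place Pinf_deg in simp)
  qed
  moreover have "Pinf \<notin> (\<lambda>x. q x \<inter> F) ` Kpts"
  proof
    assume "Pinf \<in> (\<lambda>x. q x \<inter> F) ` Kpts"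
    then obtain x where x: "x \<in> Kpts" "Pinf = q x \<inter> F" by blast
    obtain \<alpha> \<beta> \<gamma> where p: "x = (\<alpha>, \<beta>, \<gamma>)" by (metis prod.exhaust)
    have pl: "plc (q x)" and r: "rs Kb (q x) a \<alpha>" using q[of \<alpha> \<beta> \<gamma>] x p by (auto simp: cen_def)
    interpret vplace UNIV Kb "q x" using vplace_plc pl by blast
    show False using over_Pinf[OF pl] affine_iff[OF pl] x(2) rs_R[OF r] by simp
  qed
  ultimately show ?thesis
    unfolding num_rational_places_def using card_Kpts card_image[OF inj] by simp
qed

theorem maximal: "is_maximal F K 7"
  unfolding is_maximal_def using constants genus_eq num_rational by simp

end

section \<open>Osculating functions\<close>

context curve_K
begin

text \<open>The curve lies on the Hermitian surface \<open>z ^ 8 = a ^ 7 + a + 3 * w ^ 8\<close>;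
  the function \<open>osc\<close> below is the equation of its tangent plane at a point.\<close>

lemma curve_eqs_z8_alt: "curve_eqs \<alpha> \<beta> \<gamma> \<Longrightarrow> \<gamma> ^ 8 = (\<alpha>::'a) ^ 7 + \<alpha> + 3 * \<beta> ^ 8"
proof -
  assume e: "curve_eqs \<alpha> \<beta> \<gamma>"
  show ?thesis unfolding curve_eqs_z8[OF e] curve_eqs_w8[OF e] by (simp add: algebra_simps eval_nat_numeral)
qed

text \<open>On the Hermitian cover \<open>y ^ 8 = x ^ 7 + x\<close> with \<open>a = x ^ 3\<close>, \<open>w = x * y\<close>, \<open>z = y ^ 3\<close>, this is the norm
  of the equation of the tangent line at a point over \<open>(\<alpha>, \<beta>, \<gamma>)\<close>.\<close>
definition osc :: "'a \<Rightarrow> 'a \<Rightarrow> 'a \<Rightarrow> 'a" where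
  "osc \<alpha> \<beta> \<gamma> = \<gamma> ^ 7 * z - a - \<alpha> ^ 7 - 3 * \<beta> ^ 7 * w"

lemma numeral_Kb: "(numeral n :: 'a) \<in> Kb"
  using K_numeral K_Kb by blast

lemma osc_rs:
  assumes pt: "pt \<alpha> \<beta> \<gamma>" and c: "cen Q \<alpha>' \<beta>' \<gamma>'"
  shows "rs Kb Q (osc \<alpha> \<beta> \<gamma>) (\<gamma> ^ 7 * \<gamma>' - \<alpha>' - \<alpha> ^ 7 - 3 * \<beta> ^ 7 * \<beta>')"
proof -
  have r: "rs Kb Q a \<alpha>'" "rs Kb Q w \<beta>'" "rs Kb Q z \<gamma>'" "plc Q" using c by (auto simp: cen_def)
  interpret vplace UNIV Kb Q using vplace_plc r(4) by blast
  show ?thesis unfolding osc_def using pt_Kb[OF pt] numeral_Kb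
    by (intro rs_diff rs_mult r rs_const Kb_closed)
qed

lemma osc_inf: assumes pt: "pt \<alpha> \<beta> \<gamma>" shows "val Qinf (osc \<alpha> \<beta> \<gamma>) = - 8"
proof -
  interpret vplace UNIV Kb Qinf using vplace_plc Qinf_plc by blast
  note o = inf_orders[OF Qinf Kb_field subset_refl]
  note L = o(1) inf_par_nonzero Kb_field subset_refl
  have one: "lord Qinf (z / a) Kb 1 0" using lord_const[OF L, of 1] Kb_closed by simp
  have h: "c * (x * (z / a) powi (- (- 8))) \<in> max_ideal Qinf" if "c \<in> Kb" "lord Qinf (z / a) Kb x n" "n > - 8" for c x n
    by (intro m_mult' k_R that(1) lord_higher[OF L that(2,3)])
  have "\<gamma> ^ 7 * (z * (z / a) powi (- (- 8))) - \<alpha> ^ 7 * (1 * (z / a) powi (- (- 8)))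
      - 3 * \<beta> ^ 7 * (w * (z / a) powi (- (- 8))) \<in> max_ideal Qinf"
    using pt_Kb[OF pt] numeral_Kb
    by (intro m_diff h[OF _ o(3)] h[OF _ o(4)] h[OF _ one] Kb_closed) auto
  then have "(\<gamma> ^ 7 * z - \<alpha> ^ 7 - 3 * \<beta> ^ 7 * w) * (z / a) powi (- (- 8)) \<in> max_ideal Qinf"
    by (simp only: left_diff_distrib mult.assoc mult_1_left)
  from lord_add[OF L lord_minus[OF L o(2)] this]
  have "lord Qinf (z / a) Kb (- a + (\<gamma> ^ 7 * z - \<alpha> ^ 7 - 3 * \<beta> ^ 7 * w)) (- 8)" .
  moreover have "- a + (\<gamma> ^ 7 * z - \<alpha> ^ 7 - 3 * \<beta> ^ 7 * w) = osc \<alpha> \<beta> \<gamma>" by (simp add: osc_def)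
  ultimately show ?thesis using val_Qinf by simp
qed

lemma osc_nonzero: assumes pt: "pt \<alpha> \<beta> \<gamma>" shows "osc \<alpha> \<beta> \<gamma> \<noteq> 0"
proof
  assume 0: "osc \<alpha> \<beta> \<gamma> = 0"
  define c where "c j = (if j = 0 then pCons (- (\<alpha> ^ 7)) (pCons (- 1) 0) else if j = 1 then pCons (- (3 * \<beta> ^ 7)) 0
    else if j = 3 then pCons (\<gamma> ^ 7) 0 else 0)" for j :: nat
  have "(\<Sum>j<8. poly (c j) a * mono8 w z j) = 0"
    using 0 unfolding sum8 by (simp add: c_def mono8_def osc_def algebra_simps)
  moreover have "\<forall>j<8. poly_over Kb (c j)"
    using pt_Kb[OF pt] numeral_Kb Kb_closed Kb_ring by (auto simp: c_def)
  ultimately have "c 0 = 0" using cring_independent[of c 0] by simp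
  then show False by (simp add: c_def)
qed

section \<open>Zeros of the osculating functions by means of the Hermitian cover\<close>

text \<open>For nonzero \<open>\<alpha>\<close> take a cube root \<open>x\<close> of
  \<open>\<alpha>\<close> and \<open>y = \<beta> / x\<close>.\<close>

lemma hermitian_lift:
  assumes "pt \<alpha> \<beta> \<gamma>"
  obtains x y where "x ^ 3 = \<alpha>" "x * y = \<beta>" "y ^ 3 = \<gamma>" "y ^ 8 = x ^ 7 + x"
proof (cases "\<alpha> = 0")
  case True
  then show ?thesis using ram_cen[OF assms] that[of 0 0] by simp
next
  case False
  have e: "curve_eqs \<alpha> \<beta> \<gamma>" and aK: "\<alpha> \<in> Kb" using assms by (auto simp: pt_def)
  obtain x where x: "x \<in> Kb" "x ^ 3 = \<alpha>" using Kb_nth_root[OF aK] by (metis zero_less_numeral)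
  have x0: "x \<noteq> 0" using x False by auto
  define y where "y = \<beta> / x"
  have xy: "x * y = \<beta>" using x0 by (simp add: y_def)
  have "\<alpha> * y ^ 3 = \<beta> ^ 3" unfolding x(2)[symmetric] xy[symmetric] by (simp add: power_mult_distrib)
  then have y3: "y ^ 3 = \<gamma>" using e False by (simp add: curve_eqs_def)
  have "x ^ 8 * y ^ 8 = \<beta> ^ 8" unfolding xy[symmetric] by (simp add: power_mult_distrib)
  also have "\<dots> = x ^ 8 * (x ^ 7 + x)"
    unfolding curve_eqs_w8[OF e] x(2)[symmetric] by (simp add: algebra_simps flip: power_mult power_add power_Suc)
  finally show ?thesis using that[OF x(2) xy y3] x0 by simp
qed

text \<open>Eliminating \<open>x\<close> by the tangent equation \<open>t\<close> and its seventh
  power gives \<open>(y ^ 7 - y0 ^ 7) * (y - y0 ^ 49) = 0\<close>. This is the classical description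
  of the intersection of a Hermitian curve with its tangent lines.\<close>

lemma hermitian_tangent:
  assumes 0: "y0 ^ 8 = x0 ^ 7 + (x0::'a)" and 1: "y ^ 8 = x ^ 7 + x" and t: "y * y0 ^ 7 = x + x0 ^ 7"
  shows "x = x0 \<and> y = y0 \<or> x = x0 ^ 49 \<and> y = y0 ^ 49"
proof -
  have p49: "(u ^ 7) ^ 7 = u ^ 49" for u :: 'a by (simp flip: power_mult)
  have x: "x = y * y0 ^ 7 - x0 ^ 7" using t by simp
  have "x ^ 7 = y ^ 7 * y0 ^ 49 - x0 ^ 49" unfolding x pow7_diff power_mult_distrib p49 ..
  moreover have "y0 ^ 56 = x0 ^ 49 + x0 ^ 7"
  proof -
    have "y0 ^ 56 = (y0 ^ 8) ^ 7" by (simp flip: power_mult)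
    then show ?thesis unfolding 0 pow7_add p49 .
  qed
  moreover have "(y ^ 7 - y0 ^ 7) * (y - y0 ^ 49) = y ^ 8 - y ^ 7 * y0 ^ 49 - y * y0 ^ 7 + y0 ^ 56"
    by (simp add: algebra_simps flip: power_add power_Suc power_Suc2)
  ultimately have "(y ^ 7 - y0 ^ 7) * (y - y0 ^ 49) = 0" using 1 t by simp
  then consider "(y - y0) ^ 7 = 0" | "y = y0 ^ 49" by (auto simp: pow7_diff)
  then show ?thesis
  proof cases
    case 1
    then have "y = y0" by simp
    moreover from this have "x = y0 ^ 8 - x0 ^ 7" unfolding x by (simp flip: power_Suc)
    ultimately show ?thesis unfolding 0 by simp
  next
    case 2
    then have "x = y0 ^ 56 - x0 ^ 7" unfolding x by (simp flip: power_add)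
    then show ?thesis using \<open>y0 ^ 56 = _\<close> 2 by simp
  qed
qed

text \<open>In terms of preimages, \<open>v\<close> says that the norm form
  \<open>A ^ 3 + B ^ 3 + C ^ 3 - 3 * (A * B * C)\<close> vanishes. It splits into three linear
  factors because 1, 2, 4 are the cube roots of unity, and each factor is the tangent equation for
  one of the preimages of the second point. The Frobenius image of a rational point is the point
  itself.\<close>

lemma osc_zero:
  assumes k: "(\<alpha>, \<beta>, \<gamma>) \<in> Kpts" and pt': "pt \<alpha>' \<beta>' \<gamma>'"
    and v: "\<gamma> ^ 7 * \<gamma>' - \<alpha>' - \<alpha> ^ 7 - 3 * \<beta> ^ 7 * \<beta>' = 0"
  shows "\<alpha>' = \<alpha> \<and> \<beta>' = \<beta> \<and> \<gamma>' = \<gamma>"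
proof -
  obtain x0 y0 where h0: "x0 ^ 3 = \<alpha>" "x0 * y0 = \<beta>" "y0 ^ 3 = \<gamma>" "y0 ^ 8 = x0 ^ 7 + x0"
    using hermitian_lift[OF Kpts_pt[OF k]] by metis
  obtain x y where h: "x ^ 3 = \<alpha>'" "x * y = \<beta>'" "y ^ 3 = \<gamma>'" "y ^ 8 = x ^ 7 + x"
    using hermitian_lift[OF pt'] by metis
  have K: "\<alpha> ^ 49 = \<alpha>" "\<beta> ^ 49 = \<beta>" "\<gamma> ^ 49 = \<gamma>" using k K_iff by (auto simp: Kpts_def)
  have concl: ?thesis
    if X: "X ^ 3 = \<alpha>'" "X * Y = \<beta>'" "Y ^ 3 = \<gamma>'" "Y ^ 8 = X ^ 7 + X" "Y * y0 ^ 7 = X + x0 ^ 7" for X Y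
  proof -
    have sw: "(u ^ 49) ^ 3 = (u ^ 3) ^ 49" for u :: 'a by (simp flip: power_mult)
    from hermitian_tangent[OF h0(4) X(4,5)] show ?thesis
    proof
      assume "X = x0 \<and> Y = y0"
      then show ?thesis using X h0 by auto
    next
      assume e: "X = x0 ^ 49 \<and> Y = y0 ^ 49"
      have "\<alpha>' = \<alpha> ^ 49" "\<gamma>' = \<gamma> ^ 49" using e X(1,3) h0(1,3) sw by metis+
      moreover have "\<beta>' = \<beta> ^ 49" using e X(2) h0(2) power_mult_distrib by metis
      ultimately show ?thesis using K by simp
    qed
  qed
  have n: "(64::'a) = 1" "(8::'a) = 1" "(256::'a) = 4" "(16384::'a) = 4" "(65536::'a) = 2" "(128::'a) = 2" "(16::'a) = 2"
    by (subst numeral_mod7, simp)+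
  define A B C where "A = y * y0 ^ 7" and "B = - x" and "C = - (x0 ^ 7)"
  have p3: "(u ^ 7) ^ 3 = (u ^ 3) ^ 7" for u :: 'a by (simp flip: power_mult)
  have "A ^ 3 + B ^ 3 + C ^ 3 - 3 * (A * B * C) = 0"
  proof -
    have "A ^ 3 = \<gamma> ^ 7 * \<gamma>'" unfolding A_def power_mult_distrib p3 h0(3) h(3) by (rule mult.commute)
    moreover have "B ^ 3 = - \<alpha>'" unfolding B_def using h(1) by simp
    moreover have "C ^ 3 = - (\<alpha> ^ 7)" unfolding C_def using p3[of x0] h0(1) by simp
    moreover have "A * B * C = \<beta> ^ 7 * \<beta>'"
      unfolding A_def B_def C_def h0(2)[symmetric] h(2)[symmetric] by (simp add: power_mult_distrib mult_ac)
    ultimately show ?thesis using v by (simp add: mult_ac)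
  qed
  moreover have "(A + B + C) * ((A + 2 * B + 4 * C) * (A + 4 * B + 2 * C)) =
      (A ^ 3 + B ^ 3 + C ^ 3 - 3 * (A * B * C)) + 7 * ((A + B + C) * (A * B + A * C + B ^ 2 + 3 * (B * C) + C ^ 2))"
    by (simp add: algebra_simps eval_nat_numeral)
  ultimately have "(A + B + C) * ((A + 2 * B + 4 * C) * (A + 4 * B + 2 * C)) = 0" unfolding seven by simp
  then consider "A + B + C = 0" | "A + 2 * B + 4 * C = 0" | "A + 4 * B + 2 * C = 0" by auto
  then show ?thesis
  proof cases
    case 1
    have "y * y0 ^ 7 = x + x0 ^ 7" using 1 by (simp add: A_def B_def C_def algebra_simps)
    then show ?thesis using concl h by blast
  next
    case 2
    \<comment> \<open>\<open>(4 * x, 2 * y)\<close> has the same invariants as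
      \<open>(x, y)\<close>, and twice the vanishing factor is its tangent equation.\<close>
    show ?thesis
    proof (rule concl[of "4 * x" "2 * y"])
      show "(4 * x) ^ 3 = \<alpha>'" "4 * x * (2 * y) = \<beta>'" "(2 * y) ^ 3 = \<gamma>'"
        using h by (simp_all add: power_mult_distrib n mult_ac)
      show "(2 * y) ^ 8 = (4 * x) ^ 7 + 4 * x" using h(4) by (simp add: power_mult_distrib n distrib_left)
      have "2 * y * y0 ^ 7 = 4 * x + 8 * x0 ^ 7"
        using arg_cong[OF 2, of "\<lambda>u. 2 * u"] by (simp add: A_def B_def C_def algebra_simps)
      then show "2 * y * y0 ^ 7 = 4 * x + x0 ^ 7" unfolding n by simp
    qed
  next
    case 3
    show ?thesis
    proof (rule concl[of "2 * x" "4 * y"])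
      show "(2 * x) ^ 3 = \<alpha>'" "2 * x * (4 * y) = \<beta>'" "(4 * y) ^ 3 = \<gamma>'"
        using h by (simp_all add: power_mult_distrib n mult_ac)
      show "(4 * y) ^ 8 = (2 * x) ^ 7 + 2 * x" using h(4) by (simp add: power_mult_distrib n distrib_left)
      have "4 * y * y0 ^ 7 = 16 * x + 8 * x0 ^ 7"
        using arg_cong[OF 3, of "\<lambda>u. 4 * u"] by (simp add: A_def B_def C_def algebra_simps)
      then show "4 * y * y0 ^ 7 = 2 * x + x0 ^ 7" unfolding n by simp
    qed
  qed
qed

text \<open>The leading coefficient of \<open>osc + osc ^ 7\<close> at a rational point does not vanish.\<close>
lemma osc_coeff:
  assumes k: "(\<alpha>, \<beta>, \<gamma>) \<in> Kpts" and unram: "\<alpha> ^ 3 + \<alpha> \<noteq> 0"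
  shows "3 * ((5 * \<alpha> ^ 4 + 3 * \<alpha> ^ 2) / \<beta> ^ 7) ^ 8 - ((\<alpha> ^ 2 + 1) ^ 2 / \<gamma> ^ 7) ^ 8 \<noteq> 0"
proof
  assume eq: "3 * ((5 * \<alpha> ^ 4 + 3 * \<alpha> ^ 2) / \<beta> ^ 7) ^ 8 - ((\<alpha> ^ 2 + 1) ^ 2 / \<gamma> ^ 7) ^ 8 = 0"
  note nz = unram_nonzero[OF Kpts_pt[OF k] unram]
  have e: "curve_eqs \<alpha> \<beta> \<gamma>" and bK: "\<beta> \<in> K" using k by (auto simp: Kpts_def)
  define s u where "s = \<alpha> ^ 2 + 1" and "u = \<alpha> ^ 2"
  have s0: "s \<noteq> 0" using nz by (simp add: s_def)
  have sw: "(v ^ 7) ^ 8 = (v ^ 8) ^ 7" for v :: 'a by (simp flip: power_mult)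
  have b: "(\<beta> ^ 7) ^ 8 = \<alpha> ^ 21 * s ^ 7" and g: "(\<gamma> ^ 7) ^ 8 = \<alpha> ^ 7 * s ^ 21"
    unfolding sw curve_eqs_w8[OF e] curve_eqs_z8[OF e] s_def by (simp_all add: power_mult_distrib flip: power_mult)
  have f: "5 * \<alpha> ^ 4 + 3 * \<alpha> ^ 2 = \<alpha> ^ 2 * (5 * u + 3)" by (simp add: u_def algebra_simps eval_nat_numeral)
  have "3 * (\<alpha> ^ 16 * (5 * u + 3) ^ 8) / (\<alpha> ^ 21 * s ^ 7) = s ^ 16 / (\<alpha> ^ 7 * s ^ 21)"
    using eq unfolding power_divide b g f s_def[symmetric] by (simp add: power_mult_distrib flip: power_mult)
  then have "(3 * (\<alpha> ^ 16 * (5 * u + 3) ^ 8)) * (\<alpha> ^ 7 * s ^ 21) = s ^ 16 * (\<alpha> ^ 21 * s ^ 7)"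
    using nz s0 by (simp add: frac_eq_eq)
  moreover have "(3 * (\<alpha> ^ 16 * (5 * u + 3) ^ 8)) * (\<alpha> ^ 7 * s ^ 21) = (\<alpha> ^ 21 * s ^ 21) * (3 * u * (5 * u + 3) ^ 8)"
    by (simp add: u_def mult_ac flip: power_add power_mult)
  moreover have "s ^ 16 * (\<alpha> ^ 21 * s ^ 7) = (\<alpha> ^ 21 * s ^ 21) * s ^ 2"
  proof -
    have "s ^ 16 * (\<alpha> ^ 21 * s ^ 7) = \<alpha> ^ 21 * (s ^ 16 * s ^ 7)" by (rule mult.left_commute)
    also have "s ^ 16 * s ^ 7 = s ^ 21 * s ^ 2" by (simp flip: power_add)
    finally show ?thesis by (simp only: mult.assoc)
  qed
  ultimately have main: "3 * u * (5 * u + 3) ^ 8 = s ^ 2" using nz(1) s0 by simp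
  have n: "(78125::'a) = 5" "(2187::'a) = 3" by (subst numeral_mod7, simp)+
  \<comment> \<open>Splitting off an additive seventh power leaves an equation in which
    \<open>u\<close> occurs only through \<open>u ^ 8\<close> and low powers, so the possible values
    of \<open>u ^ 8\<close> can be inserted.\<close>
  have "(5 * u + 3) ^ 8 = (5 * u + 3) ^ 7 * (5 * u + 3)" by (simp only: power_Suc2[symmetric]) simp
  also have "(5 * u + 3) ^ 7 = 5 * u ^ 7 + 3" unfolding pow7_add by (simp add: power_mult_distrib n)
  finally have m2: "3 * u * ((5 * u ^ 7 + 3) * (5 * u + 3)) = (u + 1) ^ 2" using main by (simp add: s_def u_def)
  have m3: "3 * u * ((5 * u ^ 7 + 3) * (5 * u + 3)) = 75 * (u ^ 8 * u) + 45 * u ^ 8 + 45 * u ^ 2 + 27 * u"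
    by (simp add: algebra_simps eval_nat_numeral)
  have bsum: "\<alpha> \<in> absc"
  proof -
    have "(\<beta> ^ 8) ^ 6 = 1" using K_pow48[OF bK nz(3)] by (simp flip: power_mult)
    then show ?thesis unfolding curve_eqs_w8[OF e] using k unram by (simp add: absc_def Kpts_def)
  qed
  have u8: "\<alpha> ^ 16 = u ^ 8" by (simp add: u_def flip: power_mult)
  from absc_cases[OF bsum] consider "u ^ 8 = 1" | "u = 4" "u ^ 8 = 2" | "u = 2" "u ^ 8 = 4"
    unfolding u8 u_def[symmetric] by blast
  then show False
  proof cases
    case 1
    \<comment> \<open>Modulo 7 this becomes \<open>u ^ 2 + u + 1 = 0\<close>, so
      \<open>u ^ 3 = 1\<close>; with \<open>u ^ 8 = 1\<close> this forces \<open>u = 1\<close>,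
      where the sum is 3.\<close>
    have "75 * u + 45 + 45 * u ^ 2 + 27 * u = (u + 1) ^ 2" using m2 m3 unfolding 1 by simp
    then have "44 * u ^ 2 + 100 * u + 44 = 0" by (simp add: algebra_simps power2_eq_square)
    moreover have "44 * u ^ 2 + 100 * u + 44 = 2 * (u ^ 2 + u + 1) + 7 * (6 * u ^ 2 + 14 * u + 6)"
      by (simp add: algebra_simps)
    ultimately have "2 * (u ^ 2 + u + 1) + 7 * (6 * u ^ 2 + 14 * u + 6) = 0" by argo
    then have "2 * (u ^ 2 + u + 1) = 0" unfolding seven mult_zero_left add_0_right .
    then have "u ^ 2 + u + 1 = 0" unfolding mult_eq_0_iff using two_nonzero by blast
    moreover have "u ^ 3 - 1 = (u - 1) * (u ^ 2 + u + 1)" by (simp add: algebra_simps eval_nat_numeral)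
    ultimately have u3: "u ^ 3 = 1" by simp
    have "u ^ 8 * u = (u ^ 3) ^ 3" by (simp flip: power_mult power_Suc2)
    then have "u = 1" unfolding 1 u3 by simp
    then show False using \<open>u ^ 2 + u + 1 = 0\<close> three_nonzero by simp
  next
    case 2
    have "75 * (2 * 4) + 45 * 2 + 45 * 4 ^ 2 + 27 * 4 = ((4::'a) + 1) ^ 2"
      using m2 m3 unfolding 2(2) unfolding 2(1) by simp
    then have "(1518::'a) - 25 = 0" by simp
    moreover have "(1518::'a) - 25 = 2 + 7 * 213" by simp
    ultimately show False unfolding seven using two_nonzero by simp
  next
    case 3
    have "75 * (4 * 2) + 45 * 4 + 45 * 2 ^ 2 + 27 * 2 = ((2::'a) + 1) ^ 2"
      using m2 m3 unfolding 3(2) unfolding 3(1) by simp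
    then have "(1014::'a) - 9 = 0" by simp
    moreover have "(1014::'a) - 9 = 4 + 7 * 143" by simp
    ultimately show False unfolding seven using numerals_small by simp
  qed
qed

text \<open>At a ramified point \<open>osc\<close> is \<open>\<alpha> - a\<close>. Otherwise
  \<open>f + f ^ 7 = f * (1 + f ^ 6)\<close>, where the second factor is a unit because
  \<open>f\<close> vanishes at the point, and the combination of eighth powers has order exactly 8
  by \<open>osc_coeff\<close>.\<close>

lemma osc_order:
  assumes kp: "(\<alpha>, \<beta>, \<gamma>) \<in> Kpts" and c: "cen Q \<alpha> \<beta> \<gamma>" shows "val Q (osc \<alpha> \<beta> \<gamma>) = 8"
proof -
  have pt: "pt \<alpha> \<beta> \<gamma>" by (rule Kpts_pt[OF kp])
  have Q: "plc Q" using c by (simp add: cen_def)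
  interpret vplace UNIV Kb Q using vplace_plc Q by blast
  note dv = cen_dval[OF pt c]
  show ?thesis
  proof (cases "\<alpha> ^ 3 + \<alpha> = 0")
    case True
    then have "\<alpha> = 0 \<or> \<alpha> ^ 2 = - 1" unfolding cubic_factor by (simp add: eq_neg_iff_add_eq_0)
    moreover have e: "\<alpha> ^ 7 = \<alpha> * (\<alpha> ^ 2) ^ 3" by (simp flip: power_mult power_Suc)
    have "\<alpha> ^ 7 = - \<alpha>" if "\<alpha> ^ 2 = - 1" unfolding e that by simp
    ultimately have "\<alpha> ^ 7 = - \<alpha>" by auto
    then have "osc \<alpha> \<beta> \<gamma> = (- 1) * (a - \<alpha>)" using ram_cen[OF pt True] by (simp add: osc_def)
    moreover have "val Q (- 1) = 0"
      by (rule val_eqI[OF dv]) (use unit_k[of "-1"] Kb_closed in simp)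
    ultimately show ?thesis
      using val_mult[OF dv, of "- 1" "a - \<alpha>"] a_minus_nonzero[OF pt] val_a_minus[OF c] True by simp
  next
    case False
    obtain W where W: "lval \<alpha> \<beta> \<gamma> W ((5 * \<alpha> ^ 4 + 3 * \<alpha> ^ 2) / \<beta> ^ 7)" "w - \<beta> = (a - \<alpha>) * W"
      using w_quot[OF pt False] by blast
    obtain Z where Z: "lval \<alpha> \<beta> \<gamma> Z ((\<alpha> ^ 2 + 1) ^ 2 / \<gamma> ^ 7)" "z - \<gamma> = (a - \<alpha>) * Z"
      using z_quot[OF pt False] by blast
    let ?f = "osc \<alpha> \<beta> \<gamma>" and ?\<pi> = "a - \<alpha>"
    have K: "\<alpha> ^ 49 = \<alpha>" "\<beta> ^ 49 = \<beta>" "\<gamma> ^ 49 = \<gamma>" using kp K_iff by (auto simp: Kpts_def)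
    have p49: "(u ^ 7) ^ 7 = u ^ 49" for u :: 'a by (simp flip: power_mult)
    have n: "(2187::'a) = 3" by (subst numeral_mod7, simp)
    have f7: "?f ^ 7 = \<gamma> * z ^ 7 - a ^ 7 - \<alpha> - 3 * \<beta> * w ^ 7"
      unfolding osc_def pow7_diff power_mult_distrib p49 K by (simp add: n)
    have e8: "(x - y) ^ 8 = x ^ 8 - y * x ^ 7 - y ^ 7 * x + y ^ 8" for x y :: 'a
    proof -
      have "(x - y) ^ 8 = (x - y) ^ 7 * (x - y)" by (simp only: power_Suc2[symmetric]) simp
      then show ?thesis unfolding pow7_diff by (simp add: algebra_simps flip: power_Suc2 power_Suc)
    qed
    have "3 * (w - \<beta>) ^ 8 - (z - \<gamma>) ^ 8 =
        (\<gamma> ^ 7 * z - a - \<alpha> ^ 7 - 3 * \<beta> ^ 7 * w) + (\<gamma> * z ^ 7 - a ^ 7 - \<alpha> - 3 * \<beta> * w ^ 7)"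
      unfolding e8 curve_eqs_z8_alt[OF eqs] curve_eqs_z8_alt[OF pt_eqs[OF pt]]
      by (simp add: algebra_simps)
    then have "3 * (w - \<beta>) ^ 8 - (z - \<gamma>) ^ 8 = ?f + ?f ^ 7"
      unfolding f7 unfolding osc_def .
    then have "3 * (W ^ 8 * ?\<pi> ^ 8) - Z ^ 8 * ?\<pi> ^ 8 = ?f + ?f ^ 7"
      unfolding W(2) Z(2) power_mult_distrib by (simp only: mult.commute)
    moreover have "?f * (1 + ?f ^ 6) = ?f + ?f ^ 7" by (simp add: distrib_left flip: power_Suc)
    ultimately have sum: "?f * (1 + ?f ^ 6) = (3 * W ^ 8 - Z ^ 8) * ?\<pi> ^ 8"
      by (simp only: left_diff_distrib mult.assoc)
    note rW = lval_rs[OF pt W(1) c] and rZ = lval_rs[OF pt Z(1) c]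
    have r: "rs Kb Q (3 * W ^ 8 - Z ^ 8) (3 * ((5 * \<alpha> ^ 4 + 3 * \<alpha> ^ 2) / \<beta> ^ 7) ^ 8 - ((\<alpha> ^ 2 + 1) ^ 2 / \<gamma> ^ 7) ^ 8)"
      by (intro rs_diff rs_mult rs_power rW rZ rs_const numeral_Kb)
    then have u: "is_unit_in Q (3 * W ^ 8 - Z ^ 8)"
      using osc_coeff[OF kp False] rs_m_iff[OF r] rs_R[OF r] by (simp add: unit_iff)
    have "\<gamma> ^ 7 * \<gamma> - \<alpha> - \<alpha> ^ 7 - 3 * \<beta> ^ 7 * \<beta> = \<gamma> ^ 8 - \<alpha> - \<alpha> ^ 7 - 3 * \<beta> ^ 8"
      by (simp add: eval_nat_numeral)
    also have "\<dots> = 0" using curve_eqs_z8_alt[OF pt_eqs[OF pt]] by simp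
    finally have rf: "rs Kb Q ?f 0" using osc_rs[OF pt c] by simp
    have "rs Kb Q (1 + ?f ^ 6) (1 + 0 ^ 6)" by (intro rs_add rs_power rf rs_const Kb_closed(1))
    then have v: "is_unit_in Q (1 + ?f ^ 6)" using rs_R rs_m_iff by (fastforce simp: unit_iff)
    have v0: "val Q x = 0" if "is_unit_in Q x" for x by (rule val_eqI[OF dv]) (use that in simp)
    have nz: "x \<noteq> 0" if "is_unit_in Q x" for x using that by (simp add: is_unit_in_def)
    have "val Q (?f * (1 + ?f ^ 6)) = val Q ?f"
      using val_mult[OF dv _ _ osc_nonzero[OF pt] nz[OF v]] v0[OF v] by simp
    moreover have "val Q ((3 * W ^ 8 - Z ^ 8) * ?\<pi> ^ 8) = 8"
      using val_mult[OF dv _ _ nz[OF u], of "?\<pi> ^ 8"] v0[OF u] val_power[OF dv, of ?\<pi> 8] val_a_minus[OF c] False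
        a_minus_nonzero[OF pt] by simp
    ultimately show ?thesis unfolding sum by simp
  qed
qed

text \<open>Provides the function that transfers the linear series from an arbitrary rational place
  to infinity: \<open>osc\<close> at the point of \<open>Q0\<close>, which has no zeros elsewhere by
  \<open>osc_zero\<close>.\<close>

lemma frobenius_divisor:
  assumes Q0: "plc Q0" "deg_place K (Q0 \<inter> F) = 1"
  obtains g where "g \<in> F" "g \<noteq> 0"
    "\<And>Q. plc Q \<Longrightarrow> val Q g = (if Q = Q0 then 8 else 0) - (if Q = Qinf then 8 else 0)"
proof (cases "Q0 = Qinf")
  case True
  have "val Q 1 = 0" if Q: "plc Q" for Q
  proof -
    interpret vplace UNIV Kb Q using vplace_plc Q by blast
    obtain p where p: "dval UNIV Q p" using plc_dval Q by blast
    show ?thesis by (rule val_eqI[OF p]) (simp add: is_unit_in_def R_one)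
  qed
  then show ?thesis using that[of 1] True F_closed by simp
next
  case False
  then obtain \<alpha> \<beta> \<gamma> where kp: "(\<alpha>, \<beta>, \<gamma>) \<in> Kpts" "cen Q0 \<alpha> \<beta> \<gamma>" using rational_cen[OF Q0] by blast
  have pt: "pt \<alpha> \<beta> \<gamma>" by (rule Kpts_pt[OF kp(1)])
  have kk: "\<alpha> \<in> F" "\<beta> \<in> F" "\<gamma> \<in> F" "3 \<in> F" using kp F_gens(1) K_numeral by (auto simp: Kpts_def)
  have gF: "osc \<alpha> \<beta> \<gamma> \<in> F" unfolding osc_def by (intro F_closed kk F_gens)
  have "val Q (osc \<alpha> \<beta> \<gamma>) = (if Q = Q0 then 8 else 0) - (if Q = Qinf then 8 else 0)" if Q: "plc Q" for Q
  proof -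
    consider "Q = Qinf" | "Q = Q0" | "Q \<noteq> Qinf" "Q \<noteq> Q0" by blast
    then show ?thesis
    proof cases
      case 1
      then show ?thesis using osc_inf[OF pt] False by simp
    next
      case 2
      then show ?thesis using osc_order[OF kp] False by simp
    next
      case 3
      obtain \<alpha>' \<beta>' \<gamma>' where c: "cen Q \<alpha>' \<beta>' \<gamma>'" using affine_cen[OF Q] affine_iff[OF Q] 3 by blast
      then have pt': "pt \<alpha>' \<beta>' \<gamma>'" by (simp add: cen_def)
      interpret vplace UNIV Kb Q using vplace_plc Q by blast
      have ne: "\<gamma> ^ 7 * \<gamma>' - \<alpha>' - \<alpha> ^ 7 - 3 * \<beta> ^ 7 * \<beta>' \<noteq> 0"
      proof
        assume "\<gamma> ^ 7 * \<gamma>' - \<alpha>' - \<alpha> ^ 7 - 3 * \<beta> ^ 7 * \<beta>' = 0"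
        then have "cen Q \<alpha> \<beta> \<gamma>" using osc_zero[OF kp(1) pt'] c by simp
        then show False using cen_unique[OF pt kp(2)] 3 by simp
      qed
      note r = osc_rs[OF pt c]
      have "is_unit_in Q (osc \<alpha> \<beta> \<gamma>)" using rs_m_iff[OF r] rs_R[OF r] ne by (simp add: unit_iff)
      then have "val Q (osc \<alpha> \<beta> \<gamma>) = 0" by (intro val_eqI[OF cen_dval[OF pt' c]]) simp
      then show ?thesis using 3 by simp
    qed
  qed
  then show ?thesis using that gF osc_nonzero[OF pt] by blast
qed

end

section \<open>The Frobenius linear series\<close>

context curve_K
begin

text \<open>The space of functions over \<open>Kb\<close> with at most an eightfold pole at infinity
  and no other poles.\<close>

definition V8 :: "'a set" where
  "V8 = {h. h = 0 \<or> regular h \<and> val Qinf h \<ge> - 8}"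

context
  fixes Q0 g
  assumes Q0: "plc Q0" and g: "g \<in> F" "g \<noteq> 0"
    and div: "\<And>Q. plc Q \<Longrightarrow> val Q g = (if Q = Q0 then 8 else 0) - (if Q = Qinf then 8 else 0)"
begin

lemma LL_twist: "f \<in> LL UNIV Kb (pt_div Q0 8) \<longleftrightarrow> f * g \<in> V8"
proof (cases "f = 0")
  case False
  have v: "val Q (f * g) = val Q f + val Q g" if Q: "plc Q" for Q
  proof -
    interpret vplace UNIV Kb Q using vplace_plc Q by blast
    obtain p where p: "dval UNIV Q p" using plc_dval Q by blast
    show ?thesis using val_mult[OF p _ _ False g(2)] by simp
  qed
  have nn: "val Q (f * g) \<ge> 0 \<longleftrightarrow> f * g \<in> Q" if Q: "plc Q" for Q
  proof -
    interpret vplace UNIV Kb Q using vplace_plc Q by blast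
    obtain p where p: "dval UNIV Q p" using plc_dval Q by blast
    show ?thesis using val_nonneg_iff[OF p, of "f * g"] False g by simp
  qed
  have "(\<forall>Q. plc Q \<longrightarrow> val Q f \<ge> - pt_div Q0 8 Q) \<longleftrightarrow>
      (\<forall>Q. plc Q \<longrightarrow> val Q (f * g) \<ge> - (if Q = Qinf then 8 else 0))"
  proof -
    have "val Q f \<ge> - pt_div Q0 8 Q \<longleftrightarrow> val Q (f * g) \<ge> - (if Q = Qinf then 8 else 0)" if "plc Q" for Q
      using v[OF that] div[OF that] by (auto simp: pt_div_def)
    then show ?thesis by blast
  qed
  also have "\<dots> \<longleftrightarrow> regular (f * g) \<and> val Qinf (f * g) \<ge> - 8"
  proof
    assume l: "\<forall>Q. plc Q \<longrightarrow> val Q (f * g) \<ge> - (if Q = Qinf then 8 else 0)"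
    have "f * g \<in> Q" if "plc Q" "a \<in> Q" for Q
    proof -
      have "Q \<noteq> Qinf" using affine_iff that by blast
      then have "val Q (f * g) \<ge> 0" using l that(1) by (metis minus_zero)
      then show ?thesis using nn[OF that(1)] by blast
    qed
    then show "regular (f * g) \<and> val Qinf (f * g) \<ge> - 8" using l Qinf_plc by (auto simp: regular_def)
  next
    assume r: "regular (f * g) \<and> val Qinf (f * g) \<ge> - 8"
    then have "val Q (f * g) \<ge> 0" if "plc Q" "Q \<noteq> Qinf" for Q
      using nn[OF that(1)] affine_iff[OF that(1)] that by (auto simp: regular_def)
    then show "\<forall>Q. plc Q \<longrightarrow> val Q (f * g) \<ge> - (if Q = Qinf then 8 else 0)" using r by auto
  qed
  finally show ?thesis using False g by (simp add: LL_def V8_def)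
qed (simp add: LL_def V8_def)

lemma orders_twist:
  assumes Q: "plc Q"
  shows "orders UNIV Kb Q0 8 Q = (\<lambda>h. val Q h + (if Q = Qinf then 8 else 0)) ` (V8 - {0})"
proof -
  interpret vplace UNIV Kb Q using vplace_plc Q by blast
  obtain p where p: "dval UNIV Q p" using plc_dval Q by blast
  have v: "val Q f + (if Q = Q0 then 8 else 0) = val Q (f * g) + (if Q = Qinf then 8 else 0)" if "f \<noteq> 0" for f
    using val_mult[OF p _ _ that g(2)] div[OF Q] by simp
  show ?thesis
  proof (intro equalityI subsetI)
    fix n assume "n \<in> orders UNIV Kb Q0 8 Q"
    then obtain f where f: "f \<in> LL UNIV Kb (pt_div Q0 8)" "f \<noteq> 0" "n = val Q f + (if Q = Q0 then 8 else 0)"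
      by (auto simp: orders_def)
    then show "n \<in> (\<lambda>h. val Q h + (if Q = Qinf then 8 else 0)) ` (V8 - {0})"
      using LL_twist v g by (intro image_eqI[of _ _ "f * g"]) auto
  next
    fix n assume "n \<in> (\<lambda>h. val Q h + (if Q = Qinf then 8 else 0)) ` (V8 - {0})"
    then obtain h where h: "h \<in> V8" "h \<noteq> 0" "n = val Q h + (if Q = Qinf then 8 else 0)" by blast
    have "h / g * g = h" using g by simp
    then have "h / g \<in> LL UNIV Kb (pt_div Q0 8)" "h / g \<noteq> 0" "n = val Q (h / g) + (if Q = Q0 then 8 else 0)"
      using LL_twist[of "h / g"] v[of "h / g"] h g by auto
    then show "n \<in> orders UNIV Kb Q0 8 Q" unfolding orders_def by blast
  qed
qed

text \<open>The orders at \<open>Q0\<close> and at its restriction agree because a local parameter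
  can be chosen in \<open>F\<close>. At other places only the sign of an order matters, which a
  ramification index does not change, and no other place has the same restriction.\<close>

lemma ell_rational:
  assumes deg: "deg_place K (Q0 \<inter> F) = 1" shows "ell F K (pt_div (Q0 \<inter> F) 8) = 4"
proof -
  define P0 where "P0 = Q0 \<inter> F"
  have val_Q0: "val P0 x = val Q0 x" if x: "x \<in> F" "x \<noteq> 0" for x
  proof (cases "Q0 = Qinf")
    case True
    then show ?thesis using val_Pinf[OF x] by (simp add: P0_def Pinf_def)
  next
    case False
    then obtain \<alpha> \<beta> \<gamma> where k: "(\<alpha>, \<beta>, \<gamma>) \<in> Kpts" "cen Q0 \<alpha> \<beta> \<gamma>" using rational_cen[OF Q0 deg] by blast
    have pt: "pt \<alpha> \<beta> \<gamma>" by (rule Kpts_pt[OF k(1)])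
    have "\<alpha> \<in> F" using k F_gens by (auto simp: Kpts_def)
    then have "par \<alpha> \<in> F" unfolding par_def[OF pt] ram_par_def using F_gens F_closed(6) by simp
    then show ?thesis unfolding P0_def using val_restrict_eq(2)[OF Q0 cen_dval[OF pt k(2)] _ x] by blast
  qed
  have LL: "x \<in> LL F K (pt_div P0 8) \<longleftrightarrow> x * g \<in> Lc 8" if x: "x \<in> F" for x
  proof (cases "x = 0")
    case False
    have "(\<forall>P. place F K P \<longrightarrow> val P x \<ge> - pt_div P0 8 P) \<longleftrightarrow> (\<forall>Q. plc Q \<longrightarrow> val Q x \<ge> - pt_div Q0 8 Q)"
    proof -
      have key: "val (Q \<inter> F) x \<ge> - pt_div P0 8 (Q \<inter> F) \<longleftrightarrow> val Q x \<ge> - pt_div Q0 8 Q" if Q: "plc Q" for Q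
      proof (cases "Q = Q0")
        case True
        then show ?thesis using val_Q0[OF x False] by (simp add: P0_def pt_div_def)
      next
        case ne: False
        then have "Q \<inter> F \<noteq> P0" using over_rational[OF Q0 deg Q] by (auto simp: P0_def)
        moreover obtain e p where e: "e > 0" "dval F (Q \<inter> F) p"
          "\<And>x. x \<in> F \<Longrightarrow> x \<noteq> 0 \<Longrightarrow> val Q x = e * val (Q \<inter> F) x" using val_restrict[OF Q] by metis
        ultimately show ?thesis using ne e(3)[OF x False] e(1) by (simp add: pt_div_def zero_le_mult_iff)
      qed
      show ?thesis
      proof
        assume "\<forall>P. place F K P \<longrightarrow> val P x \<ge> - pt_div P0 8 P"
        then show "\<forall>Q. plc Q \<longrightarrow> val Q x \<ge> - pt_div Q0 8 Q" using key place_restrict by blast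
      next
        assume "\<forall>Q. plc Q \<longrightarrow> val Q x \<ge> - pt_div Q0 8 Q"
        then show "\<forall>P. place F K P \<longrightarrow> val P x \<ge> - pt_div P0 8 P" using key place_lift by metis
      qed
    qed
    then have "x \<in> LL F K (pt_div P0 8) \<longleftrightarrow> x \<in> LL UNIV Kb (pt_div Q0 8)"
      using x by (simp add: LL_def)
    also have "\<dots> \<longleftrightarrow> x * g \<in> V8" by (rule LL_twist)
    also have "\<dots> \<longleftrightarrow> x * g \<in> Lc 8" using x g F_closed(4) by (simp add: V8_def Lc_iff)
    finally show ?thesis .
  qed (simp add: LL_def Lc_iff F_closed)
  have bij: "bij_betw (\<lambda>x. x * g) (LL F K (pt_div P0 8)) (Lc 8)"
  proof (rule bij_betw_byWitness[where f' = "\<lambda>y. y / g"])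
    have "x \<in> F" if "x \<in> LL F K (pt_div P0 8)" for x using that by (simp add: LL_def)
    then show "(\<lambda>x. x * g) ` LL F K (pt_div P0 8) \<subseteq> Lc 8" using LL by blast
    show "(\<lambda>y. y / g) ` Lc 8 \<subseteq> LL F K (pt_div P0 8)"
    proof
      fix u assume "u \<in> (\<lambda>y. y / g) ` Lc 8"
      then obtain y where y: "y \<in> Lc 8" "u = y / g" by blast
      have "u \<in> F" using y g F_closed(9) by (auto simp: Lc_iff)
      then show "u \<in> LL F K (pt_div P0 8)" using LL y g by simp
    qed
  qed (use g in auto)
  have "finite (LL F K (pt_div P0 8))" "card (LL F K (pt_div P0 8)) = 49 ^ 4"
    using bij_betw_finite[OF bij] bij_betw_same_card[OF bij] card_Lc_small by simp_all
  then have "(49::nat) ^ ell F K (pt_div P0 8) = 49 ^ 4"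
    unfolding ell_def using card_subspace[OF LL_subspace] by simp
  then show ?thesis unfolding P0_def by (simp only: power_inject_exp)
qed

end

section \<open>Orders of the series from bases adapted to a place\<close>

text \<open>Subtracting multiples of \<open>a\<close>, \<open>z\<close>, \<open>w\<close>,
  \<open>1\<close> removes the pole orders 8, 7, 5, 0 in turn. The numbers in between are gaps, and
  what finally remains has a zero at infinity, so it is 0.\<close>

lemma V8_span: "V8 = {d0 + d1 * w + d2 * z + d3 * a | d0 d1 d2 d3. d0 \<in> Kb \<and> d1 \<in> Kb \<and> d2 \<in> Kb \<and> d3 \<in> Kb}"
proof -
  interpret vplace UNIV Kb Qinf using vplace_plc Qinf_plc by blast
  note dv = inf_dval[OF Qinf]
  note o = inf_orders[OF Qinf Kb_field subset_refl]
  note L = o(1) inf_par_nonzero Kb_field subset_refl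
  have reg: "regular x" if "x \<in> Kb \<union> {a, w, z}" for x
    using that cring_gens(1)[of Kb a w z] cring_gens(2)[of a w z Kb] cring_gens(3)[of w a z Kb]
      cring_gens(4)[of z a w Kb] by (intro regular_cring) auto
  define G where "G n h \<longleftrightarrow> regular h \<and> (h = 0 \<or> val Qinf h \<ge> n)" for n h
  have sub: "\<exists>c\<in>Kb. G (n + 1) (h - c * m)"
    if h: "G n h" and m: "regular m" "lord Qinf (z / a) Kb m n" for n h m
  proof (cases "h = 0 \<or> val Qinf h > n")
    case True
    then show ?thesis using h Kb_closed(2) by (intro bexI[of _ 0]) (auto simp: G_def)
  next
    case False
    then have h0: "h \<noteq> 0" "val Qinf h = n" using h by (auto simp: G_def)
    obtain i where "lord Qinf (z / a) Kb h i" using inf_lord[OF h0(1)] Qinf by blast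
    moreover from this have "i = n" using val_Qinf h0 by simp
    ultimately obtain b where b: "b \<in> Kb" "h * (z / a) powi (- n) - b \<in> max_ideal Qinf" by (auto simp: lord_def)
    obtain e where e: "e \<in> Kb" "e \<noteq> 0" "m * (z / a) powi (- n) - e \<in> max_ideal Qinf" using m(2) by (auto simp: lord_def)
    define c where "c = b / e"
    have c: "c \<in> Kb" "b = c * e" using b e Kb_closed by (auto simp: c_def)
    have "(h * (z / a) powi (- n) - b) - c * (m * (z / a) powi (- n) - e) \<in> max_ideal Qinf"
      by (intro m_diff b m_mult' k_R c e)
    then have "(h - c * m) * (z / a) powi (- n) \<in> max_ideal Qinf" unfolding c(2) by (simp add: algebra_simps)
    then have "h - c * m = 0 \<or> val Qinf (h - c * m) > n" using val_gt_iff[OF dv, of "h - c * m"] by auto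
    moreover have "regular (h - c * m)"
      using subring_diff[OF regular_ring] subring_mult[OF regular_ring] h m(1) reg[of c] c(1) by (auto simp: G_def)
    ultimately show ?thesis using c(1) by (intro bexI[of _ c]) (auto simp: G_def)
  qed
  have skip: "G (- n + 1) h" if "G (- n) h" "n \<in> {1, 2, 3, 4, 6}" for n h
  proof (cases "h = 0")
    case False
    have "val Qinf h \<noteq> - n"
    proof
      assume v: "val Qinf h = - n"
      have "regular h" using that(1) by (simp add: G_def)
      then obtain d j where "j < (8::nat)" "n = int (8 * d + 5 * (j mod 3) + 7 * (j div 3))"
        using regular_val[OF _ False] v by (metis neg_equal_iff_equal)
      then show False using not_pole_number[of n] that(2) by blast
    qed
    then show ?thesis using that(1) by (auto simp: G_def)
  qed (use that in \<open>simp add: G_def\<close>)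
  have pos: "h = 0" if "G 1 h" for h
  proof (rule ccontr)
    assume "h \<noteq> 0"
    moreover from this have "regular h" "val Qinf h \<ge> 1" using that by (auto simp: G_def)
    moreover from this obtain d j where "val Qinf h = - int (8 * d + 5 * (j mod 3) + 7 * (j div 3))"
      using regular_val[OF _ \<open>h \<noteq> 0\<close>] by blast
    ultimately show False using of_nat_0_le_iff[of "8 * d + 5 * (j mod 3) + 7 * (j div 3)"] by linarith
  qed
  have one: "lord Qinf (z / a) Kb 1 0" using lord_const[OF L, of 1] Kb_closed by simp
  show ?thesis
  proof (intro equalityI subsetI)
    fix h assume "h \<in> V8"
    then have "G (- 8) h" using reg[of 0] Kb_closed by (auto simp: V8_def G_def)
    then obtain d3 where d3: "d3 \<in> Kb" "G (- 7) (h - d3 * a)" using sub[of "- 8" h a] reg o(2) by auto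
    then obtain d2 where d2: "d2 \<in> Kb" "G (- 6) (h - d3 * a - d2 * z)" using sub[of "- 7" _ z] reg o(3) by force
    then have "G (- 5) (h - d3 * a - d2 * z)" using skip[of 6] by simp
    then obtain d1 where d1: "d1 \<in> Kb" "G (- 4) (h - d3 * a - d2 * z - d1 * w)" using sub[of "- 5" _ w] reg o(4) by force
    then have "G 0 (h - d3 * a - d2 * z - d1 * w)" using skip[of 4] skip[of 3] skip[of 2] skip[of 1] by simp
    then obtain d0 where d0: "d0 \<in> Kb" "G 1 (h - d3 * a - d2 * z - d1 * w - d0 * 1)"
      using sub[of 0 _ 1] reg[of 1] one Kb_closed(1,2) by (metis Un_iff add_0)
    then have "h = d0 + d1 * w + d2 * z + d3 * a" using pos[OF d0(2)] by (simp add: algebra_simps)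
    then show "h \<in> {d0 + d1 * w + d2 * z + d3 * a | d0 d1 d2 d3. d0 \<in> Kb \<and> d1 \<in> Kb \<and> d2 \<in> Kb \<and> d3 \<in> Kb}"
      using d0 d1 d2 d3 by blast
  next
    fix h assume "h \<in> {d0 + d1 * w + d2 * z + d3 * a | d0 d1 d2 d3. d0 \<in> Kb \<and> d1 \<in> Kb \<and> d2 \<in> Kb \<and> d3 \<in> Kb}"
    then obtain d0 d1 d2 d3 where d: "h = d0 + d1 * w + d2 * z + d3 * a" "d0 \<in> Kb" "d1 \<in> Kb" "d2 \<in> Kb" "d3 \<in> Kb" by blast
    have "regular h" unfolding d(1)
      using subring_add[OF regular_ring] subring_mult[OF regular_ring] reg d by auto
    moreover have "h = 0 \<or> val Qinf h \<ge> - 8"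
    proof -
      have m: "x * (z / a) powi (- (- 8)) \<in> Qinf" if "lord Qinf (z / a) Kb x n" "n \<ge> - 8" for x n
        using val_ge_iff[OF dv, of x "- 8"] val_Qinf[OF that(1)] lord_nonzero[OF L that(1)] that(2) by simp
      have "d0 * (1 * (z / a) powi (- (- 8))) + d1 * (w * (z / a) powi (- (- 8))) +
        d2 * (z * (z / a) powi (- (- 8))) + d3 * (a * (z / a) powi (- (- 8))) \<in> Qinf"
        by (intro R_add R_mult[OF k_R m] d) (use one o in auto)
      then have "h * (z / a) powi (- (- 8)) \<in> Qinf" unfolding d(1) by (simp only: distrib_right mult.assoc mult_1_left)
      then show ?thesis using val_ge_iff[OF dv, of h "- 8"] by blast
    qed
    ultimately show "h \<in> V8" by (simp add: V8_def)
  qed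
qed

text \<open>With four distinct orders no cancellation of leading terms is possible, so every nonzero
  combination takes one of them.\<close>

lemma span_orders:
  assumes Q: "plc Q" "dval UNIV Q p"
    and f: "lord Q p Kb f0 e0" "lord Q p Kb f1 e1" "lord Q p Kb f2 e2" "lord Q p Kb f3 e3" "e0 < e1" "e1 < e2" "e2 < e3"
    and V: "\<And>h. h \<in> V8 \<longleftrightarrow> (\<exists>d0\<in>Kb. \<exists>d1\<in>Kb. \<exists>d2\<in>Kb. \<exists>d3\<in>Kb. h = d0 * f0 + d1 * f1 + d2 * f2 + d3 * f3)"
  shows "val Q ` (V8 - {0}) = {e0, e1, e2, e3}"
proof -
  interpret vplace UNIV Kb Q using vplace_plc Q by blast
  note L = p_m[OF Q(2)] p0[OF Q(2)] Kb_field subset_refl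
  have v: "lord Q p Kb x n \<Longrightarrow> val Q x = n" for x n using lord_val[OF Q(2)] by blast
  have c: "lord Q p Kb (d * x) n" if "d \<in> Kb" "d \<noteq> 0" "lord Q p Kb x n" for d x n
    using lord_mult[OF L lord_const[OF L that(1,2)] that(3)] by simp
  have sum: "\<exists>n. (n = i \<or> n \<in> N) \<and> lord Q p Kb (d * x + y) n"
    if h: "d \<in> Kb" "lord Q p Kb x i" "y = 0 \<or> (\<exists>n\<in>N. lord Q p Kb y n)" "\<And>n. n \<in> N \<Longrightarrow> i < n" "d * x + y \<noteq> 0"
    for d x y i N
  proof (cases "d = 0")
    case True
    then show ?thesis using h by auto
  next
    case False
    note cx = c[OF h(1) False h(2)]
    show ?thesis
    proof (cases "y = 0")
      case True
      then show ?thesis using cx by auto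
    next
      case False
      then obtain n where "n \<in> N" "lord Q p Kb y n" using h(3) by blast
      then show ?thesis using lord_add_less[OF L cx] h(4) by blast
    qed
  qed
  show ?thesis
  proof (intro equalityI subsetI)
    fix n assume "n \<in> val Q ` (V8 - {0})"
    then obtain h where h: "h \<in> V8" "h \<noteq> 0" "n = val Q h" by blast
    then obtain d0 d1 d2 d3 where d: "d0 \<in> Kb" "d1 \<in> Kb" "d2 \<in> Kb" "d3 \<in> Kb"
      "h = d0 * f0 + d1 * f1 + d2 * f2 + d3 * f3" using V by blast
    define y3 y2 y1 where "y3 = d3 * f3 + 0" and "y2 = d2 * f2 + y3" and "y1 = d1 * f1 + y2"
    have lt: "\<And>n. n \<in> {} \<Longrightarrow> e3 < n" "\<And>n. n \<in> {e3} \<Longrightarrow> e2 < n" "\<And>n. n \<in> {e2, e3} \<Longrightarrow> e1 < n"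
      "\<And>n. n \<in> {e1, e2, e3} \<Longrightarrow> e0 < n" using f by auto
    have y3: "y3 = 0 \<or> (\<exists>n\<in>{e3}. lord Q p Kb y3 n)"
      using sum[OF d(4) f(4) _ lt(1), of 0] unfolding y3_def by blast
    have y2: "y2 = 0 \<or> (\<exists>n\<in>{e2, e3}. lord Q p Kb y2 n)"
      using sum[OF d(3) f(3) y3 lt(2)] unfolding y2_def by blast
    have y1: "y1 = 0 \<or> (\<exists>n\<in>{e1, e2, e3}. lord Q p Kb y1 n)"
      using sum[OF d(2) f(2) y2 lt(3)] unfolding y1_def by blast
    have hy: "h = d0 * f0 + y1" unfolding d(5) y1_def y2_def y3_def by simp
    have "\<exists>n. (n = e0 \<or> n \<in> {e1, e2, e3}) \<and> lord Q p Kb h n"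
      using sum[OF d(1) f(1) y1 lt(4)] h(2) unfolding hy by blast
    then show "n \<in> {e0, e1, e2, e3}" using v h(3) by auto
  next
    have in_V: "val Q x \<in> val Q ` (V8 - {0})" if "x \<in> V8" "lord Q p Kb x n" for x n
      using that lord_nonzero[OF L] by blast
    have z1: "0 \<in> Kb" "1 \<in> Kb" using Kb_closed by auto
    have "f0 \<in> V8" unfolding V using z1 by (intro bexI[of _ 1] bexI[of _ 0]) auto
    moreover have "f1 \<in> V8" unfolding V by (rule bexI[of _ 0], rule bexI[of _ 1], rule bexI[of _ 0], rule bexI[of _ 0]) (use z1 in auto)
    moreover have "f2 \<in> V8" unfolding V by (rule bexI[of _ 0], rule bexI[of _ 0], rule bexI[of _ 1], rule bexI[of _ 0]) (use z1 in auto)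
    moreover have "f3 \<in> V8" unfolding V by (rule bexI[of _ 0], rule bexI[of _ 0], rule bexI[of _ 0], rule bexI[of _ 1]) (use z1 in auto)
    moreover fix n assume "n \<in> {e0, e1, e2, e3}"
    ultimately show "n \<in> val Q ` (V8 - {0})" using in_V f v by (metis empty_iff insert_iff)
  qed
qed

lemma orders_inf: "val Qinf ` (V8 - {0}) = {- 8, - 7, - 5, 0}"
proof (rule span_orders[OF Qinf_plc inf_dval[OF Qinf]])
  note o = inf_orders[OF Qinf Kb_field subset_refl]
  interpret vplace UNIV Kb Qinf using vplace_plc Qinf_plc by blast
  show "lord Qinf (z / a) Kb a (- 8)" "lord Qinf (z / a) Kb z (- 7)" "lord Qinf (z / a) Kb w (- 5)" by (rule o)+
  show "lord Qinf (z / a) Kb 1 0"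
    using lord_const[OF o(1) inf_par_nonzero Kb_field subset_refl, of 1] Kb_closed by simp
  fix h
  show "h \<in> V8 \<longleftrightarrow> (\<exists>d0\<in>Kb. \<exists>d1\<in>Kb. \<exists>d2\<in>Kb. \<exists>d3\<in>Kb. h = d0 * a + d1 * z + d2 * w + d3 * 1)"
  proof
    assume "h \<in> V8"
    then obtain d0 d1 d2 d3 where "h = d0 + d1 * w + d2 * z + d3 * a" "d0 \<in> Kb" "d1 \<in> Kb" "d2 \<in> Kb" "d3 \<in> Kb"
      unfolding V8_span by blast
    moreover from this have "h = d3 * a + d2 * z + d1 * w + d0 * 1" by simp
    ultimately show "\<exists>d0\<in>Kb. \<exists>d1\<in>Kb. \<exists>d2\<in>Kb. \<exists>d3\<in>Kb. h = d0 * a + d1 * z + d2 * w + d3 * 1" by blast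
  next
    assume "\<exists>d0\<in>Kb. \<exists>d1\<in>Kb. \<exists>d2\<in>Kb. \<exists>d3\<in>Kb. h = d0 * a + d1 * z + d2 * w + d3 * 1"
    then obtain d0 d1 d2 d3 where "h = d0 * a + d1 * z + d2 * w + d3 * 1" "d0 \<in> Kb" "d1 \<in> Kb" "d2 \<in> Kb" "d3 \<in> Kb" by blast
    moreover from this have "h = d3 + d2 * w + d1 * z + d0 * a" by simp
    ultimately show "h \<in> V8" unfolding V8_span by blast
  qed
qed simp_all

section \<open>Orders at a general point\<close>

text \<open>The roots of this polynomial are the abscissas where the osculating function vanishes to
  order more than 7.\<close>
definition gpoly :: "'a poly" where
  "gpoly = monom 1 18 * [:1, 0, 1:] ^ 6 - monom 1 12 * [:1, 0, 1:] ^ 2 + monom 15 28 + monom 9 14"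

lemma poly_gpoly: "poly gpoly x = x ^ 18 * (x ^ 2 + 1) ^ 6 - x ^ 12 * (x ^ 2 + 1) ^ 2 + 15 * x ^ 28 + 9 * x ^ 14"
proof -
  have "poly [:1, 0, 1:] x = x ^ 2 + 1" by (simp add: power2_eq_square)
  then show ?thesis unfolding gpoly_def by (simp only: poly_add poly_diff poly_mult poly_power poly_monom mult_1_left)
qed

text \<open>The first summand has degree 30, the others at most 28.\<close>

lemma gpoly_nonzero: "gpoly \<noteq> 0"
proof
  let ?q = "[:1, 0, 1:] :: 'a poly"
  assume "gpoly = 0"
  then have "monom 1 18 * ?q ^ 6 = monom 1 12 * ?q ^ 2 - monom 15 28 - monom 9 14"
    by (simp add: gpoly_def algebra_simps eq_neg_iff_add_eq_0 add_eq_0_iff)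
  moreover have d: "degree (?q ^ n) = n * 2" for n by (subst degree_power_eq) auto
  have "degree (monom 1 18 * ?q ^ 6) = 30"
    by (subst degree_mult_eq) (auto simp: d degree_monom_eq monom_eq_0_iff)
  moreover have "degree (monom 1 12 * ?q ^ 2 - monom 15 28 - monom 9 14) \<le> 28"
  proof (intro degree_diff_le)
    show "degree (monom 1 12 * ?q ^ 2) \<le> 28"
      using degree_mult_le[of "monom (1::'a) 12" "?q ^ 2"] by (simp add: d degree_monom_eq)
    show "degree (monom (15::'a) 28) \<le> 28" by (rule degree_monom_le)
    show "degree (monom (9::'a) 14) \<le> 28" using degree_monom_le[of "9::'a" 14] by linarith
  qed
  ultimately show False by simp
qed

text \<open>The basis \<open>1\<close>, \<open>a - \<alpha>\<close>, \<open>f2\<close>,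
  \<open>f3\<close> is adapted to the point: \<open>f2\<close> subtracts from a multiple of
  \<open>w - \<beta>\<close> its linear part, and \<open>f3\<close> is \<open>osc\<close>, which is
  divisible by \<open>(a - \<alpha>) ^ 7\<close> because the seventh power is additive.\<close>

lemma orders_generic:
  assumes c: "cen Q \<alpha> \<beta> \<gamma>" and unram: "\<alpha> ^ 3 + \<alpha> \<noteq> 0" and gen: "poly gpoly \<alpha> \<noteq> 0"
  shows "val Q ` (V8 - {0}) = {0, 1, 2, 7}"
proof -
  have pt: "pt \<alpha> \<beta> \<gamma>" and Q: "plc Q" using c by (auto simp: cen_def)
  interpret vplace UNIV Kb Q using vplace_plc Q by blast
  let ?\<pi> = "a - \<alpha>"
  have dv: "dval UNIV Q ?\<pi>" using cen_dval[OF pt c] unram by (simp add: par_def[OF pt])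
  note L = p_m[OF dv] p0[OF dv] Kb_field subset_refl
  note nz = unram_nonzero[OF pt unram] and pK = pt_Kb[OF pt]
  have ra: "rs Kb Q a \<alpha>" "rs Kb Q w \<beta>" "rs Kb Q z \<gamma>" using c by (auto simp: cen_def)
  have rp: "rs Kb Q ?\<pi> 0" by (rule rs_m[OF L(1)])
  define w1 z1 where "w1 = (5 * \<alpha> ^ 4 + 3 * \<alpha> ^ 2) / \<beta> ^ 7" and "z1 = (\<alpha> ^ 2 + 1) ^ 2 / \<gamma> ^ 7"
  obtain W where W: "lval \<alpha> \<beta> \<gamma> W w1" "w - \<beta> = ?\<pi> * W"
    using w_quot[OF pt unram] unfolding w1_def by blast
  obtain Z where Z: "lval \<alpha> \<beta> \<gamma> Z z1" "z - \<gamma> = ?\<pi> * Z"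
    using z_quot[OF pt unram] unfolding z1_def by blast
  note rW = lval_rs[OF pt W(1) c] and rZ = lval_rs[OF pt Z(1) c]
  have cK: "5 * \<alpha> ^ 4 + 3 * \<alpha> ^ 2 \<in> Kb" using pK numeral_Kb by (intro Kb_closed)
  define c1 where "c1 = 5 * \<alpha> ^ 4 + 3 * \<alpha> ^ 2"
  define f2 where "f2 = \<beta> ^ 7 * (w - \<beta>) - c1 * ?\<pi>"
  define f3 where "f3 = osc \<alpha> \<beta> \<gamma>"
  have prod: "lord Q ?\<pi> Kb (x * ?\<pi> ^ n) (int n)" if "rs Kb Q x e" "e \<noteq> 0" for x e n
  proof -
    have "lord Q ?\<pi> Kb x 0" using that by (intro lord_residue[OF L]) (auto simp: rs_def)
    from lord_mult[OF L this lord_power[OF L lord_uniformizer[OF L], of n]] show ?thesis by simp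
  qed
  have o2: "lord Q ?\<pi> Kb f2 2"
  proof -
    \<comment> \<open>Up to a term divisible by \<open>(a - \<alpha>) ^ 7\<close>,
      \<open>\<beta> ^ 7 * w\<close> is \<open>w ^ 8\<close>, a polynomial in \<open>a\<close>.
      \<open>x\<close> collects its Taylor expansion at \<open>\<alpha>\<close> from the quadratic
      term on, and that correction.\<close>
    define x where "x = 10 * \<alpha> ^ 3 + 3 * \<alpha> + (10 * \<alpha> ^ 2 + 1) * ?\<pi> + 5 * \<alpha> * ?\<pi> ^ 2 + ?\<pi> ^ 3 - w * W ^ 7 * ?\<pi> ^ 5"
    have "w ^ 8 = w * w ^ 7" by (simp flip: power_Suc)
    also have "w ^ 7 = \<beta> ^ 7 + W ^ 7 * ?\<pi> ^ 7"
      using pow7_diff[of w \<beta>] unfolding W(2) power_mult_distrib by (simp add: mult.commute)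
    finally have "\<beta> ^ 7 * w = w ^ 8 - w * W ^ 7 * ?\<pi> ^ 7" by (simp add: distrib_left mult_ac)
    moreover have "\<beta> ^ 7 * \<beta> = \<beta> ^ 8" by (simp flip: power_Suc2)
    ultimately have "f2 = (w ^ 8 - \<beta> ^ 8 - c1 * ?\<pi>) - w * W ^ 7 * ?\<pi> ^ 7"
      by (simp add: f2_def right_diff_distrib)
    also have "w ^ 8 - \<beta> ^ 8 - c1 * ?\<pi> =
      (10 * \<alpha> ^ 3 + 3 * \<alpha> + (10 * \<alpha> ^ 2 + 1) * ?\<pi> + 5 * \<alpha> * ?\<pi> ^ 2 + ?\<pi> ^ 3) * ?\<pi> ^ 2"
      unfolding w8 curve_eqs_w8[OF pt_eqs[OF pt]] c1_def by (simp add: algebra_simps eval_nat_numeral)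
    also have "\<dots> - w * W ^ 7 * ?\<pi> ^ 7 = x * ?\<pi> ^ 2"
      by (simp add: x_def left_diff_distrib mult.assoc flip: power_add)
    finally have f2: "f2 = x * ?\<pi> ^ 2" .
    have "rs Kb Q x (10 * \<alpha> ^ 3 + 3 * \<alpha> + (10 * \<alpha> ^ 2 + 1) * 0 + 5 * \<alpha> * 0 ^ 2 + 0 ^ 3 - \<beta> * w1 ^ 7 * 0 ^ 5)"
      unfolding x_def using pK numeral_Kb Kb_closed(1)
      by (intro rs_diff rs_add rs_mult rs_power rp ra rW rs_const Kb_closed)
    then have "rs Kb Q x (3 * (\<alpha> ^ 3 + \<alpha>) + 7 * \<alpha> ^ 3)" by (simp add: algebra_simps)
    then have "rs Kb Q x (3 * (\<alpha> ^ 3 + \<alpha>))" unfolding seven by simp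
    moreover have "3 * (\<alpha> ^ 3 + \<alpha>) \<noteq> 0" unfolding mult_eq_0_iff using unram three_nonzero by blast
    ultimately show ?thesis using prod[of x _ 2] f2 by simp
  qed
  have o3: "lord Q ?\<pi> Kb f3 7"
  proof -
    \<comment> \<open>By the equation of the Hermitian surface, \<open>osc\<close> combines
      \<open>a ^ 7 - \<alpha> ^ 7\<close>, \<open>z * (z ^ 7 - \<gamma> ^ 7)\<close> and
      \<open>w * (w ^ 7 - \<beta> ^ 7)\<close>; each difference of seventh powers has the factor
      \<open>(a - \<alpha>) ^ 7\<close>.\<close>
    define x where "x = 1 - z * Z ^ 7 + 3 * (w * W ^ 7)"
    have sw: "(?\<pi> * W) ^ 7 = w ^ 7 - \<beta> ^ 7" "(?\<pi> * Z) ^ 7 = z ^ 7 - \<gamma> ^ 7" "?\<pi> ^ 7 = a ^ 7 - \<alpha> ^ 7"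
      unfolding W(2)[symmetric] Z(2)[symmetric] by (rule pow7_diff)+
    have "x * ?\<pi> ^ 7 = ?\<pi> ^ 7 - z * (?\<pi> * Z) ^ 7 + 3 * (w * (?\<pi> * W) ^ 7)"
      unfolding power_mult_distrib by (simp add: x_def algebra_simps)
    also have "\<dots> = a ^ 7 - \<alpha> ^ 7 - (z ^ 8 - \<gamma> ^ 7 * z) + 3 * (w ^ 8 - \<beta> ^ 7 * w)"
      unfolding sw by (simp add: right_diff_distrib mult.commute flip: power_Suc power_Suc2)
    also have "\<dots> = f3" unfolding f3_def osc_def curve_eqs_z8_alt[OF eqs] by (simp add: algebra_simps)
    finally have f3: "f3 = x * ?\<pi> ^ 7" by simp
    have r: "rs Kb Q x (1 - \<gamma> * z1 ^ 7 + 3 * (\<beta> * w1 ^ 7))"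
      unfolding x_def by (intro rs_diff rs_add rs_mult rs_power ra rW rZ rs_const numeral_Kb Kb_closed(1))
    have "1 - \<gamma> * z1 ^ 7 + 3 * (\<beta> * w1 ^ 7) \<noteq> 0"
    proof
      assume z: "1 - \<gamma> * z1 ^ 7 + 3 * (\<beta> * w1 ^ 7) = 0"
      define s where "s = \<alpha> ^ 2 + 1"
      have s0: "s \<noteq> 0" using nz by (simp add: s_def)
      have p48: "u * (v / u ^ 7) ^ 7 = v ^ 7 / (u ^ 8) ^ 6" if "u \<noteq> 0" for u v :: 'a
      proof -
        have "u ^ 49 = u * (u ^ 8) ^ 6" by (simp flip: power_mult power_Suc)
        moreover have "(u ^ 7) ^ 7 = u ^ 49" by (simp flip: power_mult)
        ultimately show ?thesis using that by (simp add: power_divide)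
      qed
      have b: "(\<beta> ^ 8) ^ 6 = \<alpha> ^ 18 * s ^ 6" and g: "(\<gamma> ^ 8) ^ 6 = \<alpha> ^ 6 * s ^ 18"
        unfolding curve_eqs_w8[OF pt_eqs[OF pt]] curve_eqs_z8[OF pt_eqs[OF pt]] s_def
        by (simp_all add: power_mult_distrib flip: power_mult)
      have n: "(78125::'a) = 5" "(2187::'a) = 3" by (subst numeral_mod7, simp)+
      have c7: "(5 * \<alpha> ^ 4 + 3 * \<alpha> ^ 2) ^ 7 = 5 * \<alpha> ^ 28 + 3 * \<alpha> ^ 14"
        unfolding pow7_add power_mult_distrib by (simp add: n flip: power_mult)
      have e1: "\<beta> * w1 ^ 7 = (5 * \<alpha> ^ 28 + 3 * \<alpha> ^ 14) / (\<alpha> ^ 18 * s ^ 6)"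
        unfolding w1_def p48[OF nz(3)] b c7 ..
      have e2: "\<gamma> * z1 ^ 7 = s ^ 14 / (\<alpha> ^ 6 * s ^ 18)"
        unfolding z1_def p48[OF nz(4)] g s_def[symmetric] by (simp flip: power_mult)
      have e2': "s ^ 14 / (\<alpha> ^ 6 * s ^ 18) = \<alpha> ^ 12 * s ^ 2 / (\<alpha> ^ 18 * s ^ 6)"
      proof -
        have "s ^ 14 * (\<alpha> ^ 18 * s ^ 6) = \<alpha> ^ 18 * (s ^ 14 * s ^ 6)" by (rule mult.left_commute)
        also have "\<dots> = (\<alpha> ^ 12 * \<alpha> ^ 6) * (s ^ 2 * s ^ 18)" by (simp flip: power_add)
        finally have "s ^ 14 * (\<alpha> ^ 18 * s ^ 6) = (\<alpha> ^ 12 * s ^ 2) * (\<alpha> ^ 6 * s ^ 18)" by (simp only: mult_ac)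
        then show ?thesis using nz(1) s0 by (simp add: frac_eq_eq)
      qed
      have clear: "(1 - x / D + 3 * (y / D)) * D = D - x + 3 * y" if "D \<noteq> 0" for x y D :: 'a
        using that by (simp add: left_diff_distrib distrib_right)
      \<comment> \<open>Clearing the denominator \<open>\<alpha> ^ 18 * s ^ 6\<close> of the leading
        coefficient of \<open>f3\<close> produces \<open>gpoly\<close>.\<close>
      have "0 = (1 - \<gamma> * z1 ^ 7 + 3 * (\<beta> * w1 ^ 7)) * (\<alpha> ^ 18 * s ^ 6)" using z by simp
      also have "\<dots> = \<alpha> ^ 18 * s ^ 6 - \<alpha> ^ 12 * s ^ 2 + 3 * (5 * \<alpha> ^ 28 + 3 * \<alpha> ^ 14)"
        unfolding e1 e2 e2' by (rule clear) (use nz(1) s0 in simp)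
      also have "\<dots> = poly gpoly \<alpha>" unfolding poly_gpoly s_def by (simp add: distrib_left)
      finally show False using gen by simp
    qed
    from prod[OF r this, of 7] show ?thesis using f3 by simp
  qed
  show ?thesis
  proof (rule span_orders[OF Q dv, of 1 0 ?\<pi> 1 f2 2 f3 7])
    show "lord Q ?\<pi> Kb 1 0" using lord_const[OF L, of 1] Kb_closed by simp
    show "lord Q ?\<pi> Kb ?\<pi> 1" by (rule lord_uniformizer[OF L])
    fix h
    have nK: "3 \<in> Kb" by (rule numeral_Kb)
    have c1K: "c1 \<in> Kb" unfolding c1_def by (rule cK)
    define q where "q = \<beta> ^ 7"
    define r where "r = \<gamma> ^ 7"
    have qr: "q \<noteq> 0" "r \<noteq> 0" "q \<in> Kb" "r \<in> Kb" using nz pK Kb_closed by (auto simp: q_def r_def)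
    have f: "f2 = q * (w - \<beta>) - c1 * ?\<pi>" "f3 = r * z - a - \<alpha> ^ 7 - 3 * q * w"
      by (simp_all add: f2_def f3_def osc_def q_def r_def)
    show "h \<in> V8 \<longleftrightarrow> (\<exists>d0\<in>Kb. \<exists>d1\<in>Kb. \<exists>d2\<in>Kb. \<exists>d3\<in>Kb. h = d0 * 1 + d1 * ?\<pi> + d2 * f2 + d3 * f3)"
    proof
      assume "h \<in> V8"
      then obtain d0 d1 d2 d3 where d: "h = d0 + d1 * w + d2 * z + d3 * a" "d0 \<in> Kb" "d1 \<in> Kb" "d2 \<in> Kb" "d3 \<in> Kb"
        unfolding V8_span by blast
      \<comment> \<open>The change of basis is triangular: \<open>z\<close> occurs only in
        \<open>f3\<close>, \<open>w\<close> only in \<open>f2\<close> and \<open>f3\<close>, so the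
        coefficients are found from the last one backwards.\<close>
      define b3 where "b3 = d2 / r"
      define b2 where "b2 = (d1 + b3 * (3 * q)) / q"
      define b1 where "b1 = d3 + b3 + b2 * c1"
      define b0 where "b0 = d0 + b3 * \<alpha> ^ 7 + b2 * q * \<beta> + (d3 + b3) * \<alpha>"
      have "b3 \<in> Kb" unfolding b3_def by (intro Kb_closed d qr)
      moreover from this have "b2 \<in> Kb" unfolding b2_def by (intro Kb_closed d qr nK)
      moreover from calculation have "b1 \<in> Kb" unfolding b1_def by (intro Kb_closed d c1K)
      moreover from calculation have "b0 \<in> Kb" unfolding b0_def by (intro Kb_closed d qr pK)
      moreover have "h = b0 * 1 + b1 * ?\<pi> + b2 * f2 + b3 * f3"
      proof -
        have r2: "d2 = b3 * r" "d1 = b2 * q - b3 * (3 * q)" using qr by (auto simp: b3_def b2_def)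
        show ?thesis unfolding d(1) f r2 b1_def b0_def by (simp add: algebra_simps)
      qed
      ultimately show "\<exists>d0\<in>Kb. \<exists>d1\<in>Kb. \<exists>d2\<in>Kb. \<exists>d3\<in>Kb. h = d0 * 1 + d1 * ?\<pi> + d2 * f2 + d3 * f3" by blast
    next
      assume "\<exists>d0\<in>Kb. \<exists>d1\<in>Kb. \<exists>d2\<in>Kb. \<exists>d3\<in>Kb. h = d0 * 1 + d1 * ?\<pi> + d2 * f2 + d3 * f3"
      then obtain d0 d1 d2 d3 where d: "d0 \<in> Kb" "d1 \<in> Kb" "d2 \<in> Kb" "d3 \<in> Kb"
        "h = d0 * 1 + d1 * ?\<pi> + d2 * f2 + d3 * f3" by blast
      have "h = (d0 - d1 * \<alpha> - d2 * (q * \<beta>) + d2 * (c1 * \<alpha>) - d3 * \<alpha> ^ 7) + (d2 * q - d3 * (3 * q)) * w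
          + (d3 * r) * z + (d1 - d2 * c1 - d3) * a"
        unfolding d(5) f by (simp add: algebra_simps)
      moreover have "d0 - d1 * \<alpha> - d2 * (q * \<beta>) + d2 * (c1 * \<alpha>) - d3 * \<alpha> ^ 7 \<in> Kb" "d2 * q - d3 * (3 * q) \<in> Kb"
        "d3 * r \<in> Kb" "d1 - d2 * c1 - d3 \<in> Kb"
        by (intro Kb_closed d pK qr c1K nK)+
      ultimately show "h \<in> V8" unfolding V8_span by blast
    qed
  qed (use o2 o3 in simp_all)
qed

lemma finite_nongeneric: "finite {Q. plc Q \<and> val Q ` (V8 - {0}) \<noteq> {0, 1, 2, 7}}"
proof -
  define B where "B = {\<alpha> \<in> Kb. \<alpha> ^ 3 + \<alpha> = 0 \<or> poly gpoly \<alpha> = 0}"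
  have "{x. x ^ 3 + x = 0} = {x. poly [:0, 1, 0, 1::'a:] x = 0}"
    by (simp add: algebra_simps eval_nat_numeral)
  then have "finite {x. x ^ 3 + (x::'a) = 0}" using poly_roots_finite[of "[:0, 1, 0, 1::'a:]"] by simp
  then have "finite ({x. x ^ 3 + (x::'a) = 0} \<union> {x. poly gpoly x = 0})"
    using poly_roots_finite[OF gpoly_nonzero] by simp
  then have B: "finite B" by (rule rev_finite_subset) (auto simp: B_def)
  have "{Q. plc Q \<and> val Q ` (V8 - {0}) \<noteq> {0, 1, 2, 7}} \<subseteq> insert Qinf (\<Union>\<alpha>\<in>B. over \<alpha>)"
  proof
    fix Q assume "Q \<in> {Q. plc Q \<and> val Q ` (V8 - {0}) \<noteq> {0, 1, 2, 7}}"
    then have Q: "plc Q" "val Q ` (V8 - {0}) \<noteq> {0, 1, 2, 7}" by auto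
    show "Q \<in> insert Qinf (\<Union>\<alpha>\<in>B. over \<alpha>)"
    proof (cases "Q = Qinf")
      case False
      then obtain \<alpha> \<beta> \<gamma> where c: "cen Q \<alpha> \<beta> \<gamma>" using affine_cen[OF Q(1)] affine_iff[OF Q(1)] by blast
      have "\<alpha> \<in> Kb" using c by (simp add: cen_def pt_def)
      then have "\<alpha> \<in> B" using orders_generic[OF c] Q(2) unfolding B_def by blast
      moreover have "Q \<in> over \<alpha>" using c by (auto simp: over_def cen_def rs_def)
      ultimately show ?thesis by blast
    qed simp
  qed
  moreover have "finite (\<Union>\<alpha>\<in>B. over \<alpha>)" using B over_sum by (auto simp: B_def)
  ultimately show ?thesis using finite_subset by blast
qed

lemma frobenius_series:
  "is_maximal F K 7
    \<and> (\<forall>P0. place F K P0 \<and> deg_place K P0 = 1 \<longrightarrow> int (ell F K (pt_div P0 8)) - 1 = 3)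
    \<and> (\<forall>P0 Q0. place F K P0 \<and> deg_place K P0 = 1 \<and> place UNIV Kb Q0 \<and> Q0 \<inter> F = P0 \<longrightarrow>
         finite {Q. place UNIV Kb Q \<and> orders UNIV Kb Q0 8 Q \<noteq> {0, 1, 2, 7}})
    \<and> (\<exists>P. place F K P \<and> deg_place K P = 1
         \<and> (\<forall>R. place F K R \<longrightarrow> (val R (a ^ 2) < 0 \<longleftrightarrow> R = P))
         \<and> (\<forall>P0 Q0 Q. place F K P0 \<and> deg_place K P0 = 1 \<and> place UNIV Kb Q0 \<and> Q0 \<inter> F = P0
              \<and> place UNIV Kb Q \<and> Q \<inter> F = P \<longrightarrow>
              sorted_list_of_set (orders UNIV Kb Q0 8 Q) ! 2 = 3
              \<and> (3::int) = 8 - \<lfloor>(2/3::real) * 8\<rfloor>))"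
proof (intro conjI allI impI maximal exI[of _ Pinf] Pinf_place Pinf_deg)
  fix P0 assume P0: "place F K P0 \<and> deg_place K P0 = 1"
  then obtain Q0 where Q0: "plc Q0" "Q0 \<inter> F = P0" using place_lift by blast
  have deg: "deg_place K (Q0 \<inter> F) = 1" using P0 Q0 by simp
  obtain g where g: "g \<in> F" "g \<noteq> 0" "\<And>Q. plc Q \<Longrightarrow> val Q g = (if Q = Q0 then 8 else 0) - (if Q = Qinf then 8 else 0)"
    using frobenius_divisor[OF Q0(1) deg] by blast
  show "int (ell F K (pt_div P0 8)) - 1 = 3" using ell_rational[OF Q0(1) g deg] Q0(2) by simp
next
  fix P0 Q0 assume h: "place F K P0 \<and> deg_place K P0 = 1 \<and> plc Q0 \<and> Q0 \<inter> F = P0"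
  then have Q0: "plc Q0" "deg_place K (Q0 \<inter> F) = 1" by auto
  obtain g where g: "g \<in> F" "g \<noteq> 0" "\<And>Q. plc Q \<Longrightarrow> val Q g = (if Q = Q0 then 8 else 0) - (if Q = Qinf then 8 else 0)"
    using frobenius_divisor[OF Q0] by blast
  have "orders UNIV Kb Q0 8 Q = val Q ` (V8 - {0})" if "plc Q" "Q \<noteq> Qinf" for Q
    using orders_twist[OF Q0(1) g that(1)] that(2) by simp
  then have "Q = Qinf \<or> val Q ` (V8 - {0}) \<noteq> {0, 1, 2, 7}" if "plc Q" "orders UNIV Kb Q0 8 Q \<noteq> {0, 1, 2, 7}" for Q
    using that by metis
  then have "{Q. plc Q \<and> orders UNIV Kb Q0 8 Q \<noteq> {0, 1, 2, 7}} \<subseteq> insert Qinf {Q. plc Q \<and> val Q ` (V8 - {0}) \<noteq> {0, 1, 2, 7}}"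
    by (intro subsetI) (simp only: mem_Collect_eq insert_iff simp_thms)
  then show "finite {Q. plc Q \<and> orders UNIV Kb Q0 8 Q \<noteq> {0, 1, 2, 7}}"
    using finite_nongeneric finite_subset by (meson finite_insert)
next
  fix R assume R: "place F K R"
  show "val R (a ^ 2) < 0 \<longleftrightarrow> R = Pinf"
  proof -
    obtain Q where Q: "plc Q" "Q \<inter> F = R" using place_lift[OF R] by blast
    obtain p where p: "dval F R p" using place_dval[OF R] by blast
    interpret R: vplace F K R using vplace_F R by blast
    interpret vplace UNIV Kb Q using vplace_plc Q by blast
    have "a ^ 2 \<in> F" by (intro F_closed F_gens)
    then have "val R (a ^ 2) < 0 \<longleftrightarrow> a ^ 2 \<notin> R" using R.val_nonneg_iff[OF p, of "a ^ 2"] a_nonzero by auto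
    also have "\<dots> \<longleftrightarrow> a ^ 2 \<notin> Q" using Q \<open>a ^ 2 \<in> F\<close> by blast
    also have "\<dots> \<longleftrightarrow> a \<notin> Q" using power_R[of a 2] R_power[of a 2] by auto
    also have "\<dots> \<longleftrightarrow> R = Pinf" using affine_iff[OF Q(1)] over_Pinf[OF Q(1)] Q(2) by simp
    finally show ?thesis .
  qed
next
  fix P0 Q0 Q assume h: "place F K P0 \<and> deg_place K P0 = 1 \<and> plc Q0 \<and> Q0 \<inter> F = P0 \<and> plc Q \<and> Q \<inter> F = Pinf"
  then have Q0: "plc Q0" "deg_place K (Q0 \<inter> F) = 1" and Q: "Q = Qinf" using over_Pinf by auto
  obtain g where g: "g \<in> F" "g \<noteq> 0" "\<And>Q. plc Q \<Longrightarrow> val Q g = (if Q = Q0 then 8 else 0) - (if Q = Qinf then 8 else 0)"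
    using frobenius_divisor[OF Q0] by blast
  \<comment> \<open>The divisor at infinity adds 8 to the orders -8, -7, -5, 0.\<close>
  have "orders UNIV Kb Q0 8 Q = (\<lambda>n. n + 8) ` val Qinf ` (V8 - {0})"
    unfolding Q using orders_twist[OF Q0(1) g Qinf_plc] by (simp add: image_image)
  also have "\<dots> = {0, 1, 3, 8}" unfolding orders_inf by auto
  finally show "sorted_list_of_set (orders UNIV Kb Q0 8 Q) ! 2 = 3" by simp
  have "\<lfloor>(2/3::real) * 8\<rfloor> = 5" by (rule floor_unique) simp_all
  then show "(3::int) = 8 - \<lfloor>(2/3::real) * 8\<rfloor>" by simp
qed

end

section \<open>Return to the original generators\<close>

text \<open>Translation by 1 permutes \<open>K\<close>, so adding 49 to the sum of its elements does
  not change it.\<close>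

lemma seven_eq_0_if_card_49:
  assumes K: "subfield (K :: 'a::field set)" "card K = 49"
  shows "(7::'a) = 0"
proof -
  have R: "subring K" by (rule subfield_subring[OF K(1)])
  have "bij_betw (\<lambda>x. x + 1) K K"
    by (rule bij_betw_byWitness[where f' = "\<lambda>x. x - 1"])
      (use subring_add[OF R] subring_diff[OF R] subring_one[OF R] in auto)
  then have "(\<Sum>x\<in>K. x + 1) = (\<Sum>x\<in>K. x)" by (rule sum.reindex_bij_betw[of _ K K "\<lambda>x. x"])
  then have "(7::'a) * 7 = 0" using K(2) by (simp add: sum.distrib)
  then show ?thesis unfolding mult_eq_0_iff by blast
qed

text \<open>Maximality and dimension are taken over \<open>K\<close>, the orders after extension of
  the constants to \<open>Kb\<close>. Quantification over all rational \<open>P0\<close> covers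
  every choice of the base place of the series.\<close>

theorem theorem7:
  fixes K Kb :: "'a::field set" and z t :: 'a and F :: "'a set"
  assumes "subfield K" and "card K = 49"
    and "alg_closed_subfield Kb" and "K \<subseteq> Kb" and "\<forall>x\<in>Kb. algebraic_over K x"
    and "\<not> algebraic_over Kb t"
    and "z ^ 16 = t * (t + 1) ^ 6"
    and "gen_field (Kb \<union> {z, t}) = UNIV"
    and F_def: "F = gen_field (K \<union> {z, t})"
  shows "is_maximal F K 7
    \<and> (\<forall>P0. place F K P0 \<and> deg_place K P0 = 1 \<longrightarrow> int (ell F K (pt_div P0 8)) - 1 = 3)
    \<and> (\<forall>P0 Q0. place F K P0 \<and> deg_place K P0 = 1 \<and> place UNIV Kb Q0 \<and> Q0 \<inter> F = P0 \<longrightarrow>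
         finite {Q. place UNIV Kb Q \<and> orders UNIV Kb Q0 8 Q \<noteq> {0, 1, 2, 7}})
    \<and> (\<exists>P. place F K P \<and> deg_place K P = 1
         \<and> (\<forall>R. place F K R \<longrightarrow> (val R t < 0 \<longleftrightarrow> R = P))
         \<and> (\<forall>P0 Q0 Q. place F K P0 \<and> deg_place K P0 = 1 \<and> place UNIV Kb Q0 \<and> Q0 \<inter> F = P0
              \<and> place UNIV Kb Q \<and> Q \<inter> F = P \<longrightarrow>
              sorted_list_of_set (orders UNIV Kb Q0 8 Q) ! 2 = 3
              \<and> (3::int) = 8 - \<lfloor>(2/3::real) * 8\<rfloor>))"
proof -
  have Kb: "subfield Kb" using assms(3) by (simp add: alg_closed_subfield_def)
  note R = subfield_subring[OF Kb]
  have t: "t \<notin> Kb"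
  proof
    assume "t \<in> Kb"
    then have "poly_over Kb [:- t, 1:]"
      using Kb by (auto simp: poly_over_def subfield_def coeff_pCons split: nat.split)
    then have "algebraic_over Kb t" unfolding algebraic_over_def by (intro exI[of _ "[:- t, 1:]"]) simp
    then show False using assms(6) by blast
  qed
  have s0: "t + 1 \<noteq> 0" using t subring_minus[OF R subring_one[OF R]] by (metis add_eq_0_iff2)
  define s where "s = t + 1"
  define a w where "a = z ^ 8 / s ^ 3" and "w = z ^ 3 / s"
  have s: "s \<noteq> 0" "t + 1 = s" using s0 by (simp_all add: s_def)
  have "a ^ 2 = z ^ 16 / s ^ 6" by (simp add: a_def power_divide flip: power_mult)
  then have a2: "a ^ 2 = t" unfolding assms(7) s(2) using s(1) by simp
  have a3: "a ^ 3 + a = a * s" by (simp add: s_def power3_eq_cube a2[symmetric] power2_eq_square algebra_simps)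
  have eqs: "curve_eqs a w z"
    unfolding curve_eqs_def a3 unfolding a2 s(2) unfolding a_def w_def using s(1)
    by (simp add: power_divide eval_nat_numeral)
  have a: "a \<notin> Kb" using t a2 subring_power[OF R, of a 2] by auto
  \<comment> \<open>Kept general in \<open>S\<close> because the generators are exchanged twice:
    over \<open>K\<close> for \<open>F\<close>, and over \<open>Kb\<close> for the whole
    type.\<close>
  have gens: "gen_field (S \<union> {z, t}) = gen_field (S \<union> {a, w, z})" for S
  proof (intro equalityI gen_field_least[OF subfield_gen_field])
    note G = subfield_subring[OF subfield_gen_field[of "S \<union> {a, w, z}"]]
    have "{S, {a, w, z}} \<subseteq> Pow (gen_field (S \<union> {a, w, z}))" using gen_field_subset[of "S \<union> {a, w, z}"] by auto
    then show "S \<union> {z, t} \<subseteq> gen_field (S \<union> {a, w, z})"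
      using subring_power[OF G, of a 2] unfolding a2 by auto
  next
    let ?G = "gen_field (S \<union> {z, t})"
    note G = subfield_subring[OF subfield_gen_field[of "S \<union> {z, t}"]]
    have g: "S \<subseteq> ?G" "z \<in> ?G" "t \<in> ?G" using gen_field_subset[of "S \<union> {z, t}"] by auto
    have "s \<in> ?G" unfolding s_def by (intro subring_add[OF G] g subring_one[OF G])
    then have "a \<in> ?G" "w \<in> ?G" unfolding a_def w_def
      by (intro subfield_divide[OF subfield_gen_field] subring_power[OF G] g; assumption)+
    then show "S \<union> {a, w, z} \<subseteq> ?G" using g by blast
  qed
  interpret curve_K Kb a w z K F
    using assms(1-5) seven_eq_0_if_card_49[OF assms(1,2)] a eqs assms(8) F_def unfolding gens
    by unfold_locales auto
  show ?thesis using frobenius_series unfolding a2 .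
qed

end
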